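(* Let $s_h^3(v,w)=h^{\alpha-c}(Q_{\Gamma_h}^e\nabla v,Q_{\Gamma_h}^e\nabla w)_{\mathcal T_h}$ with $\alpha\in[0,2]$ be the normal gradient stabilization. Then for every $v\in V_h$, $$h^{-c}\|v\|_{\mathcal T_h}^2\lesssim\|v\|_{\Gamma_h}^2+s_h^3(v,v),$$ $$h^{-c}\|v-\lambda_{\Gamma_h}(v)\|_{\mathcal T_h}^2\lesssim\|\nabla_{\Gamma_h}v\|_{\Gamma_h}^2+s_h^3(v,v).$$
   Context: Manifold: $\Gamma\subset\mathbb R^k$ is a smooth compact connected $d$-dimensional embedded submanifold without boundary, $c=k-d\ge1$. $\rho(x)=\mathrm{dist}(x,\Gamma)$, $U_\delta(\Gamma)=\{\rho<\delta\}$; $\delta_0>0$ is fixed so small that the closest point projection $p:U_{\delta_0}(\Gamma)\to\Gamma$ is well defined and smooth. $P_\Gamma(q)$ is the orthogonal projection onto $T_q\Gamma$, $P_\Gamma^e=P_\Gamma\circ p$. Discrete manifold: for $h\in(0,h_0]$, $\mathcal K_h$ is a conforming mesh without boundary of non-degenerate (not necessarily shape-regular) $d$-simplices, $\Gamma_h=\bigcup_{K\in\mathcal K_h}K$; $P_{\Gamma_h}$ is the piecewise constant orthogonal projection onto the linear space parallel to $K$, $Q_{\Gamma_h}=I-P_{\Gamma_h}$, $\nabla_{\Gamma_h}v=P_{\Gamma_h}\nabla v$. Standing assumptions: $\Gamma_h\subset U_{\delta_0}(\Gamma)$, $p:\Gamma_h\to\Gamma$ is a bijection, $\|\rho\|_{L^\infty(\Gamma_h)}\lesssim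 h^2$, $\|P_\Gamma^e-P_{\Gamma_h}\|_{L^\infty(\Gamma_h)}\lesssim h$. $Q_{\Gamma_h}^e$ is the extension of $Q_{\Gamma_h}$ to the tubular neighborhood, $Q_{\Gamma_h}^e(x)=Q_{\Gamma_h}(y)$ with $y\in\Gamma_h$, $p(y)=p(x)$. Background mesh: $\widetilde{\mathcal T}_h$ is a quasi-uniform mesh (mesh parameter $h$) of shape-regular closed $k$-simplices covering a bounded open set containing $U_{\delta_0}(\Gamma)$; active mesh $\mathcal T_h=\{T:T\cap\Gamma_h\neq\emptyset\}$, $N_h=\bigcup_{T\in\mathcal T_h}T$; $(\cdot,\cdot)_{\mathcal T_h}$, $\|\cdot\|_{\mathcal T_h}$ are the $L^2(N_h)$ inner product and norm. $\mathcal K_h$ is compatible with $\mathcal T_h$: $K\subset T$ whenever the relative interior of $K$ meets $T$. $V_h$: continuous functions on $N_h$, affine on each $T\in\mathcal T_h$. $\lambda_{\Gamma_h}(v)=|\Gamma_h|^{-1}\int_{\Gamma_h}v$ is the average. $a\lesssim b$ means $a\le Cb$ with $C>0$ independent of $h\in(0,h_0]$, $h_0$ sufficiently small, of $v$, and of the position of $\Gamma_h$ in the mesh. *)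

theory Defs
  imports "HOL-Analysis.Analysis"
begin

section \<open>Smooth submanifolds of Euclidean space\<close>

text \<open>Only meaningful for open \<open>S\<close>.\<close>

primrec Ck_on :: "nat \<Rightarrow> ('a::euclidean_space \<Rightarrow> 'b::euclidean_space) \<Rightarrow> 'a set \<Rightarrow> bool" where
  "Ck_on 0 f S \<longleftrightarrow> continuous_on S f"
| "Ck_on (Suc n) f S \<longleftrightarrow>
     (\<forall>x\<in>S. f differentiable (at x)) \<and> (\<forall>w. Ck_on n (\<lambda>x. frechet_derivative f (at x) w) S)"

definition smooth_on :: "('a::euclidean_space \<Rightarrow> 'b::euclidean_space) \<Rightarrow> 'a set \<Rightarrow> bool" where
  "smooth_on f S \<longleftrightarrow> (\<forall>n. Ck_on n f S)"

text \<open>Slice charts: near each of its points \<open>\<Gamma>\<close> is mapped by a diffeomorphism \<open>\<phi>\<close> (with inverse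
  \<open>\<psi>\<close>) of open sets onto a piece of a \<open>d\<close>-dimensional linear subspace.\<close>

definition embedded_submanifold :: "nat \<Rightarrow> 'a::euclidean_space set \<Rightarrow> bool" where
  "embedded_submanifold d \<Gamma> \<longleftrightarrow>
     (\<forall>q\<in>\<Gamma>. \<exists>U (\<phi> :: 'a \<Rightarrow> 'a) (\<psi> :: 'a \<Rightarrow> 'a) L.
        open U \<and> q \<in> U \<and> open (\<phi> ` U) \<and> smooth_on \<phi> U \<and> smooth_on \<psi> (\<phi> ` U) \<and>
        (\<forall>x\<in>U. \<psi> (\<phi> x) = x) \<and>
        subspace L \<and> dim L = d \<and> \<phi> ` (\<Gamma> \<inter> U) = L \<inter> \<phi> ` U)"

definition tangent_space :: "'a::euclidean_space set \<Rightarrow> 'a \<Rightarrow> 'a set" where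
  "tangent_space \<Gamma> q =
     {w. \<exists>\<gamma> e. 0 < e \<and> \<gamma> 0 = q \<and> (\<forall>t. \<bar>t\<bar> < e \<longrightarrow> \<gamma> t \<in> \<Gamma>) \<and>
              (\<gamma> has_vector_derivative w) (at (0::real))}"

definition orth_proj :: "'a::euclidean_space set \<Rightarrow> 'a \<Rightarrow> 'a" where
  "orth_proj S x = (THE y. y \<in> S \<and> (\<forall>z\<in>S. orthogonal (x - y) z))"

definition tube :: "'a::euclidean_space set \<Rightarrow> real \<Rightarrow> 'a set" where
  "tube \<Gamma> \<delta> = {x. infdist x \<Gamma> < \<delta>}"

text \<open>Where the nearest point is unique, \<open>closest_point \<Gamma>\<close> is the closest point projection \<open>p\<close>.\<close>

definition tubular_radius :: "'a::euclidean_space set \<Rightarrow> real \<Rightarrow> bool" where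
  "tubular_radius \<Gamma> \<delta> \<longleftrightarrow>
     0 < \<delta> \<and>
     (\<forall>x\<in>tube \<Gamma> \<delta>. \<exists>!q. q \<in> \<Gamma> \<and> dist x q = infdist x \<Gamma>) \<and>
     smooth_on (closest_point \<Gamma>) (tube \<Gamma> \<delta>)"


section \<open>Simplicial meshes\<close>

definition mesh :: "nat \<Rightarrow> 'a::euclidean_space set set \<Rightarrow> bool" where
  "mesh n \<M> \<longleftrightarrow> triangulation \<M> \<and> (\<forall>S\<in>\<M>. int n simplex S)"

definition mesh_without_boundary :: "'a::euclidean_space set set \<Rightarrow> bool" where
  "mesh_without_boundary \<M> \<longleftrightarrow>
     (\<forall>S\<in>\<M>. \<forall>F. F facet_of S \<longrightarrow> card {S'\<in>\<M>. F facet_of S'} = 2)"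

definition shape_regular :: "real \<Rightarrow> 'a::euclidean_space set set \<Rightarrow> bool" where
  "shape_regular \<kappa> \<M> \<longleftrightarrow> (\<forall>T\<in>\<M>. \<exists>z r. 0 < r \<and> cball z r \<subseteq> T \<and> diameter T \<le> \<kappa> * r)"

definition quasi_uniform :: "real \<Rightarrow> real \<Rightarrow> 'a::euclidean_space set set \<Rightarrow> bool" where
  "quasi_uniform \<mu> h \<M> \<longleftrightarrow> (\<forall>T\<in>\<M>. diameter T \<le> \<mu> * h \<and> h \<le> \<mu> * diameter T)"

definition parallel_space :: "'a::euclidean_space set \<Rightarrow> 'a set" where
  "parallel_space K = {x - y |x y. x \<in> affine hull K \<and> y \<in> affine hull K}"

text \<open>Piecewise constant quantities on a mesh are evaluated at a point by choosing a cell containing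
  it. The choice matters only on lower-dimensional faces, that is, on a null set.\<close>

definition cell :: "'a set set \<Rightarrow> 'a \<Rightarrow> 'a set" where
  "cell \<M> x = (SOME S. S \<in> \<M> \<and> x \<in> S)"

definition active_mesh :: "'a set set \<Rightarrow> 'a set set \<Rightarrow> 'a set set" where
  "active_mesh \<T> \<K> = {T\<in>\<T>. T \<inter> \<Union>\<K> \<noteq> {}}"

definition compatible :: "'a::euclidean_space set set \<Rightarrow> 'a set set \<Rightarrow> bool" where
  "compatible \<K> \<T> \<longleftrightarrow> (\<forall>K\<in>\<K>. \<forall>T\<in>\<T>. rel_interior K \<inter> T \<noteq> {} \<longrightarrow> K \<subseteq> T)"


section \<open>The discrete manifold\<close>

definition P_disc :: "'a::euclidean_space set set \<Rightarrow> 'a \<Rightarrow> 'a \<Rightarrow> 'a" where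
  "P_disc \<K> y w = orth_proj (parallel_space (cell \<K> y)) w"

definition Q_disc :: "'a::euclidean_space set set \<Rightarrow> 'a \<Rightarrow> 'a \<Rightarrow> 'a" where
  "Q_disc \<K> y w = w - P_disc \<K> y w"

definition Q_ext :: "'a::euclidean_space set \<Rightarrow> 'a set set \<Rightarrow> 'a \<Rightarrow> 'a \<Rightarrow> 'a" where
  "Q_ext \<Gamma> \<K> x w = Q_disc \<K> (THE y. y \<in> \<Union>\<K> \<and> closest_point \<Gamma> y = closest_point \<Gamma> x) w"

text \<open>The \<open>L\<^sup>\<infinity>\<close> bounds: the projection onto a cell is unambiguous exactly in the
  relative interiors of the cells, which have full measure in \<open>\<Union>\<K>\<close>; there the integrand is
  continuous, so that the essential supremum is the supremum.\<close>

definition discrete_manifold ::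
  "nat \<Rightarrow> 'a::euclidean_space set \<Rightarrow> real \<Rightarrow> real \<Rightarrow> real \<Rightarrow> real \<Rightarrow> 'a set set \<Rightarrow> bool" where
  "discrete_manifold d \<Gamma> \<delta> C\<^sub>\<rho> C\<^sub>P h \<K> \<longleftrightarrow>
     mesh d \<K> \<and> mesh_without_boundary \<K> \<and>
     \<Union>\<K> \<subseteq> tube \<Gamma> \<delta> \<and>
     bij_betw (closest_point \<Gamma>) (\<Union>\<K>) \<Gamma> \<and>
     (\<forall>x\<in>\<Union>\<K>. infdist x \<Gamma> \<le> C\<^sub>\<rho> * h\<^sup>2) \<and>
     (\<forall>K\<in>\<K>. \<forall>x\<in>rel_interior K.
        onorm (\<lambda>w. orth_proj (tangent_space \<Gamma> (closest_point \<Gamma> x)) w - P_disc \<K> x w) \<le> C\<^sub>P * h)"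

definition background_mesh ::
  "'a::euclidean_space set \<Rightarrow> real \<Rightarrow> real \<Rightarrow> real \<Rightarrow> real \<Rightarrow> 'a set set \<Rightarrow> bool" where
  "background_mesh \<Gamma> \<delta> \<kappa> \<mu> h \<T> \<longleftrightarrow>
     mesh DIM('a) \<T> \<and> shape_regular \<kappa> \<T> \<and> quasi_uniform \<mu> h \<T> \<and>
     (\<exists>\<Omega>. open \<Omega> \<and> bounded \<Omega> \<and> tube \<Gamma> \<delta> \<subseteq> \<Omega> \<and> \<Omega> \<subseteq> \<Union>\<T>)"


section \<open>Integration over the discrete manifold\<close>

definition orthonormal_basis_of :: "'a::euclidean_space set \<Rightarrow> 'a set \<Rightarrow> bool" where
  "orthonormal_basis_of B S \<longleftrightarrow>
     B \<subseteq> S \<and> pairwise orthogonal B \<and> (\<forall>b\<in>B. norm b = 1) \<and> span B = S"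

text \<open>Lebesgue measure of dimension \<open>aff_dim A\<close> on a nonempty affine subspace \<open>A\<close>: the image of
  product Lebesgue measure under orthonormal coordinates, as in the library fact \<open>lborel_eq\<close>. It
  does not depend on the chosen origin and basis.\<close>

definition affine_lebesgue :: "'a::euclidean_space set \<Rightarrow> 'a measure" where
  "affine_lebesgue A =
     (let a = (SOME a. a \<in> A); B = (SOME B. orthonormal_basis_of B (parallel_space A))
      in distr (\<Pi>\<^sub>M b\<in>B. lborel) borel (\<lambda>t. a + (\<Sum>b\<in>B. t b *\<^sub>R b)))"

definition surface_integral :: "'a::euclidean_space set set \<Rightarrow> ('a \<Rightarrow> real) \<Rightarrow> real" where
  "surface_integral \<K> f = (\<Sum>K\<in>\<K>. LINT x:K|affine_lebesgue (affine hull K). f x)"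

definition surface_average :: "'a::euclidean_space set set \<Rightarrow> ('a \<Rightarrow> real) \<Rightarrow> real" where
  "surface_average \<K> v = surface_integral \<K> v / surface_integral \<K> (\<lambda>_. 1)"


section \<open>Finite element functions and the stabilization form\<close>

definition V_space :: "'a::euclidean_space set set \<Rightarrow> ('a \<Rightarrow> real) set" where
  "V_space \<T> = {v. continuous_on (\<Union>\<T>) v \<and> (\<forall>T\<in>\<T>. \<exists>g b. \<forall>x\<in>T. v x = g \<bullet> x + b)}"

text \<open>The gradient of \<open>v\<close> restricted to \<open>T\<close>; it is constant on a nondegenerate simplex of full
  dimension on which \<open>v\<close> is affine.\<close>

definition element_gradient :: "('a::euclidean_space \<Rightarrow> real) \<Rightarrow> 'a set \<Rightarrow> 'a" where
  "element_gradient v T = (THE g. \<forall>x\<in>T. (v has_derivative (\<lambda>w. g \<bullet> w)) (at x within T))"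

definition broken_gradient :: "'a::euclidean_space set set \<Rightarrow> ('a \<Rightarrow> real) \<Rightarrow> 'a \<Rightarrow> 'a" where
  "broken_gradient \<T> v x = element_gradient v (cell \<T> x)"

text \<open>On a cell \<open>K\<close> contained in a face shared by several elements, \<open>\<nabla>v\<close> depends on the element
  chosen, but its projection onto the directions of \<open>K\<close> does not, since \<open>v\<close> is continuous.\<close>

definition surface_gradient ::
  "'a::euclidean_space set set \<Rightarrow> 'a set set \<Rightarrow> ('a \<Rightarrow> real) \<Rightarrow> 'a \<Rightarrow> 'a" where
  "surface_gradient \<K> \<T> v y = P_disc \<K> y (broken_gradient \<T> v y)"

text \<open>In this section's definitions \<open>\<T>\<close> is the active mesh, so \<open>\<Union>\<T>\<close> is \<open>N\<^sub>h\<close>.\<close>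

definition stab ::
  "real \<Rightarrow> nat \<Rightarrow> 'a::euclidean_space set \<Rightarrow> real \<Rightarrow> 'a set set \<Rightarrow> 'a set set \<Rightarrow>
   ('a \<Rightarrow> real) \<Rightarrow> ('a \<Rightarrow> real) \<Rightarrow> real" where
  "stab \<alpha> c \<Gamma> h \<K> \<T> v w =
     h powr (\<alpha> - real c) *
     (LINT x:\<Union>\<T>|lebesgue.
        Q_ext \<Gamma> \<K> x (broken_gradient \<T> v x) \<bullet> Q_ext \<Gamma> \<K> x (broken_gradient \<T> w x))"

end

theory Submission
  imports Defs "HOL-Analysis.Analysis"
begin

text \<open>
  Near a point \<open>y0\<close> of \<open>\<Gamma>\<^sub>h\<close> in an active element \<open>T\<close>, the discrete manifold is a Lipschitz graph over the
  tangent space, so every point \<open>x\<close> at distance \<open>O(h)\<close> has a vertical projection \<open>Y x\<close> onto \<open>\<Gamma>\<^sub>h\<close>, and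
  surface integrals are comparable with integrals of \<open>v (Y x)\<close> over \<open>k\<close>-dimensional balls. Since
  \<open>\<Gamma>\<^sub>h\<close> may cut \<open>T\<close> in an arbitrarily small piece, \<open>v\<close> on \<open>T\<close> has to be compared with \<open>v\<close> on a
  neighbour \<open>T'\<close> that contains a fixed fraction of the graph. At a tiny scale all elements near \<open>y0\<close>
  contain \<open>y0\<close>, and moving vertically changes \<open>v\<close> only by the normal gradient. Scales at which a further element
  comes close are jumped over by dilating about a point common to all elements seen so far; as only
  boundedly many elements are near \<open>y0\<close>, finitely many jumps reach scale \<open>h\<close>, with constants that do not depend on
  the position of \<open>\<Gamma>\<^sub>h\<close>. Replacing the tangential projection at \<open>y0\<close> by \<open>Q\<^sub>h\<close> costs \<open>O(h) |\<nabla>v|\<close>,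
  which is absorbed after summation over the elements.

  The second estimate is the first one for \<open>v\<close> minus its average, combined with a Poincare inequality
  on \<open>\<Gamma>\<^sub>h\<close>: it holds on each graph chart by integration along segments, and chains of
  overlapping charts connect any two points of \<open>\<Gamma>\<close>.
\<close>

section \<open>Linear images of Lebesgue measure\<close>

text \<open>Control passes between elements by measure: an affine function of slope \<open>b\<close>
  is small only on a thin slab, so its size on a set that fills a fixed fraction of a ball
  determines \<open>b\<close> up to a constant. A pigeonhole over boundedly many elements supplies
  such sets, and every comparison of two gradients is a slab estimate on one of them. The cells of
  the discrete manifold need not be shape-regular, so no scaling argument on a single cell is
  available; functions on the surface are therefore pulled back along the vertical projection to
  balls of the whole space, and a cell enters through the Lebesgue measure of cylinders over it. The
  constants \<open>h0\<close> and \<open>C\<close> have to be fixed before the mesh is known. This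
  is why the induction over scales carries explicit recursions (\<open>fan_c\<close>,
  \<open>fan_C\<close>), and why lengths are written as factors free of \<open>h\<close> times
  \<open>h\<close>: the constants are then functions of these factors alone.\<close>

lemma translation_invariant_proportional:
  fixes \<nu> :: "'a::euclidean_space measure"
  assumes sf: "sigma_finite_measure \<nu>" and sets: "sets \<nu> = sets borel"
    and inv: "\<And>c. distr \<nu> borel ((+) c) = \<nu>"
    and A[measurable]: "A \<in> sets borel" and B[measurable]: "B \<in> sets borel"
  shows "emeasure \<nu> A * emeasure lborel B = emeasure \<nu> B * emeasure lborel A"
proof -
  interpret n: sigma_finite_measure \<nu> by fact
  interpret p: pair_sigma_finite lborel \<nu> ..
  note sets[measurable_cong]
  \<comment> \<open>Uniqueness of Haar measure by Fubini: the double integral of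
    \<open>indicator A x * indicator B (x + y)\<close> is evaluated in both orders. Shifting
    \<open>x\<close> by \<open>- y\<close> moves the dependence on \<open>y\<close> into
    \<open>A\<close>, and the reflection of \<open>y\<close> then splits off the measure of
    \<open>A\<close>.\<close>
  have "emeasure \<nu> A * emeasure lborel B = (\<integral>\<^sup>+x. indicator A x * emeasure lborel B \<partial>\<nu>)"
    using sets by (simp add: nn_integral_multc)
  also have "\<dots> = (\<integral>\<^sup>+x. (\<integral>\<^sup>+y. indicator A x * indicator B (x + y) \<partial>lborel) \<partial>\<nu>)"
  proof (intro nn_integral_cong)
    fix x
    have "emeasure lborel B = (\<integral>\<^sup>+y. indicator B y \<partial>distr lborel borel ((+) x))"
      by (simp add: lborel_distr_plus)
    also have "\<dots> = (\<integral>\<^sup>+y. indicator B (x + y) \<partial>lborel)"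
      by (subst nn_integral_distr) auto
    finally show "indicator A x * emeasure lborel B = (\<integral>\<^sup>+y. indicator A x * indicator B (x + y) \<partial>lborel)"
      by (simp add: nn_integral_cmult)
  qed
  also have "\<dots> = (\<integral>\<^sup>+y. (\<integral>\<^sup>+x. indicator A x * indicator B (x + y) \<partial>\<nu>) \<partial>lborel)"
    by (rule p.Fubini') measurable
  also have "\<dots> = (\<integral>\<^sup>+y. (\<integral>\<^sup>+x. indicator A (x - y) * indicator B x \<partial>\<nu>) \<partial>lborel)"
  proof (rule nn_integral_cong)
    fix y
    have "(\<integral>\<^sup>+x. indicator A x * indicator B (x + y) \<partial>\<nu>)
        = (\<integral>\<^sup>+x. indicator A x * indicator B (x + y) \<partial>distr \<nu> borel ((+) (-y)))"
      by (simp add: inv)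
    also have "\<dots> = (\<integral>\<^sup>+x. indicator A (-y + x) * indicator B (-y + x + y) \<partial>\<nu>)"
      by (subst nn_integral_distr) auto
    finally show "(\<integral>\<^sup>+x. indicator A x * indicator B (x + y) \<partial>\<nu>) =
        (\<integral>\<^sup>+x. indicator A (x - y) * indicator B x \<partial>\<nu>)"
      by (simp add: algebra_simps)
  qed
  also have "\<dots> = (\<integral>\<^sup>+x. (\<integral>\<^sup>+y. indicator A (x - y) * indicator B x \<partial>lborel) \<partial>\<nu>)"
    by (rule p.Fubini'[symmetric]) measurable
  also have "\<dots> = (\<integral>\<^sup>+x. emeasure lborel A * indicator B x \<partial>\<nu>)"
  proof (intro nn_integral_cong)
    fix x
    have e: "(lborel :: 'a measure) = distr lborel borel (\<lambda>y. x - y)"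
      using lborel_affine[of "-1" x] by (simp add: density_1)
    have "emeasure lborel A = (\<integral>\<^sup>+y. indicator A y \<partial>distr lborel borel (\<lambda>y. x - y))"
      by (simp flip: e)
    also have "\<dots> = (\<integral>\<^sup>+y. indicator A (x - y) \<partial>lborel)"
      by (subst nn_integral_distr) auto
    finally show "(\<integral>\<^sup>+y. indicator A (x - y) * indicator B x \<partial>lborel) = emeasure lborel A * indicator B x"
      by (simp add: nn_integral_multc)
  qed
  also have "\<dots> = emeasure \<nu> B * emeasure lborel A"
    using sets by (subst nn_integral_cmult) (auto simp: mult.commute)
  finally show ?thesis .
qed

lemma borel_linear_image:
  fixes L :: "'a::euclidean_space \<Rightarrow> 'a"
  assumes "linear L" "inj L" "A \<in> sets borel"
  shows "L ` A \<in> sets borel"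
proof -
  obtain M where M: "linear M" "\<And>x. M (L x) = x"
    using linear_injective_left_inverse[OF assms(1,2)] by (auto simp: fun_eq_iff)
  have "surj L" using assms linear_injective_imp_surjective by blast
  then have LM: "L (M y) = y" for y using M(2) by (metis surjD)
  have "L ` A = M -` A" using M(2) LM by (auto simp: image_iff) (metis LM)
  moreover have "M \<in> borel_measurable borel"
    using M(1) by (simp add: borel_measurable_continuous_onI linear_continuous_on linear_conv_bounded_linear)
  ultimately show ?thesis using assms(3) by (metis measurable_sets_borel)
qed

text \<open>The pushforward of Lebesgue measure under the inverse of \<open>L\<close> is again
  translation invariant, hence proportional to Lebesgue measure. The factor is left implicit in the
  cross-multiplied form; it gets bounded later by comparing balls, without a determinant.\<close>

lemma emeasure_lborel_linear_image:
  fixes L :: "'a::euclidean_space \<Rightarrow> 'a"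
  assumes L: "linear L" "inj L" and A: "A \<in> sets borel" and B: "B \<in> sets borel"
  shows "emeasure lborel (L ` A) * emeasure lborel B = emeasure lborel (L ` B) * emeasure lborel A"
proof -
  obtain M where M: "linear M" "\<And>x. M (L x) = x"
    using linear_injective_left_inverse[OF L] by (auto simp: fun_eq_iff)
  have "surj L" using L linear_injective_imp_surjective by blast
  then have LM: "L (M y) = y" for y using M(2) by (metis surjD)
  have Mm[measurable]: "M \<in> borel_measurable borel"
    using M(1) by (simp add: borel_measurable_continuous_onI linear_continuous_on linear_conv_bounded_linear)
  have im: "L ` X = M -` X" for X using M(2) LM by (auto simp: image_iff) (metis LM)
  define \<nu> where "\<nu> = distr lborel borel M"
  have e: "emeasure \<nu> X = emeasure lborel (L ` X)" if "X \<in> sets borel" for X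
    unfolding \<nu>_def im using that by (simp add: emeasure_distr)
  have inv: "distr \<nu> borel ((+) c) = \<nu>" for c
  proof -
    have "distr \<nu> borel ((+) c) = distr lborel borel (\<lambda>x. c + M x)"
      unfolding \<nu>_def by (subst distr_distr) (auto simp: comp_def)
    also have "(\<lambda>x. c + M x) = (\<lambda>x. M (L c + x))"
      using M by (auto simp: linear_add)
    also have "distr lborel borel \<dots> = distr (distr lborel borel ((+) (L c))) borel M"
      by (subst distr_distr) (auto simp: comp_def)
    also have "\<dots> = \<nu>" by (simp add: lborel_distr_plus \<nu>_def)
    finally show ?thesis .
  qed
  have "sigma_finite_measure \<nu>"
  proof
    \<comment> \<open>The images of balls under \<open>M\<close> have as \<nu>-measure the volume of
      the balls, since \<open>L\<close> undoes \<open>M\<close>.\<close>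
    let ?A = "range (\<lambda>n::nat. M ` cball 0 (real n))"
    show "\<exists>A. countable A \<and> A \<subseteq> sets \<nu> \<and> \<Union> A = space \<nu> \<and> (\<forall>a\<in>A. emeasure \<nu> a \<noteq> \<infinity>)"
    proof (intro exI[of _ ?A] conjI ballI)
      have c: "compact (M ` cball 0 (real n))" for n
        by (intro compact_continuous_image linear_continuous_on) (use M in \<open>auto simp: linear_conv_bounded_linear\<close>)
      show "?A \<subseteq> sets \<nu>" using c by (auto simp: \<nu>_def intro!: borel_compact)
      show "\<Union> ?A = space \<nu>"
      proof -
        have "y \<in> \<Union> ?A" for y
        proof -
          obtain n :: nat where "norm (L y) \<le> real n" using real_arch_simple by blast
          then have "M (L y) \<in> M ` cball 0 (real n)" by (intro imageI) simp
          then show ?thesis by (auto simp: M(2))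
        qed
        then show ?thesis by (auto simp: \<nu>_def)
      qed
      fix a assume "a \<in> ?A"
      then obtain n where a: "a = M ` cball 0 (real n)" by auto
      have "emeasure \<nu> a = emeasure lborel (L ` a)" using c a by (intro e) (auto intro: borel_compact)
      also have "L ` a = cball 0 (real n)" using LM by (auto simp: a image_iff)
      finally show "emeasure \<nu> a \<noteq> \<infinity>" 
        using emeasure_lborel_cbox_finite by (metis bounded_cball emeasure_bounded_finite infinity_ennreal_def less_top)
    qed auto
  qed
  moreover have "sets \<nu> = sets borel" by (simp add: \<nu>_def)
  ultimately have "emeasure \<nu> A * emeasure lborel B = emeasure \<nu> B * emeasure lborel A"
    by (rule translation_invariant_proportional[OF _ _ inv A B])
  then show ?thesis
    using A B by (simp add: e)
qed

lemma borel_affine_scale: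
  fixes E :: "'a::euclidean_space set"
  assumes "E \<in> sets borel" "l \<noteq> 0"
  shows "(\<lambda>x. l *\<^sub>R x + a) ` E \<in> sets borel"
    and "measure lborel ((\<lambda>x. l *\<^sub>R x + a) ` E) = \<bar>l\<bar> ^ DIM('a) * measure lborel E"
proof -
  have "(\<lambda>x. l *\<^sub>R x + a) ` E = (\<lambda>y. (1 / l) *\<^sub>R (y - a)) -` E"
  proof (intro set_eqI iffI)
    fix y assume "y \<in> (\<lambda>y. (1 / l) *\<^sub>R (y - a)) -` E"
    then have "(1 / l) *\<^sub>R (y - a) \<in> E" by simp
    moreover have "y = l *\<^sub>R ((1 / l) *\<^sub>R (y - a)) + a" using assms(2) by simp
    ultimately show "y \<in> (\<lambda>x. l *\<^sub>R x + a) ` E" by blast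
  qed (use assms in auto)
  moreover have "(\<lambda>y::'a. (1 / l) *\<^sub>R (y - a)) \<in> borel_measurable borel" by measurable
  ultimately show b: "(\<lambda>x. l *\<^sub>R x + a) ` E \<in> sets borel"
    using assms(1) by (metis measurable_sets_borel)
  show "measure lborel ((\<lambda>x. l *\<^sub>R x + a) ` E) = \<bar>l\<bar> ^ DIM('a) * measure lborel E"
    using measure_lebesgue_affine[of l a E] b assms(1) by (simp add: measure_completion)
qed

section \<open>Volume of thin slabs\<close>

definition slab_const :: "nat \<Rightarrow> real" where
  "slab_const n = 3 ^ (n + 1) * unit_ball_vol (real n)"

lemma slab_const_pos: "0 < slab_const n"
  by (simp add: slab_const_def)

lemma measure_ball_lborel:
  "0 \<le> r \<Longrightarrow> measure lborel (ball (x::'a::euclidean_space) r) = unit_ball_vol (real DIM('a)) * r ^ DIM('a)"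
  by (simp add: measure_def emeasure_ball)

text \<open>A packing argument in place of a rotation: shifts of \<open>E\<close> that raise the
  functional \<open>b\<close> by more than the width of the slab are pairwise disjoint, and about
  \<open>\<rho> * norm b / (3 * \<delta>)\<close> of them fit into the concentric ball of three
  times the radius. In this multiplied form the bound also covers \<open>b = 0\<close>.\<close>

lemma measure_slab:
  fixes b g :: "'a::euclidean_space"
  assumes E: "E \<in> sets borel" "E \<subseteq> ball g \<rho>" and \<rho>: "0 < \<rho>" and "0 \<le> \<delta>"
    and slab: "\<And>x. x \<in> E \<Longrightarrow> \<bar>b \<bullet> (x - g)\<bar> \<le> \<delta>"
  shows "norm b * \<rho> * measure lborel E \<le> slab_const DIM('a) * \<delta> * \<rho> ^ DIM('a)"
proof (cases "b = 0")
  case True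
  then show ?thesis using assms slab_const_pos[of "DIM('a)"] by simp
next
  case False
  let ?w = "unit_ball_vol (real DIM('a))"
  let ?M = "measure lborel E"
  have fin: "E \<in> fmeasurable lborel"
    using E bounded_subset[OF bounded_ball E(2)] by (intro fmeasurableI emeasure_bounded_finite) auto
  \<comment> \<open>A positive \<open>d\<close> replaces \<delta>, so that the number of shifts is
    finite; \<delta> = 0 is recovered by letting \<open>d\<close> tend to 0.\<close>
  have main: "norm b * \<rho> * ?M \<le> slab_const DIM('a) * d * \<rho> ^ DIM('a)"
    if d: "0 < d" "\<delta> \<le> d" for d
  proof -
    define t where "t = \<rho> * norm b / (3 * d)"
    have t: "0 < t" using d \<rho> False by (simp add: t_def)
    \<comment> \<open>Rounding up yields at least \<open>t\<close> shifts, while their indices start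
      at 0 and so stay at most \<open>t\<close>; hence no shift moves \<open>E\<close> by more than
      \<open>t * norm e = \<rho>\<close>.\<close>
    define m where "m = nat \<lceil>t\<rceil>"
    have m: "t \<le> real m" "real m \<le> t + 1" using t by (auto simp: m_def)
    \<comment> \<open>Along \<open>e\<close> the functional grows by \<open>3 * d\<close>, whereas
      two points of \<open>E\<close> differ in it by at most \<open>2 * d\<close>; this separates
      the shifts.\<close>
    define e where "e = (3 * d / (norm b)^2) *\<^sub>R b"
    have be: "b \<bullet> e = 3 * d" using False by (simp add: e_def power2_norm_eq_inner)
    have ne: "norm e = 3 * d / norm b" using d False by (simp add: e_def power2_eq_square)
    have te: "t * norm e = \<rho>" using d False by (simp add: ne t_def)
    define D where "D j = (\<lambda>x. 1 *\<^sub>R x + real j *\<^sub>R e) ` E" for j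
    have Dm: "D j \<in> fmeasurable lborel" "measure lborel (D j) = ?M" for j
    proof -
      have Db: "D j \<in> sets borel" "measure lborel (D j) = ?M"
        using borel_affine_scale[OF E(1), of 1 "real j *\<^sub>R e"] by (simp_all add: D_def)
      have "bounded ((+) (real j *\<^sub>R e) ` E)"
        using bounded_subset[OF bounded_ball E(2)] by (rule bounded_translation)
      then have "bounded (D j)" by (simp add: D_def add.commute)
      then show "D j \<in> fmeasurable lborel"
        using Db by (intro fmeasurableI emeasure_bounded_finite) auto
      show "measure lborel (D j) = ?M" by fact
    qed
    have disj: "disjoint_family_on D {..<m}"
    proof (unfold disjoint_family_on_def, intro ballI impI)
      fix i j :: nat assume "i \<noteq> j"
      show "D i \<inter> D j = {}"
      proof (rule ccontr)
        assume "D i \<inter> D j \<noteq> {}"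
        then obtain x y where xy: "x \<in> E" "y \<in> E" "real i *\<^sub>R e + x = real j *\<^sub>R e + y"
          unfolding D_def by (auto simp: add.commute)
        then have "b \<bullet> (real i *\<^sub>R e + (x - g)) = b \<bullet> (real j *\<^sub>R e + (y - g))" 
          by (metis add_diff_eq)
        then have "(real i - real j) * (3 * d) = b \<bullet> (y - g) - b \<bullet> (x - g)"
          by (simp add: inner_add_right be algebra_simps)
        moreover have "\<bar>b \<bullet> (y - g) - b \<bullet> (x - g)\<bar> \<le> 2 * d" using slab[OF xy(1)] slab[OF xy(2)] d by linarith
        moreover have "1 \<le> \<bar>real i - real j\<bar>" using \<open>i \<noteq> j\<close> by linarith
        then have "3 * d \<le> \<bar>(real i - real j) * (3 * d)\<bar>" using d by (simp add: abs_mult)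
        ultimately show False using d by linarith
      qed
    qed
    have sub: "(\<Union>j<m. D j) \<subseteq> ball g (3 * \<rho>)"
    proof
      fix z assume "z \<in> (\<Union>j<m. D j)"
      then obtain j x where jx: "j < m" "x \<in> E" "z = real j *\<^sub>R e + x"
        unfolding D_def by (auto simp: add.commute)
      have "real j \<le> t" using jx(1) m(2) by linarith
      have "norm (z - g) \<le> real j * norm e + norm (x - g)"
        unfolding jx(3) by (metis norm_scaleR norm_triangle_ineq add_diff_eq abs_of_nat)
      also have "\<dots> \<le> t * norm e + norm (x - g)" using \<open>real j \<le> t\<close> by (intro add_right_mono mult_right_mono) auto
      also have "\<dots> < \<rho> + \<rho>" using te jx(2) E(2) by (auto simp: dist_norm norm_minus_commute)
      finally show "z \<in> ball g (3 * \<rho>)" using \<rho> by (simp add: dist_norm norm_minus_commute)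
    qed
    have "real m * ?M = measure lborel (\<Union>j<m. D j)"
    proof -
      have "D ` {..<m} \<subseteq> sets lborel" using fmeasurableD[OF Dm(1)] by auto
      from measure_finite_Union[OF _ this disj] show ?thesis
        using Dm fmeasurableD2[OF Dm(1)] by simp
    qed
    also have "\<dots> \<le> measure lborel (ball g (3 * \<rho>))"
      using sub fmeasurableD[OF Dm(1)] by (intro measure_mono_fmeasurable) (auto intro!: fmeasurableI emeasure_bounded_finite sets.finite_UN)
    also have "\<dots> = ?w * 3 ^ DIM('a) * \<rho> ^ DIM('a)"
      using \<rho> by (simp add: measure_ball_lborel power_mult_distrib)
    finally have "t * ?M \<le> ?w * 3 ^ DIM('a) * \<rho> ^ DIM('a)"
      using mult_right_mono[OF m(1), of ?M] by simp
    then have "t * ?M * (3 * d) \<le> ?w * 3 ^ DIM('a) * \<rho> ^ DIM('a) * (3 * d)"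
      using d by (intro mult_right_mono) auto
    moreover have "t * ?M * (3 * d) = norm b * \<rho> * ?M" using d by (simp add: t_def)
    moreover have "?w * 3 ^ DIM('a) * \<rho> ^ DIM('a) * (3 * d) = slab_const DIM('a) * d * \<rho> ^ DIM('a)"
      by (simp add: slab_const_def)
    ultimately show ?thesis by (simp only:)
  qed
  show ?thesis
  proof (cases "\<delta> = 0")
    case False
    then show ?thesis using \<open>0 \<le> \<delta>\<close> by (intro main) auto
  next
    case True
    show ?thesis
    proof (rule field_le_epsilon)
      fix e :: real assume "0 < e"
      define d where "d = e / (slab_const DIM('a) * \<rho> ^ DIM('a))"
      have "0 < d" using \<open>0 < e\<close> \<rho> slab_const_pos[of "DIM('a)"] by (simp add: d_def)
      moreover have "slab_const DIM('a) * d * \<rho> ^ DIM('a) = e"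
        using \<rho> slab_const_pos[of "DIM('a)"] by (simp add: d_def)
      ultimately show "norm b * \<rho> * ?M \<le> slab_const DIM('a) * \<delta> * \<rho> ^ DIM('a) + e"
        using main[of d] True by simp
    qed
  qed
qed

text \<open>Left of the first point of \<open>S i\<close> the other sets must do all the covering,
  and as they are closed and finitely many they cover that point too. An induction can therefore
  drop \<open>i\<close>.\<close>

lemma closed_cover_first:
  fixes S :: "'i \<Rightarrow> real set"
  assumes cl: "\<And>i. i \<in> I \<Longrightarrow> closed (S i)" and fin: "finite I" and cov: "{l..u} \<subseteq> (\<Union>i\<in>I. S i)"
    and i: "i \<in> I" "u \<in> S i" and lu: "l \<le> u"
  obtains m where "m \<in> S i" "l \<le> m" "m \<le> u" "m = l \<or> {l..m} \<subseteq> (\<Union>j\<in>I - {i}. S j)"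
proof -
  have "compact (S i \<inter> {l..u})" using cl i by (simp add: closed_Int_compact)
  moreover have "S i \<inter> {l..u} \<noteq> {}" using i lu by auto
  ultimately obtain m where m: "m \<in> S i \<inter> {l..u}" "\<And>t. t \<in> S i \<inter> {l..u} \<Longrightarrow> m \<le> t"
    using compact_attains_inf by metis
  have "{l..m} \<subseteq> (\<Union>j\<in>I - {i}. S j)" if "m \<noteq> l"
  proof -
    have "l < m" using m that by auto
    have "closed (\<Union>j\<in>I - {i}. S j)" using cl fin by auto
    moreover have "{l..<m} \<subseteq> (\<Union>j\<in>I - {i}. S j)"
    proof
      fix t assume t: "t \<in> {l..<m}"
      then have "t \<notin> S i" using m by force
      moreover have "t \<in> (\<Union>j\<in>I. S j)" using t m by (intro subsetD[OF cov]) auto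
      ultimately show "t \<in> (\<Union>j\<in>I - {i}. S j)" by blast
    qed
    ultimately have "closure {l..<m} \<subseteq> (\<Union>j\<in>I - {i}. S j)" by (rule closure_minimal[rotated])
    then show ?thesis using \<open>l < m\<close> by simp
  qed
  then show ?thesis using that m by auto
qed

text \<open>Going back from \<open>u\<close> at once to the first point of a set containing
  \<open>u\<close> uses every set at most once, however often the order of the sets alternates along
  the interval.\<close>

lemma closed_cover_chain:
  fixes f :: "real \<Rightarrow> real" and S :: "'i \<Rightarrow> real set"
  assumes "finite I" and "\<And>i. i \<in> I \<Longrightarrow> closed (S i)" and "{l..u} \<subseteq> (\<Union>i\<in>I. S i)" and "l \<le> u"
    and "\<And>i s t. i \<in> I \<Longrightarrow> s \<in> S i \<Longrightarrow> t \<in> S i \<Longrightarrow> s \<in> {l..u} \<Longrightarrow> t \<in> {l..u} \<Longrightarrow> \<bar>f s - f t\<bar> \<le> B"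
  shows "\<bar>f u - f l\<bar> \<le> real (card I) * B"
  using assms
proof (induction "card I" arbitrary: I u)
  case 0
  then have "I = {}" by simp
  with 0(4) have "{l..u} = {}" by simp
  with \<open>l \<le> u\<close> show ?case by simp
next
  case (Suc n)
  obtain i where i: "i \<in> I" "u \<in> S i" using subsetD[OF Suc.prems(3), of u] Suc.prems(4) by auto
  obtain m where m: "m \<in> S i" "l \<le> m" "m \<le> u" "m = l \<or> {l..m} \<subseteq> (\<Union>j\<in>I - {i}. S j)"
    using closed_cover_first[OF Suc.prems(2,1,3) i Suc.prems(4)] .
  have B: "\<bar>f u - f m\<bar> \<le> B" using Suc.prems(4) i m by (intro Suc.prems(5)[of i]) auto
  have c: "card (I - {i}) = n" using Suc.hyps(2) Suc.prems(1) i by simp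
  have "\<bar>f m - f l\<bar> \<le> real n * B"
  proof (cases "m = l")
    case True
    have "0 \<le> B" using B by linarith
    then show ?thesis using True by simp
  next
    case False
    have "\<bar>f m - f l\<bar> \<le> real (card (I - {i})) * B"
    proof (rule Suc.hyps(1))
      show "n = card (I - {i})" using c by simp
      show "{l..m} \<subseteq> (\<Union>j\<in>I - {i}. S j)" using m False by simp
      fix j s t assume "j \<in> I - {i}" "s \<in> S j" "t \<in> S j" "s \<in> {l..m}" "t \<in> {l..m}"
      then show "\<bar>f s - f t\<bar> \<le> B" using Suc.prems(5)[of j s t] m(3) by simp
    next
      show "finite (I - {i})" using Suc.prems(1) by simp
      show "closed (S j)" if "j \<in> I - {i}" for j using Suc.prems(2)[of j] that by simp
      show "l \<le> m" by fact
    qed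
    then show ?thesis by (simp add: c)
  qed
  then have "\<bar>f u - f l\<bar> \<le> real n * B + B" using B by linarith
  moreover have "real (card I) = real n + 1" using Suc.hyps(2) by simp
  ultimately show ?case by (simp add: algebra_simps)
qed

text \<open>A discrete form of the Cauchy-Schwarz bound for the square of an increment by the
  integral of the squared slope. Convexity is what lets the way from the first point of
  \<open>S i\<close> to \<open>u\<close> be charged to the length of \<open>S i\<close>.\<close>

lemma closed_cover_square:
  fixes f :: "real \<Rightarrow> real" and S :: "'i \<Rightarrow> real set"
  assumes "finite I" and "\<And>i. i \<in> I \<Longrightarrow> closed (S i)" and "\<And>i. i \<in> I \<Longrightarrow> convex (S i)"
    and "{l..u} \<subseteq> (\<Union>i\<in>I. S i)" and "l \<le> u"
    and "\<And>i s t. i \<in> I \<Longrightarrow> s \<in> S i \<Longrightarrow> t \<in> S i \<Longrightarrow> s \<in> {l..u} \<Longrightarrow> t \<in> {l..u} \<Longrightarrow> \<bar>f s - f t\<bar> \<le> a i * \<bar>s - t\<bar>"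
  shows "(f u - f l)\<^sup>2 \<le> (u - l) * (\<Sum>i\<in>I. (a i)\<^sup>2 * measure lborel (S i \<inter> {l..u}))"
  using assms
proof (induction "card I" arbitrary: I u)
  case 0
  then have "I = {}" by simp
  with 0(5) have "{l..u} = {}" by simp
  with \<open>l \<le> u\<close> show ?case by simp
next
  case (Suc n)
  obtain i where i: "i \<in> I" "u \<in> S i" using subsetD[OF Suc.prems(4), of u] Suc.prems(5) by auto
  obtain m where m: "m \<in> S i" "l \<le> m" "m \<le> u" "m = l \<or> {l..m} \<subseteq> (\<Union>j\<in>I - {i}. S j)"
    using closed_cover_first[OF Suc.prems(2,1,4) i Suc.prems(5)] .
  have c: "card (I - {i}) = n" using Suc.hyps(2) Suc.prems(1) i by simp
  have fm: "S j \<inter> {l..u} \<in> fmeasurable lborel" if "j \<in> I" for j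
    using Suc.prems(2)[OF that] by (intro fmeasurable_compact closed_Int_compact) auto
  have "\<bar>f u - f m\<bar> \<le> a i * (u - m)" using Suc.prems(5) Suc.prems(6)[of i u m] i m by simp
  then have "(f u - f m)\<^sup>2 \<le> (a i * (u - m))\<^sup>2" by (rule power_mono[of "\<bar>f u - f m\<bar>" _ 2, simplified power2_abs]) auto
  then have B: "(f u - f m)\<^sup>2 \<le> (u - m) * ((a i)\<^sup>2 * (u - m))" by (simp add: power2_eq_square mult_ac)
  let ?A = "\<Sum>j\<in>I - {i}. (a j)\<^sup>2 * measure lborel (S j \<inter> {l..u})"
  have A0: "0 \<le> ?A" by (intro sum_nonneg) auto
  have A: "(f m - f l)\<^sup>2 \<le> (m - l) * ?A"
  proof (cases "m = l")
    case False
    have "(f m - f l)\<^sup>2 \<le> (m - l) * (\<Sum>j\<in>I - {i}. (a j)\<^sup>2 * measure lborel (S j \<inter> {l..m}))"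
    proof (rule Suc.hyps(1))
      show "n = card (I - {i})" using c by simp
      show "{l..m} \<subseteq> (\<Union>j\<in>I - {i}. S j)" using m False by simp
      fix j s t assume "j \<in> I - {i}" "s \<in> S j" "t \<in> S j" "s \<in> {l..m}" "t \<in> {l..m}"
      then show "\<bar>f s - f t\<bar> \<le> a j * \<bar>s - t\<bar>" using Suc.prems(6)[of j s t] m(3) by simp
    next
      show "finite (I - {i})" using Suc.prems(1) by simp
      show "closed (S j)" if "j \<in> I - {i}" for j using Suc.prems(2)[of j] that by simp
      show "convex (S j)" if "j \<in> I - {i}" for j using Suc.prems(3)[of j] that by simp
      show "l \<le> m" by fact
    qed
    also have "\<dots> \<le> (m - l) * ?A"
      using m Suc.prems(2) fm by (intro mult_left_mono sum_mono measure_mono_fmeasurable) auto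
    finally show ?thesis .
  qed simp
  have "closed_segment m u \<subseteq> S i"
    using Suc.prems(3)[OF i(1)] m(1) i(2) by (rule closed_segment_subset[rotated 2])
  then have "{m..u} \<subseteq> S i \<inter> {l..u}"
    using m by (auto simp: closed_segment_eq_real_ivl split: if_splits)
  then have "measure lborel {m..u} \<le> measure lborel (S i \<inter> {l..u})"
    by (intro measure_mono_fmeasurable fm i) auto
  then have mu: "u - m \<le> measure lborel (S i \<inter> {l..u})" using m by simp
  define B' where "B' = (a i)\<^sup>2 * (u - m)"
  have B'0: "0 \<le> B'" using m by (simp add: B'_def)
  \<comment> \<open>Cauchy-Schwarz for two summands: the mixed term satisfies
    \<open>2 * (x * y) \<le> p * Z + q * X\<close> because the geometric mean is at most the
    arithmetic mean.\<close>
  have cs: "(x + y)\<^sup>2 \<le> (p + q) * (X + Z)"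
    if "x\<^sup>2 \<le> p * X" "y\<^sup>2 \<le> q * Z" "0 \<le> p" "0 \<le> q" "0 \<le> X" "0 \<le> Z" for x y p q X Z :: real
  proof -
    have "(x * y)\<^sup>2 \<le> (p * X) * (q * Z)" unfolding power_mult_distrib
      by (intro mult_mono that) (use that in auto)
    also have "4 * ((p * X) * (q * Z)) \<le> (p * Z + q * X)\<^sup>2"
      using zero_le_power2[of "p * Z - q * X"] by (simp add: power2_eq_square algebra_simps)
    finally have "(2 * (x * y))\<^sup>2 \<le> (p * Z + q * X)\<^sup>2" by (simp add: power_mult_distrib)
    then have "2 * (x * y) \<le> p * Z + q * X"
      by (rule power2_le_imp_le) (use that in auto)
    then show ?thesis using that by (simp add: power2_sum algebra_simps)
  qed
  have "(f u - f l)\<^sup>2 = ((f m - f l) + (f u - f m))\<^sup>2" by simp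
  also have "\<dots> \<le> ((m - l) + (u - m)) * (?A + B')"
    by (intro cs A) (use B B'0 A0 m in \<open>auto simp: B'_def\<close>)
  also have "\<dots> \<le> (u - l) * (?A + (a i)\<^sup>2 * measure lborel (S i \<inter> {l..u}))"
    using mu m unfolding B'_def by (auto intro!: mult_left_mono)
  also have "\<dots> = (u - l) * (\<Sum>i\<in>I. (a i)\<^sup>2 * measure lborel (S i \<inter> {l..u}))"
    using Suc.prems(1) i by (simp add: sum.remove[of I i] add.commute)
  finally show ?case .
qed

section \<open>Fans of elements around a point\<close>

lemma pigeonhole_measure:
  fixes E :: "'a::euclidean_space set"
  assumes E: "E \<in> fmeasurable lborel" and A: "\<And>T. T \<in> S \<Longrightarrow> E \<inter> A T \<in> sets borel"
    and cov: "E \<subseteq> (\<Union>T\<in>S. A T)" and S: "finite S" "S \<noteq> {}" "card S \<le> N"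
  obtains T where "T \<in> S" "measure lborel E \<le> real N * measure lborel (E \<inter> A T)"
proof -
  have fm: "E \<inter> A T \<in> fmeasurable lborel" if "T \<in> S" for T
    using A[OF that] E by (intro fmeasurableI2[OF E]) auto
  define M where "M = Max ((\<lambda>T. measure lborel (E \<inter> A T)) ` S)"
  have "M \<in> (\<lambda>T. measure lborel (E \<inter> A T)) ` S"
    unfolding M_def using S by (intro Max_in) auto
  then obtain T where T: "T \<in> S" "M = measure lborel (E \<inter> A T)" by auto
  have "measure lborel E = measure lborel (\<Union>T\<in>S. E \<inter> A T)"
    using cov by (intro arg_cong[where f="measure lborel"]) auto
  also have "\<dots> \<le> (\<Sum>T\<in>S. measure lborel (E \<inter> A T))"
    using fmeasurableD[OF fm] S by (intro measure_UNION_le) auto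
  also have "\<dots> \<le> (\<Sum>T\<in>S. M)"
    unfolding M_def using S by (intro sum_mono Max_ge) auto
  also have "\<dots> = real (card S) * M" by simp
  also have "\<dots> \<le> real N * M" using S T by (intro mult_right_mono) auto
  finally show ?thesis using that T by simp
qed

text \<open>Share of the relative measure that survives a jump. A jump to scale \<open>r'\<close>
  dilates a set of scale \<open>r\<close> only by \<open>r' / (M * r)\<close> with
  \<open>M = 2 * (1 + 2 * Cg)\<close>, which costs \<open>M ^ k\<close>; the choice of an element by
  pigeonhole costs \<open>N\<close>.\<close>

definition fan_ratio :: "nat \<Rightarrow> nat \<Rightarrow> real \<Rightarrow> real" where
  "fan_ratio k N Cg = 1 / (real N * (2 * (1 + 2 * Cg)) ^ k)"

text \<open>In units of \<open>G\<close>, the fraction bounds the change of the tangential gradient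
  in a jump: a slab of width proportional to \<open>(N + 2) * 6 * (2 * Cg + 1)\<close>, in a ball of
  radius \<open>(1 + Cg) * r\<close>, on a set of relative measure \<open>c / N\<close>. The
  \<open>2\<close> accounts for the normal parts of two gradients, the factor \<open>1 + Cg\<close>
  for moving the reference point from the common point to \<open>y0\<close>.\<close>

definition fan_incr :: "nat \<Rightarrow> nat \<Rightarrow> real \<Rightarrow> real \<Rightarrow> real" where
  "fan_incr k N Cg c =
     (slab_const k * (real N + 2) * 6 * (2 * Cg + 1) * (1 + Cg) ^ k * real N / c + 2) * (1 + Cg)"

text \<open>Guaranteed relative measure after \<open>n\<close> jumps; \<open>fan_C\<close> is the
  matching deviation. The initial values are those of \<open>state_tiny\<close>: a pigeonhole inside
  \<open>T0\<close>, whose relative measure is \<open>c0\<close>, and a slab of width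
  \<open>(3 * N + 3) * (G * e)\<close>.\<close>

fun fan_c :: "nat \<Rightarrow> nat \<Rightarrow> real \<Rightarrow> real \<Rightarrow> nat \<Rightarrow> real" where
  "fan_c k N Cg c0 0 = c0 / real N"
| "fan_c k N Cg c0 (Suc n) = fan_c k N Cg c0 n * fan_ratio k N Cg"

fun fan_C :: "nat \<Rightarrow> nat \<Rightarrow> real \<Rightarrow> real \<Rightarrow> nat \<Rightarrow> real" where
  "fan_C k N Cg c0 0 = slab_const k * (3 * real N + 3) * real N / c0"
| "fan_C k N Cg c0 (Suc n) = fan_C k N Cg c0 n + fan_incr k N Cg (fan_c k N Cg c0 n)"

text \<open>The situation around one point \<open>y0\<close>, freed of manifold and mesh:
  \<open>P\<close> is the tangential projection, \<open>Y\<close> moves points along the fibres of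
  \<open>P\<close> onto the surface, \<open>S\<close> collects the nearby elements, and
  \<open>G\<close> bounds the normal parts of their gradients. \<open>common_pt\<close> replaces the
  combinatorics of a simplicial mesh, \<open>fat\<close> its shape regularity, and
  \<open>local_cover\<close> says that the elements containing \<open>y0\<close> fill a
  neighbourhood of it.\<close>

locale fan =
  fixes P Y :: "'a::euclidean_space \<Rightarrow> 'a" and y0 :: 'a and R :: real and S :: "'a set set"
    and v :: "'a \<Rightarrow> real" and gr :: "'a set \<Rightarrow> 'a" and G Cg c0 :: real and N :: nat and T0 :: "'a set"
  assumes linP: "linear P" and symP: "\<And>x y. P x \<bullet> y = x \<bullet> P y" and PP: "\<And>x. P (P x) = P x"
    and finS: "finite S" and cardS: "card S \<le> N"
    and closedS: "\<And>T. T \<in> S \<Longrightarrow> closed T" and convexS: "\<And>T. T \<in> S \<Longrightarrow> convex T"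
    and aff: "\<And>T x x'. T \<in> S \<Longrightarrow> x \<in> T \<Longrightarrow> x' \<in> T \<Longrightarrow> v x - v x' = gr T \<bullet> (x - x')"
    and Gb: "\<And>T. T \<in> S \<Longrightarrow> norm (gr T - P (gr T)) \<le> G"
    and Rpos: "0 < R"
    and Y_cov: "\<And>x. x \<in> ball y0 R \<Longrightarrow> \<exists>T\<in>S. Y x \<in> T"
    and PY: "\<And>x. x \<in> ball y0 R \<Longrightarrow> P (Y x) = P x"
    and Y_lip: "\<And>x x'. x \<in> ball y0 R \<Longrightarrow> x' \<in> ball y0 R \<Longrightarrow> norm (Y x - Y x') \<le> 2 * norm (x - x')"
    and Yy0: "Y y0 = y0"
    and common_pt: "\<And>r. 0 < r \<Longrightarrow> r \<le> R \<Longrightarrow>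
        \<exists>g. norm (g - y0) \<le> Cg * r \<and> (\<forall>T\<in>S. T \<inter> cball y0 r \<noteq> {} \<longrightarrow> g \<in> T)"
    and Cg0: "0 \<le> Cg"
    and T0: "T0 \<in> S" "y0 \<in> T0" and c0: "0 < c0"
    and fat: "\<And>r. 0 < r \<Longrightarrow> r \<le> R \<Longrightarrow> c0 * r ^ DIM('a) \<le> measure lborel (T0 \<inter> ball y0 r)"
    and local_cover: "\<exists>e>0. \<forall>z\<in>ball y0 e. \<exists>T\<in>S. z \<in> T \<and> y0 \<in> T"
begin

lemma N_pos: "1 \<le> real N"
proof -
  have "card S \<noteq> 0" using T0 finS by auto
  then show ?thesis using cardS by simp
qed

lemma G0: "0 \<le> G"
  using Gb[OF T0(1)] norm_ge_zero order_trans by blast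

lemma P_diff: "P (x - y) = P x - P y"
  using linP by (rule linear_diff)

lemma gr_split:
  assumes "T \<in> S" shows "\<bar>gr T \<bullet> w - P (gr T) \<bullet> w\<bar> \<le> G * norm w"
proof -
  have "\<bar>gr T \<bullet> w - P (gr T) \<bullet> w\<bar> = \<bar>(gr T - P (gr T)) \<bullet> w\<bar>" by (simp add: inner_diff_left)
  also have "\<dots> \<le> norm (gr T - P (gr T)) * norm w" by (rule Cauchy_Schwarz_ineq2)
  also have "\<dots> \<le> G * norm w" using Gb[OF assms] by (intro mult_right_mono) auto
  finally show ?thesis .
qed

lemma gr_fiber: "P (gr T) \<bullet> w = P (gr T) \<bullet> w'" if "P w = P w'"
  by (metis PP symP that)

lemma Y_cont: "continuous_on (ball y0 R) Y"
proof -
  have "2-lipschitz_on (ball y0 R) Y"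
    by (rule lipschitz_onI) (use Y_lip in \<open>auto simp: dist_norm\<close>)
  then show ?thesis by (rule lipschitz_on_continuous_on)
qed

lemma Y_near:
  assumes "x \<in> ball y0 R" shows "norm (Y x - y0) \<le> 2 * norm (x - y0)"
  using Y_lip[OF assms, of y0] Rpos Yy0 by simp

lemma preimage_borel:
  assumes "r \<le> R" "T \<in> S" shows "{x \<in> ball y0 r. Y x \<in> T} \<in> sets borel"
proof -
  have "continuous_on (ball y0 r) Y" using assms(1) by (intro continuous_on_subset[OF Y_cont] subset_ball)
  then have "closedin (top_of_set (ball y0 r)) (ball y0 r \<inter> Y -` T)"
    using closedS[OF assms(2)] by (intro continuous_closedin_preimage)
  then obtain V where "closed V" "ball y0 r \<inter> Y -` T = ball y0 r \<inter> V"
    by (auto simp: closedin_closed)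
  moreover have "{x \<in> ball y0 r. Y x \<in> T} = ball y0 r \<inter> Y -` T" by auto
  ultimately show ?thesis by auto
qed

text \<open>Within a fibre of \<open>P\<close> the function \<open>v\<close> changes only through
  the normal part of its gradients. Counting elements by \<open>closed_cover_chain\<close> makes the
  bound depend on the diameter \<open>D\<close> of the path and not on its length.\<close>

lemma fiber_bound:
  assumes z: "continuous_on {l..u::real} z" and lu: "l \<le> u"
    and Pz: "\<And>s. s \<in> {l..u} \<Longrightarrow> P (z s) = p"
    and cov: "\<And>s. s \<in> {l..u} \<Longrightarrow> \<exists>T\<in>S. z s \<in> T"
    and D: "\<And>s t. s \<in> {l..u} \<Longrightarrow> t \<in> {l..u} \<Longrightarrow> norm (z s - z t) \<le> D"
  shows "\<bar>v (z u) - v (z l)\<bar> \<le> real N * (G * D)"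
proof -
  have "0 \<le> D" using D[of l l] lu by auto
  have "\<bar>v (z u) - v (z l)\<bar> \<le> real (card S) * (G * D)"
  proof (rule closed_cover_chain[where f="\<lambda>s. v (z s)" and S="\<lambda>T. {l..u} \<inter> z -` T"])
    show "closed ({l..u} \<inter> z -` T)" if "T \<in> S" for T
      using z closedS[OF that] by (intro continuous_closed_preimage) auto
    show "{l..u} \<subseteq> (\<Union>T\<in>S. {l..u} \<inter> z -` T)"
      using cov by (simp add: subset_iff)
    fix T s t assume a: "T \<in> S" "s \<in> {l..u} \<inter> z -` T" "t \<in> {l..u} \<inter> z -` T"
    have "v (z s) - v (z t) = gr T \<bullet> (z s - z t)" using a by (intro aff) auto
    moreover have "P (gr T) \<bullet> (z s - z t) = P (gr T) \<bullet> 0"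
      using a Pz by (intro gr_fiber) (simp add: P_diff linear_0[OF linP])
    ultimately have "\<bar>v (z s) - v (z t)\<bar> \<le> G * norm (z s - z t)"
      using gr_split[OF a(1), of "z s - z t"] by simp
    also have "\<dots> \<le> G * D" using D a G0 by (intro mult_left_mono) auto
    finally show "\<bar>v (z s) - v (z t)\<bar> \<le> G * D" .
  qed (use finS lu in auto)
  also have "\<dots> \<le> real N * (G * D)" using cardS G0 \<open>0 \<le> D\<close> by (intro mult_right_mono) auto
  finally show ?thesis .
qed

text \<open>Invariant of the induction over scales. The element \<open>T\<close> need not contain
  \<open>y0\<close>, so the middle condition compares \<open>v y0\<close> with the value at
  \<open>y0\<close> of the affine extension of \<open>v\<close> from \<open>T\<close>; the last one
  says that \<open>T\<close> carries the surface over a fixed fraction of the ball.\<close>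

definition state :: "real \<Rightarrow> real \<Rightarrow> real \<Rightarrow> bool" where
  "state r C c \<longleftrightarrow> (\<exists>T\<in>S. norm (P (gr T - gr T0)) \<le> C * G \<and>
     (\<forall>x\<in>T. \<bar>v x + gr T \<bullet> (y0 - x) - v y0\<bar> \<le> C * G * r) \<and>
     c * r ^ DIM('a) \<le> measure lborel {x \<in> ball y0 r. Y x \<in> T})"

lemma state_mono:
  assumes "state r C c" "C \<le> C'" "c' \<le> c" "0 \<le> r" shows "state r C' c'"
proof -
  have "C * G \<le> C' * G" "C * G * r \<le> C' * G * r" "c' * r ^ DIM('a) \<le> c * r ^ DIM('a)"
    using assms G0 by (auto intro!: mult_right_mono)
  then show ?thesis using assms(1) unfolding state_def by (meson order_trans)
qed

text \<open>At a scale where every nearby element contains \<open>y0\<close>, the vertical segment from \<open>x\<close> to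
  \<open>Y x\<close> stays inside elements on which \<open>v\<close> is controlled.\<close>

lemma state_tiny:
  obtains e where "0 < e" "e \<le> R" "state e (fan_C DIM('a) N Cg c0 0) (fan_c DIM('a) N Cg c0 0)"
proof -
  obtain e1 where e1: "0 < e1" "\<And>z. z \<in> ball y0 e1 \<Longrightarrow> \<exists>T\<in>S. z \<in> T \<and> y0 \<in> T"
    using local_cover by blast
  let ?F = "\<Union>{T \<in> S. y0 \<notin> T}"
  have "closed ?F" using finS closedS by (intro closed_Union) auto
  then have "open (- ?F)" by (rule open_Compl)
  moreover have "y0 \<in> - ?F" by auto
  ultimately obtain e2 where e2: "0 < e2" "ball y0 e2 \<subseteq> - ?F" by (rule openE)
  \<comment> \<open>For \<open>x\<close> within \<open>e\<close> of \<open>y0\<close> the point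
    \<open>Y x\<close> is within \<open>2 * e\<close>, so the segment between them stays in both
    balls.\<close>
  define e where "e = min R (min (e1 / 3) (e2 / 3))"
  have e: "0 < e" "e \<le> R" "3 * e \<le> e1" "3 * e \<le> e2" using Rpos e1 e2 by (auto simp: e_def)
  define E where "E = T0 \<inter> ball y0 e"
  have Eb: "E \<in> sets borel" using closedS[OF T0(1)] by (auto simp: E_def)
  have Ef: "E \<in> fmeasurable lborel"
    using Eb by (intro fmeasurableI emeasure_bounded_finite) (auto simp: E_def)
  have inR: "x \<in> ball y0 R" if "x \<in> E" for x using that e by (auto simp: E_def)
  obtain T where T: "T \<in> S" "measure lborel E \<le> real N * measure lborel (E \<inter> {x \<in> ball y0 e. Y x \<in> T})"
  proof (rule pigeonhole_measure[OF Ef, where A="\<lambda>T. {x \<in> ball y0 e. Y x \<in> T}" and S=S and N=N])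
    show "E \<subseteq> (\<Union>T\<in>S. {x \<in> ball y0 e. Y x \<in> T})"
      using Y_cov inR by (fastforce simp: E_def)
    show "E \<inter> {x \<in> ball y0 e. Y x \<in> T} \<in> sets borel" if "T \<in> S" for T
      using preimage_borel[OF e(2) that] Eb by auto
  qed (use finS cardS T0 in auto)
  define E' where "E' = E \<inter> {x \<in> ball y0 e. Y x \<in> T}"
  have E'b: "E' \<in> sets borel" unfolding E'_def using preimage_borel[OF e(2) T(1)] Eb by auto
  have meas: "c0 / N * e ^ DIM('a) \<le> measure lborel E'"
    using fat[OF e(1,2)] T(2) N_pos unfolding E_def[symmetric] E'_def[symmetric]
    by (simp add: field_simps)
  have epos: "0 < c0 / N * e ^ DIM('a)" using c0 N_pos e by simp
  then have "E' \<noteq> {}" using meas by auto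
  then obtain x0 where "x0 \<in> E'" by auto
  have Ynear: "norm (Y x - y0) < 2 * e" if "x \<in> E'" for x
    using Y_near[OF inR, of x] that by (auto simp: E'_def E_def dist_norm norm_minus_commute)
  have y0T: "y0 \<in> T"
  proof (rule ccontr)
    assume "y0 \<notin> T"
    then have "Y x0 \<in> ?F" using \<open>x0 \<in> E'\<close> T by (auto simp: E'_def)
    moreover have "Y x0 \<in> ball y0 e2"
      using Ynear[OF \<open>x0 \<in> E'\<close>] e by (auto simp: dist_norm norm_minus_commute)
    ultimately show False using e2(2) by blast
  qed
  \<comment> \<open>The share \<open>3 * real N\<close> comes from the segment between
    \<open>x\<close> and \<open>Y x\<close>, of length at most \<open>3 * e\<close>; the share
    \<open>3 = 2 + 1\<close> from the normal gradients of \<open>T\<close> and \<open>T0\<close>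
    over distances \<open>2 * e\<close> and \<open>e\<close>.\<close>
  define d where "d = (3 * real N + 3) * (G * e)"
  have slab: "\<bar>P (gr T - gr T0) \<bullet> (x - y0)\<bar> \<le> d" if x: "x \<in> E'" for x
  proof -
    have xB: "x \<in> ball y0 R" "norm (x - y0) < e" "x \<in> T0" "Y x \<in> T"
      using x inR by (auto simp: E'_def E_def dist_norm norm_minus_commute)
    have "norm ((Y x - y0) - (x - y0)) \<le> norm (Y x - y0) + norm (x - y0)" by (rule norm_triangle_ineq4)
    then have dist3: "norm (Y x - x) \<le> 3 * e" using Ynear[OF x] xB(2) by simp
    define z where "z s = x + s *\<^sub>R (Y x - x)" for s :: real
    have "\<bar>v (z 1) - v (z 0)\<bar> \<le> real N * (G * (3 * e))"
    proof (rule fiber_bound[where p="P x"])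
      show "continuous_on {0..1} z" unfolding z_def by (intro continuous_intros)
      show "P (z s) = P x" for s
        by (simp add: z_def linear_add[OF linP] linear_scale[OF linP] P_diff PY[OF xB(1)])
      show "\<exists>T\<in>S. z s \<in> T" if s: "s \<in> {0..1}" for s
      proof -
        have "x \<in> ball y0 e1" "Y x \<in> ball y0 e1"
          using xB Ynear[OF x] e by (auto simp: dist_norm norm_minus_commute)
        then have "(1 - s) *\<^sub>R x + s *\<^sub>R Y x \<in> ball y0 e1"
          using s by (intro convexD[OF convex_ball]) auto
        moreover have "(1 - s) *\<^sub>R x + s *\<^sub>R Y x = z s" by (simp add: z_def algebra_simps)
        ultimately show ?thesis using e1(2) by metis
      qed
      fix s t :: real assume st: "s \<in> {0..1}" "t \<in> {0..1}"
      have "z s - z t = (s - t) *\<^sub>R (Y x - x)" by (simp add: z_def algebra_simps)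
      then have "norm (z s - z t) \<le> 1 * norm (Y x - x)"
        using st by (simp only: norm_scaleR) (intro mult_right_mono, auto)
      then show "norm (z s - z t) \<le> 3 * e" using dist3 by simp
    qed simp
    then have 1: "\<bar>v (Y x) - v x\<bar> \<le> real N * (G * (3 * e))" by (simp add: z_def)
    have 2: "v (Y x) - v y0 = gr T \<bullet> (Y x - y0)" using T(1) xB y0T by (intro aff) auto
    have 3: "v x - v y0 = gr T0 \<bullet> (x - y0)" using T0 xB by (intro aff) auto
    have 4: "P (gr T) \<bullet> (Y x - y0) = P (gr T) \<bullet> (x - y0)"
      by (rule gr_fiber) (simp add: P_diff PY[OF xB(1)])
    have 5: "\<bar>gr T \<bullet> (Y x - y0) - P (gr T) \<bullet> (Y x - y0)\<bar> \<le> G * (2 * e)"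
      by (rule order_trans[OF gr_split[OF T(1)]]) (use Ynear[OF x] G0 in \<open>auto intro!: mult_left_mono\<close>)
    have 6: "\<bar>gr T0 \<bullet> (x - y0) - P (gr T0) \<bullet> (x - y0)\<bar> \<le> G * e"
      by (rule order_trans[OF gr_split[OF T0(1)]]) (use xB(2) G0 in \<open>auto intro!: mult_left_mono\<close>)
    have "P (gr T - gr T0) \<bullet> (x - y0) = P (gr T) \<bullet> (x - y0) - P (gr T0) \<bullet> (x - y0)"
      by (simp add: P_diff inner_diff_left)
    then have "\<bar>P (gr T - gr T0) \<bullet> (x - y0)\<bar> \<le> real N * (G * (3 * e)) + G * (2 * e) + G * e"
      using 1 2 3 4 5 6 by linarith
    also have "\<dots> = d" by (simp add: d_def algebra_simps)
    finally show ?thesis .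
  qed
  let ?b = "norm (P (gr T - gr T0))"
  have d0: "0 \<le> d" using G0 e N_pos by (simp add: d_def)
  have "?b * e * (c0 / N * e ^ DIM('a)) \<le> ?b * e * measure lborel E'"
    using meas e by (intro mult_left_mono) auto
  also have "\<dots> \<le> slab_const DIM('a) * d * e ^ DIM('a)"
    by (rule measure_slab[OF E'b _ e(1) d0 slab]) (auto simp: E'_def)
  also have "\<dots> = (slab_const DIM('a) * (3 * real N + 3) * G) * (e * e ^ DIM('a))" by (simp add: d_def)
  finally have "(?b * (c0 / N)) * (e * e ^ DIM('a)) \<le> (slab_const DIM('a) * (3 * real N + 3) * G) * (e * e ^ DIM('a))"
    by (simp add: mult_ac)
  then have "?b * (c0 / N) \<le> slab_const DIM('a) * (3 * real N + 3) * G"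
    using e by (simp only: mult_le_cancel_right) simp
  then have "?b \<le> fan_C DIM('a) N Cg c0 0 * G"
    using c0 N_pos by (simp add: field_simps)
  moreover have "v x + gr T \<bullet> (y0 - x) - v y0 = 0" if "x \<in> T" for x
    using aff[OF T(1) that y0T] by (simp add: inner_diff_right algebra_simps)
  moreover have "0 \<le> fan_C DIM('a) N Cg c0 0 * G * e"
    using G0 e c0 N_pos slab_const_pos[of "DIM('a)"] by simp
  moreover have "measure lborel E' \<le> measure lborel {x \<in> ball y0 e. Y x \<in> T}"
    using E'b preimage_borel[OF e(2) T(1)]
    by (intro measure_mono_fmeasurable) (auto simp: E'_def intro!: fmeasurableI emeasure_bounded_finite bounded_subset[OF bounded_ball])
  ultimately have "state e (fan_C DIM('a) N Cg c0 0) (fan_c DIM('a) N Cg c0 0)"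
    unfolding state_def using T(1) meas by (intro bexI[of _ T] conjI ballI) auto
  then show ?thesis using that e by blast
qed

end

lemma norm_add_diff_le: "norm (a + (b - c)) \<le> norm a + (norm b + norm c)" for a :: "'a::real_normed_vector"
  by (rule order_trans[OF norm_triangle_ineq]) (simp add: norm_triangle_ineq4)

context fan begin

text \<open>The elements near \<open>y0\<close> at scale \<open>r\<close> form a fan around a common point \<open>g\<close>. Dilating about \<open>g\<close> maps
  elements of the fan into themselves, and the dilated discrete surface stays in active elements, so the
  comparison only involves the vertical directions, in which \<open>v\<close> is controlled.\<close>

lemma state_jump:
  assumes st: "state r C c" and r: "0 < r" "r \<le> r'" "r' \<le> R" and c: "0 < c"
    and gap: "\<And>T. T \<in> S \<Longrightarrow> T \<inter> ball y0 r' \<noteq> {} \<Longrightarrow> T \<inter> cball y0 r \<noteq> {}"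
  shows "state r' (C + fan_incr DIM('a) N Cg c) (c * fan_ratio DIM('a) N Cg)"
proof -
  let ?k = "DIM('a)"
  define M where "M = 2 * (1 + 2 * Cg)"
  have M: "1 \<le> M" "0 < M" using Cg0 by (auto simp: M_def)
  define K where "K = slab_const ?k * (real N + 2) * 6 * (2 * Cg + 1) * (1 + Cg) ^ ?k * real N / c"
  have K0: "0 \<le> K" using slab_const_pos[of ?k] Cg0 c by (simp add: K_def)
  have incr: "fan_incr ?k N Cg c = (K + 2) * (1 + Cg)" by (simp add: fan_incr_def K_def)
  have incr0: "0 \<le> fan_incr ?k N Cg c" using K0 Cg0 by (simp add: incr)
  have ratio: "fan_ratio ?k N Cg = 1 / (real N * M ^ ?k)" by (simp add: fan_ratio_def M_def)
  obtain Tr where Tr: "Tr \<in> S" "norm (P (gr Tr - gr T0)) \<le> C * G"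
      "\<And>x. x \<in> Tr \<Longrightarrow> \<bar>v x + gr Tr \<bullet> (y0 - x) - v y0\<bar> \<le> C * G * r"
      "c * r ^ ?k \<le> measure lborel {x \<in> ball y0 r. Y x \<in> Tr}"
    using st unfolding state_def by blast
  have rR: "r \<le> R" using r by simp
  define E where "E = {x \<in> ball y0 r. Y x \<in> Tr}"
  have Eb: "E \<in> sets borel" unfolding E_def by (rule preimage_borel[OF rR Tr(1)])
  have Ef: "E \<in> fmeasurable lborel"
    using Eb by (intro fmeasurableI emeasure_bounded_finite) (auto simp: E_def intro: bounded_subset[OF bounded_ball])
  have EinR: "x \<in> ball y0 R" if "x \<in> E" for x using that rR by (auto simp: E_def)
  show ?thesis
  \<comment> \<open>For a growth of the scale below the factor \<open>M\<close> the old element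
    still serves, at the price of \<open>M ^ k\<close> in relative measure. Otherwise the dilation
    factor \<open>l\<close> is at least 1.\<close>
  proof (cases "r' < M * r")
    case True
    have "c * fan_ratio ?k N Cg * r' ^ ?k \<le> c * (1 / M ^ ?k) * (M * r) ^ ?k"
    proof (intro mult_mono power_mono)
      show "fan_ratio ?k N Cg \<le> 1 / M ^ ?k"
        unfolding ratio using N_pos M by (intro divide_left_mono) auto
    qed (use r M c True N_pos in \<open>auto simp: ratio\<close>)
    also have "\<dots> = c * r ^ ?k" using M by (simp add: power_mult_distrib)
    also have "\<dots> \<le> measure lborel E" using Tr(4) by (simp add: E_def)
    also have "\<dots> \<le> measure lborel {x \<in> ball y0 r'. Y x \<in> Tr}"
      using Eb preimage_borel[OF r(3) Tr(1)] r
      by (intro measure_mono_fmeasurable)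
        (auto simp: E_def intro!: fmeasurableI emeasure_bounded_finite intro: bounded_subset[OF bounded_ball])
    finally have 1: "c * fan_ratio ?k N Cg * r' ^ ?k \<le> measure lborel {x \<in> ball y0 r'. Y x \<in> Tr}" .
    have "0 \<le> C * G" using Tr(2) norm_ge_zero order_trans by blast
    then have "C * G * r \<le> C * G * r'" using r by (intro mult_left_mono) auto
    then have "state r' C (c * fan_ratio ?k N Cg)"
      unfolding state_def using Tr 1 by (intro bexI[of _ Tr] conjI ballI) (auto intro: order_trans)
    then show ?thesis using incr0 r by (auto intro: state_mono)
  next
    case False
    \<comment> \<open>The largest factor for which the dilated set is sure to stay within distance
      \<open>r' / 2\<close> of \<open>y0\<close>; the half is reserved for \<open>Y\<close>, which
      may double distances.\<close>
    define l where "l = r' / (M * r)"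
    have l1: "1 \<le> l" using False M r by (simp add: l_def)
    have lr: "l * r * M = r'" using M r by (simp add: l_def)
    obtain g where g: "norm (g - y0) \<le> Cg * r" "\<And>T. T \<in> S \<Longrightarrow> T \<inter> cball y0 r \<noteq> {} \<Longrightarrow> g \<in> T"
      using common_pt[OF r(1) rR] by blast
    define dil where "dil s x = g + s *\<^sub>R (x - g)" for s :: real and x
    have dil_near: "norm (dil s x - y0) < s * (r * (1 + 2 * Cg))" if "x \<in> E" "1 \<le> s" for s x
    proof -
      have "dil s x - y0 = (g - y0) + s *\<^sub>R ((x - y0) - (g - y0))" by (simp add: dil_def algebra_simps)
      also have "norm \<dots> \<le> norm (g - y0) + s * norm ((x - y0) - (g - y0))"
        using that norm_triangle_ineq[of "g - y0" "s *\<^sub>R ((x - y0) - (g - y0))"] by simp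
      also have "\<dots> \<le> s * norm (g - y0) + s * (norm (x - y0) + norm (g - y0))"
        using that(2) mult_right_mono[OF that(2), of "norm (g - y0)"]
        by (intro add_mono mult_left_mono norm_triangle_ineq4) auto
      also have "\<dots> = s * (norm (x - y0) + 2 * norm (g - y0))" by (simp add: algebra_simps)
      also have "\<dots> < s * (r * (1 + 2 * Cg))"
      proof (intro mult_strict_left_mono)
        have "norm (x - y0) < r" using that(1) by (auto simp: E_def dist_norm norm_minus_commute)
        then show "norm (x - y0) + 2 * norm (g - y0) < r * (1 + 2 * Cg)" using g(1) by (simp add: algebra_simps)
      qed (use that in auto)
      finally show ?thesis .
    qed
    have half: "s * (r * (1 + 2 * Cg)) \<le> r' / 2" if "s \<le> l" for s
    proof -
      have "s * (r * (1 + 2 * Cg)) \<le> l * (r * (1 + 2 * Cg))"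
        using that r Cg0 by (intro mult_right_mono) auto
      also have "\<dots> = r' / 2" using lr by (simp add: M_def algebra_simps)
      finally show ?thesis .
    qed
    have dilR: "dil s x \<in> ball y0 (r' / 2)" if "x \<in> E" "1 \<le> s" "s \<le> l" for s x
      using dil_near[OF that(1,2)] half[OF that(3)] by (simp add: dist_norm norm_minus_commute)
    have dilR': "dil s x \<in> ball y0 R" if "x \<in> E" "1 \<le> s" "s \<le> l" for s x
    proof -
      have "r' / 2 \<le> R" using r by simp
      then show ?thesis using dilR[OF that] subset_ball[of "r'/2" R y0] by blast
    qed
    \<comment> \<open>A surface point over the dilated set lies within \<open>r'\<close> of
      \<open>y0\<close>. By \<open>gap\<close> its element already meets the ball of radius
      \<open>r\<close>, and so contains the common point \<open>g\<close>.\<close>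
    have Yg: "g \<in> T" if "x \<in> E" "1 \<le> s" "s \<le> l" "T \<in> S" "Y (dil s x) \<in> T" for T s x
    proof -
      have "norm (Y (dil s x) - y0) < r'"
        using Y_near[OF dilR'[OF that(1-3)]] dilR[OF that(1-3)] by (simp add: dist_norm norm_minus_commute)
      then have "Y (dil s x) \<in> T \<inter> ball y0 r'" using that by (simp add: dist_norm norm_minus_commute)
      then show ?thesis using g(2)[OF that(4)] gap[OF that(4)] by blast
    qed
    obtain T where T: "T \<in> S"
      "measure lborel E \<le> real N * measure lborel (E \<inter> dil l -` {x \<in> ball y0 R. Y x \<in> T})"
    proof (rule pigeonhole_measure[OF Ef, where A="\<lambda>T. dil l -` {x \<in> ball y0 R. Y x \<in> T}" and S=S and N=N])
      show "E \<subseteq> (\<Union>T\<in>S. dil l -` {x \<in> ball y0 R. Y x \<in> T})"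
      proof
        fix x assume x: "x \<in> E"
        have "dil l x \<in> ball y0 R" using dilR'[OF x l1] by simp
        with Y_cov[OF this] show "x \<in> (\<Union>T\<in>S. dil l -` {x \<in> ball y0 R. Y x \<in> T})" by auto
      qed
      have "dil l \<in> borel_measurable borel" unfolding dil_def by measurable
      from measurable_sets_borel[OF this preimage_borel[OF order_refl]]
      show "E \<inter> dil l -` {x \<in> ball y0 R. Y x \<in> T} \<in> sets borel" if "T \<in> S" for T
        using that Eb by (intro sets.Int) auto
    qed (use finS cardS T0 in auto)
    define E' where "E' = E \<inter> dil l -` {x \<in> ball y0 R. Y x \<in> T}"
    have E'b: "E' \<in> sets borel"
    proof -
      have "dil l \<in> borel_measurable borel" unfolding dil_def by measurable
      from measurable_sets_borel[OF this preimage_borel[OF order_refl T(1)]]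
      show ?thesis unfolding E'_def using Eb by (intro sets.Int)
    qed
    have "c * r ^ ?k \<le> real N * measure lborel E'"
      using Tr(4) T(2) by (simp add: E_def E'_def)
    then have meas: "c / N * r ^ ?k \<le> measure lborel E'" using N_pos by (simp add: field_simps)
    have "0 < c / N * r ^ ?k" using c N_pos r by simp
    then have "E' \<noteq> {}" using meas by auto
    then obtain x0 where x0: "x0 \<in> E'" by auto
    have gT: "g \<in> T" using Yg[of x0 l T] x0 l1 T(1) by (auto simp: E'_def)
    have gTr: "g \<in> Tr"
      using Yg[of x0 1 Tr] x0 l1 Tr(1) by (auto simp: E'_def E_def dil_def)
    define Q where "Q = 2 * Cg + 1"
    have Q: "1 \<le> Q" using Cg0 by (simp add: Q_def)
    \<comment> \<open>The summand \<open>N\<close> pays for the walk in the fibre from an element of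
      the old set to one of the dilated set, the summand 2 for the normal gradients of
      \<open>T\<close> and \<open>Tr\<close>.\<close>
    define d where "d = (real N + 2) * (G * (6 * Q * r))"
    have slab: "\<bar>P (gr T - gr Tr) \<bullet> (x - g)\<bar> \<le> d" if x: "x \<in> E'" for x
    proof -
      have xE: "x \<in> E" "Y (dil l x) \<in> T" "Y x \<in> Tr" using x by (auto simp: E'_def E_def)
      \<comment> \<open>The surface point over the dilated \<open>x\<close> is pulled back towards
        \<open>g\<close> by the inverse factor. Its element is convex and contains \<open>g\<close>,
        so it also contains the pulled-back point. The resulting path stays in the fibre of
        \<open>x\<close> and within \<open>O(r)\<close> of \<open>x\<close>, even though
        \<open>s\<close> may be as large as \<open>r' / (M * r)\<close>.\<close>
      define z where "z s = g + (1 / s) *\<^sub>R (Y (dil s x) - g)" for s :: real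
      have zx: "norm (z s - x) \<le> 3 * Q * r" if s: "s \<in> {1..l}" for s
      proof -
        have "z s - x = (1 / s) *\<^sub>R (Y (dil s x) - dil s x)"
          using s by (simp add: z_def dil_def algebra_simps)
        then have "norm (z s - x) = norm (Y (dil s x) - dil s x) / s"
          using s by simp
        also have "norm (Y (dil s x) - dil s x) \<le> norm (Y (dil s x) - y0) + norm (dil s x - y0)"
          using norm_triangle_ineq4[of "Y (dil s x) - y0" "dil s x - y0"] by simp
        also have "\<dots> \<le> 3 * norm (dil s x - y0)"
          using Y_near[OF dilR'[OF xE(1)]] s by force
        also have "\<dots> \<le> 3 * (s * (r * Q))"
          using dil_near[OF xE(1), of s] s by (simp add: Q_def algebra_simps)
        finally show ?thesis using s by (simp add: divide_right_mono field_simps)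
      qed
      have Pz: "P (z s) = P x" if s: "s \<in> {1..l}" for s
      proof -
        have "P (z s) = P g + (1 / s) *\<^sub>R (P (dil s x) - P g)"
          using PY[OF dilR'[OF xE(1)], of s] s
          by (simp add: z_def linear_add[OF linP] linear_scale[OF linP] P_diff)
        also have "P (dil s x) = P g + s *\<^sub>R (P x - P g)"
          by (simp add: dil_def linear_add[OF linP] linear_scale[OF linP] P_diff)
        finally show ?thesis using s by simp
      qed
      have zT: "z s \<in> T'" if "s \<in> {1..l}" "T' \<in> S" "Y (dil s x) \<in> T'" for s T'
      proof -
        have "g \<in> T'" using Yg[OF xE(1)] that by auto
        then have "(1 - 1 / s) *\<^sub>R g + (1 / s) *\<^sub>R Y (dil s x) \<in> T'"
          using that by (intro convexD[OF convexS]) auto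
        then show ?thesis by (simp add: z_def algebra_simps)
      qed
      have chain: "\<bar>v (z l) - v (z 1)\<bar> \<le> real N * (G * (6 * Q * r))"
      proof (rule fiber_bound[where p="P x"])
        have dilc: "continuous_on {1..l} (\<lambda>s. dil s x)" unfolding dil_def by (intro continuous_intros)
        have "continuous_on {1..l} (\<lambda>s. Y (dil s x))"
          by (rule continuous_on_compose2[OF Y_cont dilc]) (use dilR'[OF xE(1)] in auto)
        then show "continuous_on {1..l} z" unfolding z_def by (intro continuous_intros) auto
        show "\<exists>T\<in>S. z s \<in> T" if "s \<in> {1..l}" for s
          using Y_cov[OF dilR'[OF xE(1), of s]] zT[OF that] that by auto
        fix s t assume "s \<in> {1..l}" "t \<in> {1..l}"
        then have "norm (z s - x) \<le> 3 * Q * r" "norm (z t - x) \<le> 3 * Q * r" using zx by auto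
        moreover have "norm (z s - z t) = norm ((z s - x) - (z t - x))" by simp
        ultimately show "norm (z s - z t) \<le> 6 * Q * r"
          using norm_triangle_ineq4[of "z s - x" "z t - x"] by linarith
      qed (use l1 Pz in auto)
      have z1: "z 1 \<in> Tr" "z l \<in> T"
        using zT[of 1 Tr] zT[of l T] l1 Tr(1) T(1) xE by (auto simp: dil_def)
      have part: "\<bar>v (z s) - v g - P (gr T') \<bullet> (x - g)\<bar> \<le> G * (6 * Q * r)"
        if "s \<in> {1..l}" "T' \<in> S" "z s \<in> T'" "g \<in> T'" for s T'
      proof -
        have "v (z s) - v g = gr T' \<bullet> (z s - g)" using that by (intro aff) auto
        moreover have "P (gr T') \<bullet> (z s - g) = P (gr T') \<bullet> (x - g)"
          by (rule gr_fiber) (simp add: P_diff Pz[OF that(1)])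
        moreover have "norm (z s - g) \<le> 6 * Q * r"
        proof -
          have "norm (z s - g) = norm ((z s - x) + ((x - y0) - (g - y0)))" by simp
          also have "\<dots> \<le> norm (z s - x) + (norm (x - y0) + norm (g - y0))"
            by (rule norm_add_diff_le)
          also have "\<dots> \<le> 3 * Q * r + (r + Cg * r)"
            using zx[OF that(1)] g(1) xE(1) by (intro add_mono) (auto simp: E_def dist_norm norm_minus_commute)
          also have "\<dots> \<le> 6 * Q * r" using Cg0 r by (simp add: Q_def algebra_simps)
          finally show ?thesis .
        qed
        then have "G * norm (z s - g) \<le> G * (6 * Q * r)" using G0 by (rule mult_left_mono)
        ultimately show ?thesis using gr_split[OF that(2), of "z s - g"] by linarith
      qed
      have "P (gr T - gr Tr) \<bullet> (x - g) = P (gr T) \<bullet> (x - g) - P (gr Tr) \<bullet> (x - g)"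
        by (simp add: P_diff inner_diff_left)
      moreover have "d = real N * (G * (6 * Q * r)) + 2 * (G * (6 * Q * r))" by (simp add: d_def algebra_simps)
      ultimately show ?thesis
        using chain part[OF _ T(1) z1(2) gT] part[OF _ Tr(1) z1(1) gTr] l1 by (simp add: abs_le_iff)
    qed
    let ?b = "norm (P (gr T - gr Tr))"
    define \<rho> where "\<rho> = (1 + Cg) * r"
    have \<rho>: "r \<le> \<rho>" "0 < \<rho>" using Cg0 r by (auto simp: \<rho>_def algebra_simps intro: add_pos_nonneg)
    have E'ball: "E' \<subseteq> ball g \<rho>"
    proof
      fix x assume "x \<in> E'"
      then have "norm (x - y0) < r" by (auto simp: E'_def E_def dist_norm norm_minus_commute)
      moreover have "norm (x - g) \<le> norm (x - y0) + norm (g - y0)"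
        using norm_triangle_ineq4[of "x - y0" "g - y0"] by simp
      ultimately have "norm (x - g) < \<rho>" using g(1) by (simp add: \<rho>_def algebra_simps)
      then show "x \<in> ball g \<rho>" by (simp add: dist_norm norm_minus_commute)
    qed
    have d0: "0 \<le> d" using G0 r Q by (simp add: d_def)
    have "?b * r * (c / N * r ^ ?k) \<le> ?b * \<rho> * measure lborel E'"
      using meas \<rho> r c by (intro mult_mono) auto
    also have "\<dots> \<le> slab_const ?k * d * \<rho> ^ ?k"
      by (rule measure_slab[OF E'b E'ball \<rho>(2) d0 slab])
    also have "\<dots> = (slab_const ?k * (real N + 2) * 6 * Q * (1 + Cg) ^ ?k * G) * (r * r ^ ?k)"
      by (simp add: d_def \<rho>_def power_mult_distrib)
    finally have "(?b * (c / N)) * (r * r ^ ?k) \<le> (slab_const ?k * (real N + 2) * 6 * Q * (1 + Cg) ^ ?k * G) * (r * r ^ ?k)"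
      by (simp add: mult_ac)
    then have "?b * (c / N) \<le> slab_const ?k * (real N + 2) * 6 * Q * (1 + Cg) ^ ?k * G"
      using r by (simp only: mult_le_cancel_right) simp
    then have bK: "?b \<le> K * G"
      using c N_pos by (simp add: K_def Q_def field_simps)
    have KI: "K \<le> fan_incr ?k N Cg c" unfolding incr using K0 Cg0 by (simp add: algebra_simps)
    have s1: "norm (P (gr T - gr T0)) \<le> (C + fan_incr ?k N Cg c) * G"
    proof -
      have "P (gr T - gr T0) = P (gr T - gr Tr) + P (gr Tr - gr T0)" by (simp add: P_diff)
      then have "norm (P (gr T - gr T0)) \<le> ?b + norm (P (gr Tr - gr T0))"
        using norm_triangle_ineq[of "P (gr T - gr Tr)" "P (gr Tr - gr T0)"] by (simp only:)
      also have "\<dots> \<le> K * G + C * G" using bK Tr(2) by simp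
      also have "\<dots> \<le> fan_incr ?k N Cg c * G + C * G" using KI G0 by (auto intro: mult_right_mono)
      finally show ?thesis by (simp add: algebra_simps)
    qed
    \<comment> \<open>The affine extensions of \<open>v\<close> from \<open>T\<close> and
      \<open>Tr\<close> agree at \<open>g\<close>, which both contain. At \<open>y0\<close> they
      differ by the full gradient difference, at most \<open>(K + 2) * G\<close>, times the distance
      \<open>Cg * r\<close> of \<open>g\<close>.\<close>
    have s2: "\<bar>v x + gr T \<bullet> (y0 - x) - v y0\<bar> \<le> (C + fan_incr ?k N Cg c) * G * r'" if "x \<in> T" for x
    proof -
      have 1: "v x - v g = gr T \<bullet> (x - g)" using T(1) that gT by (intro aff)
      have 2: "\<bar>v g + gr Tr \<bullet> (y0 - g) - v y0\<bar> \<le> C * G * r" using Tr(3) gTr by auto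
      have "\<bar>(gr T - gr Tr) \<bullet> (y0 - g)\<bar> \<le> norm (gr T - gr Tr) * norm (y0 - g)" by (rule Cauchy_Schwarz_ineq2)
      also have "\<dots> \<le> ((K + 2) * G) * (Cg * r)"
      proof (intro mult_mono)
        have "gr T - gr Tr = P (gr T - gr Tr) + ((gr T - P (gr T)) - (gr Tr - P (gr Tr)))" by (simp add: P_diff)
        then have "norm (gr T - gr Tr) \<le> ?b + (norm (gr T - P (gr T)) + norm (gr Tr - P (gr Tr)))"
          using norm_add_diff_le[of "P (gr T - gr Tr)" "gr T - P (gr T)" "gr Tr - P (gr Tr)"] by (simp only:)
        then show "norm (gr T - gr Tr) \<le> (K + 2) * G"
          using bK Gb[OF T(1)] Gb[OF Tr(1)] by (simp add: algebra_simps)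
      qed (use g(1) K0 G0 in \<open>auto simp: norm_minus_commute\<close>)
      finally have 3: "\<bar>(gr T - gr Tr) \<bullet> (y0 - g)\<bar> \<le> (K + 2) * G * (Cg * r)" .
      have "v x + gr T \<bullet> (y0 - x) - v y0 = (v g + gr Tr \<bullet> (y0 - g) - v y0) + (gr T - gr Tr) \<bullet> (y0 - g)"
        using 1 by (simp add: inner_diff_right inner_diff_left)
      then have "\<bar>v x + gr T \<bullet> (y0 - x) - v y0\<bar> \<le> C * G * r + (K + 2) * G * (Cg * r)"
        using 2 3 by linarith
      also have "\<dots> \<le> (C + fan_incr ?k N Cg c) * G * r"
      proof -
        have "(K + 2) * G * (Cg * r) \<le> (K + 2) * G * ((1 + Cg) * r)"
          using K0 G0 Cg0 r by (intro mult_left_mono mult_right_mono) auto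
        then show ?thesis unfolding incr by (simp add: algebra_simps)
      qed
      also have "\<dots> \<le> (C + fan_incr ?k N Cg c) * G * r'"
      proof -
        have "0 \<le> (C + fan_incr ?k N Cg c) * G" using s1 norm_ge_zero order_trans by blast
        then show ?thesis using r by (intro mult_left_mono)
      qed
      finally show ?thesis .
    qed
    have s3: "c * fan_ratio ?k N Cg * r' ^ ?k \<le> measure lborel {x \<in> ball y0 r'. Y x \<in> T}"
    proof -
      define E2 where "E2 = (\<lambda>x. l *\<^sub>R x + (g - l *\<^sub>R g)) ` E'"
      have E2: "E2 \<in> sets borel" "measure lborel E2 = l ^ ?k * measure lborel E'"
        using borel_affine_scale[OF E'b, of l "g - l *\<^sub>R g"] l1 by (auto simp: E2_def)
      have "dil l x = l *\<^sub>R x + (g - l *\<^sub>R g)" for x by (simp add: dil_def algebra_simps)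
      then have E2d: "E2 = dil l ` E'" by (simp add: E2_def)
      have sub: "E2 \<subseteq> {x \<in> ball y0 r'. Y x \<in> T}"
      proof
        fix y assume "y \<in> E2"
        then obtain x where x: "x \<in> E'" "y = dil l x" by (auto simp: E2d)
        have "y \<in> ball y0 (r' / 2)" using dilR[of x l] x l1 by (auto simp: E'_def)
        then have "y \<in> ball y0 r'" using r by auto
        then show "y \<in> {x \<in> ball y0 r'. Y x \<in> T}" using x by (auto simp: E'_def)
      qed
      have "c * fan_ratio ?k N Cg * r' ^ ?k = l ^ ?k * (c / N * r ^ ?k)"
        unfolding lr[symmetric] ratio using M N_pos by (simp add: power_mult_distrib field_simps)
      also have "\<dots> \<le> measure lborel E2" unfolding E2 using meas l1 by (intro mult_left_mono) auto
      also have "\<dots> \<le> measure lborel {x \<in> ball y0 r'. Y x \<in> T}"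
        using E2 sub preimage_borel[OF r(3) T(1)]
        by (intro measure_mono_fmeasurable)
          (auto intro!: fmeasurableI emeasure_bounded_finite intro: bounded_subset[OF bounded_ball])
      finally show ?thesis .
    qed
    show ?thesis unfolding state_def using T(1) s1 s2 s3 by (intro bexI[of _ T] conjI ballI) auto
  qed
qed

lemma fan_c_pos: "0 < fan_c DIM('a) N Cg c0 n"
  by (induction n) (use c0 N_pos Cg0 in \<open>auto simp: fan_ratio_def\<close>)

lemma fan_incr_nonneg: "0 \<le> fan_incr DIM('a) N Cg (fan_c DIM('a) N Cg c0 n)"
  using slab_const_pos[of "DIM('a)"] Cg0 fan_c_pos[of n] by (simp add: fan_incr_def)

lemma fan_ratio_le_1: "0 \<le> fan_ratio DIM('a) N Cg" "fan_ratio DIM('a) N Cg \<le> 1"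
proof -
  have "1 \<le> (2 * (1 + 2 * Cg)) ^ DIM('a)" using Cg0 by (intro one_le_power) auto
  then have "1 \<le> real N * (2 * (1 + 2 * Cg)) ^ DIM('a)" using N_pos by (metis mult_mono mult_1 zero_le_one order_trans)
  then show "0 \<le> fan_ratio DIM('a) N Cg" "fan_ratio DIM('a) N Cg \<le> 1" by (auto simp: fan_ratio_def)
qed

lemma state_Suc:
  assumes "state r (fan_C DIM('a) N Cg c0 n) (fan_c DIM('a) N Cg c0 n)" "0 \<le> r"
  shows "state r (fan_C DIM('a) N Cg c0 (Suc n)) (fan_c DIM('a) N Cg c0 (Suc n))"
proof (rule state_mono[OF assms(1)])
  show "fan_C DIM('a) N Cg c0 n \<le> fan_C DIM('a) N Cg c0 (Suc n)" using fan_incr_nonneg[of n] by simp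
  show "fan_c DIM('a) N Cg c0 (Suc n) \<le> fan_c DIM('a) N Cg c0 n"
    using fan_c_pos[of n] fan_ratio_le_1 by (simp add: mult_left_le)
qed fact

lemma meets_ball_iff:
  assumes "T \<in> S" "T \<noteq> {}" 
  shows "T \<inter> ball y0 s \<noteq> {} \<longleftrightarrow> infdist y0 T < s" "T \<inter> cball y0 s \<noteq> {} \<longleftrightarrow> infdist y0 T \<le> s"
proof -
  obtain x where x: "x \<in> T" "infdist y0 T = dist y0 x"
    using infdist_attains_inf[OF closedS[OF assms(1)] assms(2)] by blast
  have le: "infdist y0 T \<le> dist y0 y" if "y \<in> T" for y using that by (rule infdist_le)
  show "T \<inter> ball y0 s \<noteq> {} \<longleftrightarrow> infdist y0 T < s" using x le by (fastforce simp: set_eq_iff)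
  show "T \<inter> cball y0 s \<noteq> {} \<longleftrightarrow> infdist y0 T \<le> s" using x le by (fastforce simp: set_eq_iff)
qed

text \<open>Induction on the number of elements whose distance to \<open>y0\<close> lies strictly
  between \<open>e\<close> and \<open>r\<close>. With \<open>r1\<close> the largest such distance,
  every element met before \<open>r\<close> is met at \<open>r1\<close> already, so one jump leads
  from \<open>r1\<close> to \<open>r\<close>; and the element realizing \<open>r1\<close> no longer
  counts at scale \<open>r1\<close>. The last jump is needed even if no element lies between, whence
  \<open>Suc n\<close>.\<close>

lemma state_iterate:
  assumes e: "0 < e" "state e (fan_C DIM('a) N Cg c0 0) (fan_c DIM('a) N Cg c0 0)"
  shows "e \<le> r \<Longrightarrow> r \<le> R \<Longrightarrow> card {T \<in> S. T \<noteq> {} \<and> e < infdist y0 T \<and> infdist y0 T < r} \<le> n \<Longrightarrow>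
     state r (fan_C DIM('a) N Cg c0 (Suc n)) (fan_c DIM('a) N Cg c0 (Suc n))"
proof (induction n arbitrary: r)
  case 0
  then have none: "{T \<in> S. T \<noteq> {} \<and> e < infdist y0 T \<and> infdist y0 T < r} = {}" using finS by simp
  have "state r (fan_C DIM('a) N Cg c0 0 + fan_incr DIM('a) N Cg (fan_c DIM('a) N Cg c0 0))
     (fan_c DIM('a) N Cg c0 0 * fan_ratio DIM('a) N Cg)"
  proof (rule state_jump[OF e(2,1) 0(1,2) fan_c_pos])
    fix T assume T: "T \<in> S" "T \<inter> ball y0 r \<noteq> {}"
    then have ne: "T \<noteq> {}" by auto
    have "T \<notin> {T \<in> S. T \<noteq> {} \<and> e < infdist y0 T \<and> infdist y0 T < r}" using none by simp
    then have "infdist y0 T \<le> e" using T ne meets_ball_iff(1)[OF T(1) ne] by simp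
    then show "T \<inter> cball y0 e \<noteq> {}" using meets_ball_iff(2)[OF T(1) ne] by simp
  qed
  then show ?case by simp
next
  case (Suc n)
  define B where "B = {T \<in> S. T \<noteq> {} \<and> e < infdist y0 T \<and> infdist y0 T < r}"
  have fB: "finite B" using finS by (simp add: B_def)
  show ?case
  proof (cases "B = {}")
    case True
    have "state r (fan_C DIM('a) N Cg c0 (Suc n)) (fan_c DIM('a) N Cg c0 (Suc n))"
      by (rule Suc.IH[OF Suc.prems(1,2)]) (use True in \<open>simp add: B_def[symmetric]\<close>)
    from state_Suc[OF this] show ?thesis using Suc.prems(1) e(1) by simp
  next
    case False
    define r1 where "r1 = Max (infdist y0 ` B)"
    have "r1 \<in> infdist y0 ` B" unfolding r1_def using fB False by (intro Max_in) auto
    then obtain T1 where T1: "T1 \<in> B" "r1 = infdist y0 T1" by auto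
    have r1: "e < r1" "r1 < r" using T1 by (auto simp: B_def)
    have max: "infdist y0 T \<le> r1" if "T \<in> B" for T unfolding r1_def using fB that by (intro Max_ge) auto
    have "{T \<in> S. T \<noteq> {} \<and> e < infdist y0 T \<and> infdist y0 T < r1} \<subseteq> B - {T1}"
      using T1 r1 by (auto simp: B_def)
    then have "card {T \<in> S. T \<noteq> {} \<and> e < infdist y0 T \<and> infdist y0 T < r1} \<le> card (B - {T1})"
      using fB by (intro card_mono) auto
    also have "\<dots> \<le> n" using T1(1) fB Suc.prems(3) by (simp add: B_def[symmetric])
    finally have st: "state r1 (fan_C DIM('a) N Cg c0 (Suc n)) (fan_c DIM('a) N Cg c0 (Suc n))"
      using r1 Suc.prems by (intro Suc.IH) auto
    have "state r (fan_C DIM('a) N Cg c0 (Suc n) + fan_incr DIM('a) N Cg (fan_c DIM('a) N Cg c0 (Suc n)))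
      (fan_c DIM('a) N Cg c0 (Suc n) * fan_ratio DIM('a) N Cg)"
    proof (rule state_jump[OF st _ _ _ fan_c_pos])
      fix T assume T: "T \<in> S" "T \<inter> ball y0 r \<noteq> {}"
      then have ne: "T \<noteq> {}" by auto
      have "infdist y0 T \<le> r1"
      proof (cases "e < infdist y0 T")
        case True
        then have "T \<in> B" using T ne meets_ball_iff(1)[OF T(1) ne] by (simp add: B_def)
        then show ?thesis by (rule max)
      qed (use r1 in auto)
      then show "T \<inter> cball y0 r1 \<noteq> {}" using meets_ball_iff(2)[OF T(1) ne] by simp
    qed (use r1 e Suc.prems in auto)
    then show ?thesis by (simp only: fan_C.simps(2)[of _ _ _ _ "Suc n"] fan_c.simps(2)[of _ _ _ _ "Suc n"])
  qed
qed

lemma state_final: "state R (fan_C DIM('a) N Cg c0 (Suc N)) (fan_c DIM('a) N Cg c0 (Suc N))"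
proof -
  obtain e where e: "0 < e" "e \<le> R" "state e (fan_C DIM('a) N Cg c0 0) (fan_c DIM('a) N Cg c0 0)"
    by (rule state_tiny)
  have "card {T \<in> S. T \<noteq> {} \<and> e < infdist y0 T \<and> infdist y0 T < R} \<le> card S"
    using finS by (intro card_mono) auto
  then show ?thesis using e cardS by (intro state_iterate) auto
qed

end

text \<open>\<open>e\<close> is the threshold, relative to the size of the affine function, below
  which its values count as small. The bound \<open>1 / 3\<close> forces a large slope where small
  values occur, and the other bound keeps the set of small values below half of the available
  measure. The two summands of the result belong to the cases distinguished in
  \<open>fan_bound\<close>.\<close>

definition fan_A :: "nat \<Rightarrow> nat \<Rightarrow> real \<Rightarrow> real \<Rightarrow> real" where
  "fan_A k N Cg c0 =
     (let c = fan_c k N Cg c0 (Suc N); C = fan_C k N Cg c0 (Suc N);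
          e = min (1 / 3) (c / (6 * 2 ^ k * slab_const k))
      in 8 / (e\<^sup>2 * c) + 4 * (2 * C + 2)\<^sup>2 / e\<^sup>2)"

context fan begin

text \<open>Up to the error \<open>d\<close>, \<open>v (Y x)\<close> is the affine function with
  value \<open>v y0\<close> and slope \<open>P (gr T0)\<close>, and it is sampled on a set that
  fills a fixed fraction of the ball. The element \<open>T\<close> is fixed before the integral
  bound \<open>I\<close>, so that later the trace on a single neighbour is all that has to be
  inserted.\<close>

lemma fan_bound:
  obtains T where "T \<in> S"
    "\<And>I. 0 \<le> I \<Longrightarrow> (\<integral>\<^sup>+x\<in>{x \<in> ball y0 R. Y x \<in> T}. ennreal ((v (Y x))\<^sup>2) \<partial>lborel) \<le> ennreal I \<Longrightarrow>
      R ^ DIM('a) * (\<bar>v y0\<bar> + R * norm (P (gr T0)))\<^sup>2 \<le> fan_A DIM('a) N Cg c0 * (I + R ^ DIM('a) * (G * R)\<^sup>2)"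
proof -
  let ?k = "DIM('a)"
  define C where "C = fan_C ?k N Cg c0 (Suc N)"
  define c where "c = fan_c ?k N Cg c0 (Suc N)"
  have c: "0 < c" unfolding c_def by (rule fan_c_pos)
  define e where "e = min (1 / 3) (c / (6 * 2 ^ ?k * slab_const ?k))"
  have e: "0 < e" "e \<le> 1 / 3" "e \<le> c / (6 * 2 ^ ?k * slab_const ?k)"
    using c slab_const_pos[of ?k] by (auto simp: e_def)
  have A: "fan_A ?k N Cg c0 = 8 / (e\<^sup>2 * c) + 4 * (2 * C + 2)\<^sup>2 / e\<^sup>2"
    by (simp add: fan_A_def Let_def e_def c_def C_def)
  obtain T where T: "T \<in> S" "norm (P (gr T - gr T0)) \<le> C * G"
      "\<And>x. x \<in> T \<Longrightarrow> \<bar>v x + gr T \<bullet> (y0 - x) - v y0\<bar> \<le> C * G * R"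
      "c * R ^ ?k \<le> measure lborel {x \<in> ball y0 R. Y x \<in> T}"
    using state_final unfolding state_def C_def[symmetric] c_def[symmetric] by blast
  define E where "E = {x \<in> ball y0 R. Y x \<in> T}"
  have Eb: "E \<in> sets borel" unfolding E_def by (rule preimage_borel[OF order_refl T(1)])
  have Ef: "E \<in> fmeasurable lborel"
    using Eb by (intro fmeasurableI emeasure_bounded_finite) (auto simp: E_def intro: bounded_subset[OF bounded_ball])
  define a where "a = v y0"
  define b where "b = P (gr T0)"
  define m where "m = \<bar>a\<bar> + R * norm b"
  have m0: "0 \<le> m" using Rpos by (simp add: m_def)
  define d where "d = (2 * C + 2) * (G * R)"
  have near: "\<bar>v (Y x) - (a + b \<bullet> (x - y0))\<bar> \<le> d" if x: "x \<in> E" for x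
  proof -
    have xB: "x \<in> ball y0 R" "Y x \<in> T" "norm (x - y0) \<le> R"
      using x by (auto simp: E_def dist_norm norm_minus_commute)
    have "norm (Y x - y0) \<le> 2 * R" using Y_near[OF xB(1)] xB(3) by simp
    then have "G * norm (Y x - y0) \<le> G * (2 * R)" using G0 by (intro mult_left_mono)
    then have 1: "\<bar>gr T \<bullet> (Y x - y0) - P (gr T) \<bullet> (Y x - y0)\<bar> \<le> G * (2 * R)"
      using gr_split[OF T(1), of "Y x - y0"] by linarith
    have 2: "P (gr T) \<bullet> (Y x - y0) = P (gr T) \<bullet> (x - y0)"
      by (rule gr_fiber) (simp add: P_diff PY[OF xB(1)])
    have "\<bar>P (gr T - gr T0) \<bullet> (x - y0)\<bar> \<le> norm (P (gr T - gr T0)) * norm (x - y0)" by (rule Cauchy_Schwarz_ineq2)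
    also have "\<dots> \<le> C * G * R"
      using T(2) xB(3) by (intro mult_mono) (auto intro: order_trans[OF norm_ge_zero])
    finally have 3: "\<bar>P (gr T) \<bullet> (x - y0) - b \<bullet> (x - y0)\<bar> \<le> C * G * R"
      by (simp add: P_diff b_def inner_diff_left)
    have 4: "\<bar>v (Y x) - gr T \<bullet> (Y x - y0) - a\<bar> \<le> C * G * R"
      using T(3)[OF xB(2)] by (simp add: a_def inner_diff_right algebra_simps)
    have "d = C * G * R + G * (2 * R) + C * G * R" by (simp add: d_def algebra_simps)
    then show ?thesis using 1 2 3 4 by linarith
  qed
  define F where "F = {x \<in> E. \<bar>a + b \<bullet> (x - y0)\<bar> < e * m}"
  have Fb: "F \<in> sets borel"
  proof -
    have "{x. \<bar>a + b \<bullet> (x - y0)\<bar> < e * m} \<in> sets borel" by measurable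
    moreover have "F = E \<inter> {x. \<bar>a + b \<bullet> (x - y0)\<bar> < e * m}" by (auto simp: F_def)
    ultimately show ?thesis using Eb by auto
  qed
  have Ff: "F \<in> fmeasurable lborel" using Fb by (intro fmeasurableI2[OF Ef]) (auto simp: F_def)
  have Fsmall: "measure lborel F \<le> c / 2 * R ^ ?k"
  proof (cases "F = {}")
    case True
    then show ?thesis using c Rpos by simp
  next
    case False
    then obtain x1 where x1: "x1 \<in> F" by auto
    have mpos: "0 < m"
    proof (rule ccontr)
      assume "\<not> 0 < m" then have "m = 0" using m0 by simp
      then show False using x1 by (simp add: F_def)
    qed
    \<comment> \<open>If the slope contributed less than a third of \<open>m\<close>, the constant
      part \<open>a\<close> would dominate on the whole ball and \<open>F\<close> would be
      empty.\<close>
    have bR: "m / 3 \<le> norm b * R"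
    proof (rule ccontr)
      assume "\<not> m / 3 \<le> norm b * R"
      then have 1: "2 * (norm b * R) < \<bar>a\<bar>" by (simp add: m_def algebra_simps)
      have "\<bar>b \<bullet> (x1 - y0)\<bar> \<le> norm b * norm (x1 - y0)" by (rule Cauchy_Schwarz_ineq2)
      also have "\<dots> \<le> norm b * R"
        using x1 by (intro mult_left_mono) (auto simp: F_def E_def dist_norm norm_minus_commute)
      finally have "\<bar>a\<bar> - norm b * R \<le> \<bar>a + b \<bullet> (x1 - y0)\<bar>" by linarith
      moreover have "\<bar>a + b \<bullet> (x1 - y0)\<bar> < e * m" using x1 by (simp add: F_def)
      moreover have "e * m \<le> 1 / 3 * m" using e m0 by (intro mult_right_mono)
      ultimately show False using 1 by (simp add: m_def algebra_simps)
    qed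
    have "norm b * (2 * R) * measure lborel F \<le> slab_const ?k * (2 * (e * m)) * (2 * R) ^ ?k"
    proof (rule measure_slab[OF Fb])
      show "F \<subseteq> ball x1 (2 * R)"
      proof
        fix x assume "x \<in> F"
        then have "dist y0 x < R" "dist y0 x1 < R" using x1 by (auto simp: F_def E_def)
        then show "x \<in> ball x1 (2 * R)" using dist_triangle3[of x1 x y0] by simp
      qed
      fix x assume "x \<in> F"
      then have "\<bar>a + b \<bullet> (x - y0)\<bar> < e * m" "\<bar>a + b \<bullet> (x1 - y0)\<bar> < e * m" using x1 by (auto simp: F_def)
      moreover have "b \<bullet> (x - x1) = (a + b \<bullet> (x - y0)) - (a + b \<bullet> (x1 - y0))" by (simp add: inner_diff_right)
      ultimately show "\<bar>b \<bullet> (x - x1)\<bar> \<le> 2 * (e * m)" by linarith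
    qed (use Rpos e m0 in auto)
    moreover have "2 * (m / 3) * measure lborel F \<le> 2 * (norm b * R) * measure lborel F"
      using bR by (intro mult_right_mono mult_left_mono) auto
    ultimately have "m * (2 / 3 * measure lborel F) \<le> m * (slab_const ?k * 2 * e * (2 * R) ^ ?k)"
      by (simp add: algebra_simps)
    then have "2 / 3 * measure lborel F \<le> slab_const ?k * 2 * e * (2 * R) ^ ?k" using mpos by simp
    then have "measure lborel F \<le> 3 * slab_const ?k * 2 ^ ?k * R ^ ?k * e" by (simp add: power_mult_distrib mult_ac)
    also have "\<dots> \<le> 3 * slab_const ?k * 2 ^ ?k * R ^ ?k * (c / (6 * 2 ^ ?k * slab_const ?k))"
      using e(3) slab_const_pos[of ?k] Rpos by (intro mult_left_mono) auto
    also have "\<dots> = c / 2 * R ^ ?k" using less_imp_neq[OF slab_const_pos[of ?k]] by simp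
    finally show ?thesis .
  qed
  have diff: "c / 2 * R ^ ?k \<le> measure lborel (E - F)"
  proof -
    have "measure lborel (E - F) = measure lborel E - measure lborel F"
      by (rule measurable_measure_Diff) (use Ef Fb in \<open>auto simp: F_def\<close>)
    then show ?thesis using Fsmall T(4) by (simp add: E_def)
  qed
  have "R ^ ?k * m\<^sup>2 \<le> fan_A ?k N Cg c0 * (I + R ^ ?k * (G * R)\<^sup>2)"
    if I: "0 \<le> I" "(\<integral>\<^sup>+x\<in>E. ennreal ((v (Y x))\<^sup>2) \<partial>lborel) \<le> ennreal I" for I
  \<comment> \<open>Either the error of the affine approximation is comparable to \<open>m\<close>,
    and then \<open>G\<close> bounds \<open>m\<close>, or \<open>v (Y x)\<close> is at least
    \<open>e * m / 2\<close> in absolute value on \<open>E - F\<close>, and the integral of its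
    square bounds \<open>m\<close>.\<close>
  proof (cases "e * m / 2 \<le> \<bar>d\<bar>")
    case True
    have "(e * m / 2)\<^sup>2 \<le> \<bar>d\<bar>\<^sup>2" using True e m0 by (intro power_mono) auto
    then have "m\<^sup>2 \<le> 4 * d\<^sup>2 / e\<^sup>2" using e by (simp add: power_divide power_mult_distrib field_simps)
    also have "\<dots> = 4 * (2 * C + 2)\<^sup>2 / e\<^sup>2 * (G * R)\<^sup>2" by (simp add: d_def power_mult_distrib)
    finally have "m\<^sup>2 \<le> 4 * (2 * C + 2)\<^sup>2 / e\<^sup>2 * (G * R)\<^sup>2" .
    then have "R ^ ?k * m\<^sup>2 \<le> R ^ ?k * (4 * (2 * C + 2)\<^sup>2 / e\<^sup>2 * (G * R)\<^sup>2)"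
      using Rpos by (intro mult_left_mono) auto
    then have "R ^ ?k * m\<^sup>2 \<le> 4 * (2 * C + 2)\<^sup>2 / e\<^sup>2 * (R ^ ?k * (G * R)\<^sup>2)"
      by (simp only: mult.left_commute)
    also have "\<dots> \<le> fan_A ?k N Cg c0 * (I + R ^ ?k * (G * R)\<^sup>2)"
      unfolding A using I e c Rpos by (intro mult_mono) auto
    finally show ?thesis .
  next
    case False
    have big: "(e * m / 2)\<^sup>2 \<le> (v (Y x))\<^sup>2" if "x \<in> E - F" for x
    proof -
      have "e * m \<le> \<bar>a + b \<bullet> (x - y0)\<bar>" using that by (auto simp: F_def)
      then have "e * m / 2 \<le> \<bar>v (Y x)\<bar>" using near[of x] that False by auto
      then have "(e * m / 2)\<^sup>2 \<le> \<bar>v (Y x)\<bar>\<^sup>2" using e m0 by (intro power_mono) auto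
      then show ?thesis by simp
    qed
    have "ennreal ((e * m / 2)\<^sup>2 * (c / 2 * R ^ ?k)) \<le> ennreal ((e * m / 2)\<^sup>2 * measure lborel (E - F))"
      using diff by (intro ennreal_leI mult_left_mono) auto
    also have "\<dots> = ennreal ((e * m / 2)\<^sup>2) * emeasure lborel (E - F)"
      using emeasure_eq_measure2[OF fmeasurable.Diff[OF Ef Ff]] by (simp add: ennreal_mult'')
    also have "\<dots> = (\<integral>\<^sup>+x. ennreal ((e * m / 2)\<^sup>2) * indicator (E - F) x \<partial>lborel)"
      using Eb Fb by (subst nn_integral_cmult_indicator) auto
    also have "\<dots> \<le> (\<integral>\<^sup>+x\<in>E. ennreal ((v (Y x))\<^sup>2) \<partial>lborel)"
      using big by (intro nn_integral_mono) (auto simp: indicator_def)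
    also have "\<dots> \<le> ennreal I" by fact
    finally have "(e * m / 2)\<^sup>2 * (c / 2 * R ^ ?k) \<le> I" using I by (simp add: ennreal_le_iff)
    then have "R ^ ?k * m\<^sup>2 \<le> 8 / (e\<^sup>2 * c) * I"
      using e c by (simp add: power_divide power_mult_distrib field_simps)
    also have "\<dots> \<le> fan_A ?k N Cg c0 * (I + R ^ ?k * (G * R)\<^sup>2)"
      unfolding A using I e c Rpos by (intro mult_mono) auto
    finally show ?thesis .
  qed
  then show ?thesis using that T(1) unfolding m_def a_def b_def E_def by blast
qed

end

section \<open>Shape-regular simplicial meshes\<close>

text \<open>Barycentric coordinates, extended by 0 off the vertex set. With this convention the
  coordinates with respect to a face and to any simplex having that face are the same
  function.\<close>

definition bary :: "'a::euclidean_space set \<Rightarrow> 'a \<Rightarrow> 'a \<Rightarrow> real" where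
  "bary V x = (SOME u. (\<forall>a. a \<notin> V \<longrightarrow> u a = 0) \<and> (\<forall>a\<in>V. 0 \<le> u a) \<and> sum u V = 1 \<and> (\<Sum>a\<in>V. u a *\<^sub>R a) = x)"

lemma bary:
  assumes "finite V" "x \<in> convex hull V"
  shows "a \<notin> V \<Longrightarrow> bary V x a = 0" "0 \<le> bary V x a" "sum (bary V x) V = 1" "(\<Sum>a\<in>V. bary V x a *\<^sub>R a) = x"
proof -
  obtain u where u: "\<forall>a\<in>V. 0 \<le> u a" "sum u V = 1" "(\<Sum>a\<in>V. u a *\<^sub>R a) = x"
    using assms by (auto simp: convex_hull_finite)
  define u' where "u' a = (if a \<in> V then u a else 0)" for a
  have "(\<forall>a. a \<notin> V \<longrightarrow> u' a = 0) \<and> (\<forall>a\<in>V. 0 \<le> u' a) \<and> sum u' V = 1 \<and> (\<Sum>a\<in>V. u' a *\<^sub>R a) = x"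
    using u by (auto simp: u'_def)
  from someI[of "\<lambda>u. (\<forall>a. a \<notin> V \<longrightarrow> u a = 0) \<and> (\<forall>a\<in>V. 0 \<le> u a) \<and> sum u V = 1 \<and> (\<Sum>a\<in>V. u a *\<^sub>R a) = x", OF this]
  have *: "(\<forall>a. a \<notin> V \<longrightarrow> bary V x a = 0) \<and> (\<forall>a\<in>V. 0 \<le> bary V x a) \<and> sum (bary V x) V = 1 \<and>
      (\<Sum>a\<in>V. bary V x a *\<^sub>R a) = x" by (simp add: bary_def)
  then show "a \<notin> V \<Longrightarrow> bary V x a = 0" "sum (bary V x) V = 1" "(\<Sum>a\<in>V. bary V x a *\<^sub>R a) = x" by auto
  show "0 \<le> bary V x a" using * by (cases "a \<in> V") auto
qed

lemma bary_unique:
  assumes V: "\<not> affine_dependent V" and x: "x \<in> convex hull V"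
    and u: "\<And>a. a \<notin> V \<Longrightarrow> u a = 0" "sum u V = 1" "(\<Sum>a\<in>V. u a *\<^sub>R a) = x"
  shows "u = bary V x"
proof
  fix a
  have fin: "finite V" using V by (rule aff_independent_finite)
  note b = bary[OF fin x]
  show "u a = bary V x a"
  proof (cases "a \<in> V")
    case True
    have "sum (\<lambda>a. u a - bary V x a) V = 0" using u b by (simp add: sum_subtractf)
    moreover have "(\<Sum>a\<in>V. (u a - bary V x a) *\<^sub>R a) = 0"
      using u b by (simp add: sum_subtractf scaleR_diff_left)
    ultimately have "\<not> (\<exists>a\<in>V. u a - bary V x a \<noteq> 0)"
      using V unfolding affine_dependent_explicit_finite[OF fin] by blast
    then show ?thesis using True by auto
  qed (use u b in auto)
qed

lemma bary_convex:
  assumes V: "\<not> affine_dependent V" and x: "x \<in> convex hull V" and y: "y \<in> convex hull V"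
    and s: "0 \<le> s" "0 \<le> t" "s + t = 1"
  shows "bary V (s *\<^sub>R x + t *\<^sub>R y) a = s * bary V x a + t * bary V y a"
proof -
  have fin: "finite V" using V by (rule aff_independent_finite)
  note bx = bary[OF fin x] and by' = bary[OF fin y]
  have "(\<lambda>a. s * bary V x a + t * bary V y a) = bary V (s *\<^sub>R x + t *\<^sub>R y)"
  proof (rule bary_unique[OF V])
    show "s *\<^sub>R x + t *\<^sub>R y \<in> convex hull V" by (intro convexD[OF convex_convex_hull] x y s)
    show "(\<Sum>a\<in>V. s * bary V x a + t * bary V y a) = 1"
      using s by (simp add: sum.distrib bx by' flip: sum_distrib_left)
    show "(\<Sum>a\<in>V. (s * bary V x a + t * bary V y a) *\<^sub>R a) = s *\<^sub>R x + t *\<^sub>R y"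
      by (simp add: scaleR_add_left sum.distrib bx by' flip: scaleR_scaleR scaleR_sum_right)
  qed (simp add: bx by')
  then show ?thesis by metis
qed

lemma bary_subset:
  assumes V: "\<not> affine_dependent V" and W: "W \<subseteq> V" and x: "x \<in> convex hull W"
  shows "bary W x = bary V x"
proof (rule bary_unique[OF V])
  have fin: "finite V" "finite W" using V W by (auto dest: aff_independent_finite finite_subset)
  note b = bary[OF fin(2) x]
  show "x \<in> convex hull V" using x W hull_mono by blast
  show "bary W x a = 0" if "a \<notin> V" for a using b that W by auto
  have "sum (bary W x) V = sum (bary W x) W"
    by (rule sum.mono_neutral_right) (use fin W b in auto)
  then show "sum (bary W x) V = 1" using b by simp
  have "(\<Sum>a\<in>V. bary W x a *\<^sub>R a) = (\<Sum>a\<in>W. bary W x a *\<^sub>R a)"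
    by (rule sum.mono_neutral_right) (use fin W b in auto)
  then show "(\<Sum>a\<in>V. bary W x a *\<^sub>R a) = x" using b by simp
qed

lemma bary_le_1:
  assumes "finite V" "x \<in> convex hull V" shows "bary V x a \<le> 1"
proof (cases "a \<in> V")
  case True
  then have "bary V x a \<le> sum (bary V x) V"
    using bary(2)[OF assms] assms(1) by (intro member_le_sum) auto
  then show ?thesis using bary(3)[OF assms] by simp
qed (use bary(1)[OF assms] in auto)

text \<open>Barycentric coordinates are affine with values in \<open>[0, 1]\<close>, so a ball inside the simplex bounds
  their slope.\<close>

lemma bary_lipschitz:
  assumes V: "\<not> affine_dependent V" and \<rho>: "0 < \<rho>" "cball z \<rho> \<subseteq> convex hull V"
    and x: "x \<in> convex hull V" and y: "y \<in> convex hull V"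
  shows "\<bar>bary V x a - bary V y a\<bar> \<le> norm (x - y) / (2 * \<rho>)"
proof (cases "x = y")
  case False
  have fin: "finite V" using V by (rule aff_independent_finite)
  define e where "e = (1 / norm (x - y)) *\<^sub>R (x - y)"
  \<comment> \<open>With weight \<open>s\<close>, moving from \<open>x\<close> towards one end of a
    diameter of the ball parallel to \<open>x - y\<close>, and from \<open>y\<close> towards the
    other end, leads to the same point. The difference of the coordinates at \<open>x\<close> and
    \<open>y\<close> is therefore \<open>s\<close> times a difference of two values in
    \<open>[0, 1]\<close>.\<close>
  define s where "s = norm (x - y) / (2 * \<rho>)"
  have s: "0 < s" using False \<rho> by (simp add: s_def)
  have ne: "norm e = 1" using False by (simp add: e_def)
  have zp: "z - \<rho> *\<^sub>R e \<in> convex hull V" "z + \<rho> *\<^sub>R e \<in> convex hull V"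
    using \<rho> ne by (auto intro!: subsetD[OF \<rho>(2)] simp: dist_norm)
  have "(2 * \<rho> * s) *\<^sub>R e = x - y" using False \<rho> by (simp add: s_def e_def)
  moreover have "(2 * \<rho> * s) *\<^sub>R e = (s * \<rho>) *\<^sub>R e + (s * \<rho>) *\<^sub>R e"
    by (simp flip: scaleR_add_left)
  ultimately have "x = y + ((s * \<rho>) *\<^sub>R e + (s * \<rho>) *\<^sub>R e)" by simp
  then have eq: "x + s *\<^sub>R (z - \<rho> *\<^sub>R e) = y + s *\<^sub>R (z + \<rho> *\<^sub>R e)"
    by (simp add: scaleR_diff_right scaleR_add_right)
  define p where "p = 1 / (1 + s)"
  define q where "q = s / (1 + s)"
  have pq: "0 \<le> p" "0 \<le> q" "p + q = 1" "q = p * s" using s by (auto simp: p_def q_def field_simps)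
  have "p *\<^sub>R x + q *\<^sub>R (z - \<rho> *\<^sub>R e) = p *\<^sub>R (x + s *\<^sub>R (z - \<rho> *\<^sub>R e))"
    by (simp add: pq(4) scaleR_add_right)
  also have "\<dots> = p *\<^sub>R y + q *\<^sub>R (z + \<rho> *\<^sub>R e)"
    unfolding eq by (simp add: pq(4) scaleR_add_right)
  finally have "p * bary V x a + q * bary V (z - \<rho> *\<^sub>R e) a = p * bary V y a + q * bary V (z + \<rho> *\<^sub>R e) a"
    using bary_convex[OF V x zp(1) pq(1-3), of a] bary_convex[OF V y zp(2) pq(1-3), of a] by simp
  then have "p * (bary V x a - bary V y a) = p * (s * (bary V (z + \<rho> *\<^sub>R e) a - bary V (z - \<rho> *\<^sub>R e) a))"
    unfolding pq(4) by (simp add: algebra_simps)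
  moreover have "p \<noteq> 0" using s by (simp add: p_def)
  ultimately have "bary V x a - bary V y a = s * (bary V (z + \<rho> *\<^sub>R e) a - bary V (z - \<rho> *\<^sub>R e) a)" by simp
  moreover have "\<bar>bary V (z + \<rho> *\<^sub>R e) a - bary V (z - \<rho> *\<^sub>R e) a\<bar> \<le> 1"
    using bary(2)[OF fin zp(1), of a] bary(2)[OF fin zp(2), of a] bary_le_1[OF fin zp(1), of a] bary_le_1[OF fin zp(2), of a]
    by linarith
  ultimately show ?thesis using s by (simp add: abs_mult s_def[symmetric] mult_left_le)
qed (use \<rho> in simp)

definition verts :: "'a::euclidean_space set \<Rightarrow> 'a set" where
  "verts T = {a. a extreme_point_of T}"

lemma simplex_verts:
  assumes "n simplex T"
  shows "\<not> affine_dependent (verts T)" "int (card (verts T)) = n + 1" "T = convex hull (verts T)" "finite (verts T)"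
proof -
  obtain C where C: "\<not> affine_dependent C" "int (card C) = n + 1" "T = convex hull C"
    using assms by (auto simp: simplex_def)
  have "verts T = C" using extreme_point_of_convex_hull_affine_independent[OF C(1)] by (auto simp: verts_def C(3))
  then show "\<not> affine_dependent (verts T)" "int (card (verts T)) = n + 1" "T = convex hull (verts T)" "finite (verts T)"
    using C aff_independent_finite by auto
qed

lemma bary_face:
  assumes "n simplex T" "F face_of T" "x \<in> F"
  shows "bary (verts F) x = bary (verts T) x"
proof -
  note T = simplex_verts[OF assms(1)]
  obtain c where c: "c \<subseteq> verts T" "F = convex hull c"
    using assms(2) face_of_convex_hull_affine_independent[OF T(1)] T(3) by metis
  have "\<not> affine_dependent c" using T(1) c(1) affine_dependent_subset by blast
  then have "verts F = c" using extreme_point_of_convex_hull_affine_independent[of c] by (auto simp: verts_def c(2))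
  then show ?thesis using bary_subset[OF T(1) c(1)] assms(3) c(2) by simp
qed

locale fine_mesh =
  fixes \<T> :: "'a::euclidean_space set set" and \<rho> D :: real
  assumes tri: "triangulation \<T>" and simp: "\<And>T. T \<in> \<T> \<Longrightarrow> int DIM('a) simplex T"
    and \<rho>: "0 < \<rho>" and inball: "\<And>T. T \<in> \<T> \<Longrightarrow> \<exists>z. cball z \<rho> \<subseteq> T"
    and diam: "\<And>T x y. T \<in> \<T> \<Longrightarrow> x \<in> T \<Longrightarrow> y \<in> T \<Longrightarrow> norm (x - y) \<le> D"
begin

lemma finT: "finite \<T>" using tri by (simp add: triangulation_def)

lemma compactT: "T \<in> \<T> \<Longrightarrow> compact T" using simp compact_simplex by blast
lemma closedT: "T \<in> \<T> \<Longrightarrow> closed T" using simp closed_simplex by blast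
lemma convexT: "T \<in> \<T> \<Longrightarrow> convex T" using simp convex_simplex by blast

lemma card_verts: "T \<in> \<T> \<Longrightarrow> card (verts T) = DIM('a) + 1"
  using simplex_verts(2)[OF simp] by fastforce

lemma bary_mesh:
  assumes "T \<in> \<T>" "T' \<in> \<T>" "x \<in> T" "x \<in> T'"
  shows "bary (verts T) x = bary (verts T') x"
proof -
  have "T \<inter> T' face_of T" "T \<inter> T' face_of T'"
    using tri assms(1,2) unfolding triangulation_def by (metis Int_commute)+
  then show ?thesis using bary_face[OF simp[OF assms(1)]] bary_face[OF simp[OF assms(2)]] assms(3,4)
    by (metis IntI)
qed

text \<open>For a vertex \<open>a\<close> this is the slope of its hat function: the coordinates
  agree on common faces, so the bounds on single elements glue along the segment with the same
  constant, whatever the number of elements crossed.\<close>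

lemma bary_mesh_lipschitz:
  assumes T: "T \<in> \<T>" "T' \<in> \<T>" "x \<in> T" "x' \<in> T'" and seg: "closed_segment x x' \<subseteq> \<Union>\<T>"
  shows "\<bar>bary (verts T) x a - bary (verts T') x' a\<bar> \<le> norm (x - x') / (2 * \<rho>)"
proof -
  define z where "z t = x + t *\<^sub>R (x' - x)" for t :: real
  have zseg: "z t \<in> closed_segment x x'" if "t \<in> {0..1}" for t
    using that by (auto simp: z_def closed_segment_def algebra_simps intro!: exI[of _ t])
  define cl where "cl t = (SOME T. T \<in> \<T> \<and> z t \<in> T)" for t
  have cl: "cl t \<in> \<T> \<and> z t \<in> cl t" if "t \<in> {0..1}" for t
    unfolding cl_def by (rule someI_ex) (use zseg[OF that] seg in blast)
  define f where "f t = bary (verts (cl t)) (z t) a" for t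
  have fe: "f t = bary (verts S) (z t) a" if "t \<in> {0..1}" "S \<in> \<T>" "z t \<in> S" for t S
    unfolding f_def using bary_mesh[of "cl t" S "z t"] cl[OF that(1)] that by simp
  define M where "M = norm (x - x') / (2 * \<rho>)"
  have "M-lipschitz_on {0..1} f"
  proof (rule lipschitz_on_closed_Union[where U="\<lambda>S. {0..1} \<inter> z -` S" and I=\<T>])
    show "closed ({0..1} \<inter> z -` S)" if "S \<in> \<T>" for S
      unfolding z_def using closedT[OF that] by (intro continuous_closed_preimage continuous_intros) auto
    show "{0..1} \<subseteq> (\<Union>S\<in>\<T>. {0..1} \<inter> z -` S)" using cl by blast
    show "M \<ge> 0" using \<rho> by (simp add: M_def)
    fix S assume S: "S \<in> \<T>"
    obtain c where c: "cball c \<rho> \<subseteq> S" using inball[OF S] by blast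
    note V = simplex_verts[OF simp[OF S]]
    show "M-lipschitz_on ({0..1} \<inter> z -` S) f"
    proof (rule lipschitz_onI)
      fix s t assume st: "s \<in> {0..1} \<inter> z -` S" "t \<in> {0..1} \<inter> z -` S"
      have "dist (f s) (f t) = \<bar>bary (verts S) (z s) a - bary (verts S) (z t) a\<bar>"
        using st S by (simp add: fe dist_real_def)
      also have "\<dots> \<le> norm (z s - z t) / (2 * \<rho>)"
        by (rule bary_lipschitz[OF V(1) \<rho>]) (use V(3) c st in auto)
      also have "norm (z s - z t) = \<bar>s - t\<bar> * norm (x - x')"
        unfolding z_def by (simp add: norm_minus_commute flip: scaleR_diff_left)
      finally show "dist (f s) (f t) \<le> M * dist s t" by (simp add: M_def dist_real_def mult.commute)
    qed fact
  qed (use finT in auto)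
  then have "dist (f 0) (f 1) \<le> M * dist 0 (1::real)" by (rule lipschitz_onD) auto
  then show ?thesis using fe[of 0 T] fe[of 1 T'] T by (simp add: z_def M_def dist_real_def)
qed

text \<open>A vertex \<open>a\<close> of \<open>T0\<close> missing from some element near
  \<open>y0\<close> has weight at most \<open>r / (2 * \<rho>)\<close> at \<open>y0\<close>, because
  its hat function vanishes on that element. The remaining vertices belong to all elements near
  \<open>y0\<close>; they keep weight at least \<open>1 / 2\<close> by the bound on
  \<open>r\<close>, and renormalizing their weights shifts the point only by a multiple of
  \<open>r\<close>.\<close>

lemma common_point:
  assumes y0: "T0 \<in> \<T>" "y0 \<in> T0" and r: "0 < r" "(real DIM('a) + 1) * r \<le> \<rho>" and cov: "cball y0 r \<subseteq> \<Union>\<T>"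
  shows "\<exists>g. norm (g - y0) \<le> (real DIM('a) + 1) * D / (2 * \<rho>) * r \<and> (\<forall>T\<in>\<T>. T \<inter> cball y0 r \<noteq> {} \<longrightarrow> g \<in> T)"
proof -
  let ?n = "real DIM('a) + 1"
  let ?V = "verts T0"
  note V = simplex_verts[OF simp[OF y0(1)]]
  define u where "u = bary ?V y0"
  have y0h: "y0 \<in> convex hull ?V" using y0 V by simp
  note b = bary[OF V(4) y0h, folded u_def]
  define W where "W = {a \<in> ?V. \<forall>T\<in>\<T>. T \<inter> cball y0 r \<noteq> {} \<longrightarrow> a \<in> verts T}"
  have WV: "W \<subseteq> ?V" by (auto simp: W_def)
  have fW: "finite W" using WV V(4) finite_subset by blast
  have small: "u a \<le> r / (2 * \<rho>)" if a: "a \<in> ?V - W" for a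
  proof -
    obtain T where T: "T \<in> \<T>" "T \<inter> cball y0 r \<noteq> {}" "a \<notin> verts T" using a by (auto simp: W_def)
    then obtain x where x: "x \<in> T" "x \<in> cball y0 r" by auto
    have "closed_segment y0 x \<subseteq> cball y0 r" using x(2) r by (intro closed_segment_subset) auto
    then have "\<bar>bary ?V y0 a - bary (verts T) x a\<bar> \<le> norm (y0 - x) / (2 * \<rho>)"
      using cov by (intro bary_mesh_lipschitz y0 T x) auto
    moreover have "bary (verts T) x a = 0"
      using simplex_verts[OF simp[OF T(1)]] T(3) x(1) by (intro bary(1)) auto
    moreover have "norm (y0 - x) / (2 * \<rho>) \<le> r / (2 * \<rho>)" using x(2) \<rho> by (intro divide_right_mono) (auto simp: dist_norm)
    ultimately show ?thesis by (simp add: u_def)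
  qed
  define s where "s = sum u W"
  define s' where "s' = sum u (?V - W)"
  have ss: "s + s' = 1" unfolding s_def s'_def using b(3) sum.subset_diff[OF WV V(4), of u] by simp
  have "s' \<le> real (card (?V - W)) * (r / (2 * \<rho>))" unfolding s'_def by (rule sum_bounded_above) (rule small)
  also have "\<dots> \<le> ?n * (r / (2 * \<rho>))"
  proof (rule mult_right_mono)
    have "card (?V - W) \<le> card ?V" using V(4) by (intro card_mono) auto
    then show "real (card (?V - W)) \<le> ?n" using card_verts[OF y0(1)] by simp
  qed (use r \<rho> in auto)
  finally have s': "s' \<le> ?n * r / (2 * \<rho>)" by simp
  also have "\<dots> \<le> 1 / 2" using r \<rho> by (simp add: divide_le_eq)
  finally have s: "1 / 2 \<le> s" using ss by simp
  define g where "g = (\<Sum>a\<in>W. (u a / s) *\<^sub>R a)"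
  have gW: "g \<in> convex hull W"
    unfolding convex_hull_finite[OF fW] g_def
    using s b(2) by (intro CollectI exI[of _ "\<lambda>a. u a / s"]) (auto simp: s_def simp flip: sum_divide_distrib)
  have gT: "g \<in> T" if "T \<in> \<T>" "T \<inter> cball y0 r \<noteq> {}" for T
  proof -
    have "W \<subseteq> verts T" using that by (auto simp: W_def)
    then have "convex hull W \<subseteq> convex hull (verts T)" by (rule hull_mono)
    then show ?thesis using gW simplex_verts(3)[OF simp[OF that(1)]] by blast
  qed
  have "T0 \<inter> cball y0 r \<noteq> {}" using y0 r by (auto intro!: exI[of _ y0])
  then have gT0: "g \<in> T0" using gT y0 by blast
  have sg: "(\<Sum>a\<in>W. u a *\<^sub>R a) = s *\<^sub>R g" using s by (simp add: g_def scaleR_sum_right)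
  have "y0 - g = (\<Sum>a\<in>W. u a *\<^sub>R a) + (\<Sum>a\<in>?V - W. u a *\<^sub>R a) - (s + s') *\<^sub>R g"
    using b(4) sum.subset_diff[OF WV V(4), of "\<lambda>a. u a *\<^sub>R a"] ss by (simp add: add.commute)
  also have "\<dots> = (\<Sum>a\<in>?V - W. u a *\<^sub>R (a - g))"
    by (simp add: sg scaleR_add_left scaleR_diff_right sum_subtractf s'_def scaleR_sum_left)
  finally have "norm (y0 - g) \<le> (\<Sum>a\<in>?V - W. u a * D)"
  proof (simp only:, intro sum_norm_le)
    fix a assume a: "a \<in> ?V - W"
    have "a \<in> T0" using a V(3) by (metis DiffD1 hull_inc)
    then show "norm (u a *\<^sub>R (a - g)) \<le> u a * D"
      using diam[OF y0(1) _ gT0, of a] b(2)[of a] by (auto intro: mult_left_mono)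
  qed
  also have "\<dots> = s' * D" by (simp add: s'_def sum_distrib_right)
  also have "\<dots> \<le> ?n * r / (2 * \<rho>) * D"
    using s' diam[OF y0(1) y0(2) y0(2)] by (intro mult_right_mono) auto
  finally have "norm (g - y0) \<le> ?n * D / (2 * \<rho>) * r" by (simp add: norm_minus_commute mult_ac)
  then show ?thesis using gT by blast
qed

lemma disjoint_interiors:
  assumes "T \<in> \<T>" "T' \<in> \<T>" "T \<noteq> T'" shows "interior T \<inter> interior T' = {}"
proof -
  have f: "T \<inter> T' face_of T" "T \<inter> T' face_of T'"
    using tri assms(1,2) unfolding triangulation_def by (metis Int_commute)+
  show ?thesis
  proof (cases "T \<inter> T' = T")
    case False
    then show ?thesis using face_of_disjoint_interior[OF f(1)] interior_subset by blast
  next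
    case True
    then have "T \<inter> T' \<noteq> T'" using assms(3) by auto
    then show ?thesis using face_of_disjoint_interior[OF f(2)] interior_subset by blast
  qed
qed

text \<open>The balls inscribed in distinct elements are disjoint and all lie in one ball of radius
  \<open>L + D + \<rho>\<close>; comparing volumes counts them.\<close>

lemma card_meets:
  assumes L: "0 \<le> L" and D0: "0 \<le> D"
  shows "real (card {T \<in> \<T>. T \<inter> cball y L \<noteq> {}}) \<le> ((L + D + \<rho>) / \<rho>) ^ DIM('a)"
proof -
  let ?B = "{T \<in> \<T>. T \<inter> cball y L \<noteq> {}}"
  let ?w = "unit_ball_vol (real DIM('a))"
  have fB: "finite ?B" using finT by simp
  obtain z where z: "\<And>T. T \<in> \<T> \<Longrightarrow> cball (z T) \<rho> \<subseteq> T" using inball by metis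
  have disj: "disjoint_family_on (\<lambda>T. ball (z T) \<rho>) ?B"
  proof (unfold disjoint_family_on_def, intro ballI impI)
    fix T T' assume T: "T \<in> ?B" "T' \<in> ?B" "T \<noteq> T'"
    have "ball (z U) \<rho> \<subseteq> interior U" if "U \<in> \<T>" for U
      by (rule interior_maximal[OF order_trans[OF ball_subset_cball z[OF that]] open_ball])
    then show "ball (z T) \<rho> \<inter> ball (z T') \<rho> = {}" using disjoint_interiors[of T T'] T by fast
  qed
  have sub: "(\<Union>T\<in>?B. ball (z T) \<rho>) \<subseteq> ball y (L + D + \<rho>)"
  proof
    fix p assume "p \<in> (\<Union>T\<in>?B. ball (z T) \<rho>)"
    then obtain T where T: "T \<in> \<T>" "T \<inter> cball y L \<noteq> {}" "dist (z T) p < \<rho>" by auto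
    then obtain x where x: "x \<in> T" "dist y x \<le> L" by auto
    have "z T \<in> T" using z[OF T(1)] \<rho> by auto
    then have "dist x (z T) \<le> D" using diam[OF T(1) x(1)] by (simp add: dist_norm)
    then have "dist y p < L + D + \<rho>" using x(2) T(3) dist_triangle[of y p x] dist_triangle[of x p "z T"] by linarith
    then show "p \<in> ball y (L + D + \<rho>)" by simp
  qed
  have "real (card ?B) * (?w * \<rho> ^ DIM('a)) = (\<Sum>T\<in>?B. measure lborel (ball (z T) \<rho>))"
    using \<rho> by (simp add: measure_ball_lborel)
  also have "\<dots> = measure lborel (\<Union>T\<in>?B. ball (z T) \<rho>)"
    by (rule measure_finite_Union[symmetric]) (use fB disj emeasure_bounded_finite[OF bounded_ball] in \<open>auto simp: less_top[symmetric]\<close>)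
  also have "\<dots> \<le> measure lborel (ball y (L + D + \<rho>))"
    by (rule measure_mono_fmeasurable[OF sub]) (auto intro!: sets.finite_UN fB fmeasurableI emeasure_bounded_finite)
  also have "\<dots> = ?w * (L + D + \<rho>) ^ DIM('a)" using L D0 \<rho> by (simp add: measure_ball_lborel)
  finally have "?w * (real (card ?B) * \<rho> ^ DIM('a)) \<le> ?w * (L + D + \<rho>) ^ DIM('a)" by (simp add: mult_ac)
  then have "real (card ?B) * \<rho> ^ DIM('a) \<le> (L + D + \<rho>) ^ DIM('a)"
    by (simp add: mult_le_cancel_left_pos unit_ball_vol_pos)
  then show ?thesis using \<rho> by (simp add: power_divide field_simps)
qed

text \<open>Contracting the inscribed ball towards \<open>y\<close> by the factor
  \<open>r / (2 * D)\<close> keeps it in \<open>T\<close> by convexity and brings it into the ball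
  of radius \<open>r\<close>.\<close>

lemma fat_corner:
  assumes T: "T \<in> \<T>" "y \<in> T" and r: "0 < r" "r \<le> 2 * D"
  shows "unit_ball_vol (real DIM('a)) * (\<rho> / (2 * D)) ^ DIM('a) * r ^ DIM('a) \<le> measure lborel (T \<inter> ball y r)"
proof -
  obtain z where z: "cball z \<rho> \<subseteq> T" using inball[OF T(1)] by blast
  define t where "t = r / (2 * D)"
  have D: "0 < D" using r by simp
  have t: "0 < t" "t \<le> 1" using r D by (auto simp: t_def)
  define c where "c = (1 - t) *\<^sub>R y + t *\<^sub>R z"
  have sub: "ball c (t * \<rho>) \<subseteq> T \<inter> ball y r"
  proof
    fix x assume x: "x \<in> ball c (t * \<rho>)"
    define w where "w = z + (1 / t) *\<^sub>R (x - c)"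
    have "norm (x - c) < t * \<rho>" using x by (simp add: dist_norm norm_minus_commute)
    then have "norm (x - c) / t \<le> \<rho>" using t by (simp add: field_simps)
    then have "w \<in> cball z \<rho>" using t by (simp add: w_def dist_norm)
    then have wT: "w \<in> T" using z by auto
    have xe: "x = (1 - t) *\<^sub>R y + t *\<^sub>R w" using t by (simp add: w_def c_def algebra_simps)
    have xT: "x \<in> T" unfolding xe using t by (intro convexD[OF convexT[OF T(1)] T(2) wT]) auto
    have "x - y = t *\<^sub>R (w - y)" unfolding xe by (simp add: algebra_simps)
    then have "norm (x - y) = t * norm (w - y)" using t by simp
    also have "\<dots> \<le> t * D" using diam[OF T(1) wT T(2)] t by (intro mult_left_mono) auto
    also have "\<dots> < r" using r D by (simp add: t_def)
    finally show "x \<in> T \<inter> ball y r" using xT by (simp add: dist_norm norm_minus_commute)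
  qed
  have "unit_ball_vol (real DIM('a)) * (\<rho> / (2 * D)) ^ DIM('a) * r ^ DIM('a) = unit_ball_vol (real DIM('a)) * (t * \<rho>) ^ DIM('a)"
    by (simp add: t_def power_mult_distrib power_divide)
  also have "\<dots> = measure lborel (ball c (t * \<rho>))"
    using t \<rho> by (intro measure_ball_lborel[symmetric]) simp
  also have "\<dots> \<le> measure lborel (T \<inter> ball y r)"
    using closedT[OF T(1)] by (intro measure_mono_fmeasurable[OF sub] fmeasurableI emeasure_bounded_finite bounded_Int) auto
  finally show ?thesis .
qed

end

text \<open>An interior point makes the derivative within \<open>T\<close> unique, which determines
  the definite description.\<close>

lemma element_gradient_eq:
  fixes v :: "'a::euclidean_space \<Rightarrow> real"
  assumes int: "interior T \<noteq> {}" and v: "\<And>x. x \<in> T \<Longrightarrow> v x = g \<bullet> x + b"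
  shows "element_gradient v T = g"
proof -
  have d: "(v has_derivative (\<lambda>w. g \<bullet> w)) (at x within T)" if "x \<in> T" for x
  proof (rule has_derivative_transform[OF that])
    show "((\<lambda>x. g \<bullet> x + b) has_derivative (\<lambda>w. g \<bullet> w)) (at x within T)"
      by (auto intro!: derivative_eq_intros)
  qed (simp add: v)
  obtain p where p: "p \<in> interior T" using int by auto
  show ?thesis unfolding element_gradient_def
  proof (rule the_equality)
    fix g' assume "\<forall>x\<in>T. (v has_derivative (\<lambda>w. g' \<bullet> w)) (at x within T)"
    then have "(v has_derivative (\<lambda>w. g' \<bullet> w)) (at p)" "(v has_derivative (\<lambda>w. g \<bullet> w)) (at p)"
      using d p interior_subset at_within_interior[OF p] by (metis subsetD)+
    then have "(\<lambda>w. g' \<bullet> w) = (\<lambda>w. g \<bullet> w)" by (rule has_derivative_unique)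
    then have "g' \<bullet> w = g \<bullet> w" for w by (rule fun_cong)
    then show "g' = g" by (metis vector_eq_rdot)
  qed (use d in auto)
qed

section \<open>The closest point projection\<close>

lemma orth_proj_unique:
  assumes S: "subspace S" and y: "y \<in> S" "\<And>z. z \<in> S \<Longrightarrow> orthogonal (x - y) z"
  shows "orth_proj S x = y"
  unfolding orth_proj_def
proof (rule the_equality)
  fix y' assume y': "y' \<in> S \<and> (\<forall>z\<in>S. orthogonal (x - y') z)"
  have "y - y' \<in> S" using S y y' by (auto intro: subspace_diff)
  then have "(x - y') \<bullet> (y - y') = 0" "(x - y) \<bullet> (y - y') = 0" using y y' by (auto simp: orthogonal_def)
  then have "(y - y') \<bullet> (y - y') = 0" by (simp add: inner_diff_left)
  then show "y' = y" by simp
qed (use y in auto)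

lemma orth_proj:
  assumes S: "subspace (S :: 'a::euclidean_space set)"
  shows "orth_proj S x \<in> S" "z \<in> S \<Longrightarrow> (x - orth_proj S x) \<bullet> z = 0"
proof -
  obtain y z where yz: "y \<in> span S" "\<And>w. w \<in> span S \<Longrightarrow> orthogonal z w" "x = y + z"
    using orthogonal_subspace_decomp_exists[of S x] by blast
  have s: "span S = S" using S by (simp add: span_eq_iff)
  have "orth_proj S x = y" by (rule orth_proj_unique[OF S]) (use yz s in auto)
  then show "orth_proj S x \<in> S" "z \<in> S \<Longrightarrow> (x - orth_proj S x) \<bullet> z = 0" for z
    using yz s by (auto simp: orthogonal_def)
qed

lemma orth_proj_id: "subspace S \<Longrightarrow> x \<in> S \<Longrightarrow> orth_proj S x = x"
  by (rule orth_proj_unique) (auto simp: orthogonal_def)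

lemma orth_proj_idem: "subspace (S :: 'a::euclidean_space set) \<Longrightarrow> orth_proj S (orth_proj S x) = orth_proj S x"
  by (simp add: orth_proj orth_proj_id)

lemma orth_proj_linear: "subspace (S :: 'a::euclidean_space set) \<Longrightarrow> linear (orth_proj S)"
proof (rule linearI)
  assume S: "subspace S"
  show "orth_proj S (x + y) = orth_proj S x + orth_proj S y" for x y
  proof (rule orth_proj_unique[OF S])
    show "orth_proj S x + orth_proj S y \<in> S" using orth_proj(1)[OF S] S by (intro subspace_add)
    fix z assume "z \<in> S"
    then have "(x - orth_proj S x) \<bullet> z = 0" "(y - orth_proj S y) \<bullet> z = 0" using orth_proj(2)[OF S] by auto
    then show "orthogonal (x + y - (orth_proj S x + orth_proj S y)) z"
      by (simp add: orthogonal_def inner_diff_left inner_add_left)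
  qed
  show "orth_proj S (r *\<^sub>R x) = r *\<^sub>R orth_proj S x" for r x
  proof (rule orth_proj_unique[OF S])
    show "r *\<^sub>R orth_proj S x \<in> S" using orth_proj(1)[OF S] S by (intro subspace_scale)
    fix z assume "z \<in> S"
    then have "(x - orth_proj S x) \<bullet> z = 0" using orth_proj(2)[OF S] by auto
    then show "orthogonal (r *\<^sub>R x - r *\<^sub>R orth_proj S x) z"
      by (simp add: orthogonal_def flip: scaleR_diff_right)
  qed
qed

lemma orth_proj_sym:
  assumes S: "subspace (S :: 'a::euclidean_space set)"
  shows "orth_proj S x \<bullet> y = x \<bullet> orth_proj S y"
proof -
  have "(x - orth_proj S x) \<bullet> orth_proj S y = 0" "(y - orth_proj S y) \<bullet> orth_proj S x = 0"
    using orth_proj[OF S] by blast+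
  then show ?thesis by (metis eq_iff_diff_eq_0 inner_commute inner_diff_left)
qed

lemma proj_norm_sq:
  fixes P :: "'a::euclidean_space \<Rightarrow> 'a"
  assumes sym: "\<And>x y. P x \<bullet> y = x \<bullet> P y" and idem: "\<And>x. P (P x) = P x"
  shows "(norm x)\<^sup>2 = (norm (P x))\<^sup>2 + (norm (x - P x))\<^sup>2"
proof -
  have "P x \<bullet> (x - P x) = 0" using sym[of x x] sym[of x "P x"] idem[of x]
    by (simp add: inner_diff_right)
  then have "(norm (P x + (x - P x)))\<^sup>2 = (norm (P x))\<^sup>2 + (norm (x - P x))\<^sup>2"
    by (simp only: norm_add_Pythagorean orthogonal_def)
  then show ?thesis by simp
qed

lemma proj_norm_le:
  fixes P :: "'a::euclidean_space \<Rightarrow> 'a"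
  assumes sym: "\<And>x y. P x \<bullet> y = x \<bullet> P y" and idem: "\<And>x. P (P x) = P x"
  shows "norm (P x) \<le> norm x" "norm (x - P x) \<le> norm x"
  using proj_norm_sq[of P x, OF sym idem] by (auto intro!: power2_le_imp_le[OF _ norm_ge_zero])

section \<open>Tangent spaces from the derivative of the closest point projection\<close>

locale tubular =
  fixes \<Gamma> :: "'a::euclidean_space set" and \<delta> :: real
  assumes cpt: "compact \<Gamma>" and ne: "\<Gamma> \<noteq> {}" and tub: "tubular_radius \<Gamma> \<delta>"
begin

abbreviation p :: "'a \<Rightarrow> 'a" where "p \<equiv> closest_point \<Gamma>"

definition Dp :: "'a \<Rightarrow> 'a \<Rightarrow> 'a" where "Dp x = frechet_derivative p (at x)"

lemma \<delta>: "0 < \<delta>" using tub by (simp add: tubular_radius_def)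

lemma closed\<Gamma>: "closed \<Gamma>" using cpt by (rule compact_imp_closed)

lemma p_in: "p x \<in> \<Gamma>" using closed\<Gamma> ne by (rule closest_point_in_set)

lemma p_dist: "dist x (p x) = infdist x \<Gamma>"
proof (rule antisym)
  show "dist x (p x) \<le> infdist x \<Gamma>"
  proof -
    obtain y where y: "y \<in> \<Gamma>" "infdist x \<Gamma> = dist x y" using infdist_attains_inf[OF closed\<Gamma> ne] by blast
    show ?thesis unfolding y(2) by (rule closest_point_le[OF closed\<Gamma> y(1)])
  qed
qed (rule infdist_le[OF p_in])

lemma p_id: "q \<in> \<Gamma> \<Longrightarrow> p q = q" by (rule closest_point_self)

lemma p_le: "q \<in> \<Gamma> \<Longrightarrow> norm (x - p x) \<le> norm (x - q)"
  using closest_point_le[OF closed\<Gamma>, of q x] by (simp add: dist_norm)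

lemma smooth: "Ck_on n p (tube \<Gamma> \<delta>)"
  using tub by (simp add: tubular_radius_def smooth_on_def)

lemma p_deriv: "x \<in> tube \<Gamma> \<delta> \<Longrightarrow> (p has_derivative Dp x) (at x)"
  using smooth[of "Suc 0"] by (auto simp: Dp_def frechet_derivative_works)

lemma p_cont: "continuous_on (tube \<Gamma> \<delta>) p"
  using smooth[of 0] by simp

lemma Dp_linear: "x \<in> tube \<Gamma> \<delta> \<Longrightarrow> linear (Dp x)"
  using p_deriv has_derivative_linear by blast

lemma ball_tube: "q \<in> \<Gamma> \<Longrightarrow> ball q \<delta> \<subseteq> tube \<Gamma> \<delta>"
  by (auto simp: tube_def dist_commute intro: le_less_trans[OF infdist_le])

lemma \<Gamma>_tube: "q \<in> \<Gamma> \<Longrightarrow> q \<in> tube \<Gamma> \<delta>"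
  using ball_tube[of q] \<delta> centre_in_ball by blast

lemma p_line_deriv:
  assumes q: "q \<in> \<Gamma>"
  shows "((\<lambda>t. p (q + t *\<^sub>R w)) has_vector_derivative Dp q w) (at 0)"
proof -
  have "((\<lambda>t::real. q + t *\<^sub>R w) has_derivative (\<lambda>t. t *\<^sub>R w)) (at 0)"
    by (auto intro!: derivative_eq_intros)
  moreover have "(p has_derivative Dp q) (at (q + 0 *\<^sub>R w))" using p_deriv[OF \<Gamma>_tube[OF q]] by simp
  ultimately have "((\<lambda>t. p (q + t *\<^sub>R w)) has_derivative (\<lambda>t. Dp q (t *\<^sub>R w))) (at 0)"
    by (rule has_derivative_compose)
  then show ?thesis using Dp_linear[OF \<Gamma>_tube[OF q]] by (simp add: has_vector_derivative_def linear_scale)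
qed

lemma Dp_in_tangent:
  assumes q: "q \<in> \<Gamma>" shows "Dp q w \<in> tangent_space \<Gamma> q"
  unfolding tangent_space_def
proof (intro CollectI exI[of _ "\<lambda>t. p (q + t *\<^sub>R w)"] exI[of _ 1] conjI allI impI)
  show "p (q + 0 *\<^sub>R w) = q" using p_id[OF q] by simp
qed (use p_in p_line_deriv[OF q] in auto)

text \<open>Differentiate the identity between \<open>p\<close> applied to a curve on \<Gamma> and
  the curve itself.\<close>

lemma Dp_tangent_id:
  assumes q: "q \<in> \<Gamma>" and u: "u \<in> tangent_space \<Gamma> q" shows "Dp q u = u"
proof -
  obtain \<gamma> e where g: "0 < e" "\<gamma> 0 = q" "\<And>t. \<bar>t\<bar> < e \<Longrightarrow> \<gamma> t \<in> \<Gamma>" "(\<gamma> has_vector_derivative u) (at (0::real))"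
    using u unfolding tangent_space_def by blast
  have "(p has_derivative Dp q) (at (\<gamma> 0))" using p_deriv[OF \<Gamma>_tube[OF q]] g by simp
  from has_derivative_compose[OF g(4)[unfolded has_vector_derivative_def] this]
  have "((\<lambda>t. p (\<gamma> t)) has_vector_derivative Dp q u) (at 0)"
    using Dp_linear[OF \<Gamma>_tube[OF q]] by (simp add: has_vector_derivative_def linear_scale)
  moreover have "((\<lambda>t. p (\<gamma> t)) has_vector_derivative u) (at 0)"
  proof (rule has_vector_derivative_transform_within_open[OF g(4)])
    show "open (ball (0::real) e)" "0 \<in> ball (0::real) e" using g by auto
    show "\<gamma> t = p (\<gamma> t)" if "t \<in> ball 0 e" for t
      using p_id[OF g(3)[of t]] that by (simp add: dist_real_def)
  qed
  ultimately show ?thesis by (rule vector_derivative_unique_at)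
qed

lemma tangent_range: assumes q: "q \<in> \<Gamma>" shows "tangent_space \<Gamma> q = range (Dp q)"
  using Dp_in_tangent[OF q] Dp_tangent_id[OF q] by (metis image_iff rangeI subsetI subset_antisym image_subset_iff)

text \<open>Velocities of curves do not visibly add up; linearity comes from the description of the
  tangent space as the range of the linear map \<open>Dp q\<close>.\<close>

lemma tangent_subspace: assumes q: "q \<in> \<Gamma>" shows "subspace (tangent_space \<Gamma> q)"
  unfolding tangent_range[OF q] by (rule linear_subspace_image[OF Dp_linear[OF \<Gamma>_tube[OF q]] subspace_UNIV])

text \<open>The first-order form of the minimality of \<open>p x\<close>, applied at
  \<open>x = q + t *\<^sub>R w\<close> with competitor \<open>q\<close>.\<close>

lemma Dp_complement_norm:
  assumes q: "q \<in> \<Gamma>" shows "norm (w - Dp q w) \<le> norm w"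
proof (rule ccontr)
  assume neg: "\<not> norm (w - Dp q w) \<le> norm w"
  define e where "e = norm (w - Dp q w) - norm w"
  have e: "0 < e" using neg by (simp add: e_def)
  define f where "f t = q + t *\<^sub>R w - p (q + t *\<^sub>R w)" for t :: real
  have "((\<lambda>t::real. q + t *\<^sub>R w) has_vector_derivative w) (at 0)" by (auto intro!: derivative_eq_intros)
  then have "(f has_vector_derivative (w - Dp q w)) (at 0)"
    unfolding f_def by (rule has_vector_derivative_diff[OF _ p_line_deriv[OF q]])
  then have "(f has_derivative (\<lambda>h. h *\<^sub>R (w - Dp q w))) (at 0)" by (simp add: has_vector_derivative_def)
  then have "(\<lambda>h. norm (f (0 + h) - f 0 - h *\<^sub>R (w - Dp q w)) / norm h) \<midarrow>0\<rightarrow> 0"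
    unfolding has_derivative_at by blast
  then obtain s where s: "0 < s" "\<And>h. h \<noteq> 0 \<Longrightarrow> norm h < s \<Longrightarrow>
      norm (norm (f (0 + h) - f 0 - h *\<^sub>R (w - Dp q w)) / norm h) < e"
    using e unfolding LIM_def by (metis diff_zero dist_norm)
  define h where "h = s / 2"
  have h: "0 < h" "norm h < s" using s by (auto simp: h_def)
  have f0: "f 0 = 0" using p_id[OF q] by (simp add: f_def)
  have "norm (f h) \<le> h * norm w" using p_le[OF q, of "q + h *\<^sub>R w"] h by (simp add: f_def)
  moreover have "norm (f h - h *\<^sub>R (w - Dp q w)) < e * h"
    using s(2)[of h] h f0 by (simp add: field_simps)
  moreover have "norm (h *\<^sub>R (w - Dp q w)) \<le> norm (f h) + norm (f h - h *\<^sub>R (w - Dp q w))"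
    by (metis norm_triangle_sub norm_minus_commute)
  ultimately have "h * norm (w - Dp q w) < h * norm w + e * h" using h by simp
  then show False using h by (simp add: e_def algebra_simps)
qed

text \<open>\<open>Dp q\<close> is idempotent with range the tangent space, and \<open>I - Dp q\<close> is a contraction, so
  \<open>Dp q\<close> is the orthogonal projection.\<close>

lemma Dp_eq_orth_proj:
  assumes q: "q \<in> \<Gamma>" shows "orth_proj (tangent_space \<Gamma> q) = Dp q"
proof
  fix w
  note lin = Dp_linear[OF \<Gamma>_tube[OF q]]
  show "orth_proj (tangent_space \<Gamma> q) w = Dp q w"
  proof (rule orth_proj_unique[OF tangent_subspace[OF q] Dp_in_tangent[OF q]])
    fix u assume u: "u \<in> tangent_space \<Gamma> q"
    define n where "n = w - Dp q w"
    have Dn: "Dp q n = 0" using Dp_tangent_id[OF q Dp_in_tangent[OF q]] by (simp add: n_def linear_diff[OF lin])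
    \<comment> \<open>The map \<open>I - Dp q\<close> sends \<open>n + t *\<^sub>R u\<close> to
      \<open>n\<close>, and it does not increase norms. Minimality of the norm at
      \<open>t = 0\<close> for all \<open>t\<close> then forces \<open>n\<close> to be orthogonal to
      \<open>u\<close>.\<close>
    have le: "norm n \<le> norm (n + t *\<^sub>R u)" for t
      using Dp_complement_norm[OF q, of "n + t *\<^sub>R u"] Dp_tangent_id[OF q u] Dn
      by (simp add: linear_add[OF lin] linear_scale[OF lin])
    have "n \<bullet> u = 0"
    proof (cases "u = 0")
      case False
      define t where "t = - (n \<bullet> u) / (u \<bullet> u)"
      have uu: "0 < u \<bullet> u" using False by simp
      have "n \<bullet> n \<le> (n + t *\<^sub>R u) \<bullet> (n + t *\<^sub>R u)" using le[of t] by (simp add: norm_le)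
      also have "\<dots> = n \<bullet> n + 2 * t * (n \<bullet> u) + t * t * (u \<bullet> u)"
        by (simp add: inner_add_left inner_add_right inner_commute algebra_simps)
      also have "t * t * (u \<bullet> u) = - t * (n \<bullet> u)" using uu by (simp add: t_def)
      finally have "0 \<le> t * (n \<bullet> u)" by simp
      then have "(n \<bullet> u) * (n \<bullet> u) / (u \<bullet> u) \<le> 0" by (simp add: t_def)
      then have "(n \<bullet> u) * (n \<bullet> u) \<le> 0" using uu by (simp add: divide_le_0_iff)
      then show ?thesis by (metis mult_eq_0_iff order_antisym zero_le_square)
    qed simp
    then show "orthogonal (w - Dp q w) u" by (simp add: n_def orthogonal_def)
  qed
qed

abbreviation PG :: "'a \<Rightarrow> 'a \<Rightarrow> 'a" where "PG q \<equiv> orth_proj (tangent_space \<Gamma> q)"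

lemma PG:
  assumes q: "q \<in> \<Gamma>"
  shows "linear (PG q)" "PG q x \<bullet> y = x \<bullet> PG q y" "PG q (PG q x) = PG q x"
    "norm (PG q x) \<le> norm x" "norm (x - PG q x) \<le> norm x"
  using orth_proj_linear orth_proj_sym orth_proj_idem tangent_subspace[OF q]
    proj_norm_le[of "PG q", OF orth_proj_sym[OF tangent_subspace[OF q]] orth_proj_idem[OF tangent_subspace[OF q]]]
  by blast+

lemma tube_half_compact: "compact {x. infdist x \<Gamma> \<le> \<delta> / 2}"
proof (unfold compact_eq_bounded_closed, intro conjI)
  show "closed {x. infdist x \<Gamma> \<le> \<delta> / 2}" by (intro closed_Collect_le continuous_intros)
  obtain B where B: "\<And>x. x \<in> \<Gamma> \<Longrightarrow> norm x \<le> B" using compact_imp_bounded[OF cpt] by (auto simp: bounded_iff)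
  show "bounded {x. infdist x \<Gamma> \<le> \<delta> / 2}"
  proof (rule boundedI)
    fix x assume "x \<in> {x. infdist x \<Gamma> \<le> \<delta> / 2}"
    then have "norm (x - p x) \<le> \<delta> / 2" using p_dist[of x] by (simp add: dist_norm)
    then show "norm x \<le> B + \<delta> / 2" using B[OF p_in[of x]] norm_triangle_sub[of x "p x"] by linarith
  qed
qed

lemma tube_half_subset: "{x. infdist x \<Gamma> \<le> \<delta> / 2} \<subseteq> tube \<Gamma> \<delta>"
  using \<delta> by (auto simp: tube_def)

lemma cball_half: "q \<in> \<Gamma> \<Longrightarrow> cball q (\<delta> / 2) \<subseteq> {x. infdist x \<Gamma> \<le> \<delta> / 2}"
proof
  fix x assume "q \<in> \<Gamma>" "x \<in> cball q (\<delta> / 2)"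
  then show "x \<in> {x. infdist x \<Gamma> \<le> \<delta> / 2}" using infdist_le[of q \<Gamma> x] by (simp add: dist_commute)
qed

text \<open>The second derivatives of \<open>p\<close> are continuous, hence bounded on the compact
  tube of half width, and balls are convex. \<open>Ck_on\<close> gives continuity one direction at a
  time, so the bound is assembled from pairs of basis vectors.\<close>

lemma Dp_lipschitz:
  obtains A where "0 \<le> A"
    "\<And>q x x' w. q \<in> \<Gamma> \<Longrightarrow> x \<in> cball q (\<delta> / 2) \<Longrightarrow> x' \<in> cball q (\<delta> / 2) \<Longrightarrow>
      norm (Dp x w - Dp x' w) \<le> A * norm (x - x') * norm w"
proof -
  let ?K = "{x. infdist x \<Gamma> \<le> \<delta> / 2}"
  define D2 where "D2 w x = frechet_derivative (\<lambda>x. Dp x w) (at x)" for w x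
  have c2: "Ck_on (Suc 0) (\<lambda>x. Dp x w) (tube \<Gamma> \<delta>)" for w
    using smooth[of "Suc (Suc 0)"] by (simp add: Dp_def[abs_def])
  have D2: "((\<lambda>x. Dp x w) has_derivative D2 w x) (at x)" if "x \<in> tube \<Gamma> \<delta>" for w x
    using c2[of w] that by (auto simp: D2_def frechet_derivative_works)
  have D2c: "continuous_on ?K (\<lambda>x. D2 w x w')" for w w'
    unfolding D2_def by (rule continuous_on_subset[OF _ tube_half_subset]) (use c2[of w] in simp)
  have "\<exists>B. \<forall>x\<in>?K. norm (D2 b x b') \<le> B" for b b'
    using compact_imp_bounded[OF compact_continuous_image[OF D2c tube_half_compact, of b b']]
    by (auto simp: bounded_iff)
  then obtain B where B: "\<And>b b' x. x \<in> ?K \<Longrightarrow> norm (D2 b x b') \<le> B b b'" by metis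
  define A where "A = (\<Sum>b\<in>Basis. \<Sum>b'\<in>Basis. \<bar>B b b'\<bar>)"
  have A0: "0 \<le> A" unfolding A_def by (intro sum_nonneg) auto
  have lin_bound: "norm (L w) \<le> (\<Sum>b\<in>Basis. norm (L b)) * norm w" if "linear L" for L :: "'a \<Rightarrow> 'a" and w
  proof -
    have "norm (L w) = norm (\<Sum>b\<in>Basis. (w \<bullet> b) *\<^sub>R L b)"
      using linear_sum[OF that] linear_scale[OF that] by (metis (mono_tags, lifting) euclidean_representation sum.cong)
    also have "\<dots> \<le> (\<Sum>b\<in>Basis. norm ((w \<bullet> b) *\<^sub>R L b))" by (rule norm_sum)
    also have "\<dots> \<le> (\<Sum>b\<in>Basis. norm w * norm (L b))"
      by (intro sum_mono) (auto intro!: mult_right_mono Basis_le_norm)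
    finally show ?thesis by (simp add: sum_distrib_left mult.commute)
  qed
  show ?thesis
  proof (rule that[OF A0])
    fix q x x' w assume q: "q \<in> \<Gamma>" and x: "x \<in> cball q (\<delta> / 2)" "x' \<in> cball q (\<delta> / 2)"
    have sub: "cball q (\<delta> / 2) \<subseteq> ?K" by (rule cball_half[OF q])
    have each: "norm (Dp x b - Dp x' b) \<le> (\<Sum>b'\<in>Basis. \<bar>B b b'\<bar>) * norm (x - x')" for b
    proof (rule differentiable_bound[OF convex_cball _ _ x])
      fix y assume y: "y \<in> cball q (\<delta> / 2)"
      have yt: "y \<in> tube \<Gamma> \<delta>" using y sub tube_half_subset by blast
      show d: "((\<lambda>x. Dp x b) has_derivative D2 b y) (at y within cball q (\<delta> / 2))"
        using D2[OF yt] by (rule has_derivative_at_withinI)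
      show "onorm (D2 b y) \<le> (\<Sum>b'\<in>Basis. \<bar>B b b'\<bar>)"
      proof (rule onorm_le)
        fix w'
        have "norm (D2 b y w') \<le> (\<Sum>b'\<in>Basis. norm (D2 b y b')) * norm w'"
          using has_derivative_linear[OF D2[OF yt]] by (rule lin_bound)
        also have "\<dots> \<le> (\<Sum>b'\<in>Basis. \<bar>B b b'\<bar>) * norm w'"
          using B[OF subsetD[OF sub y]] by (intro mult_right_mono sum_mono) (auto intro: order_trans[OF _ abs_ge_self])
        finally show "norm (D2 b y w') \<le> (\<Sum>b'\<in>Basis. \<bar>B b b'\<bar>) * norm w'" .
      qed
    qed
    have xt: "x \<in> tube \<Gamma> \<delta>" "x' \<in> tube \<Gamma> \<delta>" using x sub tube_half_subset by auto
    have "linear (\<lambda>w. Dp x w - Dp x' w)" using Dp_linear xt by (intro linear_compose_sub)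
    then have "norm (Dp x w - Dp x' w) \<le> (\<Sum>b\<in>Basis. norm (Dp x b - Dp x' b)) * norm w" by (rule lin_bound)
    also have "\<dots> \<le> (\<Sum>b\<in>Basis. (\<Sum>b'\<in>Basis. \<bar>B b b'\<bar>) * norm (x - x')) * norm w"
      by (intro mult_right_mono sum_mono each) auto
    also have "\<dots> = A * norm (x - x') * norm w" by (simp add: A_def sum_distrib_right)
    finally show "norm (Dp x w - Dp x' w) \<le> A * norm (x - x') * norm w" .
  qed
qed

text \<open>Two quantitative forms of the smoothness of \<Gamma>, with one constant: tangent planes
  turn at a bounded rate, and in a ball of radius \<open>r\<close> about \<open>q\<close> the map
  \<open>p\<close> differs from the projection \<open>PG q\<close> by a map of slope
  \<open>O(r)\<close>.\<close>

lemma projection_estimates: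
  obtains A where "0 < A"
    "\<And>q q' w. q \<in> \<Gamma> \<Longrightarrow> q' \<in> \<Gamma> \<Longrightarrow> norm (q - q') \<le> \<delta> / 2 \<Longrightarrow> norm (PG q w - PG q' w) \<le> A * norm (q - q') * norm w"
    "\<And>q r x x'. q \<in> \<Gamma> \<Longrightarrow> r \<le> \<delta> / 2 \<Longrightarrow> norm (x - q) \<le> r \<Longrightarrow> norm (x' - q) \<le> r \<Longrightarrow>
      norm (p x - p x' - PG q (x - x')) \<le> A * r * norm (x - x')"
proof -
  obtain A0 where A0: "0 \<le> A0"
    "\<And>q x x' w. q \<in> \<Gamma> \<Longrightarrow> x \<in> cball q (\<delta> / 2) \<Longrightarrow> x' \<in> cball q (\<delta> / 2) \<Longrightarrow>
      norm (Dp x w - Dp x' w) \<le> A0 * norm (x - x') * norm w"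
    using Dp_lipschitz by blast
  \<comment> \<open>Raised by 1 to be positive, since \<open>A\<close> later stands in the
    denominator of the chart radius.\<close>
  define A where "A = A0 + 1"
  have A: "0 < A" "\<And>q x x' w. q \<in> \<Gamma> \<Longrightarrow> x \<in> cball q (\<delta> / 2) \<Longrightarrow> x' \<in> cball q (\<delta> / 2) \<Longrightarrow>
      norm (Dp x w - Dp x' w) \<le> A * norm (x - x') * norm w"
    using A0(1) by (auto simp: A_def algebra_simps intro!: order_trans[OF A0(2)] add_nonneg_nonneg)
  show ?thesis
  proof (rule that[OF A(1)])
    fix q q' w assume q: "q \<in> \<Gamma>" "q' \<in> \<Gamma>" "norm (q - q') \<le> \<delta> / 2"
    then show "norm (PG q w - PG q' w) \<le> A * norm (q - q') * norm w"
      using A(2)[OF q(1), of q q' w] \<delta> by (simp add: Dp_eq_orth_proj dist_norm)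
  next
    fix q r x x' assume q: "q \<in> \<Gamma>" and r: "r \<le> \<delta> / 2" and x: "norm (x - q) \<le> r" "norm (x' - q) \<le> r"
    have sub: "cball q r \<subseteq> cball q (\<delta> / 2)" using r by auto
    have "norm ((p x - Dp q x) - (p x' - Dp q x')) \<le> A * r * norm (x - x')"
    proof (rule differentiable_bound[OF convex_cball, of q r])
      fix y assume y: "y \<in> cball q r"
      have yt: "y \<in> tube \<Gamma> \<delta>" using y sub cball_half[OF q] tube_half_subset by blast
      have bl: "bounded_linear (Dp q)" using Dp_linear[OF \<Gamma>_tube[OF q]] by (simp add: linear_conv_bounded_linear)
      have "((\<lambda>x. p x - Dp q x) has_derivative (\<lambda>w. Dp y w - Dp q w)) (at y)"
        by (rule has_derivative_diff[OF p_deriv[OF yt] bounded_linear_imp_has_derivative[OF bl]])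
      then show "((\<lambda>x. p x - Dp q x) has_derivative (\<lambda>w. Dp y w - Dp q w)) (at y within cball q r)"
        by (rule has_derivative_at_withinI)
      show "onorm (\<lambda>w. Dp y w - Dp q w) \<le> A * r"
      proof (rule onorm_le)
        fix w
        have "norm (Dp y w - Dp q w) \<le> A * norm (y - q) * norm w"
          using A(2)[OF q, of y q w] y sub \<delta> by auto
        also have "\<dots> \<le> A * r * norm w"
          using y A(1) by (intro mult_right_mono mult_left_mono) (auto simp: dist_norm norm_minus_commute)
        finally show "norm (Dp y w - Dp q w) \<le> A * r * norm w" .
      qed
    qed (use x in \<open>auto simp: dist_norm norm_minus_commute\<close>)
    then show "norm (p x - p x' - PG q (x - x')) \<le> A * r * norm (x - x')"
      by (simp add: Dp_eq_orth_proj[OF q] linear_diff[OF Dp_linear[OF \<Gamma>_tube[OF q]]] algebra_simps)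
  qed
qed

end

section \<open>The discrete manifold as a graph\<close>

lemma parallel_space_eq:
  fixes K :: "'a::euclidean_space set"
  assumes a: "a \<in> affine hull K" shows "parallel_space K = (\<lambda>x. x - a) ` (affine hull K)"
proof (intro set_eqI iffI)
  fix w assume "w \<in> parallel_space K"
  then obtain x y where xy: "w = x - y" "x \<in> affine hull K" "y \<in> affine hull K" by (auto simp: parallel_space_def)
  have "1 *\<^sub>R x + (-1) *\<^sub>R y + 1 *\<^sub>R a \<in> affine hull K"
    by (rule mem_affine_3[OF affine_affine_hull]) (use xy a in auto)
  then show "w \<in> (\<lambda>x. x - a) ` (affine hull K)" unfolding xy(1) by (auto intro!: image_eqI[of _ _ "x - y + a"])
qed (use a in \<open>auto simp: parallel_space_def\<close>)

lemma subspace_parallel_space: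
  fixes K :: "'a::euclidean_space set"
  assumes "K \<noteq> {}" shows "subspace (parallel_space K)"
proof -
  obtain a where a: "a \<in> affine hull K" using assms hull_inc by fastforce
  show ?thesis
    unfolding parallel_space_eq[OF a] by (rule affine_diffs_subspace_subtract[OF affine_affine_hull a])
qed

text \<open>\<open>R0\<close> is a chart radius independent of the mesh; \<open>\<epsilon>\<close>,
  later a multiple of \<open>h\<close>, bounds the distance to \<Gamma>, the cell diameters and the
  tilt of the cells. Surface points within \<open>6 * R0\<close> of \<open>q0\<close> have their
  feet within \<open>7 * R0\<close>; \<open>112 = 7 * 16\<close> then bounds the curvature effect by
  \<open>1 / 16\<close>, and \<open>28 * R0 \<le> \<delta>\<close> keeps two feet within
  \<open>\<delta> / 2\<close> of each other. The condition with the factor 32 makes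
  \<open>B2 * \<epsilon>\<close> at most \<open>1 / 16\<close>.\<close>

locale surface = tubular \<Gamma> \<delta> for \<Gamma> :: "'a::euclidean_space set" and \<delta> +
  fixes A \<epsilon> R0 :: real and \<K> :: "'a set set"
  assumes A: "0 < A"
    and PG_lip: "\<And>q q' w. q \<in> \<Gamma> \<Longrightarrow> q' \<in> \<Gamma> \<Longrightarrow> norm (q - q') \<le> \<delta> / 2 \<Longrightarrow> norm (PG q w - PG q' w) \<le> A * norm (q - q') * norm w"
    and p_est: "\<And>q r x x'. q \<in> \<Gamma> \<Longrightarrow> r \<le> \<delta> / 2 \<Longrightarrow> norm (x - q) \<le> r \<Longrightarrow> norm (x' - q) \<le> r \<Longrightarrow>
      norm (p x - p x' - PG q (x - x')) \<le> A * r * norm (x - x')"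
    and finK: "finite \<K>" and compactK: "\<And>K. K \<in> \<K> \<Longrightarrow> compact K" and convexK: "\<And>K. K \<in> \<K> \<Longrightarrow> convex K"
    and neK: "\<And>K. K \<in> \<K> \<Longrightarrow> K \<noteq> {}"
    and near: "\<And>y. y \<in> \<Union>\<K> \<Longrightarrow> norm (y - p y) \<le> \<epsilon>"
    and diamK: "\<And>K x y. K \<in> \<K> \<Longrightarrow> x \<in> K \<Longrightarrow> y \<in> K \<Longrightarrow> norm (x - y) \<le> \<epsilon>"
    and projK: "\<And>K y w. K \<in> \<K> \<Longrightarrow> y \<in> K \<Longrightarrow> norm (PG (p y) w - orth_proj (parallel_space K) w) \<le> \<epsilon> * norm w"
    and bij: "bij_betw p (\<Union>\<K>) \<Gamma>"
    and R0: "0 < R0" "112 * A * R0 \<le> 1" "28 * R0 \<le> \<delta>"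
    and \<epsilon>: "0 < \<epsilon>" "32 * (2 * A + 1) * (A * \<delta> + 1) * \<epsilon> \<le> 1" "4 * \<epsilon> \<le> R0"
begin

abbreviation \<Gamma>h :: "'a set" where "\<Gamma>h \<equiv> \<Union>\<K>"

definition \<eta> :: "'a \<Rightarrow> 'a" where "\<eta> = inv_into \<Gamma>h p"

lemma \<eta>: "q \<in> \<Gamma> \<Longrightarrow> \<eta> q \<in> \<Gamma>h" "q \<in> \<Gamma> \<Longrightarrow> p (\<eta> q) = q" "y \<in> \<Gamma>h \<Longrightarrow> \<eta> (p y) = y"
proof -
  have im: "p ` \<Gamma>h = \<Gamma>" and inj: "inj_on p \<Gamma>h" using bij by (auto simp: bij_betw_def)
  show "q \<in> \<Gamma> \<Longrightarrow> \<eta> q \<in> \<Gamma>h" unfolding \<eta>_def by (rule inv_into_into) (simp only: im)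
  show "q \<in> \<Gamma> \<Longrightarrow> p (\<eta> q) = q" unfolding \<eta>_def by (rule f_inv_into_f) (simp only: im)
  show "y \<in> \<Gamma>h \<Longrightarrow> \<eta> (p y) = y" unfolding \<eta>_def by (rule inv_into_f_f[OF inj])
qed

lemma \<eta>_near: "q \<in> \<Gamma> \<Longrightarrow> norm (\<eta> q - q) \<le> \<epsilon>"
  using near[OF \<eta>(1)] \<eta>(2) by metis

lemma compact_\<Gamma>h: "compact \<Gamma>h" using finK compactK by (rule compact_Union)

lemma \<Gamma>h_tube: "\<Gamma>h \<subseteq> tube \<Gamma> \<delta>"
proof
  fix y assume "y \<in> \<Gamma>h"
  then have "infdist y \<Gamma> \<le> \<epsilon>" using near[of y] p_dist[of y] by (simp add: dist_norm)
  then show "y \<in> tube \<Gamma> \<delta>" using \<epsilon> R0 by (simp add: tube_def)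
qed

lemma \<eta>_cont: "continuous_on \<Gamma> \<eta>"
proof -
  have "continuous_on (p ` \<Gamma>h) \<eta>"
    by (rule continuous_on_inv[OF continuous_on_subset[OF p_cont \<Gamma>h_tube] compact_\<Gamma>h]) (simp add: \<eta>)
  then show ?thesis using bij by (simp add: bij_betw_def)
qed

lemma parallel_mem: "K \<in> \<K> \<Longrightarrow> x \<in> K \<Longrightarrow> y \<in> K \<Longrightarrow> x - y \<in> parallel_space K"
  unfolding parallel_space_def by (auto intro: hull_inc)

abbreviation B1 :: real where "B1 \<equiv> 2 * A + 1"
abbreviation B2 :: real where "B2 \<equiv> 2 * B1 * (A * \<delta> + 1)"

lemma B2\<epsilon>: "B2 * \<epsilon> \<le> 1 / 16" using \<epsilon>(2) by (simp add: algebra_simps)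

lemma B1\<epsilon>: "B1 * \<epsilon> \<le> 1 / 16"
proof -
  have "B1 * 1 * \<epsilon> \<le> B1 * (A * \<delta> + 1) * \<epsilon>" using A \<delta> \<epsilon>(1) by (intro mult_right_mono mult_left_mono) auto
  moreover have "0 \<le> B1 * (A * \<delta> + 1) * \<epsilon>" using A \<delta> \<epsilon>(1) by simp
  ultimately show ?thesis using B2\<epsilon> by linarith
qed

text \<open>A difference of two points of a cell is parallel to the cell, so the tangential
  projection changes it by a factor \<open>\<epsilon>\<close> only, and \<open>p\<close> is close to
  that projection.\<close>

lemma cell_est:
  assumes K: "K \<in> \<K>" "y \<in> K" "y' \<in> K"
  shows "norm (p y - p y' - (y - y')) \<le> B1 * \<epsilon> * norm (y - y')"
proof -
  have sub: "subspace (parallel_space K)" using neK[OF K(1)] by (rule subspace_parallel_space)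
  have 1: "norm (y - p y) \<le> \<epsilon>" using near K by auto
  have 2: "norm (y' - p y) \<le> 2 * \<epsilon>"
    using 1 diamK[OF K(1,3,2)] norm_triangle_ineq[of "y' - y" "y - p y"] by simp
  have "norm (p y - p y' - PG (p y) (y - y')) \<le> A * (2 * \<epsilon>) * norm (y - y')"
    by (rule p_est[OF p_in]) (use 1 2 \<epsilon> R0 in auto)
  moreover have "norm (PG (p y) (y - y') - (y - y')) \<le> \<epsilon> * norm (y - y')"
    using projK[OF K(1,2), of "y - y'"] orth_proj_id[OF sub parallel_mem[OF K]] by simp
  moreover have "norm (p y - p y' - (y - y')) \<le> norm (p y - p y' - PG (p y) (y - y')) + norm (PG (p y) (y - y') - (y - y'))"
    using dist_triangle[of "p y - p y'" "y - y'" "PG (p y) (y - y')"] by (simp only: dist_norm)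
  ultimately have "norm (p y - p y' - (y - y')) \<le> A * (2 * \<epsilon>) * norm (y - y') + \<epsilon> * norm (y - y')" by linarith
  then show ?thesis by (simp add: algebra_simps)
qed

text \<open>The displacement of the discrete manifold from \<Gamma> has slope
  \<open>O(\<epsilon>)\<close>. The bound is known over single cells; along a curve on \<Gamma> the
  preimages of the cells form a finite closed cover, so it passes to the whole curve regardless of
  the number and shape of the cells.\<close>

lemma \<eta>_lip:
  assumes q: "q \<in> \<Gamma>" "q' \<in> \<Gamma>" and close: "norm (q' - q) \<le> \<delta> / 2"
  shows "norm ((\<eta> q' - q') - (\<eta> q - q)) \<le> B2 * \<epsilon> * norm (q' - q)"
proof -
  \<comment> \<open>The straight segment projected to \<Gamma>: a curve from \<open>q\<close> to
    \<open>q'\<close> of speed at most \<open>(A * \<delta> + 1) * r\<close>.\<close>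
  define c where "c t = p (q + t *\<^sub>R (q' - q))" for t :: real
  have cG: "c t \<in> \<Gamma>" for t unfolding c_def by (rule p_in)
  have c01: "c 0 = q" "c 1 = q'" using q p_id by (auto simp: c_def)
  define r where "r = norm (q' - q)"
  have rad: "norm (q + t *\<^sub>R (q' - q) - q) \<le> r" if "t \<in> {0..1}" for t
    using that mult_right_mono[of t 1 "norm (q' - q)"] by (simp add: r_def)
  have c_lip: "norm (c s - c t) \<le> (A * \<delta> + 1) * (r * \<bar>s - t\<bar>)" if st: "s \<in> {0..1}" "t \<in> {0..1}" for s t
  proof -
    let ?w = "q + s *\<^sub>R (q' - q) - (q + t *\<^sub>R (q' - q))"
    have w: "norm ?w = r * \<bar>s - t\<bar>" by (simp add: r_def mult.commute flip: scaleR_diff_left)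
    have 1: "norm (c s - c t - PG q ?w) \<le> A * r * norm ?w"
      unfolding c_def by (rule p_est[OF q(1) _ rad[OF st(1)] rad[OF st(2)]]) (use close r_def in simp)
    have "A * r * norm ?w \<le> A * \<delta> * norm ?w"
      using A close \<delta> by (intro mult_right_mono mult_left_mono) (auto simp: r_def)
    moreover have "norm (PG q ?w) \<le> norm ?w" by (rule PG(4)[OF q(1)])
    moreover have "norm (c s - c t) \<le> norm (c s - c t - PG q ?w) + norm (PG q ?w)"
      using norm_triangle_ineq[of "c s - c t - PG q ?w" "PG q ?w"] by simp
    ultimately show ?thesis using 1 w by (simp add: algebra_simps)
  qed
  define f where "f t = \<eta> (c t) - c t" for t
  have ball: "q + t *\<^sub>R (q' - q) \<in> tube \<Gamma> \<delta>" if "t \<in> {0..1}" for t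
    using rad[OF that] close \<delta> ball_tube[OF q(1)] by (auto simp: r_def dist_norm norm_minus_commute)
  have c_cont: "continuous_on {0..1} c"
    unfolding c_def by (rule continuous_on_compose2[OF p_cont]) (use ball in \<open>auto intro!: continuous_intros\<close>)
  have \<eta>c: "continuous_on {0..1} (\<lambda>t. \<eta> (c t))"
    by (rule continuous_on_compose2[OF \<eta>_cont c_cont]) (use cG in auto)
  define M where "M = B2 * \<epsilon> * r"
  have "M-lipschitz_on {0..1} f"
  proof (rule lipschitz_on_closed_Union[where U="\<lambda>K. {0..1} \<inter> (\<lambda>t. \<eta> (c t)) -` K" and I=\<K>])
    show "closed ({0..1} \<inter> (\<lambda>t. \<eta> (c t)) -` K)" if "K \<in> \<K>" for K
      using \<eta>c compact_imp_closed[OF compactK[OF that]] by (intro continuous_closed_preimage) auto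
    show "{0..1} \<subseteq> (\<Union>K\<in>\<K>. {0..1} \<inter> (\<lambda>t. \<eta> (c t)) -` K)" using \<eta>(1)[OF cG] by blast
    show "M \<ge> 0" using A \<delta> \<epsilon> by (simp add: M_def r_def)
    fix K assume K: "K \<in> \<K>"
    show "M-lipschitz_on ({0..1} \<inter> (\<lambda>t. \<eta> (c t)) -` K) f"
    proof (rule lipschitz_onI)
      fix s t assume st: "s \<in> {0..1} \<inter> (\<lambda>t. \<eta> (c t)) -` K" "t \<in> {0..1} \<inter> (\<lambda>t. \<eta> (c t)) -` K"
      let ?y = "\<eta> (c s)" and ?y' = "\<eta> (c t)"
      have pe: "norm (c s - c t - (?y - ?y')) \<le> B1 * \<epsilon> * norm (?y - ?y')"
        using cell_est[OF K, of ?y ?y'] st \<eta>(2)[OF cG] by simp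
      have "norm (?y - ?y') \<le> norm (c s - c t) + norm (c s - c t - (?y - ?y'))"
        using norm_triangle_ineq4[of "c s - c t" "c s - c t - (?y - ?y')"] by simp
      moreover have "B1 * \<epsilon> * norm (?y - ?y') \<le> 1 / 16 * norm (?y - ?y')" using B1\<epsilon> by (intro mult_right_mono) auto
      ultimately have "norm (?y - ?y') \<le> 2 * norm (c s - c t)" using pe norm_ge_zero[of "c s - c t"] by linarith
      then have "B1 * \<epsilon> * norm (?y - ?y') \<le> B1 * \<epsilon> * (2 * ((A * \<delta> + 1) * (r * \<bar>s - t\<bar>)))"
        using c_lip[of s t] st A \<epsilon> by (intro mult_left_mono) auto
      also have "\<dots> = M * dist s t" by (simp add: M_def dist_real_def)
      finally have "norm (c s - c t - (?y - ?y')) \<le> M * dist s t" using pe by linarith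
      moreover have "dist (f s) (f t) = norm (c s - c t - (?y - ?y'))"
        unfolding f_def dist_norm using norm_minus_commute[of "c s - c t" "?y - ?y'"] by (simp add: algebra_simps)
      ultimately show "dist (f s) (f t) \<le> M * dist s t" by simp
    qed fact
  qed (use finK in auto)
  then have "dist (f 1) (f 0) \<le> M * dist 1 (0::real)" by (rule lipschitz_onD) auto
  then show ?thesis by (simp add: f_def c01 M_def r_def dist_norm)
qed

text \<open>The graph condition. The displacement and the curvature of \<Gamma> contribute
  \<open>1 / 16\<close> each, relative to the feet, whose distance is at most twice that of the
  surface points.\<close>

lemma vertical_lip:
  assumes q0: "q0 \<in> \<Gamma>" and y: "y \<in> \<Gamma>h" "y' \<in> \<Gamma>h" "norm (y - q0) \<le> 6 * R0" "norm (y' - q0) \<le> 6 * R0"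
  shows "norm ((y - y') - PG q0 (y - y')) \<le> 1 / 4 * norm (y - y')"
proof -
  define q where "q = p y" define q' where "q' = p y'"
  have q: "q \<in> \<Gamma>" "q' \<in> \<Gamma>" by (auto simp: q_def q'_def p_in)
  have "norm (y - q) \<le> \<epsilon>" "norm (y' - q') \<le> \<epsilon>" using near y by (auto simp: q_def q'_def)
  then have rad: "norm (q - q0) \<le> 7 * R0" "norm (q' - q0) \<le> 7 * R0"
    using norm_triangle_ineq4[of "y - q0" "y - q"] norm_triangle_ineq4[of "y' - q0" "y' - q'"] y \<epsilon> by auto
  have qq: "norm (q - q') \<le> \<delta> / 2"
    using norm_triangle_ineq4[of "q - q0" "q' - q0"] rad R0 by simp
  have 1: "norm ((y - y') - (q - q')) \<le> B2 * \<epsilon> * norm (q - q')"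
  proof -
    have eq: "(y - y') - (q - q') = (\<eta> q - q) - (\<eta> q' - q')" using \<eta>(3) y by (simp add: q_def q'_def)
    show ?thesis unfolding eq by (rule \<eta>_lip[OF q(2,1) qq])
  qed
  have 2: "norm ((q - q') - PG q0 (q - q')) \<le> 1 / 16 * norm (q - q')"
  proof -
    have "norm (p q - p q' - PG q0 (q - q')) \<le> A * (7 * R0) * norm (q - q')"
      by (rule p_est[OF q0 _ rad]) (use R0 in auto)
    also have "\<dots> \<le> 1 / 16 * norm (q - q')" using R0 by (intro mult_right_mono) auto
    finally show ?thesis using p_id q by simp
  qed
  have 3: "B2 * \<epsilon> * norm (q - q') \<le> 1 / 16 * norm (q - q')" using B2\<epsilon> by (intro mult_right_mono) auto
  have 4: "norm (q - q') \<le> 2 * norm (y - y')"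
  proof -
    have "norm (q - q') \<le> norm (y - y') + norm ((y - y') - (q - q'))"
      using norm_triangle_ineq4[of "y - y'" "(y - y') - (q - q')"] by simp
    then show ?thesis using 1 3 norm_ge_zero[of "y - y'"] by linarith
  qed
  let ?w = "(y - y') - (q - q')"
  have "norm (?w - PG q0 ?w) \<le> norm ?w" by (rule PG(5)[OF q0])
  moreover have "(y - y') - PG q0 (y - y') = (?w - PG q0 ?w) + ((q - q') - PG q0 (q - q'))"
    by (simp add: linear_diff[OF PG(1)[OF q0]])
  then have "norm ((y - y') - PG q0 (y - y')) \<le> norm (?w - PG q0 ?w) + norm ((q - q') - PG q0 (q - q'))"
    by (simp only: norm_triangle_ineq)
  ultimately show ?thesis using 1 2 3 4 by linarith
qed

lemma horizontal_lower:
  assumes q0: "q0 \<in> \<Gamma>" and y: "y \<in> \<Gamma>h" "y' \<in> \<Gamma>h" "norm (y - q0) \<le> 6 * R0" "norm (y' - q0) \<le> 6 * R0"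
  shows "norm (y - y') \<le> 2 * norm (PG q0 (y - y'))"
  using vertical_lip[OF assms] norm_triangle_ineq[of "PG q0 (y - y')" "(y - y') - PG q0 (y - y')"]
    norm_ge_zero[of "PG q0 (y - y')"] unfolding add.commute[of "PG q0 (y - y')"] diff_add_cancel by linarith

text \<open>A surface point over \<open>x\<close> is found by Banach's fixed point theorem on
  tangential vectors. Lifting \<open>q0 + s\<close> to the surface and projecting back to the
  tangent space is a perturbation of the identity in \<open>s\<close>, of slope at most
  \<open>2 / 16\<close> from the displacement plus \<open>1 / 16\<close> from the curvature.\<close>

lemma graph_exists:
  assumes q0: "q0 \<in> \<Gamma>" and x: "norm (x - q0) < R0"
  shows "\<exists>y\<in>\<Gamma>h. norm (y - q0) \<le> 6 * R0 \<and> PG q0 y = PG q0 x"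
proof -
  note P = PG[OF q0]
  let ?P = "PG q0"
  define X where "X = {s. ?P s = s} \<inter> cball 0 (2 * R0)"
  define t where "t = ?P (x - q0)"
  have tR: "norm t \<le> R0" using P(4)[of "x - q0"] x by (simp add: t_def)
  \<comment> \<open>A fixed point says that the tangential coordinate of the lifted point is exactly
    \<open>t\<close>, the one of \<open>x\<close>.\<close>
  define F where "F s = t - (?P (\<eta> (p (q0 + s)) - q0) - s)" for s
  have Pid: "?P (s - s') = s - s'" if "s \<in> X" "s' \<in> X" for s s'
    using that by (simp add: X_def linear_diff[OF P(1)])
  have pe: "norm (p (q0 + s) - p (q0 + s') - (s - s')) \<le> 1 / 16 * norm (s - s')" if "s \<in> X" "s' \<in> X" for s s'
  proof -
    have "norm (p (q0 + s) - p (q0 + s') - ?P ((q0 + s) - (q0 + s'))) \<le> A * (2 * R0) * norm ((q0 + s) - (q0 + s'))"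
      by (rule p_est[OF q0]) (use that R0 in \<open>auto simp: X_def\<close>)
    also have "\<dots> = A * (2 * R0) * norm (s - s')" by simp
    also have "\<dots> \<le> 1 / 16 * norm (s - s')"
    proof (rule mult_right_mono)
      have "0 \<le> A * R0" using A R0 by simp
      then show "A * (2 * R0) \<le> 1 / 16" using R0(2) by linarith
    qed simp
    finally show ?thesis using Pid[OF that] by simp
  qed
  have contr: "norm (F s - F s') \<le> 1 / 4 * norm (s - s')" if ss: "s \<in> X" "s' \<in> X" for s s'
  proof -
    define c where "c = p (q0 + s)" define c' where "c' = p (q0 + s')"
    have c: "c \<in> \<Gamma>" "c' \<in> \<Gamma>" by (auto simp: c_def c'_def p_in)
    have pe': "norm (c - c' - (s - s')) \<le> 1 / 16 * norm (s - s')" using pe[OF ss] by (simp add: c_def c'_def)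
    have cc: "norm (c - c') \<le> 2 * norm (s - s')"
    proof -
      have "norm (c - c') \<le> norm (c - c' - (s - s')) + norm (s - s')"
        using norm_triangle_ineq[of "c - c' - (s - s')" "s - s'"] by simp
      then show ?thesis using pe' norm_ge_zero[of "s - s'"] by linarith
    qed
    have "norm (s - s') \<le> 4 * R0" using ss norm_triangle_ineq4[of s s'] by (auto simp: X_def)
    then have "norm (c - c') \<le> \<delta> / 2" using cc R0 by linarith
    then have e: "norm ((\<eta> c - c) - (\<eta> c' - c')) \<le> B2 * \<epsilon> * norm (c - c')" using \<eta>_lip[OF c(2,1)] by simp
    have e2: "B2 * \<epsilon> * norm (c - c') \<le> 1 / 16 * (2 * norm (s - s'))"
      using B2\<epsilon> cc A \<delta> \<epsilon> by (intro mult_mono) auto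
    let ?w = "((\<eta> c - c) - (\<eta> c' - c')) + (c - c' - (s - s'))"
    have "F s' - F s = ?P (\<eta> c - q0) - ?P (\<eta> c' - q0) - (s - s')" by (simp add: F_def c_def c'_def)
    also have "\<dots> = ?P (\<eta> c - \<eta> c') - ?P (s - s')" using Pid[OF ss] by (simp add: linear_diff[OF P(1)])
    also have "\<dots> = ?P ?w" by (simp add: linear_diff[OF P(1)] linear_add[OF P(1)])
    finally have "norm (F s' - F s) \<le> norm ?w" using P(4)[of ?w] by (simp only:)
    also have "\<dots> \<le> norm ((\<eta> c - c) - (\<eta> c' - c')) + norm (c - c' - (s - s'))" by (rule norm_triangle_ineq)
    finally show ?thesis using e e2 pe' norm_minus_commute[of "F s'" "F s"] norm_ge_zero[of "s - s'"] by linarith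
  qed
  have X0: "0 \<in> X" using R0 by (simp add: X_def linear_0[OF P(1)])
  have FX: "F s \<in> X" if s: "s \<in> X" for s
  proof -
    have "?P (F s) = F s" using s P(3) by (simp add: F_def t_def X_def linear_diff[OF P(1)] linear_add[OF P(1)])
    moreover have "norm (F s) \<le> 2 * R0"
    proof -
      have "norm (F 0) \<le> norm t + norm (?P (\<eta> q0 - q0))"
        using p_id[OF q0] norm_triangle_ineq4[of t "?P (\<eta> q0 - q0)"] by (simp add: F_def)
      also have "\<dots> \<le> R0 + \<epsilon>" using tR order_trans[OF P(4) \<eta>_near[OF q0]] by linarith
      finally have "norm (F 0) \<le> R0 + \<epsilon>" .
      moreover have "norm (F s - F 0) \<le> 1 / 4 * norm s" using contr[OF s X0] by simp
      moreover have "norm s \<le> 2 * R0" using s by (simp add: X_def)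
      ultimately show ?thesis using norm_triangle_ineq[of "F s - F 0" "F 0"] \<epsilon> by simp
    qed
    ultimately show ?thesis by (simp add: X_def)
  qed
  have "closed {s. ?P s = s}"
    using P(1) by (intro closed_Collect_eq continuous_intros linear_continuous_on) (simp add: linear_conv_bounded_linear)
  then have "complete X" unfolding X_def complete_eq_closed by auto
  then have "\<exists>!s. s \<in> X \<and> F s = s"
    using X0 FX contr by (intro Banach_fix[where c="1/4"]) (auto simp: dist_norm)
  then obtain s where s: "s \<in> X" "F s = s" by auto
  define y where "y = \<eta> (p (q0 + s))"
  have y: "y \<in> \<Gamma>h" unfolding y_def by (rule \<eta>(1)[OF p_in])
  have "?P (y - q0) = t" using s(2) by (simp add: F_def y_def)
  then have Py: "?P y = ?P x" by (simp add: t_def linear_diff[OF P(1)])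
  have "norm (p (q0 + s) - q0 - s) \<le> 1 / 16 * norm s" using pe[OF s(1) X0] p_id[OF q0] by simp
  moreover have "norm (y - p (q0 + s)) \<le> \<epsilon>" unfolding y_def by (rule \<eta>_near[OF p_in])
  moreover have "norm s \<le> 2 * R0" using s by (simp add: X_def)
  moreover have "norm (y - q0) \<le> norm (y - p (q0 + s)) + (norm (p (q0 + s) - q0 - s) + norm s)"
    using norm_triangle_ineq[of "y - p (q0 + s)" "p (q0 + s) - q0"] norm_triangle_ineq[of "p (q0 + s) - q0 - s" s] by simp
  ultimately have "norm (y - q0) \<le> 6 * R0" using \<epsilon> by linarith
  then show ?thesis using y Py by blast
qed

definition Yc :: "'a \<Rightarrow> 'a \<Rightarrow> 'a" where
  "Yc q0 x = (SOME y. y \<in> \<Gamma>h \<and> norm (y - q0) \<le> 6 * R0 \<and> PG q0 y = PG q0 x)"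

lemma Yc:
  assumes "q0 \<in> \<Gamma>" "norm (x - q0) < R0"
  shows "Yc q0 x \<in> \<Gamma>h" "norm (Yc q0 x - q0) \<le> 6 * R0" "PG q0 (Yc q0 x) = PG q0 x"
proof -
  have "Yc q0 x \<in> \<Gamma>h \<and> norm (Yc q0 x - q0) \<le> 6 * R0 \<and> PG q0 (Yc q0 x) = PG q0 x"
    unfolding Yc_def by (rule someI_ex) (use graph_exists[OF assms] in blast)
  then show "Yc q0 x \<in> \<Gamma>h" "norm (Yc q0 x - q0) \<le> 6 * R0" "PG q0 (Yc q0 x) = PG q0 x" by auto
qed

lemma Yc_unique:
  assumes q0: "q0 \<in> \<Gamma>" "norm (x - q0) < R0" and y: "y \<in> \<Gamma>h" "norm (y - q0) \<le> 6 * R0" "PG q0 y = PG q0 x"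
  shows "Yc q0 x = y"
proof -
  have "norm (Yc q0 x - y) \<le> 2 * norm (PG q0 (Yc q0 x - y))"
    by (rule horizontal_lower[OF q0(1)]) (use Yc[OF q0] y in auto)
  then show ?thesis using Yc(3)[OF q0] y(3) by (simp add: linear_diff[OF PG(1)[OF q0(1)]])
qed

lemma Yc_self:
  assumes "q0 \<in> \<Gamma>" "y \<in> \<Gamma>h" "norm (y - q0) < R0" shows "Yc q0 y = y"
  by (rule Yc_unique) (use assms R0 in auto)

lemma Yc_lip:
  assumes q0: "q0 \<in> \<Gamma>" and x: "norm (x - q0) < R0" "norm (x' - q0) < R0"
  shows "norm (Yc q0 x - Yc q0 x') \<le> 2 * norm (x - x')"
proof -
  have "norm (Yc q0 x - Yc q0 x') \<le> 2 * norm (PG q0 (Yc q0 x - Yc q0 x'))"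
    by (rule horizontal_lower[OF q0]) (use Yc[OF q0] x in auto)
  also have "PG q0 (Yc q0 x - Yc q0 x') = PG q0 (x - x')"
    using Yc(3)[OF q0] x by (simp add: linear_diff[OF PG(1)[OF q0]])
  also have "2 * norm (PG q0 (x - x')) \<le> 2 * norm (x - x')" using PG(4)[OF q0, of "x - x'"] by simp
  finally show ?thesis .
qed

text \<open>One half of \<open>1 / 8\<close> pays for the turning of the tangent plane between
  \<open>q0\<close> and the foot of \<open>y\<close>, the other for the tilt of the cell against the
  tangent plane there.\<close>

lemma cell_proj_close:
  assumes q0: "q0 \<in> \<Gamma>" and K: "K \<in> \<K>" "y \<in> K" "norm (y - q0) \<le> 6 * R0"
  shows "norm (PG q0 w - orth_proj (parallel_space K) w) \<le> 1 / 8 * norm w"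
proof -
  have "y \<in> \<Gamma>h" using K by auto
  then have "norm (y - p y) \<le> \<epsilon>" by (rule near)
  then have r: "norm (q0 - p y) \<le> 7 * R0" using norm_triangle_ineq4[of "y - p y" "y - q0"] K(3) \<epsilon> by simp
  have "norm (PG q0 w - PG (p y) w) \<le> A * norm (q0 - p y) * norm w"
    by (rule PG_lip[OF q0 p_in]) (use r R0 in auto)
  also have "\<dots> \<le> A * (7 * R0) * norm w" using r A by (intro mult_right_mono mult_left_mono) auto
  also have "\<dots> \<le> 1 / 16 * norm w" using R0 by (intro mult_right_mono) auto
  finally have 1: "norm (PG q0 w - PG (p y) w) \<le> 1 / 16 * norm w" .
  have "1 * \<epsilon> \<le> B1 * \<epsilon>" using A \<epsilon>(1) by (intro mult_right_mono) auto
  then have "\<epsilon> * norm w \<le> 1 / 16 * norm w" using B1\<epsilon> by (intro mult_right_mono) auto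
  then have "norm (PG (p y) w - orth_proj (parallel_space K) w) \<le> 1 / 16 * norm w" using projK[OF K(1,2), of w] by linarith
  then show ?thesis
    using 1 norm_triangle_ineq[of "PG q0 w - PG (p y) w" "PG (p y) w - orth_proj (parallel_space K) w"] by simp
qed

end

section \<open>Cylinders over a cell\<close>

lemma cball_borel [measurable]: "cball (x :: 'a::euclidean_space) r \<in> sets borel"
  by (rule borel_closed) simp

text \<open>\<kappa> plays the role of the determinant of \<open>L\<close>; it is only enclosed, by
  squeezing the image of the unit ball between balls of radius \<open>l\<close> and
  \<open>u\<close>.\<close>

lemma nn_integral_linear_change:
  fixes L M :: "'a::euclidean_space \<Rightarrow> 'a"
  assumes L: "linear L" "linear M" "\<And>x. M (L x) = x" "\<And>x. L (M x) = x"
    and lo: "\<And>x. l * norm x \<le> norm (L x)" and hi: "\<And>x. norm (L x) \<le> u * norm x" and lu: "0 < l" "0 < u"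
  obtains \<kappa> :: real where "l ^ DIM('a) \<le> \<kappa>" "\<kappa> \<le> u ^ DIM('a)"
    "\<And>g. g \<in> borel_measurable borel \<Longrightarrow> (\<integral>\<^sup>+x. g (M x) \<partial>lborel) = ennreal \<kappa> * (\<integral>\<^sup>+x. g x \<partial>lborel)"
proof -
  let ?k = "DIM('a)" let ?w = "unit_ball_vol (real ?k)" let ?B = "ball (0::'a) 1"
  have inj: "inj L" using L(3) by (metis injI)
  have Mm[measurable]: "M \<in> borel_measurable borel"
    using L(2) by (simp add: borel_measurable_continuous_onI linear_continuous_on linear_conv_bounded_linear)
  have LB: "L ` ?B \<in> sets borel" by (intro borel_linear_image L inj) auto
  have sub1: "ball 0 l \<subseteq> L ` ?B"
  proof
    fix y :: 'a assume y: "y \<in> ball 0 l"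
    have "l * norm (M y) \<le> norm y" using lo[of "M y"] L(4) by simp
    also have "\<dots> < l" using y by simp
    finally have "M y \<in> ?B" using lu by simp
    then show "y \<in> L ` ?B" using L(4) by (metis imageI)
  qed
  have sub2: "L ` ?B \<subseteq> ball 0 u"
  proof
    fix y assume "y \<in> L ` ?B"
    then obtain x where x: "y = L x" "norm x < 1" by auto
    have "norm y \<le> u * norm x" using hi x by simp
    also have "\<dots> < u" using x lu by simp
    finally show "y \<in> ball 0 u" by simp
  qed
  have fin: "L ` ?B \<in> fmeasurable lborel"
    using LB bounded_subset[OF bounded_ball sub2] by (intro fmeasurableI emeasure_bounded_finite) auto
  define \<kappa> where "\<kappa> = measure lborel (L ` ?B) / ?w"
  have w: "0 < ?w" by simp
  have "?w * l ^ ?k \<le> measure lborel (L ` ?B)"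
    using measure_mono_fmeasurable[OF sub1 _ fin] lu by (simp add: measure_ball_lborel)
  then have k1: "l ^ ?k \<le> \<kappa>" using w by (simp add: \<kappa>_def field_simps)
  have "measure lborel (L ` ?B) \<le> measure lborel (ball (0::'a) u)"
    using LB by (intro measure_mono_fmeasurable[OF sub2] fmeasurableI emeasure_bounded_finite) auto
  then have "measure lborel (L ` ?B) \<le> ?w * u ^ ?k"
    using lu by (simp add: measure_ball_lborel)
  then have k2: "\<kappa> \<le> u ^ ?k" using w by (simp add: \<kappa>_def field_simps)
  have e: "emeasure lborel (L ` X) = ennreal \<kappa> * emeasure lborel X" if X: "X \<in> sets borel" for X
  proof -
    have eB: "emeasure lborel ?B = ennreal ?w" by (simp add: emeasure_ball)
    have eLB: "emeasure lborel (L ` ?B) = ennreal \<kappa> * ennreal ?w"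
      using emeasure_eq_measure2[OF fin] less_imp_neq[OF w] by (simp add: \<kappa>_def flip: ennreal_mult'')
    have "emeasure lborel (L ` X) * ennreal ?w = (ennreal \<kappa> * emeasure lborel X) * ennreal ?w"
      using emeasure_lborel_linear_image[OF L(1) inj X, of ?B] unfolding eB eLB by (simp add: mult_ac)
    then show ?thesis using w by (subst (asm) (1 2) mult.commute, subst (asm) ennreal_mult_cancel_left) (auto simp: ennreal_eq_0_iff not_le)
  qed
  have "distr lborel borel M = density lborel (\<lambda>_. ennreal \<kappa>)"
  proof (rule measure_eqI)
    fix X assume "X \<in> sets (distr lborel borel M)"
    then have X: "X \<in> sets borel" by simp
    have "M -` X = L ` X" using L(3,4) by (auto simp: image_iff) metis
    then show "emeasure (distr lborel borel M) X = emeasure (density lborel (\<lambda>_. ennreal \<kappa>)) X"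
      using X e[OF X] by (simp add: emeasure_distr emeasure_density nn_integral_cmult)
  qed simp
  then have "(\<integral>\<^sup>+x. g (M x) \<partial>lborel) = ennreal \<kappa> * (\<integral>\<^sup>+x. g x \<partial>lborel)"
    if [measurable]: "g \<in> borel_measurable borel" for g
    using nn_integral_distr[of M lborel borel g] by (simp add: nn_integral_density nn_integral_cmult)
  then show ?thesis using that k1 k2 by blast
qed

section \<open>Lebesgue measure in orthonormal coordinates\<close>

lemma orthonormal_facts:
  assumes "pairwise orthogonal (B :: 'a::euclidean_space set)" "\<forall>b\<in>B. norm b = 1"
  shows "finite B" "independent B" "\<And>b b'. b \<in> B \<Longrightarrow> b' \<in> B \<Longrightarrow> b \<bullet> b' = (if b = b' then 1 else 0)"
proof -
  have "0 \<notin> B" using assms(2) by force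
  then show "independent B" using assms(1) by (intro pairwise_orthogonal_independent)
  then show "finite B" by (rule independent_imp_finite)
  fix b b' assume "b \<in> B" "b' \<in> B"
  then show "b \<bullet> b' = (if b = b' then 1 else 0)"
    using assms by (auto simp: pairwise_def orthogonal_def norm_eq_1)
qed

lemma orthonormal_sum_norm:
  fixes t :: "'a::euclidean_space \<Rightarrow> real"
  assumes B: "finite B" "\<And>b b'. b \<in> B \<Longrightarrow> b' \<in> B \<Longrightarrow> b \<bullet> b' = (if b = b' then 1 else 0)"
  shows "(norm (\<Sum>b\<in>B. t b *\<^sub>R b))\<^sup>2 = (\<Sum>b\<in>B. (t b)\<^sup>2)"
proof -
  have "(norm (\<Sum>b\<in>B. t b *\<^sub>R b))\<^sup>2 = (\<Sum>b\<in>B. \<Sum>b'\<in>B. t b * t b' * (b \<bullet> b'))"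
    by (simp add: power2_norm_eq_inner inner_sum_left inner_sum_right sum_distrib_left inner_commute mult_ac)
  also have "\<dots> = (\<Sum>b\<in>B. \<Sum>b'\<in>B. if b' = b then (t b)\<^sup>2 else 0)"
    by (intro sum.cong refl) (auto simp: B power2_eq_square)
  also have "\<dots> = (\<Sum>b\<in>B. (t b)\<^sup>2)" using B(1) by simp
  finally show ?thesis .
qed

interpretation lborel_product: product_sigma_finite "\<lambda>_ :: 'i. lborel :: real measure" ..

text \<open>\<open>affine_lebesgue\<close> indexes its product measure by an orthonormal basis of a
  subspace, \<open>lborel\<close> by \<open>Basis\<close>; a bijection of the index sets has to be
  carried through.\<close>

lemma PiM_lborel_reindex:
  fixes \<sigma> :: "'i \<Rightarrow> 'j"
  assumes fin: "finite I" and bij: "bij_betw \<sigma> I J"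
  shows "distr (\<Pi>\<^sub>M j\<in>J. lborel :: real measure) (\<Pi>\<^sub>M i\<in>I. lborel) (\<lambda>t. \<lambda>i\<in>I. t (\<sigma> i)) = (\<Pi>\<^sub>M i\<in>I. lborel)"
proof -
  have finJ: "finite J" using fin bij bij_betw_finite by blast
  have \<sigma>J: "\<sigma> i \<in> J" if "i \<in> I" for i using bij that by (auto simp: bij_betw_def)
  have meas[measurable]: "(\<lambda>t. \<lambda>i\<in>I. t (\<sigma> i)) \<in> measurable (\<Pi>\<^sub>M j\<in>J. lborel :: real measure) (\<Pi>\<^sub>M i\<in>I. lborel)"
    by (intro measurable_restrict measurable_component_singleton \<sigma>J)
  show ?thesis
  proof (rule lborel_product.PiM_eqI[OF fin])
    fix A :: "'i \<Rightarrow> real set" assume A: "\<And>i. i \<in> I \<Longrightarrow> A i \<in> sets lborel"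
    define inv where "inv = the_inv_into I \<sigma>"
    have inv: "inv (\<sigma> i) = i" if "i \<in> I" for i
      using bij that by (simp add: inv_def bij_betw_def the_inv_into_f_f)
    have invI: "inv j \<in> I" "\<sigma> (inv j) = j" if "j \<in> J" for j
    proof -
      obtain i where "i \<in> I" "j = \<sigma> i" using bij \<open>j \<in> J\<close> by (auto simp: bij_betw_def)
      then show "inv j \<in> I" "\<sigma> (inv j) = j" using inv by auto
    qed
    have pre: "(\<lambda>t. \<lambda>i\<in>I. t (\<sigma> i)) -` (\<Pi>\<^sub>E i\<in>I. A i) \<inter> space (\<Pi>\<^sub>M j\<in>J. lborel :: real measure) = (\<Pi>\<^sub>E j\<in>J. A (inv j))"
    proof (intro set_eqI iffI)
      fix t assume t: "t \<in> (\<lambda>t. \<lambda>i\<in>I. t (\<sigma> i)) -` (\<Pi>\<^sub>E i\<in>I. A i) \<inter> space (\<Pi>\<^sub>M j\<in>J. lborel :: real measure)"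
      have "t j \<in> A (inv j)" if "j \<in> J" for j
      proof -
        have "(\<lambda>i\<in>I. t (\<sigma> i)) (inv j) \<in> A (inv j)" using t invI[OF that] by (auto simp: PiE_iff)
        then show ?thesis using invI[OF that] by simp
      qed
      then show "t \<in> (\<Pi>\<^sub>E j\<in>J. A (inv j))" using t by (auto simp: space_PiM PiE_iff)
    next
      fix t assume t: "t \<in> (\<Pi>\<^sub>E j\<in>J. A (inv j))"
      have "t (\<sigma> i) \<in> A i" if "i \<in> I" for i using t \<sigma>J[OF that] inv[OF that] by (auto simp: PiE_iff)
      then show "t \<in> (\<lambda>t. \<lambda>i\<in>I. t (\<sigma> i)) -` (\<Pi>\<^sub>E i\<in>I. A i) \<inter> space (\<Pi>\<^sub>M j\<in>J. lborel :: real measure)"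
        using t by (auto simp: space_PiM PiE_iff)
    qed
    have "emeasure (distr (\<Pi>\<^sub>M j\<in>J. lborel) (\<Pi>\<^sub>M i\<in>I. lborel) (\<lambda>t. \<lambda>i\<in>I. t (\<sigma> i))) (\<Pi>\<^sub>E i\<in>I. A i)
      = emeasure (\<Pi>\<^sub>M j\<in>J. lborel) (\<Pi>\<^sub>E j\<in>J. A (inv j))"
      using A fin by (subst emeasure_distr) (auto simp: pre intro!: sets_PiM_I_finite)
    also have "\<dots> = (\<Prod>j\<in>J. emeasure lborel (A (inv j)))"
      using A finJ invI by (intro lborel_product.emeasure_PiM) auto
    also have "\<dots> = (\<Prod>i\<in>I. emeasure lborel (A i))"
      by (rule prod.reindex_bij_betw[OF bij, symmetric, THEN trans]) (auto simp: inv intro!: prod.cong)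
    finally show "emeasure (distr (\<Pi>\<^sub>M j\<in>J. lborel) (\<Pi>\<^sub>M i\<in>I. lborel) (\<lambda>t. \<lambda>i\<in>I. t (\<sigma> i))) (\<Pi>\<^sub>E i\<in>I. A i)
      = (\<Prod>i\<in>I. emeasure lborel (A i))" .
  qed simp
qed

text \<open>Rotation invariance: for an isometry the enclosure of \<kappa> in
  \<open>nn_integral_linear_change\<close> collapses to 1.\<close>

lemma lborel_orthonormal:
  fixes B :: "'a::euclidean_space set" and F :: "'a \<Rightarrow> ennreal"
  assumes B: "pairwise orthogonal B" "\<forall>b\<in>B. norm b = 1" "card B = DIM('a)"
    and F[measurable]: "F \<in> borel_measurable borel"
  shows "(\<integral>\<^sup>+x. F x \<partial>lborel) = (\<integral>\<^sup>+t. F (\<Sum>b\<in>B. t b *\<^sub>R b) \<partial>(\<Pi>\<^sub>M b\<in>B. lborel))"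
proof -
  note on = orthonormal_facts[OF B(1,2)]
  obtain \<sigma> where \<sigma>: "bij_betw \<sigma> B (Basis :: 'a set)"
    using on(1) B(3) by (metis finite_Basis finite_same_card_bij)
  define \<tau> where "\<tau> = the_inv_into B \<sigma>"
  have \<tau>: "bij_betw \<tau> Basis B" unfolding \<tau>_def by (rule bij_betw_the_inv_into[OF \<sigma>])
  have \<tau>B: "\<tau> i \<in> B" if "i \<in> Basis" for i using \<tau> that by (auto simp: bij_betw_def)
  have \<tau>\<sigma>: "\<tau> (\<sigma> b) = b" if "b \<in> B" for b using \<sigma> that by (simp add: \<tau>_def bij_betw_def the_inv_into_f_f)
  define O' where "O' x = (\<Sum>i\<in>Basis. (x \<bullet> i) *\<^sub>R \<tau> i)" for x :: 'a
  define M where "M y = (\<Sum>i\<in>Basis. (y \<bullet> \<tau> i) *\<^sub>R i)" for y :: 'a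
  have lin: "linear O'" "linear M"
    by (auto simp: O'_def M_def inner_add_left scaleR_add_left sum.distrib scaleR_sum_right intro!: linearI)
  have on\<tau>: "\<tau> i \<bullet> \<tau> j = (if i = j then 1 else 0)" if "i \<in> Basis" "j \<in> Basis" for i j
    using on(3)[OF \<tau>B[OF that(1)] \<tau>B[OF that(2)]] \<tau> that by (auto simp: bij_betw_def inj_on_def)
  have MO: "M (O' x) = x" for x
  proof -
    have "O' x \<bullet> \<tau> j = x \<bullet> j" if "j \<in> Basis" for j
    proof -
      have "O' x \<bullet> \<tau> j = (\<Sum>i\<in>Basis. (x \<bullet> i) * (\<tau> i \<bullet> \<tau> j))" by (simp add: O'_def inner_sum_left)
      also have "\<dots> = (\<Sum>i\<in>Basis. if i = j then x \<bullet> i else 0)" by (intro sum.cong refl) (auto simp: on\<tau> that)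
      finally show ?thesis using that by simp
    qed
    then show ?thesis by (simp add: M_def euclidean_representation)
  qed
  have OM: "O' (M y) = y" for y
  proof -
    have "inj O'" using MO by (metis injI)
    then have "surj O'" using lin(1) linear_injective_imp_surjective by blast
    then obtain x where "y = O' x" by (metis surjD)
    then show ?thesis using MO by simp
  qed
  have nO: "norm (O' x) = norm x" for x
  proof -
    have "(norm (O' x))\<^sup>2 = (\<Sum>i\<in>Basis. \<Sum>j\<in>Basis. (x \<bullet> i) * (x \<bullet> j) * (\<tau> i \<bullet> \<tau> j))"
      by (simp add: O'_def power2_norm_eq_inner inner_sum_left inner_sum_right sum_distrib_left inner_commute mult_ac)
    also have "\<dots> = (\<Sum>i\<in>Basis. \<Sum>j\<in>Basis. if j = i then (x \<bullet> i)\<^sup>2 else 0)"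
      by (intro sum.cong refl) (auto simp: on\<tau> power2_eq_square)
    also have "\<dots> = (\<Sum>i\<in>Basis. (x \<bullet> i)\<^sup>2)" by simp
    also have "\<dots> = x \<bullet> x" by (simp add: power2_eq_square euclidean_inner[of x x])
    also have "\<dots> = (norm x)\<^sup>2" by (rule power2_norm_eq_inner[symmetric])
    finally show ?thesis by simp
  qed
  have nM: "norm (M y) = norm y" for y using nO[of "M y"] OM by simp
  obtain \<kappa> :: real where \<kappa>: "1 ^ DIM('a) \<le> \<kappa>" "\<kappa> \<le> 1 ^ DIM('a)"
    "\<And>g. g \<in> borel_measurable borel \<Longrightarrow> (\<integral>\<^sup>+x. g (O' x) \<partial>lborel) = ennreal \<kappa> * (\<integral>\<^sup>+x. g x \<partial>lborel)"
    using nn_integral_linear_change[OF lin(2,1) OM MO, of 1 1] nM by auto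
  have "(\<integral>\<^sup>+x. F x \<partial>lborel) = (\<integral>\<^sup>+x. F (O' x) \<partial>lborel)" using \<kappa> by simp
  also have "\<dots> = (\<integral>\<^sup>+t. F (O' (\<Sum>i\<in>Basis. t i *\<^sub>R i)) \<partial>(\<Pi>\<^sub>M i\<in>Basis. lborel))"
  proof -
    have [measurable]: "O' \<in> borel_measurable borel"
      using lin(1) by (simp add: borel_measurable_continuous_onI linear_continuous_on linear_conv_bounded_linear)
    show ?thesis by (subst lborel_eq, subst nn_integral_distr) auto
  qed
  also have "\<dots> = (\<integral>\<^sup>+t. F (\<Sum>b\<in>B. (\<lambda>b\<in>B. t (\<sigma> b)) b *\<^sub>R b) \<partial>(\<Pi>\<^sub>M i\<in>(Basis::'a set). lborel))"
  proof (intro nn_integral_cong arg_cong[where f=F])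
    fix t :: "'a \<Rightarrow> real"
    have "O' (\<Sum>i\<in>Basis. t i *\<^sub>R i) = (\<Sum>i\<in>Basis. t i *\<^sub>R \<tau> i)"
      unfolding O'_def by (intro sum.cong refl) simp
    also have "\<dots> = (\<Sum>b\<in>B. t (\<sigma> b) *\<^sub>R \<tau> (\<sigma> b))" by (rule sum.reindex_bij_betw[OF \<sigma>, symmetric])
    also have "\<dots> = (\<Sum>b\<in>B. (\<lambda>b\<in>B. t (\<sigma> b)) b *\<^sub>R b)" by (intro sum.cong refl) (simp add: \<tau>\<sigma>)
    finally show "O' (\<Sum>i\<in>Basis. t i *\<^sub>R i) = (\<Sum>b\<in>B. (\<lambda>b\<in>B. t (\<sigma> b)) b *\<^sub>R b)" .
  qed
  also have "\<dots> = (\<integral>\<^sup>+t. F (\<Sum>b\<in>B. t b *\<^sub>R b) \<partial>distr (\<Pi>\<^sub>M i\<in>(Basis::'a set). lborel) (\<Pi>\<^sub>M b\<in>B. lborel) (\<lambda>t. \<lambda>b\<in>B. t (\<sigma> b)))"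
  proof (subst nn_integral_distr)
    show "(\<lambda>t. \<lambda>b\<in>B. t (\<sigma> b)) \<in> measurable (\<Pi>\<^sub>M i\<in>(Basis::'a set). lborel :: real measure) (\<Pi>\<^sub>M b\<in>B. lborel)"
      using \<sigma> by (intro measurable_restrict measurable_component_singleton) (auto simp: bij_betw_def)
  qed (auto)
  also have "\<dots> = (\<integral>\<^sup>+t. F (\<Sum>b\<in>B. t b *\<^sub>R b) \<partial>(\<Pi>\<^sub>M b\<in>B. lborel))"
    by (simp only: PiM_lborel_reindex[OF on(1) \<sigma>])
  finally show ?thesis .
qed

text \<open>The volume of a ball in the span of \<open>C\<close>, enclosed by cubes. The inner cube
  has half side \<open>r / (card C + 1)\<close>, where the 1 keeps the quotient meaningful for empty
  \<open>C\<close>.\<close>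

lemma box_sandwich:
  fixes C :: "'a::euclidean_space set"
  assumes C: "finite C" "\<And>b b'. b \<in> C \<Longrightarrow> b' \<in> C \<Longrightarrow> b \<bullet> b' = (if b = b' then 1 else 0)" and r: "0 < r"
  shows "ennreal ((2 / (real (card C) + 1)) ^ card C * r ^ card C) \<le>
      (\<integral>\<^sup>+s. indicator (cball 0 r) (\<Sum>b\<in>C. s b *\<^sub>R b) \<partial>(\<Pi>\<^sub>M b\<in>C. lborel))"
    and "(\<integral>\<^sup>+s. indicator (cball 0 r) (\<Sum>b\<in>C. s b *\<^sub>R b) \<partial>(\<Pi>\<^sub>M b\<in>C. lborel)) \<le> ennreal (2 ^ card C * r ^ card C)"
proof -
  let ?M = "\<Pi>\<^sub>M b\<in>C. lborel :: real measure"
  have box: "emeasure ?M (\<Pi>\<^sub>E b\<in>C. {-x..x}) = ennreal ((2 * x) ^ card C)" if "0 \<le> x" for x :: real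
    using that C(1) by (subst lborel_product.emeasure_PiM) (auto simp: prod_constant ennreal_power)
  have sets: "(\<Pi>\<^sub>E b\<in>C. {-x..x}) \<in> sets ?M" for x :: real
    using C(1) by (intro sets_PiM_I_finite) auto
  let ?x = "r / (real (card C) + 1)"
  have small: "norm (\<Sum>b\<in>C. s b *\<^sub>R b) \<le> r" if "s \<in> (\<Pi>\<^sub>E b\<in>C. {-?x..?x})" for s
  proof -
    have "norm (\<Sum>b\<in>C. s b *\<^sub>R b) \<le> (\<Sum>b\<in>C. ?x)"
    proof (rule sum_norm_le)
      fix b assume b: "b \<in> C"
      have "norm b = 1" using C(2)[OF b b] by (simp add: norm_eq_1)
      then show "norm (s b *\<^sub>R b) \<le> ?x" using that b by (auto simp: PiE_iff)
    qed
    also have "\<dots> \<le> r" using r by (simp add: field_simps)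
    finally show ?thesis .
  qed
  have "ennreal ((2 * ?x) ^ card C) = (\<integral>\<^sup>+s. indicator (\<Pi>\<^sub>E b\<in>C. {-?x..?x}) s \<partial>?M)"
    using r sets box[of ?x] by simp
  also have "\<dots> \<le> (\<integral>\<^sup>+s. indicator (cball 0 r) (\<Sum>b\<in>C. s b *\<^sub>R b) \<partial>?M)"
    using small by (intro nn_integral_mono) (auto simp: indicator_def)
  finally show "ennreal ((2 / (real (card C) + 1)) ^ card C * r ^ card C) \<le>
      (\<integral>\<^sup>+s. indicator (cball 0 r) (\<Sum>b\<in>C. s b *\<^sub>R b) \<partial>?M)"
    by (simp add: power_mult_distrib power_divide)
  have large: "s \<in> (\<Pi>\<^sub>E b\<in>C. {-r..r})" if s: "s \<in> space ?M" "norm (\<Sum>b\<in>C. s b *\<^sub>R b) \<le> r" for s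
  proof -
    have "s b \<in> {-r..r}" if b: "b \<in> C" for b
    proof -
      have "(s b)\<^sup>2 \<le> (\<Sum>b\<in>C. (s b)\<^sup>2)" using C(1) b by (intro member_le_sum) auto
      also have "\<dots> = (norm (\<Sum>b\<in>C. s b *\<^sub>R b))\<^sup>2" by (rule orthonormal_sum_norm[OF C, symmetric])
      also have "\<dots> \<le> r\<^sup>2" using s by (intro power_mono) auto
      finally have "\<bar>s b\<bar> \<le> \<bar>r\<bar>" by (simp only: abs_le_square_iff)
      then show ?thesis using r by auto
    qed
    then show ?thesis using s by (auto simp: space_PiM PiE_iff)
  qed
  have "(\<integral>\<^sup>+s. indicator (cball 0 r) (\<Sum>b\<in>C. s b *\<^sub>R b) \<partial>?M) \<le> (\<integral>\<^sup>+s. indicator (\<Pi>\<^sub>E b\<in>C. {-r..r}) s \<partial>?M)"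
    using large by (intro nn_integral_mono) (auto simp: indicator_def)
  also have "\<dots> = ennreal ((2 * r) ^ card C)" using r sets box[of r] by simp
  finally show "(\<integral>\<^sup>+s. indicator (cball 0 r) (\<Sum>b\<in>C. s b *\<^sub>R b) \<partial>?M) \<le> ennreal (2 ^ card C * r ^ card C)"
    by (simp add: power_mult_distrib)
qed

lemma sets_affine_lebesgue [simp, measurable_cong]: "sets (affine_lebesgue A) = sets borel"
  by (simp add: affine_lebesgue_def Let_def)

lemma space_affine_lebesgue [simp]: "space (affine_lebesgue A) = UNIV"
  by (simp add: affine_lebesgue_def Let_def)

lemma parallel_space_hull: "parallel_space (affine hull K) = parallel_space K"
  by (simp add: parallel_space_def hull_hull)

lemma parallel_space_add:
  fixes K :: "'a::euclidean_space set"
  assumes "a \<in> affine hull K" "w \<in> parallel_space K" shows "a + w \<in> affine hull K"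
proof -
  obtain x y where xy: "w = x - y" "x \<in> affine hull K" "y \<in> affine hull K" using assms(2) by (auto simp: parallel_space_def)
  have "1 *\<^sub>R x + (-1) *\<^sub>R y + 1 *\<^sub>R a \<in> affine hull K"
    by (rule mem_affine_3[OF affine_affine_hull]) (use xy assms in auto)
  then show ?thesis by (simp add: xy(1) algebra_simps)
qed

text \<open>Cavalieri: the cylinder of radius \<open>r\<close> over the affine hull of \<open>K\<close> splits as a product.\<close>

lemma affine_lebesgue_cylinder:
  fixes K :: "'a::euclidean_space set"
  assumes K: "K \<noteq> {}" and c: "c + dim (parallel_space K) = DIM('a)"
  defines "P \<equiv> orth_proj (parallel_space K)"
  obtains a where "a \<in> affine hull K"
    "\<And>f r. f \<in> borel_measurable borel \<Longrightarrow> 0 < r \<Longrightarrow>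
      ennreal ((2 / (real c + 1)) ^ c * r ^ c) * (\<integral>\<^sup>+x. f x \<partial>affine_lebesgue (affine hull K))
        \<le> (\<integral>\<^sup>+x. f (a + P x) * indicator (cball 0 r) (x - P x) \<partial>lborel)"
    "\<And>f r. f \<in> borel_measurable borel \<Longrightarrow> 0 < r \<Longrightarrow>
      (\<integral>\<^sup>+x. f (a + P x) * indicator (cball 0 r) (x - P x) \<partial>lborel)
        \<le> ennreal (2 ^ c * r ^ c) * (\<integral>\<^sup>+x. f x \<partial>affine_lebesgue (affine hull K))"
proof -
  define V where "V = parallel_space K"
  have V: "subspace V" unfolding V_def by (rule subspace_parallel_space[OF K])
  define a where "a = (SOME a. a \<in> affine hull K)"
  obtain a' where "a' \<in> affine hull K" using K hull_inc by fastforce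
  then have a: "a \<in> affine hull K" unfolding a_def by (rule someI)
  define B where "B = (SOME B. orthonormal_basis_of B V)"
  have "orthonormal_basis_of B V"
  proof -
    obtain B' where "B' \<subseteq> V" "pairwise orthogonal B'" "\<And>x. x \<in> B' \<Longrightarrow> norm x = 1" "span B' = V"
      using orthonormal_basis_subspace[OF V] by metis
    then have "orthonormal_basis_of B' V" by (simp add: orthonormal_basis_of_def)
    then show ?thesis unfolding B_def by (rule someI)
  qed
  then have B: "B \<subseteq> V" "pairwise orthogonal B" "\<forall>b\<in>B. norm b = 1" "span B = V"
    by (auto simp: orthonormal_basis_of_def)
  note onB = orthonormal_facts[OF B(2,3)]
  have \<mu>: "affine_lebesgue (affine hull K) = distr (\<Pi>\<^sub>M b\<in>B. lborel) borel (\<lambda>t. a + (\<Sum>b\<in>B. t b *\<^sub>R b))"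
    by (simp add: affine_lebesgue_def Let_def parallel_space_hull a_def B_def V_def)
  define V' where "V' = {y \<in> UNIV. \<forall>x\<in>V. orthogonal x y}"
  have V': "subspace V'"
    by (auto simp: V'_def subspace_def orthogonal_def inner_add_right)
  have dimV': "dim V' + dim V = DIM('a)"
    unfolding V'_def using dim_subspace_orthogonal_to_vectors[OF V subspace_UNIV] by simp
  obtain C where C: "C \<subseteq> V'" "pairwise orthogonal C" "\<And>x. x \<in> C \<Longrightarrow> norm x = 1" "independent C" "card C = dim V'" "span C = V'"
    using orthonormal_basis_subspace[OF V'] by metis
  have C': "\<forall>b\<in>C. norm b = 1" using C(3) by blast
  note onC = orthonormal_facts[OF C(2) C']
  have cC: "card C = c" using C(5) dimV' c by (simp add: V_def)
  have cross: "b \<bullet> b' = 0" if "b \<in> V" "b' \<in> V'" for b b' using that by (auto simp: V'_def orthogonal_def)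
  have disj: "B \<inter> C = {}"
  proof (rule ccontr)
    assume "B \<inter> C \<noteq> {}"
    then obtain b where b: "b \<in> B" "b \<in> C" by auto
    then have "b \<bullet> b = 0" using cross[of b b] B(1) C(1) by blast
    then show False using B(3) b by (auto simp: norm_eq_sqrt_inner)
  qed
  have "dim V = card B" using B(4) onB(2) by (metis dim_span_eq_card_independent)
  then have card: "card (B \<union> C) = DIM('a)"
    using disj onB(1) onC(1) C(5) dimV' by (simp add: card_Un_disjoint)
  have on: "pairwise orthogonal (B \<union> C)"
  proof (unfold pairwise_def, intro ballI impI)
    fix x y assume xy: "x \<in> B \<union> C" "y \<in> B \<union> C" "x \<noteq> y"
    show "orthogonal x y"
      using xy B(1,2) C(1,2) cross unfolding orthogonal_def pairwise_def by (metis Un_iff inner_commute subsetD)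
  qed
  have BV: "(\<Sum>b\<in>B. t b *\<^sub>R b) \<in> V" for t using B(1) V by (intro subspace_sum subspace_scale) auto
  have CV: "(\<Sum>b\<in>C. s b *\<^sub>R b) \<in> V'" for s using C(1) V' by (intro subspace_sum subspace_scale) auto
  have Psum: "P ((\<Sum>b\<in>B. t b *\<^sub>R b) + (\<Sum>b\<in>C. s b *\<^sub>R b)) = (\<Sum>b\<in>B. t b *\<^sub>R b)" for t s
    unfolding P_def V_def[symmetric]
    by (rule orth_proj_unique[OF V BV]) (use cross[OF _ CV] in \<open>auto simp: orthogonal_def inner_commute\<close>)
  have [measurable]: "P \<in> borel_measurable borel"
    using orth_proj_linear[OF V] unfolding P_def V_def
    by (simp add: borel_measurable_continuous_onI linear_continuous_on linear_conv_bounded_linear)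
  define W where "W r = (\<integral>\<^sup>+s. indicator (cball 0 r) (\<Sum>b\<in>C. s b *\<^sub>R b) \<partial>(\<Pi>\<^sub>M b\<in>C. lborel))" for r
  \<comment> \<open>In the coordinates \<open>B \<union> C\<close> the integrand separates exactly;
    the two inequalities stem from the enclosure of the volume \<open>W r\<close> alone.\<close>
  have main: "(\<integral>\<^sup>+x. f (a + P x) * indicator (cball 0 r) (x - P x) \<partial>lborel)
      = W r * (\<integral>\<^sup>+x. f x \<partial>affine_lebesgue (affine hull K))"
    if f[measurable]: "f \<in> borel_measurable borel" for f r
  proof -
    let ?g = "\<lambda>x. f (a + P x) * indicator (cball 0 r) (x - P x)"
    have gm: "?g \<in> borel_measurable borel" by measurable
    have "(\<integral>\<^sup>+x. ?g x \<partial>lborel) = (\<integral>\<^sup>+t. ?g (\<Sum>b\<in>B \<union> C. t b *\<^sub>R b) \<partial>(\<Pi>\<^sub>M b\<in>B \<union> C. lborel))"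
      by (rule lborel_orthonormal[OF on _ card gm]) (use B C in auto)
    also have "\<dots> = (\<integral>\<^sup>+t. (\<integral>\<^sup>+s. ?g (\<Sum>b\<in>B \<union> C. merge B C (t, s) b *\<^sub>R b) \<partial>(\<Pi>\<^sub>M b\<in>C. lborel)) \<partial>(\<Pi>\<^sub>M b\<in>B. lborel))"
      by (rule lborel_product.product_nn_integral_fold[OF disj onB(1) onC(1)])
        (intro measurable_compose[OF _ gm] borel_measurable_sum borel_measurable_scaleR measurable_component_singleton, auto)
    also have "\<dots> = (\<integral>\<^sup>+t. (\<integral>\<^sup>+s. f (a + (\<Sum>b\<in>B. t b *\<^sub>R b)) * indicator (cball 0 r) (\<Sum>b\<in>C. s b *\<^sub>R b) \<partial>(\<Pi>\<^sub>M b\<in>C. lborel)) \<partial>(\<Pi>\<^sub>M b\<in>B. lborel))"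
    proof (intro nn_integral_cong)
      fix t s :: "'a \<Rightarrow> real"
      have "(\<Sum>b\<in>B \<union> C. merge B C (t, s) b *\<^sub>R b) = (\<Sum>b\<in>B. merge B C (t, s) b *\<^sub>R b) + (\<Sum>b\<in>C. merge B C (t, s) b *\<^sub>R b)"
        using onB(1) onC(1) disj by (rule sum.union_disjoint)
      also have "\<dots> = (\<Sum>b\<in>B. t b *\<^sub>R b) + (\<Sum>b\<in>C. s b *\<^sub>R b)"
        using disj by (intro arg_cong2[where f="(+)"] sum.cong refl) (auto simp: merge_def)
      finally show "?g (\<Sum>b\<in>B \<union> C. merge B C (t, s) b *\<^sub>R b) = f (a + (\<Sum>b\<in>B. t b *\<^sub>R b)) * indicator (cball 0 r) (\<Sum>b\<in>C. s b *\<^sub>R b)"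
        by (simp add: Psum)
    qed
    also have "\<dots> = (\<integral>\<^sup>+t. f (a + (\<Sum>b\<in>B. t b *\<^sub>R b)) * W r \<partial>(\<Pi>\<^sub>M b\<in>B. lborel))"
      unfolding W_def by (intro nn_integral_cong nn_integral_cmult) measurable
    also have "\<dots> = (\<integral>\<^sup>+t. f (a + (\<Sum>b\<in>B. t b *\<^sub>R b)) \<partial>(\<Pi>\<^sub>M b\<in>B. lborel)) * W r"
      by (rule nn_integral_multc) measurable
    also have "(\<integral>\<^sup>+t. f (a + (\<Sum>b\<in>B. t b *\<^sub>R b)) \<partial>(\<Pi>\<^sub>M b\<in>B. lborel)) = (\<integral>\<^sup>+x. f x \<partial>affine_lebesgue (affine hull K))"
      unfolding \<mu> by (subst nn_integral_distr) measurable
    finally show ?thesis by (simp add: mult.commute)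
  qed
  have W: "ennreal ((2 / (real c + 1)) ^ c * r ^ c) \<le> W r" "W r \<le> ennreal (2 ^ c * r ^ c)" if "0 < r" for r
    using box_sandwich[OF onC(1,3) that] by (simp_all add: W_def cC)
  show ?thesis
    by (rule that[OF a]) (simp_all add: main W mult_right_mono)
qed

text \<open>The factors \<open>9 / 8\<close> and \<open>7 / 8\<close> enclose the volume distortion
  of the shear in \<open>cylinder\<close>. The base 4 is 2 from the outer cube times 2 because the
  shear can shorten normal vectors by a factor of at most 2.\<close>

definition cyl_u :: "nat \<Rightarrow> nat \<Rightarrow> real" where "cyl_u k c = (9 / 8) ^ k * 4 ^ c"
definition cyl_l :: "nat \<Rightarrow> nat \<Rightarrow> real" where "cyl_l k c = (7 / 8) ^ k * (2 / (real c + 1)) ^ c"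

lemma cyl_pos: "0 < cyl_u k c" "0 < cyl_l k c"
  by (auto simp: cyl_u_def cyl_l_def)

text \<open>Fibres along the kernel of \<open>P0\<close> instead of orthogonal ones:
  \<open>y\<close> is the projection onto the affine hull of \<open>K\<close> along that kernel. A
  linear map within \<open>1 / 8\<close> of the identity reduces the claim to the orthogonal
  cylinder.\<close>

lemma cylinder:
  fixes K :: "'a::euclidean_space set"
  assumes K: "K \<noteq> {}" and c: "c + dim (parallel_space K) = DIM('a)"
    and P0: "linear P0" "\<And>x y. P0 x \<bullet> y = x \<bullet> P0 y" "\<And>x. P0 (P0 x) = P0 x"
    and close: "\<And>w. norm (P0 w - orth_proj (parallel_space K) w) \<le> 1 / 8 * norm w"
  obtains y where "y \<in> borel_measurable borel" "\<And>x. y x \<in> affine hull K" "\<And>x. P0 (y x) = P0 x"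
    "\<And>f r. f \<in> borel_measurable borel \<Longrightarrow> 0 < r \<Longrightarrow>
      ennreal (cyl_l DIM('a) c * r ^ c) * (\<integral>\<^sup>+x. f x \<partial>affine_lebesgue (affine hull K))
        \<le> (\<integral>\<^sup>+x. f (y x) * indicator (cball 0 r) (x - y x) \<partial>lborel)"
    "\<And>f r. f \<in> borel_measurable borel \<Longrightarrow> 0 < r \<Longrightarrow>
      (\<integral>\<^sup>+x. f (y x) * indicator (cball 0 r) (x - y x) \<partial>lborel)
        \<le> ennreal (cyl_u DIM('a) c * r ^ c) * (\<integral>\<^sup>+x. f x \<partial>affine_lebesgue (affine hull K))"
proof -
  let ?k = "DIM('a)"
  define V where "V = parallel_space K"
  have V: "subspace V" unfolding V_def by (rule subspace_parallel_space[OF K])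
  define P where "P = orth_proj V"
  have P: "linear P" "\<And>x y. P x \<bullet> y = x \<bullet> P y" "\<And>x. P (P x) = P x" "\<And>x. P x \<in> V"
    unfolding P_def using orth_proj_linear[OF V] orth_proj_sym[OF V] orth_proj_idem[OF V] orth_proj(1)[OF V] by auto
  have cl: "norm (P0 w - P w) \<le> 1 / 8 * norm w" for w using close by (simp add: P_def V_def)
  \<comment> \<open>\<open>L\<close> fixes the directions of \<open>K\<close> and sends a vector
    normal to \<open>K\<close> to its component in the kernel of \<open>P0\<close>. Its inverse
    turns the oblique decomposition into the orthogonal one.\<close>
  define L where "L z = P z + ((z - P z) - P0 (z - P z))" for z
  have linL: "linear L"
    unfolding L_def by (intro linear_compose_add linear_compose_sub P(1) linear_ident
      linear_compose[OF _ P0(1), unfolded comp_def])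
  have Lz: "norm (L z - z) \<le> 1 / 8 * norm z" for z
  proof -
    have "L z - z = - (P0 (z - P z) - P (z - P z))" using P(3) by (simp add: L_def linear_diff[OF P(1)])
    then have "norm (L z - z) \<le> 1 / 8 * norm (z - P z)" using cl[of "z - P z"] by (simp only: norm_minus_cancel)
    also have "\<dots> \<le> 1 / 8 * norm z" using proj_norm_le(2)[of P, OF P(2,3)] by simp
    finally show ?thesis .
  qed
  have lo: "7 / 8 * norm z \<le> norm (L z)" for z using Lz[of z] norm_triangle_ineq4[of "L z" "L z - z"] by simp
  have hi: "norm (L z) \<le> 9 / 8 * norm z" for z using Lz[of z] norm_triangle_ineq[of "L z - z" z] by simp
  have injL: "inj L"
    unfolding linear_injective_0[OF linL] using lo by (metis mult_le_0_iff norm_eq_zero norm_ge_zero norm_zero not_le zero_less_divide_iff zero_less_numeral order_antisym)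
  obtain M where M: "linear M" "\<And>x. M (L x) = x"
    using linear_injective_left_inverse[OF linL injL] by (auto simp: fun_eq_iff)
  have LM: "L (M x) = x" for x using linear_injective_imp_surjective[OF linL injL] M(2) by (metis surjD)
  obtain \<kappa> :: real where \<kappa>: "(7 / 8) ^ ?k \<le> \<kappa>" "\<kappa> \<le> (9 / 8) ^ ?k"
    "\<And>g. g \<in> borel_measurable borel \<Longrightarrow> (\<integral>\<^sup>+x. g (M x) \<partial>lborel) = ennreal \<kappa> * (\<integral>\<^sup>+x. g x \<partial>lborel)"
    using nn_integral_linear_change[OF linL M(1) M(2) LM lo hi] by auto
  obtain a where a: "a \<in> affine hull K"
    "\<And>f r. f \<in> borel_measurable borel \<Longrightarrow> 0 < r \<Longrightarrow>
      ennreal ((2 / (real c + 1)) ^ c * r ^ c) * (\<integral>\<^sup>+x. f x \<partial>affine_lebesgue (affine hull K))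
        \<le> (\<integral>\<^sup>+x. f (a + P x) * indicator (cball 0 r) (x - P x) \<partial>lborel)"
    "\<And>f r. f \<in> borel_measurable borel \<Longrightarrow> 0 < r \<Longrightarrow>
      (\<integral>\<^sup>+x. f (a + P x) * indicator (cball 0 r) (x - P x) \<partial>lborel)
        \<le> ennreal (2 ^ c * r ^ c) * (\<integral>\<^sup>+x. f x \<partial>affine_lebesgue (affine hull K))"
    using affine_lebesgue_cylinder[OF K c] unfolding P_def V_def by blast
  have [measurable]: "P \<in> borel_measurable borel" "M \<in> borel_measurable borel" "P0 \<in> borel_measurable borel"
    using P(1) M(1) P0(1) by (simp_all add: borel_measurable_continuous_onI linear_continuous_on linear_conv_bounded_linear)
  define y where "y x = a + P (M (x - a))" for x
  have y1: "y \<in> borel_measurable borel" unfolding y_def by measurable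
  have y2: "y x \<in> affine hull K" for x
    unfolding y_def by (rule parallel_space_add[OF a(1)]) (use P(4) in \<open>simp add: V_def\<close>)
  have off: "x - y x = (M (x - a) - P (M (x - a))) - P0 (M (x - a) - P (M (x - a)))" for x
  proof -
    have "x - a = L (M (x - a))" by (simp add: LM)
    then have "x - a = P (M (x - a)) + ((M (x - a) - P (M (x - a))) - P0 (M (x - a) - P (M (x - a))))"
      unfolding L_def .
    then show ?thesis by (simp add: y_def algebra_simps)
  qed
  have y3: "P0 (y x) = P0 x" for x
  proof -
    have "P0 (x - y x) = 0" unfolding off by (simp add: linear_diff[OF P0(1)] P0(3))
    then show ?thesis by (simp add: linear_diff[OF P0(1)])
  qed
  have trans: "(\<integral>\<^sup>+x. f (y x) * indicator (cball 0 r) (x - y x) \<partial>lborel)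
      = ennreal \<kappa> * (\<integral>\<^sup>+z. f (a + P z) * indicator (cball 0 r) ((z - P z) - P0 (z - P z)) \<partial>lborel)"
    if [measurable]: "f \<in> borel_measurable borel" for f r
  proof -
    let ?g = "\<lambda>z. f (a + P z) * indicator (cball 0 r) ((z - P z) - P0 (z - P z))"
    have "(\<integral>\<^sup>+x. f (y x) * indicator (cball 0 r) (x - y x) \<partial>lborel) = (\<integral>\<^sup>+x. ?g (M (x - a)) \<partial>lborel)"
      unfolding off by (simp add: y_def)
    also have "\<dots> = (\<integral>\<^sup>+x. ?g (M (x - a)) \<partial>distr lborel borel ((+) a))" by (simp only: lborel_distr_plus)
    also have "\<dots> = (\<integral>\<^sup>+x. ?g (M x) \<partial>lborel)"
    proof -
      have g: "?g \<in> borel_measurable borel" by measurable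
      have gm: "(\<lambda>x. ?g (M (x - a))) \<in> borel_measurable borel" by (rule measurable_compose[OF _ g]) measurable
      show ?thesis by (subst nn_integral_distr) (use gm in simp_all)
    qed
    also have "\<dots> = ennreal \<kappa> * (\<integral>\<^sup>+x. ?g x \<partial>lborel)" by (rule \<kappa>(3)) measurable
    finally show ?thesis .
  qed
  have Q1: "norm (w - P0 w) \<le> norm w" for w using proj_norm_le(2)[of P0, OF P0(2,3)] .
  have Q2: "norm (z - P z) \<le> 2 * norm ((z - P z) - P0 (z - P z))" for z
  proof -
    have "norm (P0 (z - P z)) \<le> 1 / 8 * norm (z - P z)" using cl[of "z - P z"] P(3) by (simp add: linear_diff[OF P(1)])
    moreover have "norm (z - P z) \<le> norm ((z - P z) - P0 (z - P z)) + norm (P0 (z - P z))"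
      using norm_triangle_ineq[of "(z - P z) - P0 (z - P z)" "P0 (z - P z)"] by simp
    ultimately show ?thesis using norm_ge_zero[of "(z - P z) - P0 (z - P z)"] by linarith
  qed
  show ?thesis
  proof (rule that[OF y1 y2 y3])
    fix f :: "'a \<Rightarrow> ennreal" and r :: real assume f: "f \<in> borel_measurable borel" and r: "0 < r"
    let ?I = "\<integral>\<^sup>+x. f x \<partial>affine_lebesgue (affine hull K)"
    have "ennreal (cyl_l ?k c * r ^ c) * ?I = ennreal ((7 / 8) ^ ?k) * (ennreal ((2 / (real c + 1)) ^ c * r ^ c) * ?I)"
      unfolding cyl_l_def mult.assoc by (subst ennreal_mult') (auto simp: mult_ac)
    also have "\<dots> \<le> ennreal \<kappa> * (\<integral>\<^sup>+x. f (a + P x) * indicator (cball 0 r) (x - P x) \<partial>lborel)"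
      by (intro mult_mono ennreal_leI \<kappa> a(2) f r) auto
    also have "\<dots> \<le> ennreal \<kappa> * (\<integral>\<^sup>+z. f (a + P z) * indicator (cball 0 r) ((z - P z) - P0 (z - P z)) \<partial>lborel)"
      by (intro mult_left_mono nn_integral_mono) (auto simp: indicator_def intro: order_trans[OF Q1])
    finally show "ennreal (cyl_l ?k c * r ^ c) * ?I \<le> (\<integral>\<^sup>+x. f (y x) * indicator (cball 0 r) (x - y x) \<partial>lborel)"
      by (simp only: trans[OF f])
    have "(\<integral>\<^sup>+z. f (a + P z) * indicator (cball 0 r) ((z - P z) - P0 (z - P z)) \<partial>lborel)
        \<le> (\<integral>\<^sup>+x. f (a + P x) * indicator (cball 0 (2 * r)) (x - P x) \<partial>lborel)"
      by (intro nn_integral_mono mult_left_mono) (auto simp: indicator_def intro: order_trans[OF Q2])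
    also have "\<dots> \<le> ennreal (2 ^ c * (2 * r) ^ c) * ?I" using r by (intro a(3) f) auto
    finally have "(\<integral>\<^sup>+x. f (y x) * indicator (cball 0 r) (x - y x) \<partial>lborel) \<le> ennreal ((9 / 8) ^ ?k) * (ennreal (2 ^ c * (2 * r) ^ c) * ?I)"
      unfolding trans[OF f] by (intro mult_mono ennreal_leI \<kappa>) auto
    also have "\<dots> = ennreal (cyl_u ?k c * r ^ c) * ?I"
    proof -
      have "cyl_u ?k c * r ^ c = (9 / 8) ^ ?k * (2 ^ c * (2 * r) ^ c)"
        by (simp add: cyl_u_def power_mult_distrib) (simp flip: power_mult_distrib)
      moreover have "ennreal ((9 / 8) ^ ?k * (2 ^ c * (2 * r) ^ c)) = ennreal ((9 / 8) ^ ?k) * ennreal (2 ^ c * (2 * r) ^ c)"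
        by (rule ennreal_mult') simp
      ultimately show ?thesis by (simp only: mult.assoc)
    qed
    finally show "(\<integral>\<^sup>+x. f (y x) * indicator (cball 0 r) (x - y x) \<partial>lborel) \<le> ennreal (cyl_u ?k c * r ^ c) * ?I" .
  qed
qed

section \<open>Surface integrals\<close>

text \<open>Pulled back along the affine projection, \<open>K\<close> becomes a convex set of full
  dimension type whose frontier contains the pulled-back relative boundary, and frontiers of convex
  sets are negligible. The cylinder estimate carries the null set back to the affine hull.\<close>

lemma affine_lebesgue_rel_boundary:
  fixes K :: "'a::euclidean_space set"
  assumes K: "K \<noteq> {}" "convex K" "closed K"
  shows "emeasure (affine_lebesgue (affine hull K)) (K - rel_interior K) = 0"
proof -
  let ?P = "orth_proj (parallel_space K)"
  have sub: "subspace (parallel_space K)" by (rule subspace_parallel_space[OF K(1)])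
  define c where "c = DIM('a) - dim (parallel_space K)"
  have c: "c + dim (parallel_space K) = DIM('a)" using dim_subset_UNIV[of "parallel_space K"] by (simp add: c_def)
  have "\<exists>a. a \<in> affine hull K \<and> (\<forall>f r. f \<in> borel_measurable borel \<longrightarrow> 0 < r \<longrightarrow> ennreal ((2 / (real c + 1)) ^ c * r ^ c) * (\<integral>\<^sup>+x. f x \<partial>affine_lebesgue (affine hull K))
        \<le> (\<integral>\<^sup>+x. f (a + ?P x) * indicator (cball 0 r) (x - ?P x) \<partial>lborel))"
  proof (rule affine_lebesgue_cylinder[OF K(1) c])
    fix a assume "a \<in> affine hull K" "\<And>f r. f \<in> borel_measurable borel \<Longrightarrow> 0 < r \<Longrightarrow> ennreal ((2 / (real c + 1)) ^ c * r ^ c) * (\<integral>\<^sup>+x. f x \<partial>affine_lebesgue (affine hull K))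
        \<le> (\<integral>\<^sup>+x. f (a + ?P x) * indicator (cball 0 r) (x - ?P x) \<partial>lborel)" "\<And>f r. f \<in> borel_measurable borel \<Longrightarrow> 0 < r \<Longrightarrow> (\<integral>\<^sup>+x. f (a + ?P x) * indicator (cball 0 r) (x - ?P x) \<partial>lborel)
        \<le> ennreal (2 ^ c * r ^ c) * (\<integral>\<^sup>+x. f x \<partial>affine_lebesgue (affine hull K))"
    then show ?thesis by (intro exI[of _ a] conjI allI impI)
  qed
  then obtain a where aa: "a \<in> affine hull K" "\<forall>f r. f \<in> borel_measurable borel \<longrightarrow> 0 < r \<longrightarrow> ennreal ((2 / (real c + 1)) ^ c * r ^ c) * (\<integral>\<^sup>+x. f x \<partial>affine_lebesgue (affine hull K))
        \<le> (\<integral>\<^sup>+x. f (a + ?P x) * indicator (cball 0 r) (x - ?P x) \<partial>lborel)"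
    by (elim exE conjE)
  then have a: "a \<in> affine hull K" "\<And>f r. f \<in> borel_measurable borel \<Longrightarrow> 0 < r \<Longrightarrow> ennreal ((2 / (real c + 1)) ^ c * r ^ c) * (\<integral>\<^sup>+x. f x \<partial>affine_lebesgue (affine hull K))
        \<le> (\<integral>\<^sup>+x. f (a + ?P x) * indicator (cball 0 r) (x - ?P x) \<partial>lborel)"
    by simp_all
  have cont: "continuous_on UNIV (\<lambda>x. a + ?P x)"
    using orth_proj_linear[OF sub] by (intro continuous_intros linear_continuous_on) (simp add: linear_conv_bounded_linear)
  define S where "S = (\<lambda>x. a + ?P x) -` K"
  have clS: "closed S" unfolding S_def using K(3) cont by (rule closed_vimage)
  have "convex S"
  proof (rule convexI)
    fix x y and u w :: real assume *: "x \<in> S" "y \<in> S" "0 \<le> u" "0 \<le> w" "u + w = 1"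
    have "a + ?P (u *\<^sub>R x + w *\<^sub>R y) = u *\<^sub>R (a + ?P x) + w *\<^sub>R (a + ?P y)"
      using orth_proj_linear[OF sub] *(5)
      by (simp add: linear_add linear_scale scaleR_add_right) (metis scaleR_add_left scaleR_one add.assoc add.commute)
    then show "u *\<^sub>R x + w *\<^sub>R y \<in> S" using * K(2) by (simp add: S_def convexD)
  qed
  have ri_borel: "K - rel_interior K \<in> sets borel"
    using K(3) borel_closed closed_affine_hull by (metis Diff_eq rel_interior_subset_closure closed_rel_frontier rel_frontier_def closure_closed borel_closed)
  have sub2: "(\<lambda>x. a + ?P x) -` (K - rel_interior K) \<subseteq> frontier S"
  proof -
    obtain U where U: "open U" "rel_interior K = affine hull K \<inter> U"
      using openin_rel_interior[of K] by (auto simp: openin_open)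
    have in_hull: "a + ?P x \<in> affine hull K" for x
      using parallel_space_add[OF a(1) orth_proj(1)[OF sub]] .
    have "interior S \<subseteq> (\<lambda>x. a + ?P x) -` rel_interior K"
    proof
      fix x assume x: "x \<in> interior S"
      then obtain e where e: "0 < e" "ball x e \<subseteq> S" by (auto simp: mem_interior)
      have "a + ?P x \<in> rel_interior K"
        unfolding mem_rel_interior_ball
      proof (intro conjI exI[of _ e])
        have "x \<in> S" using x interior_subset by blast
        then show "a + ?P x \<in> K" by (simp add: S_def)
        show "ball (a + ?P x) e \<inter> affine hull K \<subseteq> K"
        proof
          fix y assume y: "y \<in> ball (a + ?P x) e \<inter> affine hull K"
          have "y - (a + ?P x) \<in> parallel_space K" using y in_hull by (auto simp: parallel_space_def)
          then have id: "?P (y - (a + ?P x)) = y - (a + ?P x)" by (rule orth_proj_id[OF sub])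
          have "x + (y - (a + ?P x)) \<in> ball x e" using y by (simp add: dist_norm norm_minus_commute)
          then have "x + (y - (a + ?P x)) \<in> S" using e by blast
          then have "a + (?P x + ?P (y - (a + ?P x))) \<in> K" by (simp add: S_def linear_add[OF orth_proj_linear[OF sub]])
          then show "y \<in> K" unfolding id by (simp add: algebra_simps)
        qed
      qed (use e in auto)
      then show "x \<in> (\<lambda>x. a + ?P x) -` rel_interior K" by simp
    qed
    moreover have "(\<lambda>x. a + ?P x) -` rel_interior K \<subseteq> interior S"
    proof (rule interior_maximal)
      show "(\<lambda>x. a + ?P x) -` rel_interior K \<subseteq> S" using rel_interior_subset[of K] by (auto simp: S_def)
      have "(\<lambda>x. a + ?P x) -` rel_interior K = (\<lambda>x. a + ?P x) -` U" using U(2) in_hull by auto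
      then show "open ((\<lambda>x. a + ?P x) -` rel_interior K)" using open_vimage[OF U(1) cont] by simp
    qed
    ultimately show ?thesis using clS by (auto simp: frontier_def S_def)
  qed
  have "negligible ((\<lambda>x. a + ?P x) -` (K - rel_interior K))"
    using negligible_convex_frontier[OF \<open>convex S\<close>] sub2 by (rule negligible_subset)
  moreover have meas: "(\<lambda>x. a + ?P x) -` (K - rel_interior K) \<in> sets borel"
    using measurable_sets_borel[OF borel_measurable_continuous_onI[OF cont] ri_borel] .
  ultimately have null: "emeasure lborel ((\<lambda>x. a + ?P x) -` (K - rel_interior K)) = 0"
    by (simp add: negligible_iff_null_sets null_sets_def)
  have "ennreal ((2 / (real c + 1)) ^ c * 1 ^ c) * (\<integral>\<^sup>+x. indicator (K - rel_interior K) x \<partial>affine_lebesgue (affine hull K))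
      \<le> (\<integral>\<^sup>+x. indicator (K - rel_interior K) (a + ?P x) * indicator (cball 0 1) (x - ?P x) \<partial>lborel)"
    using ri_borel by (intro a(2)) auto
  also have "\<dots> \<le> (\<integral>\<^sup>+x. indicator ((\<lambda>x. a + ?P x) -` (K - rel_interior K)) x \<partial>lborel)"
    by (intro nn_integral_mono) (auto simp: indicator_def)
  also have "\<dots> = 0" using meas null by simp
  finally have "ennreal ((2 / (real c + 1)) ^ c) * emeasure (affine_lebesgue (affine hull K)) (K - rel_interior K) = 0"
    using ri_borel by simp
  moreover have "ennreal ((2 / (real c + 1)) ^ c) \<noteq> 0" by (simp add: ennreal_eq_0_iff not_le)
  ultimately show ?thesis by simp
qed

locale surface_mesh = surface \<Gamma> \<delta> A \<epsilon> R0 \<K> for \<Gamma> :: "'a::euclidean_space set" and \<delta> A \<epsilon> R0 \<K> +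
  fixes c :: nat
  assumes dimK: "\<And>K. K \<in> \<K> \<Longrightarrow> c + dim (parallel_space K) = DIM('a)"
    and disjK: "\<And>K K'. K \<in> \<K> \<Longrightarrow> K' \<in> \<K> \<Longrightarrow> K \<noteq> K' \<Longrightarrow> rel_interior K \<inter> rel_interior K' = {}"
    and \<epsilon>16: "16 * \<epsilon> \<le> R0"
begin

abbreviation \<mu> :: "'a set \<Rightarrow> 'a measure" where "\<mu> K \<equiv> affine_lebesgue (affine hull K)"

lemma closedK: "K \<in> \<K> \<Longrightarrow> closed K" using compactK compact_imp_closed by blast

lemma K_borel: "K \<in> \<K> \<Longrightarrow> K \<in> sets borel" using closedK borel_closed by blast

lemma ri_borel: assumes "K \<in> \<K>" shows "rel_interior K \<in> sets borel"
proof -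
  obtain U where U: "open U" "rel_interior K = affine hull K \<inter> U"
    using openin_rel_interior[of K] by (auto simp: openin_open)
  then show ?thesis using closed_affine_hull borel_closed borel_open by auto
qed

lemma AE_ri: assumes K: "K \<in> \<K>" shows "AE x in \<mu> K. x \<in> K \<longrightarrow> x \<in> rel_interior K"
proof (rule AE_I)
  show "{x \<in> space (\<mu> K). \<not> (x \<in> K \<longrightarrow> x \<in> rel_interior K)} \<subseteq> K - rel_interior K" by auto
  show "emeasure (\<mu> K) (K - rel_interior K) = 0"
    by (rule affine_lebesgue_rel_boundary[OF neK[OF K] convexK[OF K] closedK[OF K]])
  show "K - rel_interior K \<in> sets (\<mu> K)" using K_borel[OF K] ri_borel[OF K] by auto
qed

text \<open>A direction \<open>w\<close> of a cell near \<open>q0\<close> annihilated by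
  \<open>PG q0\<close> would satisfy \<open>norm w \<le> norm w / 8\<close>. Injectivity on the
  affine hull is what identifies the oblique projection of \<open>cylinder\<close> with the graph
  map \<open>Yc\<close>.\<close>

lemma aff_eq:
  assumes q0: "q0 \<in> \<Gamma>" and K: "K \<in> \<K>" "z \<in> K" "norm (z - q0) \<le> 6 * R0"
    and y: "y \<in> affine hull K" "y' \<in> affine hull K" "PG q0 y = PG q0 y'"
  shows "y = y'"
proof -
  have sub: "subspace (parallel_space K)" by (rule subspace_parallel_space[OF neK[OF K(1)]])
  have "y - y' \<in> parallel_space K" using y by (auto simp: parallel_space_def)
  then have "orth_proj (parallel_space K) (y - y') = y - y'" by (rule orth_proj_id[OF sub])
  moreover have "PG q0 (y - y') = 0" using y(3) by (simp add: linear_diff[OF PG(1)[OF q0]])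
  ultimately show ?thesis using cell_proj_close[OF q0 K, of "y - y'"] by (simp add: norm_minus_commute)
qed

definition chart_proj :: "'a \<Rightarrow> 'a set \<Rightarrow> ('a \<Rightarrow> 'a) \<Rightarrow> bool" where
  "chart_proj q0 K y \<longleftrightarrow> y \<in> borel_measurable borel \<and> (\<forall>x. y x \<in> affine hull K) \<and> (\<forall>x. PG q0 (y x) = PG q0 x) \<and>
    (\<forall>f r. f \<in> borel_measurable borel \<longrightarrow> 0 < r \<longrightarrow> ennreal (cyl_l DIM('a) c * r ^ c) * (\<integral>\<^sup>+x. f x \<partial>\<mu> K) \<le> (\<integral>\<^sup>+x. f (y x) * indicator (cball 0 r) (x - y x) \<partial>lborel)) \<and>
    (\<forall>f r. f \<in> borel_measurable borel \<longrightarrow> 0 < r \<longrightarrow> (\<integral>\<^sup>+x. f (y x) * indicator (cball 0 r) (x - y x) \<partial>lborel) \<le> ennreal (cyl_u DIM('a) c * r ^ c) * (\<integral>\<^sup>+x. f x \<partial>\<mu> K))"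

lemma chart_proj_exists:
  assumes q0: "q0 \<in> \<Gamma>" and K: "K \<in> \<K>" "z \<in> K" "norm (z - q0) \<le> 6 * R0"
  shows "\<exists>y. chart_proj q0 K y"
proof (rule cylinder[OF neK[OF K(1)] dimK[OF K(1)] PG(1-3)[OF q0] cell_proj_close[OF q0 K]])
  fix y
  assume "y \<in> borel_measurable borel" "\<And>x. y x \<in> affine hull K" "\<And>x. PG q0 (y x) = PG q0 x"
    "\<And>f r. f \<in> borel_measurable borel \<Longrightarrow> 0 < r \<Longrightarrow>
      ennreal (cyl_l DIM('a) c * r ^ c) * (\<integral>\<^sup>+x. f x \<partial>\<mu> K)
        \<le> (\<integral>\<^sup>+x. f (y x) * indicator (cball 0 r) (x - y x) \<partial>lborel)"
    "\<And>f r. f \<in> borel_measurable borel \<Longrightarrow> 0 < r \<Longrightarrow>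
      (\<integral>\<^sup>+x. f (y x) * indicator (cball 0 r) (x - y x) \<partial>lborel)
        \<le> ennreal (cyl_u DIM('a) c * r ^ c) * (\<integral>\<^sup>+x. f x \<partial>\<mu> K)"
  then show ?thesis unfolding chart_proj_def by (intro exI[of _ y] conjI allI impI)
qed

text \<open>\<open>Yc\<close> fixes \<open>y0\<close> and at most doubles distances, so a point
  \<open>x\<close> of the ball is within \<open>3 * \<rho>\<close> of \<open>Yc q0 x\<close>. If the
  latter lies in \<open>K\<close>, then \<open>x\<close> belongs to the cylinder of that radius, on
  which \<open>y\<close> and \<open>Yc\<close> agree.\<close>

lemma surface_upper:
  assumes q0: "q0 \<in> \<Gamma>" and y0: "y0 \<in> \<Gamma>h" and \<rho>: "0 < \<rho>" "norm (y0 - q0) + \<rho> \<le> R0" and K: "K \<in> \<K>"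
    and f: "f \<in> borel_measurable borel"
  shows "(\<integral>\<^sup>+x. f (Yc q0 x) * indicator {x \<in> ball y0 \<rho>. Yc q0 x \<in> K} x \<partial>lborel)
    \<le> ennreal (cyl_u DIM('a) c * (3 * \<rho>) ^ c) * (\<integral>\<^sup>+x. f x * indicator K x \<partial>\<mu> K)"
proof (cases "{x \<in> ball y0 \<rho>. Yc q0 x \<in> K} = {}")
  case True
  then show ?thesis by simp
next
  case False
  have inR: "norm (x - q0) < R0" if "x \<in> ball y0 \<rho>" for x
    using that \<rho> norm_triangle_ineq[of "x - y0" "y0 - q0"] by (simp add: dist_norm norm_minus_commute)
  obtain x1 where x1: "x1 \<in> ball y0 \<rho>" "Yc q0 x1 \<in> K" using False by auto
  have z: "norm (Yc q0 x1 - q0) \<le> 6 * R0" using Yc(2)[OF q0 inR[OF x1(1)]] .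
  obtain y where cp: "chart_proj q0 K y" using chart_proj_exists[OF q0 K x1(2) z] by blast
  then have y: "y \<in> borel_measurable borel" "\<And>x. y x \<in> affine hull K" "\<And>x. PG q0 (y x) = PG q0 x"
    "\<And>f r. f \<in> borel_measurable borel \<Longrightarrow> 0 < r \<Longrightarrow>
      (\<integral>\<^sup>+x. f (y x) * indicator (cball 0 r) (x - y x) \<partial>lborel)
        \<le> ennreal (cyl_u DIM('a) c * r ^ c) * (\<integral>\<^sup>+x. f x \<partial>\<mu> K)"
    unfolding chart_proj_def by simp_all
  have [measurable]: "K \<in> sets borel" "f \<in> borel_measurable borel" using K_borel[OF K] f by auto
  have "(\<integral>\<^sup>+x. f (Yc q0 x) * indicator {x \<in> ball y0 \<rho>. Yc q0 x \<in> K} x \<partial>lborel)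
      \<le> (\<integral>\<^sup>+x. (f (y x) * indicator K (y x)) * indicator (cball 0 (3 * \<rho>)) (x - y x) \<partial>lborel)"
  proof (intro nn_integral_mono)
    fix x
    show "f (Yc q0 x) * indicator {x \<in> ball y0 \<rho>. Yc q0 x \<in> K} x
      \<le> (f (y x) * indicator K (y x)) * indicator (cball 0 (3 * \<rho>)) (x - y x)"
    proof (cases "x \<in> ball y0 \<rho> \<and> Yc q0 x \<in> K")
      case True
      then have x: "x \<in> ball y0 \<rho>" "Yc q0 x \<in> K" by auto
      have e: "y x = Yc q0 x"
        using x(2) by (intro aff_eq[OF q0 K x1(2) z y(2)]) (auto simp: y(3) Yc(3)[OF q0 inR[OF x(1)]] intro: hull_inc)
      have "norm (y0 - q0) < R0" using \<rho> by simp
      then have "norm (Yc q0 x - y0) \<le> 2 * norm (x - y0)"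
        using Yc_lip[OF q0 inR[OF x(1)], of y0] Yc_self[OF q0 y0] by simp
      moreover have "norm (x - y0) < \<rho>" using x(1) by (simp add: dist_norm norm_minus_commute)
      moreover have "norm (x - Yc q0 x) \<le> norm (x - y0) + norm (Yc q0 x - y0)"
        using norm_triangle_ineq4[of "x - y0" "Yc q0 x - y0"] by simp
      ultimately have "norm (x - Yc q0 x) \<le> 3 * \<rho>" by linarith
      then show ?thesis using x e by simp
    qed (auto simp: indicator_def)
  qed
  also have "\<dots> \<le> ennreal (cyl_u DIM('a) c * (3 * \<rho>) ^ c) * (\<integral>\<^sup>+x. f x * indicator K x \<partial>\<mu> K)"
    using \<rho> by (intro y(4)) auto
  finally show ?thesis .
qed

text \<open>The cylinder of radius \<open>R0 / 4\<close> over points within \<open>R0 / 4\<close> of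
  \<open>q0\<close> stays in the ball of radius \<open>R0 / 2\<close>. Passing to relative interiors
  loses only a null set and makes the right-hand sets of different cells disjoint, so that summation
  over cells costs no factor (\<open>sum_ri_le\<close>).\<close>

lemma surface_lower:
  assumes q0: "q0 \<in> \<Gamma>" and K: "K \<in> \<K>" and f: "f \<in> borel_measurable borel"
  shows "ennreal (cyl_l DIM('a) c * (R0 / 4) ^ c) * (\<integral>\<^sup>+x. f x * indicator (K \<inter> ball q0 (R0 / 4)) x \<partial>\<mu> K)
    \<le> (\<integral>\<^sup>+x. f (Yc q0 x) * indicator {x \<in> ball q0 (R0 / 2). Yc q0 x \<in> rel_interior K} x \<partial>lborel)"
proof (cases "K \<inter> ball q0 (R0 / 4) = {}")
  case True
  then show ?thesis by simp
next
  case False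
  then obtain z where z: "z \<in> K" "norm (z - q0) < R0 / 4" by (auto simp: dist_norm norm_minus_commute)
  then have z6: "norm (z - q0) \<le> 6 * R0" using R0 by simp
  obtain y where cp: "chart_proj q0 K y" using chart_proj_exists[OF q0 K z(1) z6] by blast
  then have y: "y \<in> borel_measurable borel" "\<And>x. y x \<in> affine hull K" "\<And>x. PG q0 (y x) = PG q0 x"
    "\<And>f r. f \<in> borel_measurable borel \<Longrightarrow> 0 < r \<Longrightarrow>
      ennreal (cyl_l DIM('a) c * r ^ c) * (\<integral>\<^sup>+x. f x \<partial>\<mu> K)
        \<le> (\<integral>\<^sup>+x. f (y x) * indicator (cball 0 r) (x - y x) \<partial>lborel)"
    unfolding chart_proj_def by simp_all
  have [measurable]: "K \<in> sets borel" "rel_interior K \<in> sets borel" "f \<in> borel_measurable borel"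
    using K_borel[OF K] ri_borel[OF K] f by auto
  have "(\<integral>\<^sup>+x. f x * indicator (K \<inter> ball q0 (R0 / 4)) x \<partial>\<mu> K)
      = (\<integral>\<^sup>+x. f x * indicator (rel_interior K \<inter> ball q0 (R0 / 4)) x \<partial>\<mu> K)"
    using AE_ri[OF K] rel_interior_subset[of K] by (intro nn_integral_cong_AE) (auto simp: indicator_def elim!: eventually_mono)
  then have "ennreal (cyl_l DIM('a) c * (R0 / 4) ^ c) * (\<integral>\<^sup>+x. f x * indicator (K \<inter> ball q0 (R0 / 4)) x \<partial>\<mu> K)
    \<le> (\<integral>\<^sup>+x. (f (y x) * indicator (rel_interior K \<inter> ball q0 (R0 / 4)) (y x)) * indicator (cball 0 (R0 / 4)) (x - y x) \<partial>lborel)"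
  proof (simp only:, intro y(4))
    show "(\<lambda>x. f x * indicator (rel_interior K \<inter> ball q0 (R0 / 4)) x) \<in> borel_measurable borel"
      by (intro borel_measurable_times_ennreal f borel_measurable_indicator) (use ri_borel[OF K] in auto)
  qed (use R0 in simp)
  also have "\<dots> \<le> (\<integral>\<^sup>+x. f (Yc q0 x) * indicator {x \<in> ball q0 (R0 / 2). Yc q0 x \<in> rel_interior K} x \<partial>lborel)"
  proof (intro nn_integral_mono)
    fix x
    show "(f (y x) * indicator (rel_interior K \<inter> ball q0 (R0 / 4)) (y x)) * indicator (cball 0 (R0 / 4)) (x - y x)
      \<le> f (Yc q0 x) * indicator {x \<in> ball q0 (R0 / 2). Yc q0 x \<in> rel_interior K} x"
    proof (cases "y x \<in> rel_interior K \<inter> ball q0 (R0 / 4) \<and> x - y x \<in> cball 0 (R0 / 4)")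
      case True
      then have 1: "y x \<in> rel_interior K" "norm (y x - q0) < R0 / 4" "norm (x - y x) \<le> R0 / 4"
        by (auto simp: dist_norm norm_minus_commute)
      have 2: "norm (x - q0) < R0 / 2" using 1 norm_triangle_ineq[of "x - y x" "y x - q0"] by simp
      have "y x \<in> K" using 1 rel_interior_subset by blast
      then have "Yc q0 x = y x" using 1 2 R0 K y(3) by (intro Yc_unique[OF q0]) auto
      then show ?thesis using 1 2 by (simp add: dist_norm norm_minus_commute)
    qed (auto simp: indicator_def)
  qed
  finally show ?thesis .
qed

lemma sum_ri_le:
  "(\<Sum>K\<in>\<K>. indicator {x \<in> B. g x \<in> rel_interior K} x) \<le> (indicator B x :: ennreal)"
proof (cases "\<exists>K\<in>\<K>. x \<in> B \<and> g x \<in> rel_interior K")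
  case True
  then obtain K where K: "K \<in> \<K>" "x \<in> B" "g x \<in> rel_interior K" by auto
  have "(\<Sum>K\<in>\<K>. indicator {x \<in> B. g x \<in> rel_interior K} x) = (\<Sum>K'\<in>\<K>. if K' = K then 1 else (0::ennreal))"
    using disjK K by (intro sum.cong refl) (auto simp: indicator_def)
  also have "\<dots> = 1" using finK K by simp
  finally show ?thesis using K by simp
next
  case False
  then have "(\<Sum>K\<in>\<K>. indicator {x \<in> B. g x \<in> rel_interior K} x) = (0::ennreal)"
    by (intro sum.neutral) (auto simp: indicator_def)
  then show ?thesis by simp
qed

end

section \<open>The Poincare inequality on the discrete manifold\<close>

lemma nn_integral_affine_scale:
  fixes g :: "'a::euclidean_space \<Rightarrow> ennreal"
  assumes g[measurable]: "g \<in> borel_measurable borel" and t: "t \<noteq> 0"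
  shows "(\<integral>\<^sup>+x. g x \<partial>lborel) = ennreal (\<bar>t\<bar> ^ DIM('a)) * (\<integral>\<^sup>+x. g (y + t *\<^sub>R x) \<partial>lborel)"
  by (subst lborel_affine[OF t, of y]) (simp add: nn_integral_density nn_integral_distr nn_integral_cmult)

lemma nn_integral_affine_scale_le:
  fixes Z :: "'a::euclidean_space set"
  assumes Z[measurable]: "Z \<in> sets borel" and t: "1 / 2 \<le> t"
  shows "(\<integral>\<^sup>+x. indicator Z (y + t *\<^sub>R x) \<partial>lborel) \<le> ennreal (2 ^ DIM('a)) * emeasure lborel Z"
proof -
  have "1 \<le> (2 * t) ^ DIM('a)" using t by (intro one_le_power) auto
  then have 1: "(1::ennreal) \<le> ennreal (2 ^ DIM('a)) * ennreal (\<bar>t\<bar> ^ DIM('a))"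
    using t by (simp add: power_mult_distrib flip: ennreal_mult' ennreal_1)
  have "(\<integral>\<^sup>+x. indicator Z (y + t *\<^sub>R x) \<partial>lborel) \<le> (ennreal (2 ^ DIM('a)) * ennreal (\<bar>t\<bar> ^ DIM('a))) * (\<integral>\<^sup>+x. indicator Z (y + t *\<^sub>R x) \<partial>lborel)"
    using mult_right_mono[OF 1] by simp
  also have "\<dots> = ennreal (2 ^ DIM('a)) * (\<integral>\<^sup>+x. indicator Z x \<partial>lborel)"
    using t by (subst nn_integral_affine_scale[where t=t and y=y]) (auto simp: mult.assoc)
  finally show ?thesis by simp
qed

text \<open>The classical trick for the Poincare inequality on convex sets: for
  \<open>t \<ge> 1 / 2\<close> substitute in \<open>x\<close>, otherwise in \<open>x'\<close>. The
  Jacobian is then at least \<open>2 ^ (- k)\<close>, so no point of the segment becomes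
  singular.\<close>

lemma segment_average:
  fixes Z B :: "'a::euclidean_space set"
  assumes Z[measurable]: "Z \<in> sets borel" and B[measurable]: "B \<in> sets borel"
  shows "(\<integral>\<^sup>+x'. \<integral>\<^sup>+x. (\<integral>\<^sup>+t. indicator Z (x' + t *\<^sub>R (x - x')) * indicator {0..1::real} t \<partial>lborel) * indicator B x * indicator B x' \<partial>lborel \<partial>lborel)
    \<le> ennreal (2 ^ DIM('a)) * emeasure lborel B * emeasure lborel Z"
proof -
  let ?g = "\<lambda>t x x'. indicator Z (x' + t *\<^sub>R (x - x')) * (indicator B x * indicator B x') * indicator {0..1::real} t :: ennreal"
  let ?C = "ennreal (2 ^ DIM('a)) * emeasure lborel B * emeasure lborel Z"
  have [measurable]: "(\<lambda>(t, x, x'). ?g t x x') \<in> borel_measurable (borel \<Otimes>\<^sub>M borel \<Otimes>\<^sub>M borel)" by measurable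
  have bound: "(\<integral>\<^sup>+x'. \<integral>\<^sup>+x. ?g t x x' \<partial>lborel \<partial>lborel) \<le> ?C * indicator {0..1} t" for t
  proof (cases "t \<in> {0..1}")
    case False
    then show ?thesis by simp
  next
    case True
    show ?thesis
    proof (cases "1 / 2 \<le> t")
      case half: True
      have "(\<integral>\<^sup>+x'. \<integral>\<^sup>+x. ?g t x x' \<partial>lborel \<partial>lborel) \<le> (\<integral>\<^sup>+x'. ennreal (2 ^ DIM('a)) * emeasure lborel Z * indicator B x' \<partial>lborel)"
      proof (intro nn_integral_mono)
        fix x'
        have "(\<integral>\<^sup>+x. ?g t x x' \<partial>lborel) \<le> (\<integral>\<^sup>+x. indicator Z ((1 - t) *\<^sub>R x' + t *\<^sub>R x) * indicator B x' \<partial>lborel)"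
          by (intro nn_integral_mono) (auto simp: indicator_def algebra_simps)
        also have "\<dots> = (\<integral>\<^sup>+x. indicator Z ((1 - t) *\<^sub>R x' + t *\<^sub>R x) \<partial>lborel) * indicator B x'"
          by (rule nn_integral_multc) measurable
        also have "\<dots> \<le> ennreal (2 ^ DIM('a)) * emeasure lborel Z * indicator B x'"
          by (intro mult_right_mono nn_integral_affine_scale_le half Z) auto
        finally show "(\<integral>\<^sup>+x. ?g t x x' \<partial>lborel) \<le> ennreal (2 ^ DIM('a)) * emeasure lborel Z * indicator B x'" .
      qed
      also have "\<dots> = ?C" by (subst nn_integral_cmult) (auto simp: mult_ac)
      finally show ?thesis using True by simp
    next
      case half: False
      have "(\<integral>\<^sup>+x'. \<integral>\<^sup>+x. ?g t x x' \<partial>lborel \<partial>lborel) = (\<integral>\<^sup>+x. \<integral>\<^sup>+x'. ?g t x x' \<partial>lborel \<partial>lborel)"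
        by (rule lborel_pair.Fubini') measurable
      also have "\<dots> \<le> (\<integral>\<^sup>+x. ennreal (2 ^ DIM('a)) * emeasure lborel Z * indicator B x \<partial>lborel)"
      proof (intro nn_integral_mono)
        fix x
        have "(\<integral>\<^sup>+x'. ?g t x x' \<partial>lborel) \<le> (\<integral>\<^sup>+x'. indicator Z (t *\<^sub>R x + (1 - t) *\<^sub>R x') * indicator B x \<partial>lborel)"
          by (intro nn_integral_mono) (auto simp: indicator_def algebra_simps)
        also have "\<dots> = (\<integral>\<^sup>+x'. indicator Z (t *\<^sub>R x + (1 - t) *\<^sub>R x') \<partial>lborel) * indicator B x"
          by (rule nn_integral_multc) measurable
        also have "\<dots> \<le> ennreal (2 ^ DIM('a)) * emeasure lborel Z * indicator B x"
          using half by (intro mult_right_mono nn_integral_affine_scale_le Z) auto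
        finally show "(\<integral>\<^sup>+x'. ?g t x x' \<partial>lborel) \<le> ennreal (2 ^ DIM('a)) * emeasure lborel Z * indicator B x" .
      qed
      also have "\<dots> = ?C" by (subst nn_integral_cmult) (auto simp: mult_ac)
      finally show ?thesis using True by simp
    qed
  qed
  have "(\<integral>\<^sup>+x'. \<integral>\<^sup>+x. (\<integral>\<^sup>+t. indicator Z (x' + t *\<^sub>R (x - x')) * indicator {0..1::real} t \<partial>lborel) * indicator B x * indicator B x' \<partial>lborel \<partial>lborel)
      = (\<integral>\<^sup>+x'. \<integral>\<^sup>+x. (\<integral>\<^sup>+t. ?g t x x' \<partial>lborel) \<partial>lborel \<partial>lborel)"
  proof (intro nn_integral_cong)
    fix x' x
    have "(\<integral>\<^sup>+t. ?g t x x' \<partial>lborel) = (\<integral>\<^sup>+t. (indicator Z (x' + t *\<^sub>R (x - x')) * indicator {0..1::real} t) * (indicator B x * indicator B x') \<partial>lborel)"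
      by (intro nn_integral_cong) (simp add: mult_ac)
    also have "\<dots> = (\<integral>\<^sup>+t. indicator Z (x' + t *\<^sub>R (x - x')) * indicator {0..1::real} t \<partial>lborel) * (indicator B x * indicator B x')"
      by (rule nn_integral_multc) measurable
    finally show "(\<integral>\<^sup>+t. indicator Z (x' + t *\<^sub>R (x - x')) * indicator {0..1::real} t \<partial>lborel) * indicator B x * indicator B x' = (\<integral>\<^sup>+t. ?g t x x' \<partial>lborel)"
      by (simp add: mult.assoc)
  qed
  also have "\<dots> = (\<integral>\<^sup>+x'. \<integral>\<^sup>+t. (\<integral>\<^sup>+x. ?g t x x' \<partial>lborel) \<partial>lborel \<partial>lborel)"
    by (intro nn_integral_cong lborel_pair.Fubini'[symmetric]) measurable
  also have "\<dots> = (\<integral>\<^sup>+t. \<integral>\<^sup>+x'. (\<integral>\<^sup>+x. ?g t x x' \<partial>lborel) \<partial>lborel \<partial>lborel)"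
    by (rule lborel_pair.Fubini'[symmetric]) measurable
  also have "\<dots> \<le> (\<integral>\<^sup>+t. ?C * indicator {0..1::real} t \<partial>lborel)"
    by (intro nn_integral_mono bound)
  also have "\<dots> = ?C" by (subst nn_integral_cmult) auto
  finally show ?thesis .
qed

lemma exists_below_average:
  fixes \<phi> :: "'a::euclidean_space \<Rightarrow> ennreal"
  assumes \<phi>[measurable]: "\<phi> \<in> borel_measurable borel" and B[measurable]: "B \<in> sets borel"
    and fin: "0 < measure lborel B" "emeasure lborel B < \<infinity>"
    and J: "(\<integral>\<^sup>+x. \<phi> x * indicator B x \<partial>lborel) \<le> emeasure lborel B * j"
  shows "\<exists>x\<in>B. \<phi> x \<le> j"
proof (rule ccontr)
  assume "\<not> ?thesis"
  then have big: "j < \<phi> x" if "x \<in> B" for x using that by (auto simp: not_le)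
  have eB: "emeasure lborel B \<noteq> 0" using fin by (auto simp: measure_def)
  then have "B \<noteq> {}" by auto
  then obtain x0 where "x0 \<in> B" by auto
  have jfin: "j < \<infinity>" using less_le_trans[OF big[OF \<open>x0 \<in> B\<close>] top_greatest] by simp
  have "(\<integral>\<^sup>+x. j * indicator B x \<partial>lborel) < (\<integral>\<^sup>+x. \<phi> x * indicator B x \<partial>lborel)"
  proof (rule nn_integral_less)
    show "(\<integral>\<^sup>+x. j * indicator B x \<partial>lborel) \<noteq> \<infinity>"
      using jfin fin(2) by (simp add: nn_integral_cmult ennreal_mult_eq_top_iff less_top)
    show "AE x in lborel. j * indicator B x \<le> \<phi> x * indicator B x"
      using big by (auto simp: indicator_def intro: less_imp_le)
    show "\<not> (AE x in lborel. \<phi> x * indicator B x \<le> j * indicator B x)"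
    proof
      assume "AE x in lborel. \<phi> x * indicator B x \<le> j * indicator B x"
      then have "AE x in lborel. x \<notin> B"
        by (rule AE_mp) (use big in \<open>auto simp: indicator_def not_less[symmetric]\<close>)
      then have "emeasure lborel B = 0" by (subst (asm) AE_iff_measurable[of B]) auto
      then show False using eB by simp
    qed
  qed measurable
  also have "\<dots> \<le> emeasure lborel B * j" by fact
  finally show False by (simp add: nn_integral_cmult mult.commute)
qed

context surface_mesh begin

lemma Yc_cont:
  assumes q0: "q0 \<in> \<Gamma>" and r: "r \<le> R0" shows "continuous_on (ball q0 r) (Yc q0)"
proof -
  have "2-lipschitz_on (ball q0 r) (Yc q0)"
    by (rule lipschitz_onI) (use Yc_lip[OF q0] r in \<open>auto simp: dist_norm norm_minus_commute\<close>)
  then show ?thesis by (rule lipschitz_on_continuous_on)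
qed

text \<open>Over a cell \<open>Yc\<close> is affine: a convex combination of surface points in
  \<open>K\<close> is again in \<open>K\<close> and lies over the same combination of base points,
  so uniqueness applies. This supplies the intervals required by
  \<open>closed_cover_square\<close>.\<close>

lemma Yc_convex:
  assumes q0: "q0 \<in> \<Gamma>" and K: "K \<in> \<K>" and r: "r \<le> R0"
  shows "convex {x \<in> ball q0 r. Yc q0 x \<in> K}"
proof (rule convexI)
  fix x x' and u w :: real
  assume x: "x \<in> {x \<in> ball q0 r. Yc q0 x \<in> K}" "x' \<in> {x \<in> ball q0 r. Yc q0 x \<in> K}" and uw: "0 \<le> u" "0 \<le> w" "u + w = 1"
  have xb: "u *\<^sub>R x + w *\<^sub>R x' \<in> ball q0 r" using x uw by (intro convexD[OF convex_ball]) auto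
  have nR: "norm (z - q0) < R0" if "z \<in> ball q0 r" for z using that r by (simp add: dist_norm norm_minus_commute)
  have nx: "norm (x - q0) < R0" "norm (x' - q0) < R0" "norm (u *\<^sub>R x + w *\<^sub>R x' - q0) < R0" using x xb nR by auto
  have yK: "u *\<^sub>R Yc q0 x + w *\<^sub>R Yc q0 x' \<in> K" using x uw by (intro convexD[OF convexK[OF K]]) auto
  have "Yc q0 (u *\<^sub>R x + w *\<^sub>R x') = u *\<^sub>R Yc q0 x + w *\<^sub>R Yc q0 x'"
  proof (rule Yc_unique[OF q0 nx(3)])
    show "u *\<^sub>R Yc q0 x + w *\<^sub>R Yc q0 x' \<in> \<Gamma>h" using yK K by auto
    have "u *\<^sub>R Yc q0 x + w *\<^sub>R Yc q0 x' \<in> cball q0 (6 * R0)"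
      using Yc(2)[OF q0 nx(1)] Yc(2)[OF q0 nx(2)] uw
      by (intro convexD[OF convex_cball]) (auto simp: dist_norm norm_minus_commute)
    then show "norm (u *\<^sub>R Yc q0 x + w *\<^sub>R Yc q0 x' - q0) \<le> 6 * R0" by (simp add: dist_norm norm_minus_commute)
    show "PG q0 (u *\<^sub>R Yc q0 x + w *\<^sub>R Yc q0 x') = PG q0 (u *\<^sub>R x + w *\<^sub>R x')"
      using Yc(3)[OF q0 nx(1)] Yc(3)[OF q0 nx(2)] by (simp add: linear_add[OF PG(1)[OF q0]] linear_scale[OF PG(1)[OF q0]])
  qed
  then show "u *\<^sub>R x + w *\<^sub>R x' \<in> {x \<in> ball q0 r. Yc q0 x \<in> K}" using xb yK by simp
qed

definition cell_lip :: "('a \<Rightarrow> real) \<Rightarrow> ('a set \<Rightarrow> real) \<Rightarrow> bool" where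
  "cell_lip v g \<longleftrightarrow> (\<forall>K\<in>\<K>. 0 \<le> g K \<and> (\<forall>y\<in>K. \<forall>y'\<in>K. \<bar>v y - v y'\<bar> \<le> g K * norm (y - y')))"

definition chart_cell :: "'a \<Rightarrow> 'a set \<Rightarrow> 'a set" where
  "chart_cell q0 K = {x \<in> ball q0 (R0 / 2). Yc q0 x \<in> K}"

text \<open>\<open>closed_cover_square\<close> along the segment from \<open>x'\<close> to
  \<open>x\<close>. The factor \<open>4 * R0\<^sup>2\<close> collects the Lipschitz constant 2 of
  \<open>Yc\<close> and the length of the segment, both squared. The time spent over
  \<open>K\<close> is written as an integral so that it can be averaged over both end
  points.\<close>

lemma pair_bound:
  assumes v: "cell_lip v g" and q0: "q0 \<in> \<Gamma>" and x: "x \<in> ball q0 (R0 / 2)" "x' \<in> ball q0 (R0 / 2)"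
  shows "ennreal ((v (Yc q0 x) - v (Yc q0 x'))\<^sup>2) \<le>
    (\<Sum>K\<in>\<K>. ennreal (4 * R0\<^sup>2 * (g K)\<^sup>2) * (\<integral>\<^sup>+t. indicator (chart_cell q0 K) (x' + t *\<^sub>R (x - x')) * indicator {0..1::real} t \<partial>lborel))"
proof -
  define z where "z t = x' + t *\<^sub>R (x - x')" for t :: real
  have zB: "z t \<in> ball q0 (R0 / 2)" if "t \<in> {0..1}" for t
  proof -
    have "(1 - t) *\<^sub>R x' + t *\<^sub>R x \<in> ball q0 (R0 / 2)" using x that by (intro convexD[OF convex_ball]) auto
    then show ?thesis by (simp add: z_def algebra_simps)
  qed
  have zR: "norm (z t - q0) < R0" if "t \<in> {0..1}" for t
    using zB[OF that] R0 by (simp add: dist_norm norm_minus_commute)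
  define S where "S K = {0..1} \<inter> (\<lambda>t. Yc q0 (z t)) -` K" for K
  have Scc: "S K = {0..1} \<inter> z -` chart_cell q0 K" for K using zB by (auto simp: S_def chart_cell_def)
  have cont: "continuous_on {0..1} (\<lambda>t. Yc q0 (z t))"
    by (rule continuous_on_compose2[OF Yc_cont[OF q0, of "R0 / 2"]]) (use zB R0 in \<open>auto simp: z_def intro!: continuous_intros\<close>)
  have xx: "norm (x - x') \<le> R0"
    using x dist_triangle3[of x x' q0] by (simp add: dist_norm norm_minus_commute)
  have Sclosed: "closed (S K)" if "K \<in> \<K>" for K
    unfolding S_def using cont closedK[OF that] by (intro continuous_closed_preimage) auto
  have sq: "(v (Yc q0 (z 1)) - v (Yc q0 (z 0)))\<^sup>2 \<le> (1 - 0) * (\<Sum>K\<in>\<K>. (2 * g K * norm (x - x'))\<^sup>2 * measure lborel (S K \<inter> {0..1}))"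
  proof (rule closed_cover_square[OF finK Sclosed])
    show "convex (S K)" if "K \<in> \<K>" for K
    proof -
      have "convex (chart_cell q0 K)" unfolding chart_cell_def by (rule Yc_convex[OF q0 that]) (use R0 in simp)
      then have cv: "convex (chart_cell q0 K)" .
      show ?thesis
      proof (rule convexI)
        fix s t u w :: real assume *: "s \<in> S K" "t \<in> S K" "0 \<le> u" "0 \<le> w" "u + w = 1"
        have "z (u *\<^sub>R s + w *\<^sub>R t) = u *\<^sub>R z s + w *\<^sub>R z t"
        proof -
          have "u *\<^sub>R x' + w *\<^sub>R x' = x'" using *(5) by (simp flip: scaleR_add_left)
          moreover have "u *\<^sub>R z s + w *\<^sub>R z t = (u *\<^sub>R x' + w *\<^sub>R x') + (u * s + w * t) *\<^sub>R (x - x')"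
            unfolding z_def by (simp only: scaleR_add_right scaleR_scaleR scaleR_add_left add_ac)
          ultimately show ?thesis by (simp add: z_def)
        qed
        moreover have "u *\<^sub>R z s + w *\<^sub>R z t \<in> chart_cell q0 K"
          using * by (intro convexD[OF cv]) (auto simp: Scc)
        moreover have "u *\<^sub>R s + w *\<^sub>R t \<in> {0..1}"
          using * by (intro convexD[OF convex_closed_interval]) (auto simp: Scc)
        ultimately show "u *\<^sub>R s + w *\<^sub>R t \<in> S K" by (simp add: Scc)
      qed
    qed
    show "{0..1} \<subseteq> (\<Union>K\<in>\<K>. S K)" using Yc(1)[OF q0 zR] by (auto simp: S_def)
    fix K s t assume K: "K \<in> \<K>" "s \<in> S K" "t \<in> S K"
    have "\<bar>v (Yc q0 (z s)) - v (Yc q0 (z t))\<bar> \<le> g K * norm (Yc q0 (z s) - Yc q0 (z t))"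
      using v K by (auto simp: cell_lip_def S_def)
    also have "\<dots> \<le> g K * (2 * norm (z s - z t))"
      using v K zR by (intro mult_left_mono Yc_lip[OF q0]) (auto simp: cell_lip_def S_def)
    also have "z s - z t = (s - t) *\<^sub>R (x - x')" by (simp add: z_def algebra_simps)
    finally show "\<bar>v (Yc q0 (z s)) - v (Yc q0 (z t))\<bar> \<le> 2 * g K * norm (x - x') * \<bar>s - t\<bar>" by (simp add: mult_ac)
  qed auto
  also have "\<dots> \<le> (\<Sum>K\<in>\<K>. 4 * R0\<^sup>2 * (g K)\<^sup>2 * measure lborel (S K))"
  proof -
    have "(2 * g K * norm (x - x'))\<^sup>2 * measure lborel (S K \<inter> {0..1}) \<le> 4 * R0\<^sup>2 * (g K)\<^sup>2 * measure lborel (S K)" for K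
    proof -
      have "S K \<inter> {0..1} = S K" by (auto simp: S_def)
      moreover have "(norm (x - x'))\<^sup>2 \<le> R0\<^sup>2" using xx by (intro power_mono) auto
      then have "(2 * g K * norm (x - x'))\<^sup>2 \<le> 4 * R0\<^sup>2 * (g K)\<^sup>2"
        using mult_left_mono[of "(norm (x - x'))\<^sup>2" "R0\<^sup>2" "4 * (g K)\<^sup>2"] by (simp add: power_mult_distrib mult_ac)
      ultimately show ?thesis by (simp add: mult_right_mono)
    qed
    then show ?thesis by (simp add: sum_mono)
  qed
  finally have "ennreal ((v (Yc q0 x) - v (Yc q0 x'))\<^sup>2) \<le> ennreal (\<Sum>K\<in>\<K>. 4 * R0\<^sup>2 * (g K)\<^sup>2 * measure lborel (S K))"
    by (intro ennreal_leI) (simp add: z_def)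
  also have "\<dots> = (\<Sum>K\<in>\<K>. ennreal (4 * R0\<^sup>2 * (g K)\<^sup>2 * measure lborel (S K)))" by (rule sum_ennreal[symmetric]) simp
  also have "\<dots> = (\<Sum>K\<in>\<K>. ennreal (4 * R0\<^sup>2 * (g K)\<^sup>2) * (\<integral>\<^sup>+t. indicator (chart_cell q0 K) (x' + t *\<^sub>R (x - x')) * indicator {0..1::real} t \<partial>lborel))"
  proof (rule sum.cong[OF refl])
    fix K assume K: "K \<in> \<K>"
    have "compact (S K)" using Sclosed[OF K] unfolding S_def by (auto simp: compact_eq_bounded_closed intro: bounded_subset[of "{0..1}"])
    then have fm: "S K \<in> fmeasurable lborel" by (rule fmeasurable_compact)
    have "ennreal (measure lborel (S K)) = emeasure lborel (S K)" using emeasure_eq_measure2[OF fm] by simp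
    also have "\<dots> = (\<integral>\<^sup>+t. indicator (S K) t \<partial>lborel)" using fmeasurableD[OF fm] by simp
    also have "\<dots> = (\<integral>\<^sup>+t. indicator (chart_cell q0 K) (x' + t *\<^sub>R (x - x')) * indicator {0..1::real} t \<partial>lborel)"
      by (intro nn_integral_cong) (auto simp: Scc z_def indicator_def)
    finally show "ennreal (4 * R0\<^sup>2 * (g K)\<^sup>2 * measure lborel (S K)) =
        ennreal (4 * R0\<^sup>2 * (g K)\<^sup>2) * (\<integral>\<^sup>+t. indicator (chart_cell q0 K) (x' + t *\<^sub>R (x - x')) * indicator {0..1::real} t \<partial>lborel)"
      by (simp add: ennreal_mult'')
  qed
  finally show ?thesis .
qed

end

text \<open>Points of \<open>G\<close> reachable from \<open>q0\<close> by steps shorter than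
  \<open>e\<close> and points not reachable are at least \<open>e\<close> apart, so connectedness
  makes all points reachable, and compactness bounds the number of steps. The number
  \<open>n\<close> precedes \<open>m\<close> and \<open>b\<close>: it depends on \<open>G\<close>
  and \<open>e\<close> alone. The chain between two points runs through \<open>q0\<close>, hence
  \<open>2 * n\<close> in the end.\<close>

lemma connected_chain_bound:
  fixes G :: "'a::metric_space set"
  assumes "compact G" "connected G" "0 < e"
  obtains n :: nat where "\<And>(m :: 'a \<Rightarrow> real) b q q'. (\<And>q q'. q \<in> G \<Longrightarrow> q' \<in> G \<Longrightarrow> dist q q' < e \<Longrightarrow> \<bar>m q - m q'\<bar> \<le> b) \<Longrightarrow>
      q \<in> G \<Longrightarrow> q' \<in> G \<Longrightarrow> \<bar>m q - m q'\<bar> \<le> real n * b"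
proof (cases "G = {}")
  case True
  then show ?thesis using that[of 0] by simp
next
  case False
  then obtain q0 where q0: "q0 \<in> G" by auto
  define R where "R = rec_nat {q0} (\<lambda>_ S. {q \<in> G. \<exists>a\<in>S. dist a q < e})"
  have R0: "R 0 = {q0}" and RS: "R (Suc n) = {q \<in> G. \<exists>a\<in>R n. dist a q < e}" for n by (auto simp: R_def)
  have RG: "R n \<subseteq> G" for n by (cases n) (use q0 in \<open>auto simp: R0 RS\<close>)
  have mono1: "R n \<subseteq> R (Suc n)" for n using RG[of n] \<open>0 < e\<close> by (auto simp: RS intro!: bexI)
  have mono: "R n \<subseteq> R m" if "n \<le> m" for n m using mono1 that by (rule lift_Suc_mono_le)
  define U where "U n = (\<Union>a\<in>R n. ball a e)" for n
  have UR: "R (Suc n) = G \<inter> U n" for n by (auto simp: RS U_def)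
  have all: "G \<subseteq> (\<Union>n. U n)"
  proof (rule ccontr)
    assume "\<not> ?thesis"
    then obtain z where z: "z \<in> G" "z \<notin> (\<Union>n. U n)" by auto
    define V where "V = (\<Union>y\<in>G - (\<Union>n. U n). ball y e)"
    have "open (\<Union>n. U n)" "open V" by (auto simp: U_def V_def)
    moreover have "q0 \<in> U 0" using \<open>0 < e\<close> by (simp add: U_def R0)
    then have "(\<Union>n. U n) \<inter> G \<noteq> {}" using q0 by blast
    moreover have "V \<inter> G \<noteq> {}" using z \<open>0 < e\<close> by (force simp: V_def)
    moreover have "G \<subseteq> (\<Union>n. U n) \<union> V" using \<open>0 < e\<close> by (auto simp: V_def)
    moreover have "(\<Union>n. U n) \<inter> V \<inter> G = {}"
    proof (rule ccontr)
      assume "(\<Union>n. U n) \<inter> V \<inter> G \<noteq> {}"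
      then obtain x n y where x: "x \<in> G" "x \<in> U n" "y \<in> G" "y \<notin> (\<Union>n. U n)" "dist y x < e" by (auto simp: V_def)
      then have "x \<in> R (Suc n)" by (simp add: UR)
      then have "y \<in> U (Suc n)" using x(5) by (auto simp: U_def dist_commute)
      then show False using x(4) by auto
    qed
    ultimately show False using \<open>connected G\<close> unfolding connected_def by blast
  qed
  obtain N where N: "finite N" "G \<subseteq> (\<Union>n\<in>N. U n)"
    using compactE_image[OF \<open>compact G\<close>, of UNIV U] all by (auto simp: U_def)
  define n where "n = Suc (Max (insert 0 N))"
  have Gn: "G \<subseteq> R n"
  proof
    fix x assume x: "x \<in> G"
    then obtain i where i: "i \<in> N" "x \<in> U i" using N by auto
    have "i \<le> Max (insert 0 N)" using N(1) i(1) by auto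
    then have "R (Suc i) \<subseteq> R n" unfolding n_def by (intro mono) simp
    then show "x \<in> R n" using x i(2) UR by auto
  qed
  have reach: "\<bar>m q - m q0\<bar> \<le> real i * b"
    if m: "\<And>q q'. q \<in> G \<Longrightarrow> q' \<in> G \<Longrightarrow> dist q q' < e \<Longrightarrow> \<bar>m q - m q'\<bar> \<le> b" and "q \<in> R i" for m :: "'a \<Rightarrow> real" and b q i
    using that(2)
  proof (induction i arbitrary: q)
    case 0
    then show ?case by (simp add: R0)
  next
    case (Suc i)
    then obtain a where a: "a \<in> R i" "dist a q < e" "q \<in> G" by (auto simp: RS)
    have "\<bar>m q - m a\<bar> \<le> b" using m[of a q] a RG[of i] by (auto simp: abs_minus_commute)
    then show ?case using Suc.IH[OF a(1)] by (simp add: algebra_simps)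
  qed
  show ?thesis
  proof (rule that[of "2 * n"])
    fix m :: "'a \<Rightarrow> real" and b q q'
    assume m: "\<And>q q'. q \<in> G \<Longrightarrow> q' \<in> G \<Longrightarrow> dist q q' < e \<Longrightarrow> \<bar>m q - m q'\<bar> \<le> b" and q: "q \<in> G" "q' \<in> G"
    have "\<bar>m z - m q0\<bar> \<le> real n * b" if "z \<in> G" for z
    proof (rule reach[where m=m and b=b])
      show "\<bar>m q - m q'\<bar> \<le> b" if "q \<in> G" "q' \<in> G" "dist q q' < e" for q q' using that by (rule m)
      show "z \<in> R n" using that Gn by blast
    qed
    from this[OF q(1)] this[OF q(2)]
    show "\<bar>m q - m q'\<bar> \<le> real (2 * n) * b" by (simp add: algebra_simps)
  qed
qed

lemma ennreal_one_divide_mult: "0 < u \<Longrightarrow> ennreal (1 / u) * ennreal u = 1"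
  by (subst ennreal_mult[symmetric]) auto

lemma ennreal_divide_bound:
  fixes S :: ennreal
  assumes "ennreal l * S \<le> ennreal u * T" "0 < l" "0 \<le> u" shows "S \<le> ennreal (u / l) * T"
proof -
  have "S = ennreal (1 / l) * (ennreal l * S)"
    using assms(2) by (simp add: mult.assoc[symmetric] flip: ennreal_mult)
  also have "\<dots> \<le> ennreal (1 / l) * (ennreal u * T)" using assms(1) by (rule mult_left_mono) simp
  also have "\<dots> = ennreal (u / l) * T"
    using assms(2,3) by (simp add: mult.assoc[symmetric] flip: ennreal_mult)
  finally show ?thesis .
qed

context surface_mesh begin

definition lowc :: real where "lowc = cyl_l DIM('a) c * (R0 / 4) ^ c"
text \<open>\<open>surface_upper\<close> wants a ball about a surface point: the ball of radius
  \<open>R0 / 2\<close> about \<open>q0\<close> lies in the ball of radius \<open>3 * R0 / 4\<close>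
  about \<open>\<eta> q0\<close>, as the centres are at most \<open>R0 / 16\<close> apart.\<close>

definition upc :: real where "upc = cyl_u DIM('a) c * (3 * (3 * R0 / 4)) ^ c"
definition poinc1 :: real where "poinc1 = (4 * R0\<^sup>2 * 2 ^ DIM('a) * upc) / lowc"

lemma lowc_pos: "0 < lowc" and upc_pos: "0 < upc" and poinc1_pos: "0 < poinc1"
  using R0 cyl_pos by (auto simp: lowc_def upc_def poinc1_def)

lemma \<eta>_start: "q0 \<in> \<Gamma> \<Longrightarrow> norm (\<eta> q0 - q0) \<le> R0 / 16"
  using \<eta>_near \<epsilon>16 by fastforce

lemma Yb_measurable:
  assumes q0: "q0 \<in> \<Gamma>" and r: "r \<le> R0"
  shows "(\<lambda>x. indicator (ball q0 r) x *\<^sub>R Yc q0 x) \<in> borel_measurable borel"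
  by (intro borel_measurable_continuous_on_indicator Yc_cont[OF q0 r]) auto

lemma Yc_vimage_borel:
  assumes q0: "q0 \<in> \<Gamma>" and r: "r \<le> R0" and Z: "Z \<in> sets borel"
  shows "{x \<in> ball q0 r. Yc q0 x \<in> Z} \<in> sets borel"
proof -
  have "{x \<in> ball q0 r. Yc q0 x \<in> Z} = ball q0 r \<inter> (\<lambda>x. indicator (ball q0 r) x *\<^sub>R Yc q0 x) -` Z" by auto
  then show ?thesis using measurable_sets_borel[OF Yb_measurable[OF q0 r] Z] by auto
qed

lemma chart_cell_measure:
  assumes q0: "q0 \<in> \<Gamma>" and K: "K \<in> \<K>"
  shows "emeasure lborel (chart_cell q0 K) \<le> ennreal upc * emeasure (\<mu> K) K"
proof -
  have s: "norm (\<eta> q0 - q0) \<le> R0 / 16" by (rule \<eta>_start[OF q0])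
  have sub: "ball q0 (R0 / 2) \<subseteq> ball (\<eta> q0) (3 * R0 / 4)"
  proof
    fix x assume "x \<in> ball q0 (R0 / 2)"
    then show "x \<in> ball (\<eta> q0) (3 * R0 / 4)"
      using s dist_triangle[of "\<eta> q0" x q0] R0 by (simp add: dist_norm)
  qed
  have "chart_cell q0 K \<in> sets borel" unfolding chart_cell_def using K_borel[OF K] R0 by (intro Yc_vimage_borel q0) auto
  then have "emeasure lborel (chart_cell q0 K) = (\<integral>\<^sup>+x. indicator (chart_cell q0 K) x \<partial>lborel)" by simp
  also have "\<dots> \<le> (\<integral>\<^sup>+x. 1 * indicator {x \<in> ball (\<eta> q0) (3 * R0 / 4). Yc q0 x \<in> K} x \<partial>lborel)"
    using sub by (intro nn_integral_mono) (auto simp: indicator_def chart_cell_def)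
  also have "\<dots> \<le> ennreal (cyl_u DIM('a) c * (3 * (3 * R0 / 4)) ^ c) * (\<integral>\<^sup>+x. 1 * indicator K x \<partial>\<mu> K)"
    by (rule surface_upper[OF q0 \<eta>(1)[OF q0] _ _ K, where f="\<lambda>_. 1"]) (use s R0 in auto)
  also have "\<dots> = ennreal upc * emeasure (\<mu> K) K" using K_borel[OF K] by (simp add: upc_def)
  finally show ?thesis .
qed

text \<open>\<open>pair_bound\<close> is averaged over both points of the chart. The constant is not
  a mean value but the value of \<open>v\<close> over a point \<open>x'\<close> at which the
  integral in the other variable does not exceed its average.\<close>

lemma local_poincare:
  assumes v: "cell_lip v g" and vm[measurable]: "v \<in> borel_measurable borel" and q0: "q0 \<in> \<Gamma>"
  shows "\<exists>m. (\<Sum>K\<in>\<K>. \<integral>\<^sup>+y. ennreal ((v y - m)\<^sup>2) * indicator (K \<inter> ball q0 (R0 / 4)) y \<partial>\<mu> K)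
    \<le> ennreal poinc1 * (\<Sum>K\<in>\<K>. ennreal ((g K)\<^sup>2) * emeasure (\<mu> K) K)"
proof -
  let ?k = "DIM('a)"
  define B where "B = ball q0 (R0 / 2)"
  have [measurable]: "B \<in> sets borel" by (simp add: B_def)
  have Bf: "B \<in> fmeasurable lborel" by (intro fmeasurableI emeasure_bounded_finite) (auto simp: B_def)
  have Bpos: "0 < measure lborel B" using R0 by (simp add: B_def measure_ball_lborel)
  define Yb where "Yb x = indicator B x *\<^sub>R Yc q0 x" for x
  have [measurable]: "Yb \<in> borel_measurable borel"
    unfolding Yb_def B_def using R0 by (intro Yb_measurable q0) auto
  define F where "F x = v (Yb x)" for x
  have [measurable]: "F \<in> borel_measurable borel" unfolding F_def by measurable
  have FB: "F x = v (Yc q0 x)" if "x \<in> B" for x using that by (simp add: F_def Yb_def)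
  define Z where "Z = chart_cell q0"
  have Zm[measurable]: "Z K \<in> sets borel" if "K \<in> \<K>" for K
    unfolding Z_def chart_cell_def using K_borel[OF that] R0 by (intro Yc_vimage_borel q0) auto
  define a where "a K = ennreal (4 * R0\<^sup>2 * (g K)\<^sup>2)" for K
  define j where "j = (\<Sum>K\<in>\<K>. a K * (ennreal (2 ^ ?k) * emeasure lborel (Z K)))"
  define \<phi> where "\<phi> x' = (\<integral>\<^sup>+x. ennreal ((F x - F x')\<^sup>2) * indicator B x \<partial>lborel)" for x'
  have [measurable]: "\<phi> \<in> borel_measurable borel" unfolding \<phi>_def by measurable
  let ?T = "\<lambda>K x x'. (\<integral>\<^sup>+t. indicator (Z K) (x' + t *\<^sub>R (x - x')) * indicator {0..1::real} t \<partial>lborel) * indicator B x * indicator B x'"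
  have Tm: "(\<lambda>(x', x). ?T K x x') \<in> borel_measurable (borel \<Otimes>\<^sub>M borel)" if [measurable]: "Z K \<in> sets borel" for K
    by measurable
  have "(\<integral>\<^sup>+x'. \<phi> x' * indicator B x' \<partial>lborel) = (\<integral>\<^sup>+x'. \<integral>\<^sup>+x. ennreal ((F x - F x')\<^sup>2) * indicator B x * indicator B x' \<partial>lborel \<partial>lborel)"
    unfolding \<phi>_def by (intro nn_integral_cong nn_integral_multc[symmetric]) measurable
  also have "\<dots> \<le> (\<integral>\<^sup>+x'. \<integral>\<^sup>+x. (\<Sum>K\<in>\<K>. a K * ?T K x x') \<partial>lborel \<partial>lborel)"
  proof (intro nn_integral_mono)
    fix x' x
    show "ennreal ((F x - F x')\<^sup>2) * indicator B x * indicator B x' \<le> (\<Sum>K\<in>\<K>. a K * ?T K x x')"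
    proof (cases "x \<in> B \<and> x' \<in> B")
      case True
      then show ?thesis
        using pair_bound[OF v q0, of x x'] by (simp add: FB B_def Z_def a_def)
    qed (auto simp: indicator_def)
  qed
  also have "\<dots> = (\<integral>\<^sup>+x'. (\<Sum>K\<in>\<K>. \<integral>\<^sup>+x. a K * ?T K x x' \<partial>lborel) \<partial>lborel)"
    by (intro nn_integral_cong nn_integral_sum) measurable
  also have "\<dots> = (\<Sum>K\<in>\<K>. \<integral>\<^sup>+x'. \<integral>\<^sup>+x. a K * ?T K x x' \<partial>lborel \<partial>lborel)"
    by (rule nn_integral_sum) measurable
  also have "\<dots> = (\<Sum>K\<in>\<K>. a K * (\<integral>\<^sup>+x'. \<integral>\<^sup>+x. ?T K x x' \<partial>lborel \<partial>lborel))"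
  proof (rule sum.cong[OF refl])
    fix K assume K: "K \<in> \<K>"
    have [measurable]: "Z K \<in> sets borel" by (rule Zm[OF K])
    have "(\<integral>\<^sup>+x'. \<integral>\<^sup>+x. a K * ?T K x x' \<partial>lborel \<partial>lborel) = (\<integral>\<^sup>+x'. a K * (\<integral>\<^sup>+x. ?T K x x' \<partial>lborel) \<partial>lborel)"
      by (intro nn_integral_cong nn_integral_cmult) measurable
    also have "\<dots> = a K * (\<integral>\<^sup>+x'. \<integral>\<^sup>+x. ?T K x x' \<partial>lborel \<partial>lborel)"
      by (rule nn_integral_cmult) measurable
    finally show "(\<integral>\<^sup>+x'. \<integral>\<^sup>+x. a K * ?T K x x' \<partial>lborel \<partial>lborel) = a K * (\<integral>\<^sup>+x'. \<integral>\<^sup>+x. ?T K x x' \<partial>lborel \<partial>lborel)" .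
  qed
  also have "\<dots> \<le> (\<Sum>K\<in>\<K>. a K * (ennreal (2 ^ ?k) * emeasure lborel B * emeasure lborel (Z K)))"
    by (intro sum_mono mult_left_mono segment_average) auto
  also have "\<dots> = emeasure lborel B * j" by (simp add: j_def sum_distrib_left mult_ac)
  finally have "\<exists>x'\<in>B. \<phi> x' \<le> j"
    using Bpos fmeasurableD2[OF Bf] by (intro exists_below_average) (auto simp: less_top)
  then obtain x' where x': "x' \<in> B" "\<phi> x' \<le> j" by blast
  define m where "m = F x'"
  define f where "f y = ennreal ((v y - m)\<^sup>2)" for y
  have fm[measurable]: "f \<in> borel_measurable borel" unfolding f_def by measurable
  let ?D = "\<Sum>K\<in>\<K>. ennreal ((g K)\<^sup>2) * emeasure (\<mu> K) K"
  have "ennreal lowc * (\<Sum>K\<in>\<K>. \<integral>\<^sup>+y. f y * indicator (K \<inter> ball q0 (R0 / 4)) y \<partial>\<mu> K)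
      = (\<Sum>K\<in>\<K>. ennreal lowc * (\<integral>\<^sup>+y. f y * indicator (K \<inter> ball q0 (R0 / 4)) y \<partial>\<mu> K))"
    by (rule sum_distrib_left)
  also have "\<dots> \<le> (\<Sum>K\<in>\<K>. \<integral>\<^sup>+x. f (Yc q0 x) * indicator {x \<in> ball q0 (R0 / 2). Yc q0 x \<in> rel_interior K} x \<partial>lborel)"
    unfolding lowc_def by (intro sum_mono surface_lower q0 fm)
  also have "\<dots> = (\<Sum>K\<in>\<K>. \<integral>\<^sup>+x. f (Yb x) * indicator {x \<in> B. Yc q0 x \<in> rel_interior K} x \<partial>lborel)"
    by (intro sum.cong nn_integral_cong refl) (auto simp: indicator_def Yb_def B_def)
  also have "\<dots> = (\<integral>\<^sup>+x. (\<Sum>K\<in>\<K>. f (Yb x) * indicator {x \<in> B. Yc q0 x \<in> rel_interior K} x) \<partial>lborel)"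
  proof (rule nn_integral_sum[symmetric])
    fix K assume K: "K \<in> \<K>"
    have [measurable]: "{x \<in> B. Yc q0 x \<in> rel_interior K} \<in> sets borel"
      unfolding B_def using ri_borel[OF K] R0 by (intro Yc_vimage_borel q0) auto
    show "(\<lambda>x. f (Yb x) * indicator {x \<in> B. Yc q0 x \<in> rel_interior K} x) \<in> borel_measurable lborel" by measurable
  qed
  also have "\<dots> \<le> (\<integral>\<^sup>+x. f (Yb x) * indicator B x \<partial>lborel)"
    by (intro nn_integral_mono) (auto simp: simp flip: sum_distrib_left intro!: mult_left_mono sum_ri_le)
  also have "\<dots> = \<phi> x'" by (simp add: \<phi>_def f_def m_def F_def)
  also have "\<dots> \<le> j" by fact
  also have "\<dots> \<le> (\<Sum>K\<in>\<K>. a K * (ennreal (2 ^ ?k) * (ennreal upc * emeasure (\<mu> K) K)))"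
    unfolding j_def Z_def by (intro sum_mono mult_left_mono chart_cell_measure q0) auto
  also have "\<dots> = ennreal (4 * R0\<^sup>2 * 2 ^ ?k * upc) * ?D"
  proof -
    have "a K * (ennreal (2 ^ ?k) * (ennreal upc * e)) = ennreal (4 * R0\<^sup>2 * 2 ^ ?k * upc) * (ennreal ((g K)\<^sup>2) * e)" for K e
    proof -
      have "a K * (ennreal (2 ^ ?k) * (ennreal upc * e)) = ennreal (4 * R0\<^sup>2 * (g K)\<^sup>2 * (2 ^ ?k * upc)) * e"
        using upc_pos by (simp add: a_def ennreal_mult mult.assoc)
      also have "4 * R0\<^sup>2 * (g K)\<^sup>2 * (2 ^ ?k * upc) = (4 * R0\<^sup>2 * 2 ^ ?k * upc) * (g K)\<^sup>2" by (simp add: mult_ac)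
      also have "ennreal ((4 * R0\<^sup>2 * 2 ^ ?k * upc) * (g K)\<^sup>2) = ennreal (4 * R0\<^sup>2 * 2 ^ ?k * upc) * ennreal ((g K)\<^sup>2)"
        using upc_pos by (intro ennreal_mult) auto
      finally show ?thesis by (simp only: mult.assoc)
    qed
    then show ?thesis by (simp only: sum_distrib_left)
  qed
  finally have "(\<Sum>K\<in>\<K>. \<integral>\<^sup>+y. f y * indicator (K \<inter> ball q0 (R0 / 4)) y \<partial>\<mu> K) \<le> ennreal poinc1 * ?D"
    unfolding poinc1_def using lowc_pos upc_pos by (intro ennreal_divide_bound) auto
  then show ?thesis unfolding f_def by blast
qed

text \<open>The surface over the ball of radius \<open>R0 / 64\<close> about \<open>\<eta> q\<close>
  stays within \<open>R0 / 32\<close> of \<open>\<eta> q\<close>, itself within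
  \<open>R0 / 16\<close> of \<open>q\<close>, and so inside the ball of radius \<open>R0 / 8\<close>
  about \<open>q\<close>.\<close>

definition meas_lo :: real where
  "meas_lo = unit_ball_vol (real DIM('a)) * (R0 / 64) ^ DIM('a) / (cyl_u DIM('a) c * (3 * (R0 / 64)) ^ c)"
definition meas_up :: real where "meas_up = unit_ball_vol (real DIM('a)) * (R0 / 2) ^ DIM('a) / lowc"

lemma meas_lo_pos: "0 < meas_lo" and meas_up_pos: "0 < meas_up"
  using R0 cyl_pos lowc_pos by (auto simp: meas_lo_def meas_up_def)

lemma measure_lower:
  assumes q: "q \<in> \<Gamma>" shows "ennreal meas_lo \<le> (\<Sum>K\<in>\<K>. emeasure (\<mu> K) (K \<inter> ball q (R0 / 8)))"
proof -
  let ?r = "R0 / 64" let ?y = "\<eta> q" let ?u = "cyl_u DIM('a) c * (3 * ?r) ^ c"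
  have s: "norm (?y - q) \<le> R0 / 16" by (rule \<eta>_start[OF q])
  have upos: "0 < ?u" using cyl_pos R0 by simp
  have inB: "norm (x - q) < R0" if "x \<in> ball ?y ?r" for x
    using that s R0 norm_triangle_ineq[of "x - ?y" "?y - q"] by (simp add: dist_norm norm_minus_commute)
  have yR: "norm (?y - q) < R0" using s R0 by linarith
  have YB: "Yc q x \<in> ball q (R0 / 8)" if x: "x \<in> ball ?y ?r" for x
  proof -
    have "norm (Yc q x - ?y) \<le> 2 * norm (x - ?y)"
      using Yc_lip[OF q inB[OF x] yR] Yc_self[OF q \<eta>(1)[OF q] yR] by simp
    then have "norm (Yc q x - q) < R0 / 8"
      using x s R0 norm_triangle_ineq[of "Yc q x - ?y" "?y - q"] by (simp add: dist_norm norm_minus_commute)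
    then show ?thesis by (simp add: dist_norm norm_minus_commute)
  qed
  have "ennreal (unit_ball_vol (real DIM('a)) * ?r ^ DIM('a)) * 1 = (\<integral>\<^sup>+x. indicator (ball ?y ?r) x \<partial>lborel)"
    using R0 by (simp add: emeasure_ball)
  also have "\<dots> \<le> (\<integral>\<^sup>+x. (\<Sum>K\<in>\<K>. indicator {x \<in> ball ?y ?r. Yc q x \<in> K} x) \<partial>lborel)"
  proof (intro nn_integral_mono)
    fix x
    show "indicator (ball ?y ?r) x \<le> (\<Sum>K\<in>\<K>. indicator {x \<in> ball ?y ?r. Yc q x \<in> K} x :: ennreal)"
    proof (cases "x \<in> ball ?y ?r")
      case True
      then obtain K where K: "K \<in> \<K>" "Yc q x \<in> K" using Yc(1)[OF q inB[OF True]] by auto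
      have "(1::ennreal) = indicator {x \<in> ball ?y ?r. Yc q x \<in> K} x" using True K by simp
      also have "\<dots> \<le> (\<Sum>K\<in>\<K>. indicator {x \<in> ball ?y ?r. Yc q x \<in> K} x)"
        using finK K(1) by (intro member_le_sum) auto
      finally show ?thesis using True by simp
    qed simp
  qed
  also have "\<dots> = (\<Sum>K\<in>\<K>. \<integral>\<^sup>+x. indicator {x \<in> ball ?y ?r. Yc q x \<in> K} x \<partial>lborel)"
  proof (rule nn_integral_sum)
    fix K assume K: "K \<in> \<K>"
    have "{x \<in> ball ?y ?r. Yc q x \<in> K} = ball ?y ?r \<inter> {x \<in> ball q R0. Yc q x \<in> K}"
      using inB by (auto simp: dist_norm norm_minus_commute)
    then have "{x \<in> ball ?y ?r. Yc q x \<in> K} \<in> sets borel"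
      using Yc_vimage_borel[OF q order_refl K_borel[OF K]] by auto
    then show "(\<lambda>x. indicator {x \<in> ball ?y ?r. Yc q x \<in> K} x :: ennreal) \<in> borel_measurable lborel" by simp
  qed
  also have "\<dots> = (\<Sum>K\<in>\<K>. \<integral>\<^sup>+x. indicator (ball q (R0 / 8)) (Yc q x) * indicator {x \<in> ball ?y ?r. Yc q x \<in> K} x \<partial>lborel)"
    using YB by (intro sum.cong nn_integral_cong refl) (auto simp: indicator_def)
  also have "\<dots> \<le> (\<Sum>K\<in>\<K>. ennreal ?u * (\<integral>\<^sup>+x. indicator (ball q (R0 / 8)) x * indicator K x \<partial>\<mu> K))"
    using s R0 by (intro sum_mono surface_upper q \<eta>(1) borel_measurable_indicator) auto
  also have "\<dots> = ennreal ?u * (\<Sum>K\<in>\<K>. emeasure (\<mu> K) (K \<inter> ball q (R0 / 8)))"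
  proof -
    have "(\<integral>\<^sup>+x. indicator (ball q (R0 / 8)) x * indicator K x \<partial>\<mu> K) = emeasure (\<mu> K) (K \<inter> ball q (R0 / 8))"
      if "K \<in> \<K>" for K
    proof -
      have "(\<integral>\<^sup>+x. indicator (ball q (R0 / 8)) x * indicator K x \<partial>\<mu> K) = (\<integral>\<^sup>+x. indicator (K \<inter> ball q (R0 / 8)) x \<partial>\<mu> K)"
        by (intro nn_integral_cong) (auto simp: indicator_def)
      then show ?thesis using K_borel[OF that] by simp
    qed
    then show ?thesis by (simp add: sum_distrib_left)
  qed
  finally have "ennreal (unit_ball_vol (real DIM('a)) * ?r ^ DIM('a)) * 1 \<le> ennreal ?u * (\<Sum>K\<in>\<K>. emeasure (\<mu> K) (K \<inter> ball q (R0 / 8)))" .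
  then have "ennreal (1 / ?u) * ennreal (unit_ball_vol (real DIM('a)) * ?r ^ DIM('a)) \<le> ennreal (1 / ?u) * (ennreal ?u * (\<Sum>K\<in>\<K>. emeasure (\<mu> K) (K \<inter> ball q (R0 / 8))))"
    by (intro mult_left_mono) auto
  also have "\<dots> = (\<Sum>K\<in>\<K>. emeasure (\<mu> K) (K \<inter> ball q (R0 / 8)))"
  proof -
    have "ennreal (1 / ?u) * ennreal ?u = 1" by (rule ennreal_one_divide_mult[OF upos])
    then show ?thesis by (simp only: mult.assoc[symmetric] mult_1)
  qed
  also have "ennreal (1 / ?u) * ennreal (unit_ball_vol (real DIM('a)) * ?r ^ DIM('a)) = ennreal meas_lo"
    unfolding meas_lo_def using upos R0 by (subst ennreal_mult[symmetric]) auto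
  finally show ?thesis .
qed

lemma measure_upper:
  assumes q: "q \<in> \<Gamma>" shows "(\<Sum>K\<in>\<K>. emeasure (\<mu> K) (K \<inter> ball q (R0 / 4))) \<le> ennreal meas_up"
proof -
  let ?B = "ball q (R0 / 2)"
  have "ennreal lowc * (\<Sum>K\<in>\<K>. emeasure (\<mu> K) (K \<inter> ball q (R0 / 4)))
      = (\<Sum>K\<in>\<K>. ennreal lowc * (\<integral>\<^sup>+x. 1 * indicator (K \<inter> ball q (R0 / 4)) x \<partial>\<mu> K))"
    using K_borel by (simp add: sum_distrib_left)
  also have "\<dots> \<le> (\<Sum>K\<in>\<K>. \<integral>\<^sup>+x. 1 * indicator {x \<in> ?B. Yc q x \<in> rel_interior K} x \<partial>lborel)"
    unfolding lowc_def by (intro sum_mono surface_lower[where f="\<lambda>_. 1"] q) auto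
  also have "\<dots> = (\<integral>\<^sup>+x. (\<Sum>K\<in>\<K>. indicator {x \<in> ?B. Yc q x \<in> rel_interior K} x) \<partial>lborel)"
    unfolding mult_1
  proof (rule nn_integral_sum[symmetric])
    fix K assume K: "K \<in> \<K>"
    have "{x \<in> ?B. Yc q x \<in> rel_interior K} \<in> sets borel"
      using ri_borel[OF K] R0 by (intro Yc_vimage_borel q) auto
    then show "(\<lambda>x. indicator {x \<in> ?B. Yc q x \<in> rel_interior K} x :: ennreal) \<in> borel_measurable lborel" by simp
  qed
  also have "\<dots> \<le> (\<integral>\<^sup>+x. indicator ?B x \<partial>lborel)" by (intro nn_integral_mono sum_ri_le)
  also have "\<dots> = ennreal (unit_ball_vol (real DIM('a)) * (R0 / 2) ^ DIM('a)) * 1" using R0 by (simp add: emeasure_ball)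
  finally have "(\<Sum>K\<in>\<K>. emeasure (\<mu> K) (K \<inter> ball q (R0 / 4))) \<le> ennreal meas_up * 1"
    unfolding meas_up_def by (rule ennreal_divide_bound) (use lowc_pos R0 in auto)
  then show ?thesis by simp
qed

lemma cell_in_ball:
  assumes K: "K \<in> \<K>" "y \<in> K" and f: "norm (p y - f) < R0 / 16" shows "K \<subseteq> ball f (R0 / 4)"
proof
  fix x assume x: "x \<in> K"
  have "norm (x - y) \<le> \<epsilon>" "norm (y - p y) \<le> \<epsilon>" using diamK[OF K(1) x K(2)] near K by auto
  then have "norm (x - f) < R0 / 4"
    using f \<epsilon>16 R0 norm_triangle_ineq[of "x - y" "y - f"] norm_triangle_ineq[of "y - p y" "p y - f"] by simp
  then show "x \<in> ball f (R0 / 4)" by (simp add: dist_norm norm_minus_commute)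
qed

lemma square_integrals:
  fixes v :: "'a \<Rightarrow> real"
  assumes [measurable]: "v \<in> borel_measurable borel" and Z: "\<And>K. K \<in> \<K> \<Longrightarrow> Z K \<in> sets borel"
  shows "(\<Sum>K\<in>\<K>. \<integral>\<^sup>+y. ennreal ((v y - m)\<^sup>2) * indicator (Z K) y \<partial>\<mu> K)
    \<le> 2 * (\<Sum>K\<in>\<K>. \<integral>\<^sup>+y. ennreal ((v y - m')\<^sup>2) * indicator (Z K) y \<partial>\<mu> K)
      + ennreal (2 * (m' - m)\<^sup>2) * (\<Sum>K\<in>\<K>. emeasure (\<mu> K) (Z K))"
proof -
  have "(\<integral>\<^sup>+y. ennreal ((v y - m)\<^sup>2) * indicator (Z K) y \<partial>\<mu> K)
      \<le> 2 * (\<integral>\<^sup>+y. ennreal ((v y - m')\<^sup>2) * indicator (Z K) y \<partial>\<mu> K) + ennreal (2 * (m' - m)\<^sup>2) * emeasure (\<mu> K) (Z K)"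
    if K: "K \<in> \<K>" for K
  proof -
    have [measurable]: "Z K \<in> sets borel" by (rule Z[OF K])
    have "(\<integral>\<^sup>+y. ennreal ((v y - m)\<^sup>2) * indicator (Z K) y \<partial>\<mu> K)
      \<le> (\<integral>\<^sup>+y. 2 * (ennreal ((v y - m')\<^sup>2) * indicator (Z K) y) + ennreal (2 * (m' - m)\<^sup>2) * indicator (Z K) y \<partial>\<mu> K)"
    proof (intro nn_integral_mono)
      fix y
      have "(v y - m)\<^sup>2 \<le> 2 * (v y - m')\<^sup>2 + 2 * (m' - m)\<^sup>2"
        using zero_le_power2[of "(v y - m') - (m' - m)"] by (simp add: power2_eq_square algebra_simps)
      then have "ennreal ((v y - m)\<^sup>2) \<le> ennreal (2 * (v y - m')\<^sup>2 + 2 * (m' - m)\<^sup>2)" by (rule ennreal_leI)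
      also have "\<dots> = 2 * ennreal ((v y - m')\<^sup>2) + ennreal (2 * (m' - m)\<^sup>2)"
        by (simp add: ennreal_plus ennreal_mult')
      finally show "ennreal ((v y - m)\<^sup>2) * indicator (Z K) y
        \<le> 2 * (ennreal ((v y - m')\<^sup>2) * indicator (Z K) y) + ennreal (2 * (m' - m)\<^sup>2) * indicator (Z K) y"
        by (auto simp: indicator_def)
    qed
    also have "\<dots> = (\<integral>\<^sup>+y. 2 * (ennreal ((v y - m')\<^sup>2) * indicator (Z K) y) \<partial>\<mu> K) + (\<integral>\<^sup>+y. ennreal (2 * (m' - m)\<^sup>2) * indicator (Z K) y \<partial>\<mu> K)"
      by (rule nn_integral_add) measurable
    also have "(\<integral>\<^sup>+y. ennreal (2 * (m' - m)\<^sup>2) * indicator (Z K) y \<partial>\<mu> K) = ennreal (2 * (m' - m)\<^sup>2) * emeasure (\<mu> K) (Z K)"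
      by (rule nn_integral_cmult_indicator) simp
    also have "(\<integral>\<^sup>+y. 2 * (ennreal ((v y - m')\<^sup>2) * indicator (Z K) y) \<partial>\<mu> K) = 2 * (\<integral>\<^sup>+y. ennreal ((v y - m')\<^sup>2) * indicator (Z K) y \<partial>\<mu> K)"
      by (rule nn_integral_cmult) measurable
    finally show ?thesis .
  qed
  then show ?thesis by (simp add: sum_mono sum_distrib_left flip: sum.distrib)
qed

text \<open>\<open>M\<close> counts the covering charts, \<open>n\<close> the steps of a chain;
  \<open>4 * poinc1 / meas_lo\<close> bounds, relative to the energy, the squared difference of the
  constants of two neighbouring charts. The final 1 keeps the factor positive, which matters when
  the right-hand side of the inequality is infinite.\<close>

definition poinc :: "nat \<Rightarrow> nat \<Rightarrow> real" where
  "poinc M n = real M * (2 * poinc1 + 2 * (real n)\<^sup>2 * (4 * poinc1 / meas_lo) * meas_up) + 1"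

text \<open>The constants of two charts with centres closer than \<open>R0 / 8\<close> both
  approximate \<open>v\<close> on the ball of radius \<open>R0 / 8\<close> about one centre. This
  ball has surface measure at least \<open>meas_lo\<close>, so the constants are close, and chains
  spread this over all of \<Gamma>. The cover \<open>F\<close> and the chain length \<open>n\<close>
  concern \<Gamma> only and enter from outside, which keeps the factor independent of the
  mesh.\<close>

lemma global_poincare:
  assumes v: "cell_lip v g" and vm[measurable]: "v \<in> borel_measurable borel"
    and F: "finite F" "F \<subseteq> \<Gamma>" "\<Gamma> \<subseteq> (\<Union>f\<in>F. ball f (R0 / 16))"
    and n: "\<And>(m :: 'a \<Rightarrow> real) b q q'. (\<And>q q'. q \<in> \<Gamma> \<Longrightarrow> q' \<in> \<Gamma> \<Longrightarrow> dist q q' < R0 / 8 \<Longrightarrow> \<bar>m q - m q'\<bar> \<le> b) \<Longrightarrow>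
      q \<in> \<Gamma> \<Longrightarrow> q' \<in> \<Gamma> \<Longrightarrow> \<bar>m q - m q'\<bar> \<le> real n * b"
  shows "\<exists>m. (\<Sum>K\<in>\<K>. \<integral>\<^sup>+y. ennreal ((v y - m)\<^sup>2) * indicator K y \<partial>\<mu> K)
    \<le> ennreal (poinc (card F) n) * (\<Sum>K\<in>\<K>. ennreal ((g K)\<^sup>2) * emeasure (\<mu> K) K)"
proof -
  let ?D = "\<Sum>K\<in>\<K>. ennreal ((g K)\<^sup>2) * emeasure (\<mu> K) K"
  have pp: "1 \<le> poinc (card F) n"
    using poinc1_pos meas_lo_pos meas_up_pos by (simp add: poinc_def)
  show ?thesis
  proof (cases "?D = top")
    case True
    then show ?thesis using pp by (auto simp: ennreal_mult_eq_top_iff)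
  next
    case False
    then obtain D where D: "0 \<le> D" "?D = ennreal D" by (cases ?D) auto
    let ?S = "\<lambda>m Z. \<Sum>K\<in>\<K>. \<integral>\<^sup>+y. ennreal ((v y - m)\<^sup>2) * indicator (K \<inter> Z) y \<partial>\<mu> K"
    obtain mm where mm: "\<And>q. q \<in> \<Gamma> \<Longrightarrow> ?S (mm q) (ball q (R0 / 4)) \<le> ennreal (poinc1 * D)"
    proof -
      have "\<forall>q\<in>\<Gamma>. \<exists>m. ?S m (ball q (R0 / 4)) \<le> ennreal (poinc1 * D)"
        using local_poincare[OF v vm] D poinc1_pos by (simp add: ennreal_mult)
      from bchoice[OF this] obtain m0 where "\<forall>q\<in>\<Gamma>. ?S (m0 q) (ball q (R0 / 4)) \<le> ennreal (poinc1 * D)" ..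
      then show ?thesis by (intro that[of m0]) simp
    qed
    define b where "b = sqrt (4 * poinc1 * D / meas_lo)"
    have b2: "b\<^sup>2 = 4 * poinc1 * D / meas_lo" using D poinc1_pos meas_lo_pos by (simp add: b_def)
    have step: "\<bar>mm q - mm q'\<bar> \<le> b" if q: "q \<in> \<Gamma>" "q' \<in> \<Gamma>" "dist q q' < R0 / 8" for q q'
    proof -
      let ?B = "ball q (R0 / 8)"
      have sub: "?B \<subseteq> ball q (R0 / 4)" "?B \<subseteq> ball q' (R0 / 4)"
      proof -
        show "?B \<subseteq> ball q (R0 / 4)" using R0 by (intro subset_ball) simp
        show "?B \<subseteq> ball q' (R0 / 4)"
        proof
          fix x assume "x \<in> ?B"
          then show "x \<in> ball q' (R0 / 4)" using q(3) dist_triangle[of q' x q] by (simp add: dist_commute)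
        qed
      qed
      have small: "?S (mm r) ?B \<le> ennreal (poinc1 * D)" if "r \<in> \<Gamma>" "?B \<subseteq> ball r (R0 / 4)" for r
      proof -
        have "?S (mm r) ?B \<le> ?S (mm r) (ball r (R0 / 4))"
          using that(2) by (intro sum_mono nn_integral_mono mult_left_mono) (auto simp: indicator_def)
        then show ?thesis using mm[OF that(1)] by (rule order_trans)
      qed
      have pw: "ennreal ((mm q - mm q')\<^sup>2) \<le> 2 * ennreal ((v y - mm q)\<^sup>2) + 2 * ennreal ((v y - mm q')\<^sup>2)" for y
      proof -
        have "(mm q - mm q')\<^sup>2 \<le> 2 * (v y - mm q)\<^sup>2 + 2 * (v y - mm q')\<^sup>2"
          using zero_le_power2[of "(v y - mm q) + (v y - mm q')"] by (simp add: power2_eq_square algebra_simps)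
        then have "ennreal ((mm q - mm q')\<^sup>2) \<le> ennreal (2 * (v y - mm q)\<^sup>2 + 2 * (v y - mm q')\<^sup>2)" by (rule ennreal_leI)
        then show ?thesis by (simp add: ennreal_plus ennreal_mult')
      qed
      have "ennreal ((mm q - mm q')\<^sup>2) * ennreal meas_lo \<le> ennreal ((mm q - mm q')\<^sup>2) * (\<Sum>K\<in>\<K>. emeasure (\<mu> K) (K \<inter> ?B))"
        by (intro mult_left_mono measure_lower q) auto
      also have "\<dots> = (\<Sum>K\<in>\<K>. \<integral>\<^sup>+y. ennreal ((mm q - mm q')\<^sup>2) * indicator (K \<inter> ?B) y \<partial>\<mu> K)"
        using K_borel by (simp add: sum_distrib_left nn_integral_cmult_indicator)
      also have "\<dots> \<le> (\<Sum>K\<in>\<K>. \<integral>\<^sup>+y. 2 * (ennreal ((v y - mm q)\<^sup>2) * indicator (K \<inter> ?B) y) + 2 * (ennreal ((v y - mm q')\<^sup>2) * indicator (K \<inter> ?B) y) \<partial>\<mu> K)"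
        by (intro sum_mono nn_integral_mono) (use pw in \<open>auto simp: indicator_def\<close>)
      also have "\<dots> = (\<Sum>K\<in>\<K>. 2 * (\<integral>\<^sup>+y. ennreal ((v y - mm q)\<^sup>2) * indicator (K \<inter> ?B) y \<partial>\<mu> K) + 2 * (\<integral>\<^sup>+y. ennreal ((v y - mm q')\<^sup>2) * indicator (K \<inter> ?B) y \<partial>\<mu> K))"
      proof (rule sum.cong[OF refl])
        fix K assume K: "K \<in> \<K>"
        have [measurable]: "K \<inter> ?B \<in> sets borel" using K_borel[OF K] by auto
        show "(\<integral>\<^sup>+y. 2 * (ennreal ((v y - mm q)\<^sup>2) * indicator (K \<inter> ?B) y) + 2 * (ennreal ((v y - mm q')\<^sup>2) * indicator (K \<inter> ?B) y) \<partial>\<mu> K)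
          = 2 * (\<integral>\<^sup>+y. ennreal ((v y - mm q)\<^sup>2) * indicator (K \<inter> ?B) y \<partial>\<mu> K) + 2 * (\<integral>\<^sup>+y. ennreal ((v y - mm q')\<^sup>2) * indicator (K \<inter> ?B) y \<partial>\<mu> K)"
          by (subst nn_integral_add, measurable, subst (1 2) nn_integral_cmult, measurable)
      qed
      also have "\<dots> = 2 * ?S (mm q) ?B + 2 * ?S (mm q') ?B" by (simp add: sum.distrib sum_distrib_left)
      also have "\<dots> \<le> 2 * ennreal (poinc1 * D) + 2 * ennreal (poinc1 * D)"
        by (intro add_mono mult_left_mono small q sub) auto
      also have "\<dots> = ennreal (4 * poinc1 * D)"
      proof -
        have "2 * ennreal (poinc1 * D) = ennreal (2 * (poinc1 * D))" using D poinc1_pos by (simp add: ennreal_mult')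
        then show ?thesis using D poinc1_pos by (simp flip: ennreal_plus)
      qed
      finally have "(mm q - mm q')\<^sup>2 * meas_lo \<le> 4 * poinc1 * D"
        using meas_lo_pos D poinc1_pos by (simp flip: ennreal_mult'' add: ennreal_le_iff)
      then have "(mm q - mm q')\<^sup>2 \<le> b\<^sup>2" unfolding b2 using meas_lo_pos by (simp add: field_simps)
      moreover have "0 \<le> b" using D poinc1_pos meas_lo_pos by (simp add: b_def)
      ultimately show ?thesis by (metis abs_le_square_iff abs_of_nonneg)
    qed
    obtain q where q: "q \<in> \<Gamma>" using ne by auto
    define m where "m = mm q"
    have far: "(mm f - m)\<^sup>2 \<le> (real n)\<^sup>2 * b\<^sup>2" if "f \<in> \<Gamma>" for f
    proof -
      have "\<bar>mm f - m\<bar> \<le> real n * b" unfolding m_def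
      proof (rule n[of mm b f q])
        show "\<bar>mm q - mm q'\<bar> \<le> b" if "q \<in> \<Gamma>" "q' \<in> \<Gamma>" "dist q q' < R0 / 8" for q q' using that by (rule step)
      qed fact+
      then have "\<bar>mm f - m\<bar>\<^sup>2 \<le> (real n * b)\<^sup>2" by (intro power_mono) auto
      then show ?thesis by (simp add: power_mult_distrib)
    qed
    define E where "E = 2 * poinc1 * D + 2 * ((real n)\<^sup>2 * b\<^sup>2) * meas_up"
    have E0: "0 \<le> E" using D poinc1_pos meas_up_pos by (simp add: E_def)
    have each: "?S m (ball f (R0 / 4)) \<le> ennreal E" if f: "f \<in> F" for f
    proof -
      have fG: "f \<in> \<Gamma>" using f F by auto
      have "?S m (ball f (R0 / 4)) \<le> 2 * ?S (mm f) (ball f (R0 / 4)) + ennreal (2 * (mm f - m)\<^sup>2) * (\<Sum>K\<in>\<K>. emeasure (\<mu> K) (K \<inter> ball f (R0 / 4)))"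
        using K_borel by (intro square_integrals vm) auto
      also have "\<dots> \<le> 2 * ennreal (poinc1 * D) + ennreal (2 * ((real n)\<^sup>2 * b\<^sup>2)) * ennreal meas_up"
        using far[OF fG] by (intro add_mono mult_mono mm[OF fG] measure_upper[OF fG] ennreal_leI) auto
      also have "\<dots> = ennreal E"
      proof -
        have "2 * ennreal (poinc1 * D) = ennreal (2 * (poinc1 * D))" using D poinc1_pos by (simp add: ennreal_mult')
        then show ?thesis unfolding E_def using D poinc1_pos meas_up_pos by (simp add: ennreal_plus ennreal_mult' mult.assoc)
      qed
      finally show ?thesis .
    qed
    have "(\<Sum>K\<in>\<K>. \<integral>\<^sup>+y. ennreal ((v y - m)\<^sup>2) * indicator K y \<partial>\<mu> K) \<le> (\<Sum>K\<in>\<K>. \<Sum>f\<in>F. \<integral>\<^sup>+y. ennreal ((v y - m)\<^sup>2) * indicator (K \<inter> ball f (R0 / 4)) y \<partial>\<mu> K)"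
    proof (rule sum_mono)
      fix K assume K: "K \<in> \<K>"
      obtain y where y: "y \<in> K" using neK[OF K] by auto
      obtain f where f: "f \<in> F" "p y \<in> ball f (R0 / 16)" using F(3) p_in[of y] by blast
      have "K \<subseteq> ball f (R0 / 4)" using f(2) by (intro cell_in_ball[OF K y]) (simp add: dist_norm norm_minus_commute)
      then have "K \<inter> ball f (R0 / 4) = K" by auto
      then have "(\<integral>\<^sup>+y. ennreal ((v y - m)\<^sup>2) * indicator K y \<partial>\<mu> K) = (\<integral>\<^sup>+y. ennreal ((v y - m)\<^sup>2) * indicator (K \<inter> ball f (R0 / 4)) y \<partial>\<mu> K)" by simp
      also have "\<dots> \<le> (\<Sum>f\<in>F. \<integral>\<^sup>+y. ennreal ((v y - m)\<^sup>2) * indicator (K \<inter> ball f (R0 / 4)) y \<partial>\<mu> K)"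
        using F(1) f(1) by (intro member_le_sum[of f F "\<lambda>f. \<integral>\<^sup>+y. ennreal ((v y - m)\<^sup>2) * indicator (K \<inter> ball f (R0 / 4)) y \<partial>\<mu> K"]) auto
      finally show "(\<integral>\<^sup>+y. ennreal ((v y - m)\<^sup>2) * indicator K y \<partial>\<mu> K) \<le> (\<Sum>f\<in>F. \<integral>\<^sup>+y. ennreal ((v y - m)\<^sup>2) * indicator (K \<inter> ball f (R0 / 4)) y \<partial>\<mu> K)" .
    qed
    also have "\<dots> = (\<Sum>f\<in>F. ?S m (ball f (R0 / 4)))" by (rule sum.swap)
    also have "\<dots> \<le> (\<Sum>f\<in>F. ennreal E)" by (intro sum_mono each)
    also have "\<dots> = ennreal (real (card F) * E)" using E0 by (simp add: ennreal_of_nat_eq_real_of_nat ennreal_mult')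
    also have "\<dots> \<le> ennreal (poinc (card F) n * D)"
    proof (rule ennreal_leI)
      have "E = (2 * poinc1 + 2 * (real n)\<^sup>2 * (4 * poinc1 / meas_lo) * meas_up) * D"
        by (simp add: E_def b2 algebra_simps)
      then have "real (card F) * E = (poinc (card F) n - 1) * D" by (simp add: poinc_def)
      then show "real (card F) * E \<le> poinc (card F) n * D" using D(1) by (simp add: algebra_simps)
    qed
    also have "\<dots> = ennreal (poinc (card F) n) * ?D" using pp D by (simp add: ennreal_mult)
    finally show ?thesis by blast
  qed
qed

end

section \<open>Local control by the trace and the normal gradient\<close>

text \<open>The mesh and the surface together. Inscribed radius, diameter and
  \<open>\<epsilon>\<close> are tied to \<open>h\<close> by the factors \<open>\<rho>1\<close>,
  \<open>D1\<close> and \<open>L\<close>; the constants defined below use these factors and never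
  \<open>h\<close> itself.\<close>

locale trace_mesh = surface_mesh \<Gamma> \<delta> A \<epsilon> R0 \<K> c + fine_mesh \<T> \<rho> D
  for \<Gamma> :: "'a::euclidean_space set" and \<delta> A \<epsilon> R0 \<K> c \<T> \<rho> D +
  fixes h \<rho>1 D1 L :: real
  assumes h: "0 < h" and \<rho>_eq: "\<rho> = \<rho>1 * h" and D_eq: "D = D1 * h" and \<epsilon>_eq: "\<epsilon> = L * h"
    and pars: "0 < \<rho>1" "\<rho>1 \<le> D1" "0 < L"
    and cov: "\<And>y. y \<in> \<Gamma>h \<Longrightarrow> cball y \<rho> \<subseteq> \<Union>\<T>"
    and small: "4 * D + \<epsilon> \<le> R0"
begin

abbreviation act :: "'a set set" where "act \<equiv> active_mesh \<T> \<K>"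

definition R1 :: real where "R1 = \<rho>1 / (real DIM('a) + 1)"
definition R :: real where "R = R1 * h"
definition N1 :: nat where "N1 = nat \<lceil>(3 + 2 * D1 / \<rho>1) ^ DIM('a)\<rceil>"
definition Cg1 :: real where "Cg1 = (real DIM('a) + 1) * D1 / (2 * \<rho>1)"
definition c01 :: real where "c01 = unit_ball_vol (real DIM('a)) * (\<rho>1 / (2 * D1)) ^ DIM('a)"

lemma act_T: "T \<in> act \<Longrightarrow> T \<in> \<T>" by (simp add: active_mesh_def)
lemma fin_act: "finite act" using finT by (simp add: active_mesh_def)

lemma D\<rho>: "0 < D" "\<rho> \<le> D" using h pars by (auto simp: \<rho>_eq D_eq)

lemma R_pos: "0 < R" "0 < R1" using h pars by (auto simp: R_def R1_def)

lemma R_\<rho>: "(real DIM('a) + 1) * R \<le> \<rho>" "R \<le> \<rho>" "R \<le> D"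
proof -
  show 1: "(real DIM('a) + 1) * R \<le> \<rho>" by (simp add: R_def R1_def \<rho>_eq)
  have "1 * R \<le> (real DIM('a) + 1) * R" using R_pos by (intro mult_right_mono) auto
  then show "R \<le> \<rho>" using 1 by simp
  then show "R \<le> D" using D\<rho> by simp
qed

lemma ratio: "D / \<rho> = D1 / \<rho>1" using h by (simp add: \<rho>_eq D_eq)

lemma N1_bound:
  assumes "0 \<le> l" "l \<le> 2 * \<rho> + D" shows "card {T \<in> \<T>. T \<inter> cball y l \<noteq> {}} \<le> N1"
proof -
  have "real (card {T \<in> \<T>. T \<inter> cball y l \<noteq> {}}) \<le> ((l + D + \<rho>) / \<rho>) ^ DIM('a)"
    using assms D\<rho> by (intro card_meets) auto
  also have "\<dots> \<le> (3 + 2 * D1 / \<rho>1) ^ DIM('a)"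
  proof (rule power_mono)
    have "(l + D + \<rho>) / \<rho> \<le> (3 * \<rho> + 2 * D) / \<rho>" using assms \<rho> by (intro divide_right_mono) auto
    also have "\<dots> = 3 + 2 * (D / \<rho>)" using \<rho> by (simp add: add_divide_distrib)
    finally show "(l + D + \<rho>) / \<rho> \<le> 3 + 2 * D1 / \<rho>1" by (simp add: ratio)
  qed (use assms D\<rho> \<rho> in auto)
  finally show ?thesis unfolding N1_def using le_nat_iff nat_ceiling_le_eq by linarith
qed

lemma interiorT: "T \<in> \<T> \<Longrightarrow> interior T \<noteq> {}"
proof -
  assume "T \<in> \<T>"
  then obtain z where "cball z \<rho> \<subseteq> T" using inball by blast
  then have "ball z \<rho> \<subseteq> interior T" by (intro interior_maximal order_trans[OF ball_subset_cball]) auto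
  then show ?thesis using \<rho> by force
qed

lemma V_affine:
  assumes v: "v \<in> V_space act" and T: "T \<in> act" "x \<in> T" "x' \<in> T"
  shows "v x - v x' = element_gradient v T \<bullet> (x - x')"
proof -
  obtain g b where gb: "\<forall>x\<in>T. v x = g \<bullet> x + b" using v T(1) unfolding V_space_def by blast
  have "element_gradient v T = g"
    using gb interiorT[OF act_T[OF T(1)]] by (intro element_gradient_eq) auto
  then show ?thesis using gb T by (simp add: inner_diff_right)
qed

lemma \<Gamma>h_act: "\<Gamma>h \<subseteq> \<Union>act"
proof
  fix y assume y: "y \<in> \<Gamma>h"
  then have "y \<in> \<Union>\<T>" using subsetD[OF cov[OF y], of y] \<rho> by simp
  then show "y \<in> \<Union>act" using y by (auto simp: active_mesh_def)
qed

definition base :: "'a set \<Rightarrow> 'a" where "base T = (SOME y. y \<in> T \<and> y \<in> \<Gamma>h)"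

lemma base: assumes "T \<in> act" shows "base T \<in> T" "base T \<in> \<Gamma>h"
proof -
  have "\<exists>y. y \<in> T \<and> y \<in> \<Gamma>h" using assms by (auto simp: active_mesh_def)
  from someI_ex[OF this] show "base T \<in> T" "base T \<in> \<Gamma>h" by (auto simp: base_def)
qed

text \<open>The radius is \<open>2 * R\<close> because the graph map may double the distance from
  the base point: the surface over the ball of radius \<open>R\<close> is covered by these
  elements.\<close>

definition nbr :: "'a set \<Rightarrow> 'a set set" where "nbr T = {T' \<in> act. T' \<inter> cball (base T) (2 * R) \<noteq> {}}"

text \<open>The exact normal projection at the foot of the base point. Unlike \<open>Q_ext\<close>
  it does not vary over the neighbourhood of \<open>T\<close>, as a fan requires.\<close>

definition Qp :: "'a set \<Rightarrow> 'a \<Rightarrow> 'a" where "Qp T w = w - PG (p (base T)) w"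

lemma near_base: "T \<in> act \<Longrightarrow> norm (base T - p (base T)) \<le> \<epsilon>" using near base by blast

lemma card_nbr: "card (nbr T) \<le> N1"
proof -
  have "card (nbr T) \<le> card {T' \<in> \<T>. T' \<inter> cball (base T) (2 * R) \<noteq> {}}"
    using finT by (intro card_mono) (auto simp: nbr_def active_mesh_def)
  also have "\<dots> \<le> N1" using R_pos R_\<rho> D\<rho> by (intro N1_bound) auto
  finally show ?thesis .
qed

lemma fan_instance:
  assumes v: "v \<in> V_space act" and T: "T \<in> act"
    and G: "\<And>T'. T' \<in> nbr T \<Longrightarrow> norm (Qp T (element_gradient v T')) \<le> G"
  shows "fan (PG (p (base T))) (Yc (p (base T))) (base T) R (nbr T) v (element_gradient v) G Cg1 c01 N1 T"
proof (rule fan.intro)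
  let ?q = "p (base T)" let ?y = "base T"
  have q: "?q \<in> \<Gamma>" by (rule p_in)
  note P = PG[OF q]
  have near': "norm (?y - ?q) \<le> \<epsilon>" by (rule near_base[OF T])
  have inR: "norm (x - ?q) < R0" if "x \<in> ball ?y R" for x
    using that near' R_\<rho> D\<rho> small norm_triangle_ineq[of "x - ?y" "?y - ?q"] by (simp add: dist_norm norm_minus_commute)
  have yR: "norm (?y - ?q) < R0" using near' small D\<rho> by simp
  show "linear (PG ?q)" by (rule P(1))
  show "PG ?q x \<bullet> y = x \<bullet> PG ?q y" for x y by (rule P(2))
  show "PG ?q (PG ?q x) = PG ?q x" for x by (rule P(3))
  show "finite (nbr T)" using fin_act by (simp add: nbr_def)
  show "card (nbr T) \<le> N1" by (rule card_nbr)
  show "closed T'" if "T' \<in> nbr T" for T' using that closedT act_T by (simp add: nbr_def)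
  show "convex T'" if "T' \<in> nbr T" for T' using that convexT act_T by (simp add: nbr_def)
  show "v x - v x' = element_gradient v T' \<bullet> (x - x')" if "T' \<in> nbr T" "x \<in> T'" "x' \<in> T'" for T' x x'
    using that by (intro V_affine[OF v]) (auto simp: nbr_def)
  show "norm (element_gradient v T' - PG ?q (element_gradient v T')) \<le> G" if "T' \<in> nbr T" for T'
    using G[OF that] by (simp add: Qp_def)
  show "0 < R" by (rule R_pos)
  show "PG ?q (Yc ?q x) = PG ?q x" if "x \<in> ball ?y R" for x using Yc(3)[OF q inR[OF that]] .
  show lip: "norm (Yc ?q x - Yc ?q x') \<le> 2 * norm (x - x')" if "x \<in> ball ?y R" "x' \<in> ball ?y R" for x x'
    by (rule Yc_lip[OF q inR[OF that(1)] inR[OF that(2)]])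
  show Yy: "Yc ?q ?y = ?y" using base[OF T] yR by (intro Yc_self q)
  show "\<exists>T'\<in>nbr T. Yc ?q x \<in> T'" if x: "x \<in> ball ?y R" for x
  proof -
    have "norm (Yc ?q x - ?y) \<le> 2 * norm (x - ?y)" using lip[OF x, of ?y] Yy R_pos by simp
    then have 1: "Yc ?q x \<in> cball ?y (2 * R)" using x by (simp add: dist_norm norm_minus_commute)
    obtain T' where "T' \<in> act" "Yc ?q x \<in> T'" using Yc(1)[OF q inR[OF x]] \<Gamma>h_act by blast
    moreover from this have "T' \<in> nbr T" using 1 by (auto simp: nbr_def)
    ultimately show ?thesis by blast
  qed
  show "\<exists>g. norm (g - ?y) \<le> Cg1 * r \<and> (\<forall>T'\<in>nbr T. T' \<inter> cball ?y r \<noteq> {} \<longrightarrow> g \<in> T')" if r: "0 < r" "r \<le> R" for r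
  proof -
    have "(real DIM('a) + 1) * r \<le> (real DIM('a) + 1) * R" using r by (intro mult_left_mono) auto
    then have rr: "(real DIM('a) + 1) * r \<le> \<rho>" by (rule order_trans[OF _ R_\<rho>(1)])
    have "cball ?y r \<subseteq> cball ?y \<rho>" using r R_\<rho> by auto
    then have cv: "cball ?y r \<subseteq> \<Union>\<T>" using cov base[OF T] by blast
    have "(real DIM('a) + 1) * D / (2 * \<rho>) = Cg1" using h by (simp add: Cg1_def \<rho>_eq D_eq)
    then show ?thesis using common_point[OF act_T[OF T] base(1)[OF T] r(1) rr cv] by (auto simp: nbr_def active_mesh_def)
  qed
  show "0 \<le> Cg1" using pars by (simp add: Cg1_def)
  show "T \<in> nbr T" using T base[OF T] R_pos by (auto simp: nbr_def intro!: exI[of _ "base T"])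
  show "base T \<in> T" by (rule base[OF T])
  show "0 < c01" using pars by (simp add: c01_def)
  show "c01 * r ^ DIM('a) \<le> measure lborel (T \<inter> ball ?y r)" if "0 < r" "r \<le> R" for r
  proof -
    have "\<rho> / (2 * D) = \<rho>1 / (2 * D1)" using h by (simp add: \<rho>_eq D_eq)
    moreover have "r \<le> 2 * D" using that R_\<rho> D\<rho> by simp
    ultimately show ?thesis using fat_corner[OF act_T[OF T] base(1)[OF T] that(1)] by (simp add: c01_def)
  qed
  \<comment> \<open>Elements missing the base point form a closed set away from it. The others
    contain a point of the surface, hence are active, and they are neighbours of
    \<open>T\<close>.\<close>
  show "\<exists>e>0. \<forall>z\<in>ball ?y e. \<exists>T'\<in>nbr T. z \<in> T' \<and> ?y \<in> T'"
  proof -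
    let ?F = "\<Union>{T' \<in> \<T>. ?y \<notin> T'}"
    have "closed ?F" using finT closedT by (intro closed_Union) auto
    then have "open (- ?F)" by (rule open_Compl)
    moreover have "?y \<in> - ?F" by auto
    ultimately obtain e where e: "0 < e" "ball ?y e \<subseteq> - ?F" by (rule openE)
    show ?thesis
    proof (intro exI[of _ "min e \<rho>"] conjI ballI)
      fix z assume z: "z \<in> ball ?y (min e \<rho>)"
      then have "z \<in> cball ?y \<rho>" by simp
      then obtain T' where T': "T' \<in> \<T>" "z \<in> T'" using cov[OF base(2)[OF T]] by blast
      have "z \<in> - ?F" using e(2) z by auto
      then have yT: "?y \<in> T'" using T' by auto
      then have "T' \<in> act" using T' base(2)[OF T] by (auto simp: active_mesh_def)
      then have "T' \<in> nbr T" using yT R_pos by (auto simp: nbr_def intro!: exI[of _ ?y])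
      then show "\<exists>T'\<in>nbr T. z \<in> T' \<and> ?y \<in> T'" using T' yT by blast
    qed (use e \<rho> in auto)
  qed
qed

text \<open>A function in \<open>V_space\<close> is controlled on the active elements only; its
  restriction to the surface, extended by 0, is Borel on the whole space.\<close>

definition vb :: "('a \<Rightarrow> real) \<Rightarrow> 'a \<Rightarrow> real" where "vb v x = indicator \<Gamma>h x *\<^sub>R v x"

lemma V_cont: "v \<in> V_space act \<Longrightarrow> continuous_on \<Gamma>h v"
  using \<Gamma>h_act by (auto simp: V_space_def intro: continuous_on_subset)

lemma vb_measurable: "v \<in> V_space act \<Longrightarrow> vb v \<in> borel_measurable borel"
  unfolding vb_def[abs_def]
  by (intro borel_measurable_continuous_on_indicator V_cont) (use compact_\<Gamma>h borel_compact in auto)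

lemma emeasure_K_finite: assumes "K \<in> \<K>" shows "emeasure (\<mu> K) K < \<infinity>"
proof -
  obtain y where y: "y \<in> K" using neK[OF assms] by auto
  have sub: "K \<subseteq> ball (p y) (R0 / 4)" using R0 by (intro cell_in_ball[OF assms y]) simp
  then have "emeasure (\<mu> K) K = emeasure (\<mu> K) (K \<inter> ball (p y) (R0 / 4))" by (simp add: Int_absorb2)
  also have "\<dots> \<le> (\<Sum>K\<in>\<K>. emeasure (\<mu> K) (K \<inter> ball (p y) (R0 / 4)))"
    using finK assms by (intro member_le_sum[of K \<K> "\<lambda>K. emeasure (\<mu> K) (K \<inter> ball (p y) (R0 / 4))"]) auto
  also have "\<dots> \<le> ennreal meas_up" by (rule measure_upper[OF p_in])
  also have "\<dots> < \<infinity>" by simp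
  finally show ?thesis .
qed

definition sq_int :: "('a \<Rightarrow> real) \<Rightarrow> 'a set \<Rightarrow> ennreal" where
  "sq_int v Z = (\<Sum>K\<in>\<K>. \<integral>\<^sup>+y. ennreal ((vb v y)\<^sup>2) * indicator (K \<inter> Z) y \<partial>\<mu> K)"

lemma sq_int_finite: assumes v: "v \<in> V_space act" shows "sq_int v Z < \<infinity>"
proof -
  have "compact (v ` \<Gamma>h)" by (rule compact_continuous_image[OF V_cont[OF v] compact_\<Gamma>h])
  then obtain b where b: "\<And>y. y \<in> \<Gamma>h \<Longrightarrow> \<bar>v y\<bar> \<le> b" using compact_imp_bounded by (fastforce simp: bounded_iff)
  have "(\<integral>\<^sup>+y. ennreal ((vb v y)\<^sup>2) * indicator (K \<inter> Z) y \<partial>\<mu> K) < \<infinity>" if K: "K \<in> \<K>" for K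
  proof -
    have "(\<integral>\<^sup>+y. ennreal ((vb v y)\<^sup>2) * indicator (K \<inter> Z) y \<partial>\<mu> K) \<le> (\<integral>\<^sup>+y. ennreal (b\<^sup>2) * indicator K y \<partial>\<mu> K)"
    proof (intro nn_integral_mono)
      fix y
      have "(v y)\<^sup>2 \<le> b\<^sup>2" if "y \<in> K"
      proof -
        have "\<bar>v y\<bar>\<^sup>2 \<le> b\<^sup>2" using b[of y] that K by (intro power_mono) auto
        then show ?thesis by simp
      qed
      then show "ennreal ((vb v y)\<^sup>2) * indicator (K \<inter> Z) y \<le> ennreal (b\<^sup>2) * indicator K y"
        using K by (auto simp: vb_def indicator_def intro!: ennreal_leI)
    qed
    also have "\<dots> = ennreal (b\<^sup>2) * emeasure (\<mu> K) K" using K_borel[OF K] by (simp add: nn_integral_cmult_indicator)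
    also have "\<dots> < \<infinity>" using emeasure_K_finite[OF K] by (simp add: ennreal_mult_less_top)
    finally show ?thesis .
  qed
  then show ?thesis using finK by (simp add: sq_int_def)
qed

definition J :: "('a \<Rightarrow> real) \<Rightarrow> 'a set \<Rightarrow> real" where "J v T = enn2real (sq_int v T)"

lemma J: "v \<in> V_space act \<Longrightarrow> ennreal (J v T) = sq_int v T" "0 \<le> J v T"
  using sq_int_finite[of v T] by (auto simp: J_def less_top)

text \<open>Measures the size of \<open>v\<close> on \<open>T\<close>, slope included, at length
  scale \<open>R\<close>; it bounds the square of \<open>v\<close> everywhere on \<open>T\<close> up
  to a factor (\<open>V_sq_integral\<close>).\<close>

definition Mq :: "('a \<Rightarrow> real) \<Rightarrow> 'a set \<Rightarrow> real" where
  "Mq v T = (\<bar>v (base T)\<bar> + R * norm (element_gradient v T))\<^sup>2"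

definition C5 :: real where
  "C5 = 2 * fan_A DIM('a) N1 Cg1 c01 * (cyl_u DIM('a) c * 3 ^ c + 1) + 2"

lemma fan_A_nonneg: "0 \<le> fan_A DIM('a) N1 Cg1 c01"
proof -
  have N: "1 \<le> real N1"
  proof -
    have "1 \<le> (3 + 2 * D1 / \<rho>1) ^ DIM('a)" using pars by (intro one_le_power) auto
    then show ?thesis unfolding N1_def by linarith
  qed
  have Cg: "0 \<le> Cg1" and c0: "0 < c01" using pars by (auto simp: Cg1_def c01_def)
  have "0 < fan_c DIM('a) N1 Cg1 c01 n" for n
    by (induction n) (use c0 N Cg in \<open>auto simp: fan_ratio_def\<close>)
  from less_imp_le[OF this[of "Suc N1"]] show ?thesis
    by (auto simp: fan_A_def Let_def simp del: fan_c.simps fan_C.simps intro!: add_nonneg_nonneg divide_nonneg_nonneg mult_nonneg_nonneg)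
qed

text \<open>\<open>fan_bound\<close> at the base point of \<open>T\<close>, with the integral over
  the ball turned into the trace on one neighbour by \<open>surface_upper\<close>. The passage from
  the full-dimensional ball to the surface accounts for the factor \<open>R ^ c\<close>; the normal
  part of the gradient of \<open>T\<close> itself adds another \<open>R * G\<close>.\<close>

lemma local_control:
  assumes v: "v \<in> V_space act" and T: "T \<in> act" and G0: "0 \<le> G"
    and G: "\<And>T'. T' \<in> nbr T \<Longrightarrow> norm (Qp T (element_gradient v T')) \<le> G"
  obtains T' where "T' \<in> nbr T"
    "R ^ DIM('a) * Mq v T \<le> C5 * (R ^ c * J v T' + R ^ DIM('a) * (R\<^sup>2 * G\<^sup>2))"
proof -
  let ?q = "p (base T)" let ?y = "base T" let ?k = "DIM('a)"
  let ?A = "fan_A ?k N1 Cg1 c01"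
  have q: "?q \<in> \<Gamma>" by (rule p_in)
  interpret F: fan "PG ?q" "Yc ?q" ?y R "nbr T" v "element_gradient v" G Cg1 c01 N1 T
    by (rule fan_instance[OF v T G])
  have "\<exists>T'\<in>nbr T. \<forall>I. 0 \<le> I \<longrightarrow> (\<integral>\<^sup>+x\<in>{x \<in> ball ?y R. Yc ?q x \<in> T'}. ennreal ((v (Yc ?q x))\<^sup>2) \<partial>lborel) \<le> ennreal I \<longrightarrow>
      R ^ ?k * (\<bar>v ?y\<bar> + R * norm (PG ?q (element_gradient v T)))\<^sup>2 \<le> ?A * (I + R ^ ?k * (G * R)\<^sup>2)"
  proof (rule F.fan_bound)
    fix T' assume a: "T' \<in> nbr T" "\<And>I. 0 \<le> I \<Longrightarrow> (\<integral>\<^sup>+x\<in>{x \<in> ball ?y R. Yc ?q x \<in> T'}. ennreal ((v (Yc ?q x))\<^sup>2) \<partial>lborel) \<le> ennreal I \<Longrightarrow>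
      R ^ ?k * (\<bar>v ?y\<bar> + R * norm (PG ?q (element_gradient v T)))\<^sup>2 \<le> ?A * (I + R ^ ?k * (G * R)\<^sup>2)"
    show ?thesis using a(1) by (intro bexI[of _ T'] allI impI a(2))
  qed
  then obtain T' where T': "T' \<in> nbr T" "\<And>I. 0 \<le> I \<Longrightarrow> (\<integral>\<^sup>+x\<in>{x \<in> ball ?y R. Yc ?q x \<in> T'}. ennreal ((v (Yc ?q x))\<^sup>2) \<partial>lborel) \<le> ennreal I \<Longrightarrow>
      R ^ ?k * (\<bar>v ?y\<bar> + R * norm (PG ?q (element_gradient v T)))\<^sup>2 \<le> ?A * (I + R ^ ?k * (G * R)\<^sup>2)"
    by (elim bexE) simp
  have near': "norm (?y - ?q) \<le> \<epsilon>" by (rule near_base[OF T])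
  have inR: "norm (x - ?q) < R0" if "x \<in> ball ?y R" for x
    using that near' R_\<rho> D\<rho> small norm_triangle_ineq[of "x - ?y" "?y - ?q"] by (simp add: dist_norm norm_minus_commute)
  define u where "u = cyl_u ?k c * (3 * R) ^ c"
  have u0: "0 \<le> u" using cyl_pos R_pos by (simp add: u_def less_imp_le)
  have T'c: "T' \<in> sets borel" using T'(1) closedT act_T borel_closed by (simp add: nbr_def)
  have fm: "(\<lambda>y. ennreal ((vb v y)\<^sup>2) * indicator T' y) \<in> borel_measurable borel"
    using vb_measurable[OF v] T'c by measurable
  have "(\<integral>\<^sup>+x\<in>{x \<in> ball ?y R. Yc ?q x \<in> T'}. ennreal ((v (Yc ?q x))\<^sup>2) \<partial>lborel)
    \<le> (\<integral>\<^sup>+x. (\<Sum>K\<in>\<K>. (ennreal ((vb v (Yc ?q x))\<^sup>2) * indicator T' (Yc ?q x)) * indicator {x \<in> ball ?y R. Yc ?q x \<in> K} x) \<partial>lborel)"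
  proof (intro nn_integral_mono)
    fix x
    show "ennreal ((v (Yc ?q x))\<^sup>2) * indicator {x \<in> ball ?y R. Yc ?q x \<in> T'} x
      \<le> (\<Sum>K\<in>\<K>. (ennreal ((vb v (Yc ?q x))\<^sup>2) * indicator T' (Yc ?q x)) * indicator {x \<in> ball ?y R. Yc ?q x \<in> K} x)"
    proof (cases "x \<in> ball ?y R \<and> Yc ?q x \<in> T'")
      case True
      then have Yh: "Yc ?q x \<in> \<Gamma>h" using Yc(1)[OF q inR] by blast
      then obtain K where K: "K \<in> \<K>" "Yc ?q x \<in> K" by auto
      let ?t = "\<lambda>K. (ennreal ((vb v (Yc ?q x))\<^sup>2) * indicator T' (Yc ?q x)) * indicator {x \<in> ball ?y R. Yc ?q x \<in> K} x"
      have "ennreal ((v (Yc ?q x))\<^sup>2) * indicator {x \<in> ball ?y R. Yc ?q x \<in> T'} x = ?t K"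
        using True Yh K by (simp add: vb_def)
      also have "\<dots> \<le> (\<Sum>K\<in>\<K>. ?t K)" using finK K(1) by (intro member_le_sum[of K \<K> ?t]) auto
      finally show ?thesis .
    qed simp
  qed
  also have "\<dots> = (\<Sum>K\<in>\<K>. \<integral>\<^sup>+x. (ennreal ((vb v (Yc ?q x))\<^sup>2) * indicator T' (Yc ?q x)) * indicator {x \<in> ball ?y R. Yc ?q x \<in> K} x \<partial>lborel)"
  proof (rule nn_integral_sum)
    fix K assume K: "K \<in> \<K>"
    define Yb where "Yb x = indicator (ball ?q R0) x *\<^sub>R Yc ?q x" for x
    have [measurable]: "Yb \<in> borel_measurable borel" unfolding Yb_def by (intro Yb_measurable q) simp
    have "{x \<in> ball ?y R. Yc ?q x \<in> K} = ball ?y R \<inter> {x \<in> ball ?q R0. Yc ?q x \<in> K}"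
      using inR by (auto simp: dist_norm norm_minus_commute)
    then have [measurable]: "{x \<in> ball ?y R. Yc ?q x \<in> K} \<in> sets borel"
      using Yc_vimage_borel[OF q order_refl K_borel[OF K]] by auto
    have eq: "(\<lambda>x. (ennreal ((vb v (Yc ?q x))\<^sup>2) * indicator T' (Yc ?q x)) * indicator {x \<in> ball ?y R. Yc ?q x \<in> K} x)
      = (\<lambda>x. (ennreal ((vb v (Yb x))\<^sup>2) * indicator T' (Yb x)) * indicator {x \<in> ball ?y R. Yc ?q x \<in> K} x)"
      using inR by (auto simp: fun_eq_iff indicator_def Yb_def dist_norm norm_minus_commute)
    show "(\<lambda>x. (ennreal ((vb v (Yc ?q x))\<^sup>2) * indicator T' (Yc ?q x)) * indicator {x \<in> ball ?y R. Yc ?q x \<in> K} x) \<in> borel_measurable lborel"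
      unfolding eq using measurable_compose[OF \<open>Yb \<in> borel_measurable borel\<close> fm] by measurable
  qed
  also have "\<dots> \<le> (\<Sum>K\<in>\<K>. ennreal u * (\<integral>\<^sup>+y. (ennreal ((vb v y)\<^sup>2) * indicator T' y) * indicator K y \<partial>\<mu> K))"
    unfolding u_def
  proof (intro sum_mono)
    fix K assume K: "K \<in> \<K>"
    have "norm (?y - ?q) + R \<le> R0" using near' R_\<rho> D\<rho> small by simp
    from surface_upper[OF q base(2)[OF T] R_pos(1) this K fm]
    show "(\<integral>\<^sup>+x. (ennreal ((vb v (Yc ?q x))\<^sup>2) * indicator T' (Yc ?q x)) * indicator {x \<in> ball ?y R. Yc ?q x \<in> K} x \<partial>lborel)
      \<le> ennreal (cyl_u ?k c * (3 * R) ^ c) * (\<integral>\<^sup>+y. (ennreal ((vb v y)\<^sup>2) * indicator T' y) * indicator K y \<partial>\<mu> K)" .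
  qed
  also have "\<dots> = ennreal u * sq_int v T'"
  proof -
    have "(\<integral>\<^sup>+y. (ennreal ((vb v y)\<^sup>2) * indicator T' y) * indicator K y \<partial>\<mu> K) = (\<integral>\<^sup>+y. ennreal ((vb v y)\<^sup>2) * indicator (K \<inter> T') y \<partial>\<mu> K)" for K
      by (rule nn_integral_cong) (auto simp: indicator_def)
    then show ?thesis by (simp only: sq_int_def sum_distrib_left)
  qed
  also have "\<dots> = ennreal (u * J v T')" using u0 J(1)[OF v, of T'] by (simp add: ennreal_mult')
  finally have I: "R ^ ?k * (\<bar>v ?y\<bar> + R * norm (PG ?q (element_gradient v T)))\<^sup>2 \<le> ?A * (u * J v T' + R ^ ?k * (G * R)\<^sup>2)"
    using u0 J(2) by (intro T'(2)) auto
  have A0: "0 \<le> ?A" by (rule fan_A_nonneg)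
  have "norm (Qp T (element_gradient v T)) \<le> G" using F.T0 by (intro G)
  then have gr: "norm (element_gradient v T) \<le> norm (PG ?q (element_gradient v T)) + G"
    using norm_triangle_sub[of "element_gradient v T" "PG ?q (element_gradient v T)"] by (simp add: Qp_def)
  have "Mq v T \<le> ((\<bar>v ?y\<bar> + R * norm (PG ?q (element_gradient v T))) + R * G)\<^sup>2"
    unfolding Mq_def using R_pos mult_left_mono[OF gr, of R]
    by (intro power_mono) (auto simp: algebra_simps)
  also have "\<dots> \<le> 2 * (\<bar>v ?y\<bar> + R * norm (PG ?q (element_gradient v T)))\<^sup>2 + 2 * (R * G)\<^sup>2"
    using zero_le_power2[of "(\<bar>v ?y\<bar> + R * norm (PG ?q (element_gradient v T))) - R * G"] by (simp add: power2_eq_square algebra_simps)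
  finally have "R ^ ?k * Mq v T \<le> R ^ ?k * (2 * (\<bar>v ?y\<bar> + R * norm (PG ?q (element_gradient v T)))\<^sup>2 + 2 * (R * G)\<^sup>2)"
    using R_pos by (intro mult_left_mono) auto
  also have "\<dots> = 2 * (R ^ ?k * (\<bar>v ?y\<bar> + R * norm (PG ?q (element_gradient v T)))\<^sup>2) + 2 * (R ^ ?k * (R * G)\<^sup>2)"
    by (simp add: algebra_simps)
  also have "\<dots> \<le> 2 * (?A * (u * J v T' + R ^ ?k * (G * R)\<^sup>2)) + 2 * (R ^ ?k * (R * G)\<^sup>2)" using I by simp
  also have "\<dots> \<le> C5 * (R ^ c * J v T' + R ^ ?k * (R\<^sup>2 * G\<^sup>2))"
  proof -
    define a where "a = R ^ c * J v T'"
    define b where "b = R ^ ?k * (R\<^sup>2 * G\<^sup>2)"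
    define w where "w = cyl_u ?k c * 3 ^ c"
    have ab: "0 \<le> a" "0 \<le> b" "0 \<le> w" using R_pos J(2)[of v T'] cyl_pos by (auto simp: a_def b_def w_def less_imp_le)
    have "u * J v T' = w * a" by (simp add: u_def w_def a_def power_mult_distrib)
    moreover have "R ^ ?k * (G * R)\<^sup>2 = b" "R ^ ?k * (R * G)\<^sup>2 = b" by (auto simp: b_def power_mult_distrib mult_ac)
    moreover have "2 * (?A * (w * a + b)) + 2 * b \<le> (2 * ?A * (w + 1) + 2) * (a + b)"
    proof -
      have "0 \<le> 2 * (?A * a) + 2 * (?A * (w * b)) + 2 * a" using ab A0 by simp
      then show ?thesis by (simp add: algebra_simps)
    qed
    ultimately show ?thesis by (simp only: C5_def a_def[symmetric] b_def[symmetric] w_def[symmetric])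
  qed
  finally show ?thesis using that T'(1) by blast
qed

end

section \<open>The normal gradient energy\<close>

text \<open>The choices made by \<open>cell\<close> depend on a point only through the set of cells
  containing it. That set takes finitely many values, each on a measurable set, so everything
  computed from the chosen cell is measurable.\<close>

lemma measurable_incidence:
  assumes "finite \<A>" and W: "\<And>A. A \<in> \<A> \<Longrightarrow> W A \<in> sets M"
  shows "(\<lambda>x. {A \<in> \<A>. x \<in> W A}) \<in> measurable M (count_space (Pow \<A>))"
proof (subst measurable_count_space_eq2)
  show "finite (Pow \<A>)" using assms by simp
  show "(\<lambda>x. {A \<in> \<A>. x \<in> W A}) \<in> space M \<rightarrow> Pow \<A> \<and>
    (\<forall>a\<in>Pow \<A>. (\<lambda>x. {A \<in> \<A>. x \<in> W A}) -` {a} \<inter> space M \<in> sets M)"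
  proof (intro conjI ballI)
    fix a assume "a \<in> Pow \<A>"
    then have "(\<lambda>x. {A \<in> \<A>. x \<in> W A}) -` {a} \<inter> space M = {x \<in> space M. \<forall>A\<in>\<A>. (x \<in> W A) = (A \<in> a)}"
      by blast
    also have "\<dots> \<in> sets M"
    proof -
      note W[measurable]
      have "Measurable.pred M (\<lambda>x. \<forall>A\<in>\<A>. (x \<in> W A) = (A \<in> a))" using assms(1) by measurable
      then show ?thesis by (simp add: pred_def)
    qed
    finally show "(\<lambda>x. {A \<in> \<A>. x \<in> W A}) -` {a} \<inter> space M \<in> sets M" .
  qed auto
qed

lemma borel_measurable_incidence:
  fixes G :: "'b set \<Rightarrow> 'c set \<Rightarrow> real"
  assumes A: "finite \<A>" "\<And>A. A \<in> \<A> \<Longrightarrow> W A \<in> sets M" and B: "finite \<B>" "\<And>B. B \<in> \<B> \<Longrightarrow> X B \<in> sets M"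
  shows "(\<lambda>x. G {A \<in> \<A>. x \<in> W A} {B \<in> \<B>. x \<in> X B}) \<in> borel_measurable M"
proof (rule measurable_compose_countable'[where g="\<lambda>x. {A \<in> \<A>. x \<in> W A}" and f="\<lambda>a x. G a {B \<in> \<B>. x \<in> X B}" and I="Pow \<A>"])
  show "(\<lambda>x. G a {B \<in> \<B>. x \<in> X B}) \<in> borel_measurable M" for a
    by (rule measurable_compose[OF measurable_incidence[OF B]]) (auto simp: measurable_count_space_eq1)
  show "countable (Pow \<A>)" using A(1) by (simp add: countable_finite)
qed (rule measurable_incidence[OF A])

context trace_mesh begin

definition CQ :: real where "CQ = A * (2 * (3 * D1 + L)) + L"

lemma Q_ext_eq: "Q_ext \<Gamma> \<K> x w = w - orth_proj (parallel_space (cell \<K> (\<eta> (p x)))) w"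
proof -
  have "(THE y. y \<in> \<Gamma>h \<and> p y = p x) = \<eta> (p x)"
  proof (rule the_equality)
    show "\<eta> (p x) \<in> \<Gamma>h \<and> p (\<eta> (p x)) = p x" using \<eta>(1,2)[OF p_in] by blast
    show "y = \<eta> (p x)" if "y \<in> \<Gamma>h \<and> p y = p x" for y using \<eta>(3) that by metis
  qed
  then show ?thesis by (simp add: Q_ext_def Q_disc_def P_disc_def)
qed

lemma cell_K: "y \<in> \<Gamma>h \<Longrightarrow> cell \<K> y \<in> \<K> \<and> y \<in> cell \<K> y"
  unfolding cell_def by (rule someI_ex) auto

text \<open>Points of a neighbour are within \<open>3 * D\<close> of the base point. The summand of
  \<open>CQ\<close> with \<open>A\<close> is the turning of the tangent plane between the foot of
  the base point and the foot of \<open>x\<close>, at distance at most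
  \<open>2 * (3 * D + \<epsilon>)\<close>; the summand \<open>L\<close> is the tilt of the cell
  below \<open>x\<close>.\<close>

lemma Q_ext_close:
  assumes T: "T \<in> act" "T' \<in> nbr T" "x \<in> T'"
  shows "norm (Q_ext \<Gamma> \<K> x w - Qp T w) \<le> CQ * h * norm w"
proof -
  let ?q = "p (base T)"
  obtain z where z: "z \<in> T'" "norm (z - base T) \<le> 2 * R"
    using T(2) by (auto simp: nbr_def dist_norm norm_minus_commute)
  have "norm (x - z) \<le> D" using T z by (intro diam) (auto simp: nbr_def active_mesh_def)
  then have "norm (x - base T) \<le> 3 * D" using z(2) R_\<rho> norm_triangle_ineq[of "x - z" "z - base T"] by simp
  then have xq: "norm (x - ?q) \<le> 3 * D + \<epsilon>"
    using near_base[OF T(1)] norm_triangle_ineq[of "x - base T" "base T - ?q"] by simp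
  have "norm (x - p x) \<le> norm (x - ?q)" by (rule p_le[OF p_in])
  then have pq: "norm (?q - p x) \<le> 2 * (3 * D + \<epsilon>)"
    using xq norm_triangle_ineq4[of "x - p x" "x - ?q"] by simp
  let ?y = "\<eta> (p x)"
  have y: "?y \<in> \<Gamma>h" "p ?y = p x" using \<eta> p_in by blast+
  have 1: "norm (PG ?q w - PG (p x) w) \<le> A * norm (?q - p x) * norm w"
  proof (rule PG_lip[OF p_in p_in])
    have "2 * (3 * D + \<epsilon>) \<le> \<delta> / 2" using small R0(1,3) D\<rho>(1) \<epsilon>(1) by argo
    then show "norm (?q - p x) \<le> \<delta> / 2" using pq by (rule order_trans[rotated])
  qed
  have 2: "norm (PG (p x) w - orth_proj (parallel_space (cell \<K> ?y)) w) \<le> \<epsilon> * norm w"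
    using projK[of "cell \<K> ?y" ?y w] cell_K[OF y(1)] y(2) by simp
  have 3: "A * norm (?q - p x) * norm w \<le> A * (2 * (3 * D + \<epsilon>)) * norm w"
    using pq A by (intro mult_right_mono mult_left_mono) auto
  have "Q_ext \<Gamma> \<K> x w - Qp T w = (PG ?q w - PG (p x) w) + (PG (p x) w - orth_proj (parallel_space (cell \<K> ?y)) w)"
    by (simp add: Q_ext_eq Qp_def)
  then have "norm (Q_ext \<Gamma> \<K> x w - Qp T w) \<le> A * (2 * (3 * D + \<epsilon>)) * norm w + \<epsilon> * norm w"
    using 1 2 3 norm_triangle_ineq[of "PG ?q w - PG (p x) w" "PG (p x) w - orth_proj (parallel_space (cell \<K> ?y)) w"] by (simp only:)
  also have "\<dots> = CQ * h * norm w" by (simp add: CQ_def D_eq \<epsilon>_eq algebra_simps)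
  finally show ?thesis .
qed

lemma cell_interior:
  assumes T: "T \<in> act" "x \<in> interior T" shows "cell act x = T"
proof -
  have uniq: "T' = T" if "T' \<in> act" "x \<in> T'" for T'
  proof (rule ccontr)
    assume ne: "T' \<noteq> T"
    have TT: "T \<in> \<T>" "T' \<in> \<T>" using that T act_T by auto
    have f: "T \<inter> T' face_of T" using tri TT unfolding triangulation_def by blast
    show False
    proof (cases "T \<inter> T' = T")
      case False
      then show False using face_of_disjoint_interior[OF f False] T(2) that(2) interior_subset by blast
    next
      case True
      then have "interior T \<subseteq> interior T'" by (metis inf.orderI inf_commute interior_mono)
      then show False using disjoint_interiors[OF TT ne[symmetric]] T(2) by blast
    qed
  qed
  have "x \<in> T" using T(2) interior_subset by blast
  then have a: "T \<in> act \<and> x \<in> T" using T(1) by (rule conjI[rotated])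
  show ?thesis unfolding cell_def by (rule some_equality, rule a) (use uniq in blast)
qed

abbreviation Nh :: "'a set" where "Nh \<equiv> \<Union>act"

lemma compact_Nh: "compact Nh" using fin_act compactT act_T by (intro compact_Union) auto

lemma Nh_borel: "Nh \<in> sets borel" using compact_Nh borel_compact by blast

lemma Nh_tube: "Nh \<subseteq> tube \<Gamma> \<delta>"
proof
  fix x assume "x \<in> Nh"
  then obtain T where T: "T \<in> act" "x \<in> T" by auto
  have "norm (x - base T) \<le> D" using T base[OF T(1)] act_T by (intro diam) auto
  then have "norm (x - p (base T)) \<le> D + \<epsilon>"
    using near_base[OF T(1)] norm_triangle_ineq[of "x - base T" "base T - p (base T)"] by simp
  then have "infdist x \<Gamma> \<le> D + \<epsilon>" using infdist_le[OF p_in[of "base T"], of x] by (simp add: dist_norm)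
  also have "\<dots> < \<delta>" using small R0 D\<rho> by linarith
  finally show "x \<in> tube \<Gamma> \<delta>" by (simp add: tube_def)
qed

definition qgrad :: "('a \<Rightarrow> real) \<Rightarrow> 'a \<Rightarrow> 'a" where
  "qgrad v x = Q_ext \<Gamma> \<K> x (broken_gradient act v x)"

lemma qgrad_measurable: "(\<lambda>x. indicator Nh x * (norm (qgrad v x))\<^sup>2) \<in> borel_measurable borel"
proof -
  define g where "g a = element_gradient v (SOME S. S \<in> a)" for a
  define G where "G a b = (norm (g a - orth_proj (parallel_space (SOME S. S \<in> b)) (g a)))\<^sup>2" for a b
  define W where "W K = {x \<in> Nh. \<eta> (p x) \<in> K}" for K
  have cont: "continuous_on Nh (\<lambda>x. \<eta> (p x))"
    by (rule continuous_on_compose2[OF \<eta>_cont continuous_on_subset[OF p_cont Nh_tube]]) (use p_in in auto)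
  have Wb: "W K \<in> sets borel" if "K \<in> \<K>" for K
  proof -
    have "W K = Nh \<inter> (\<lambda>x. \<eta> (p x)) -` K" by (auto simp: W_def)
    moreover have "closed \<dots>"
      using cont compact_imp_closed[OF compact_Nh] closedK[OF that] by (rule continuous_closed_preimage)
    ultimately show ?thesis by auto
  qed
  have Tb: "T \<in> sets borel" if "T \<in> act" for T using closedT act_T that borel_closed by blast
  have "(\<lambda>x. indicator Nh x * (norm (qgrad v x))\<^sup>2) = (\<lambda>x. indicator Nh x * G {T \<in> act. x \<in> T} {K \<in> \<K>. x \<in> W K})"
  proof
    fix x
    show "indicator Nh x * (norm (qgrad v x))\<^sup>2 = indicator Nh x * G {T \<in> act. x \<in> T} {K \<in> \<K>. x \<in> W K}"
    proof (cases "x \<in> Nh")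
      case True
      then have "{K \<in> \<K>. x \<in> W K} = {K \<in> \<K>. \<eta> (p x) \<in> K}" by (simp only: W_def mem_Collect_eq simp_thms)
      then show ?thesis by (simp add: qgrad_def Q_ext_eq broken_gradient_def cell_def G_def g_def)
    qed simp
  qed
  moreover have "(\<lambda>x. indicator Nh x * G {T \<in> act. x \<in> T} {K \<in> \<K>. x \<in> W K}) \<in> borel_measurable borel"
    by (intro borel_measurable_times borel_measurable_indicator Nh_borel borel_measurable_incidence[where W="\<lambda>T. T"] fin_act finK Tb Wb)
  ultimately show ?thesis by simp
qed

lemma orth_comp_norm: assumes "K \<in> \<K>" shows "norm (w - orth_proj (parallel_space K) w) \<le> norm w"
proof -
  have s: "subspace (parallel_space K)" by (rule subspace_parallel_space[OF neK[OF assms]])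
  show ?thesis using proj_norm_le(2)[of "orth_proj (parallel_space K)", OF orth_proj_sym[OF s] orth_proj_idem[OF s]] .
qed

definition Itot :: "('a \<Rightarrow> real) \<Rightarrow> real" where
  "Itot v = (LINT x:Nh|lebesgue. qgrad v x \<bullet> qgrad v x)"

text \<open>The integrand is bounded by the finitely many element gradients on a bounded set.
  Finiteness excludes that the Bochner integral is merely the default value 0.\<close>

lemma Itot:
  shows "(\<integral>\<^sup>+x. ennreal (indicator Nh x * (norm (qgrad v x))\<^sup>2) \<partial>lborel) = ennreal (Itot v)" "0 \<le> Itot v"
proof -
  have m: "(\<lambda>x. indicator Nh x * (norm (qgrad v x))\<^sup>2) \<in> borel_measurable borel" by (rule qgrad_measurable)
  have e: "Itot v = (LINT x|lebesgue. indicator Nh x * (norm (qgrad v x))\<^sup>2)"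
    by (simp add: Itot_def set_lebesgue_integral_def power2_norm_eq_inner)
  also have "\<dots> = (LINT x|lborel. indicator Nh x * (norm (qgrad v x))\<^sup>2)"
    using m by (intro integral_completion) simp
  finally have e: "Itot v = (LINT x|lborel. indicator Nh x * (norm (qgrad v x))\<^sup>2)" .
  have "0 \<le> (LINT x|lborel. indicator Nh x * (norm (qgrad v x))\<^sup>2)"
    by (rule Bochner_Integration.integral_nonneg) simp
  then show "0 \<le> Itot v" by (simp only: e)
  define b where "b = (\<Sum>T\<in>act. (norm (element_gradient v T))\<^sup>2)"
  have bd: "indicator Nh x * (norm (qgrad v x))\<^sup>2 \<le> b * indicator Nh x" for x
  proof (cases "x \<in> Nh")
    case True
    then have "\<exists>S. S \<in> act \<and> x \<in> S" by blast
    then have "cell act x \<in> act \<and> x \<in> cell act x" unfolding cell_def by (rule someI_ex)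
    then have c: "cell act x \<in> act" ..
    let ?w = "broken_gradient act v x"
    have "\<eta> (p x) \<in> \<Gamma>h" by (rule \<eta>(1)[OF p_in])
    then have "norm (qgrad v x) \<le> norm ?w"
      unfolding qgrad_def Q_ext_eq using cell_K by (intro orth_comp_norm) blast
    then have "(norm (qgrad v x))\<^sup>2 \<le> (norm ?w)\<^sup>2" by (intro power_mono) auto
    also have "\<dots> \<le> b" unfolding b_def broken_gradient_def
      using fin_act c by (intro member_le_sum[of "cell act x" act "\<lambda>T. (norm (element_gradient v T))\<^sup>2"]) auto
    finally show ?thesis using True by simp
  qed simp
  have "(\<integral>\<^sup>+x. ennreal (indicator Nh x * (norm (qgrad v x))\<^sup>2) \<partial>lborel) \<le> (\<integral>\<^sup>+x. ennreal (b * indicator Nh x) \<partial>lborel)"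
    by (intro nn_integral_mono ennreal_leI bd)
  also have "\<dots> = ennreal b * emeasure lborel Nh"
  proof -
    have "ennreal (b * indicator Nh x) = ennreal b * indicator Nh x" for x by (auto simp: indicator_def)
    then show ?thesis using Nh_borel by (simp add: nn_integral_cmult_indicator)
  qed
  also have "\<dots> < \<infinity>" using emeasure_bounded_finite[OF compact_imp_bounded[OF compact_Nh]] by (simp add: ennreal_mult_less_top)
  finally have "(\<integral>\<^sup>+x. ennreal (indicator Nh x * (norm (qgrad v x))\<^sup>2) \<partial>lborel) \<noteq> \<infinity>" by simp
  moreover have "Itot v = enn2real (\<integral>\<^sup>+x. ennreal (indicator Nh x * (norm (qgrad v x))\<^sup>2) \<partial>lborel)"
    unfolding e using m by (intro integral_eq_nn_integral) auto
  ultimately show "(\<integral>\<^sup>+x. ennreal (indicator Nh x * (norm (qgrad v x))\<^sup>2) \<partial>lborel) = ennreal (Itot v)"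
    by (simp add: less_top)
qed

lemma qgrad_energy_measurable: "(\<lambda>x. ennreal (indicator Nh x * (norm (qgrad v x))\<^sup>2)) \<in> borel_measurable lborel"
  by (rule measurable_compose[OF _ measurable_ennreal]) (use qgrad_measurable in simp)

definition ctr :: "'a set \<Rightarrow> 'a" where "ctr T = (SOME z. cball z \<rho> \<subseteq> T)"

lemma ctr: "T \<in> act \<Longrightarrow> ball (ctr T) \<rho> \<subseteq> interior T"
proof -
  assume T: "T \<in> act"
  have "cball (ctr T) \<rho> \<subseteq> T" unfolding ctr_def by (rule someI_ex[OF inball[OF act_T[OF T]]])
  then show ?thesis by (intro interior_maximal order_trans[OF ball_subset_cball]) auto
qed

text \<open>The energy is collected on inscribed balls only: they are pairwise disjoint, all have
  the volume \<open>B0\<close>, and lie in interiors, where the element chosen by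
  \<open>cell\<close> is forced.\<close>

definition en :: "('a \<Rightarrow> real) \<Rightarrow> 'a set \<Rightarrow> ennreal" where
  "en v T = (\<integral>\<^sup>+x. ennreal ((norm (qgrad v x))\<^sup>2) * indicator (ball (ctr T) \<rho>) x \<partial>lborel)"

lemma en_sum: "(\<Sum>T\<in>act. en v T) \<le> ennreal (Itot v)"
proof -
  let ?f = "\<lambda>x. indicator Nh x * (norm (qgrad v x))\<^sup>2"
  note fm = qgrad_energy_measurable[of v]
  have inN: "ball (ctr T) \<rho> \<subseteq> Nh" if "T \<in> act" for T using ctr[OF that] interior_subset that by blast
  have "(\<Sum>T\<in>act. en v T) = (\<Sum>T\<in>act. \<integral>\<^sup>+x. ennreal (?f x) * indicator (ball (ctr T) \<rho>) x \<partial>lborel)"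
    unfolding en_def
  proof (intro sum.cong nn_integral_cong refl)
    fix T x assume T: "T \<in> act"
    show "ennreal ((norm (qgrad v x))\<^sup>2) * indicator (ball (ctr T) \<rho>) x = ennreal (?f x) * indicator (ball (ctr T) \<rho>) x"
    proof (cases "x \<in> ball (ctr T) \<rho>")
      case True
      then have "x \<in> Nh" using inN[OF T] by blast
      then show ?thesis by simp
    qed simp
  qed
  also have "\<dots> = (\<integral>\<^sup>+x. (\<Sum>T\<in>act. ennreal (?f x) * indicator (ball (ctr T) \<rho>) x) \<partial>lborel)"
    by (rule nn_integral_sum[symmetric], rule borel_measurable_times_ennreal[OF fm borel_measurable_indicator]) simp
  also have "\<dots> \<le> (\<integral>\<^sup>+x. ennreal (?f x) \<partial>lborel)"
  proof (intro nn_integral_mono)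
    fix x
    show "(\<Sum>T\<in>act. ennreal (?f x) * indicator (ball (ctr T) \<rho>) x) \<le> ennreal (?f x)"
    proof (cases "\<exists>T\<in>act. x \<in> ball (ctr T) \<rho>")
      case True
      then obtain T where T: "T \<in> act" "x \<in> ball (ctr T) \<rho>" by auto
      have uniq: "T' = T" if "T' \<in> act" "x \<in> ball (ctr T') \<rho>" for T'
        using cell_interior[OF T(1) subsetD[OF ctr[OF T(1)] T(2)]] cell_interior[OF that(1) subsetD[OF ctr[OF that(1)] that(2)]]
        by (simp only:)
      have "(\<Sum>T\<in>act. ennreal (?f x) * indicator (ball (ctr T) \<rho>) x) = (\<Sum>T'\<in>act. if T' = T then ennreal (?f x) else 0)"
      proof (intro sum.cong refl)
        fix T' assume T': "T' \<in> act"
        show "ennreal (?f x) * indicator (ball (ctr T') \<rho>) x = (if T' = T then ennreal (?f x) else 0)"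
        proof (cases "T' = T")
          case True
          then show ?thesis using T(2) by simp
        next
          case False
          then have "x \<notin> ball (ctr T') \<rho>" using uniq[OF T'] by blast
          then show ?thesis using False by simp
        qed
      qed
      then show ?thesis using fin_act T by simp
    next
      case False
      then have "(\<Sum>T\<in>act. ennreal (?f x) * indicator (ball (ctr T) \<rho>) x) = 0"
        by (intro sum.neutral) (auto simp: indicator_def)
      then show ?thesis by simp
    qed
  qed
  finally show ?thesis by (simp only: Itot)
qed

definition e_r :: "('a \<Rightarrow> real) \<Rightarrow> 'a set \<Rightarrow> real" where "e_r v T = enn2real (en v T)"

lemma en_finite: assumes "T \<in> act" shows "en v T < \<infinity>"
proof -
  have "en v T \<le> (\<Sum>T\<in>act. en v T)" using fin_act assms by (intro member_le_sum) auto
  also have "\<dots> \<le> ennreal (Itot v)" by (rule en_sum)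
  finally show ?thesis by (rule le_less_trans) simp
qed

lemma e_r: "T \<in> act \<Longrightarrow> ennreal (e_r v T) = en v T" "0 \<le> e_r v T"
  using en_finite[of T v] by (auto simp: e_r_def less_top)

lemma e_r_sum: "(\<Sum>T\<in>act. e_r v T) \<le> Itot v"
proof -
  have "ennreal (\<Sum>T\<in>act. e_r v T) = (\<Sum>T\<in>act. ennreal (e_r v T))" by (rule sum_ennreal[symmetric]) (rule e_r)
  also have "\<dots> = (\<Sum>T\<in>act. en v T)" using e_r(1) by (intro sum.cong) auto
  also have "\<dots> \<le> ennreal (Itot v)" by (rule en_sum)
  finally show ?thesis using Itot(2) by (simp add: ennreal_le_iff)
qed

definition B0 :: real where "B0 = unit_ball_vol (real DIM('a)) * \<rho> ^ DIM('a)"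

lemma B0_pos: "0 < B0" using \<rho> by (simp add: B0_def)

text \<open>Both the gradient and \<open>Qp T\<close> are constant on the ball, so the left-hand
  side is an integral over it. Exchanging \<open>Qp T\<close> for \<open>Q_ext\<close> produces the
  term with \<open>h\<^sup>2\<close> that is absorbed later.\<close>

lemma Qp_energy:
  assumes T: "T \<in> act" "T' \<in> nbr T"
  shows "B0 * (norm (Qp T (element_gradient v T')))\<^sup>2 \<le> 2 * e_r v T' + B0 * (2 * CQ\<^sup>2 * h\<^sup>2 * (norm (element_gradient v T'))\<^sup>2)"
proof -
  let ?g = "element_gradient v T'" let ?B = "ball (ctr T') \<rho>"
  have T': "T' \<in> act" using T(2) by (simp add: nbr_def)
  define X where "X = (norm (Qp T ?g))\<^sup>2"
  define Y where "Y = 2 * CQ\<^sup>2 * h\<^sup>2 * (norm ?g)\<^sup>2"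
  have XY: "0 \<le> X" "0 \<le> Y" by (auto simp: X_def Y_def)
  have eB: "emeasure lborel ?B = ennreal B0" using \<rho> by (simp add: emeasure_ball B0_def)
  have pt: "X \<le> 2 * (norm (qgrad v x))\<^sup>2 + Y" if x: "x \<in> ?B" for x
  proof -
    have xi: "x \<in> interior T'" using ctr[OF T'] x by blast
    then have xT: "x \<in> T'" using interior_subset by blast
    have q: "qgrad v x = Q_ext \<Gamma> \<K> x ?g" by (simp add: qgrad_def broken_gradient_def cell_interior[OF T' xi])
    have "norm (Qp T ?g) \<le> norm (qgrad v x) + norm (Q_ext \<Gamma> \<K> x ?g - Qp T ?g)"
      unfolding q using norm_triangle_ineq4[of "Q_ext \<Gamma> \<K> x ?g" "Q_ext \<Gamma> \<K> x ?g - Qp T ?g"] by simp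
    also have "\<dots> \<le> norm (qgrad v x) + CQ * h * norm ?g" using Q_ext_close[OF T xT] by simp
    finally have "X \<le> (norm (qgrad v x) + CQ * h * norm ?g)\<^sup>2" unfolding X_def by (intro power_mono) auto
    also have "\<dots> \<le> 2 * (norm (qgrad v x))\<^sup>2 + 2 * (CQ * h * norm ?g)\<^sup>2"
      using zero_le_power2[of "norm (qgrad v x) - CQ * h * norm ?g"] by (simp add: power2_eq_square algebra_simps)
    finally show ?thesis by (simp add: Y_def power_mult_distrib mult_ac)
  qed
  let ?f = "\<lambda>x. indicator Nh x * (norm (qgrad v x))\<^sup>2"
  note fm = qgrad_energy_measurable[of v]
  have inN: "?B \<subseteq> Nh" using ctr[OF T'] interior_subset T' by blast
  have "ennreal (B0 * X) = (\<integral>\<^sup>+x. ennreal X * indicator ?B x \<partial>lborel)"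
    using B0_pos XY by (simp add: nn_integral_cmult_indicator eB ennreal_mult mult.commute)
  also have "\<dots> \<le> (\<integral>\<^sup>+x. 2 * (ennreal (?f x) * indicator ?B x) + ennreal Y * indicator ?B x \<partial>lborel)"
  proof (intro nn_integral_mono)
    fix x
    show "ennreal X * indicator ?B x \<le> 2 * (ennreal (?f x) * indicator ?B x) + ennreal Y * indicator ?B x"
    proof (cases "x \<in> ?B")
      case True
      have "ennreal X \<le> ennreal (2 * (norm (qgrad v x))\<^sup>2 + Y)" using pt[OF True] by (rule ennreal_leI)
      also have "\<dots> = 2 * ennreal ((norm (qgrad v x))\<^sup>2) + ennreal Y" using XY by (simp add: ennreal_plus ennreal_mult')
      finally have "ennreal X \<le> 2 * ennreal ((norm (qgrad v x))\<^sup>2) + ennreal Y" .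
      moreover have "x \<in> Nh" using True inN by blast
      ultimately show ?thesis using True by simp
    qed simp
  qed
  also have "\<dots> = 2 * (\<integral>\<^sup>+x. ennreal (?f x) * indicator ?B x \<partial>lborel) + ennreal Y * emeasure lborel ?B"
  proof -
    have pm: "(\<lambda>x. ennreal (?f x) * indicator ?B x) \<in> borel_measurable lborel"
      by (rule borel_measurable_times_ennreal[OF fm borel_measurable_indicator]) simp
    have "(\<integral>\<^sup>+x. 2 * (ennreal (?f x) * indicator ?B x) + ennreal Y * indicator ?B x \<partial>lborel)
      = (\<integral>\<^sup>+x. 2 * (ennreal (?f x) * indicator ?B x) \<partial>lborel) + (\<integral>\<^sup>+x. ennreal Y * indicator ?B x \<partial>lborel)"
      by (rule nn_integral_add, rule borel_measurable_times_ennreal[OF borel_measurable_const pm],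
          rule borel_measurable_times_ennreal[OF borel_measurable_const borel_measurable_indicator]) simp
    also have "(\<integral>\<^sup>+x. ennreal Y * indicator ?B x \<partial>lborel) = ennreal Y * emeasure lborel ?B"
      by (rule nn_integral_cmult_indicator) simp
    finally show ?thesis by (simp only: nn_integral_cmult[OF pm])
  qed
  also have "(\<integral>\<^sup>+x. ennreal (?f x) * indicator ?B x \<partial>lborel) = en v T'"
    unfolding en_def
  proof (intro nn_integral_cong)
    fix x
    show "ennreal (?f x) * indicator ?B x = ennreal ((norm (qgrad v x))\<^sup>2) * indicator ?B x"
    proof (cases "x \<in> ?B")
      case True
      then have "x \<in> Nh" using inN by blast
      then show ?thesis by simp
    qed simp
  qed
  also have "2 * en v T' + ennreal Y * emeasure lborel ?B = ennreal (2 * e_r v T' + B0 * Y)"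
    using e_r(1)[OF T', of v] e_r(2)[of v T'] XY B0_pos
    by (simp add: eB ennreal_plus ennreal_mult' mult.commute[of B0] flip: e_r(1)[OF T'])
  finally have "ennreal (B0 * X) \<le> ennreal (2 * e_r v T' + B0 * Y)" .
  moreover have "0 \<le> 2 * e_r v T' + B0 * Y" using e_r(2)[of v T'] XY B0_pos by simp
  ultimately have "B0 * X \<le> 2 * e_r v T' + B0 * Y" by (simp only: ennreal_le_iff)
  then show ?thesis by (simp only: X_def Y_def)
qed

text \<open>Elements overlap in faces, and a cell may lie inside a common face, so the parts of the
  trace are not disjoint; but no point lies in more than \<open>N1\<close> elements.\<close>

lemma J_sum:
  assumes v: "v \<in> V_space act" shows "(\<Sum>T\<in>act. J v T) \<le> real N1 * J v UNIV"
proof -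
  note vb_measurable[OF v, measurable]
  have Tb: "T \<in> sets borel" if "T \<in> act" for T using closedT act_T that borel_closed by blast
  have "ennreal (\<Sum>T\<in>act. J v T) = (\<Sum>T\<in>act. sq_int v T)"
    using J(1)[OF v] J(2)[of v] by (simp flip: sum_ennreal)
  also have "\<dots> = (\<Sum>K\<in>\<K>. \<Sum>T\<in>act. \<integral>\<^sup>+y. ennreal ((vb v y)\<^sup>2) * indicator (K \<inter> T) y \<partial>\<mu> K)"
    unfolding sq_int_def by (rule sum.swap)
  also have "\<dots> = (\<Sum>K\<in>\<K>. \<integral>\<^sup>+y. (\<Sum>T\<in>act. ennreal ((vb v y)\<^sup>2) * indicator (K \<inter> T) y) \<partial>\<mu> K)"
  proof (intro sum.cong refl nn_integral_sum[symmetric])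
    fix K T assume "K \<in> \<K>" "T \<in> act"
    then have [measurable]: "K \<inter> T \<in> sets borel" using K_borel Tb by auto
    show "(\<lambda>y. ennreal ((vb v y)\<^sup>2) * indicator (K \<inter> T) y) \<in> borel_measurable (\<mu> K)" by measurable
  qed
  also have "\<dots> \<le> (\<Sum>K\<in>\<K>. \<integral>\<^sup>+y. of_nat N1 * (ennreal ((vb v y)\<^sup>2) * indicator (K \<inter> UNIV) y) \<partial>\<mu> K)"
  proof (intro sum_mono nn_integral_mono)
    fix K y
    have "card {T \<in> act. y \<in> T} \<le> card {T \<in> \<T>. T \<inter> cball y 0 \<noteq> {}}"
      using finT by (intro card_mono) (auto simp: active_mesh_def)
    also have "\<dots> \<le> N1" using D\<rho> \<rho> by (intro N1_bound) auto
    finally have c: "card {T \<in> act. y \<in> T} \<le> N1" .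
    have "(\<Sum>T\<in>act. ennreal ((vb v y)\<^sup>2) * indicator (K \<inter> T) y)
        = (\<Sum>T\<in>act. if y \<in> T then ennreal ((vb v y)\<^sup>2) * indicator K y else 0)"
      by (intro sum.cong refl) (auto simp: indicator_def)
    also have "\<dots> = of_nat (card {T \<in> act. y \<in> T}) * (ennreal ((vb v y)\<^sup>2) * indicator K y)"
      using fin_act by (simp add: sum.If_cases Int_def)
    also have "\<dots> \<le> of_nat N1 * (ennreal ((vb v y)\<^sup>2) * indicator K y)"
      using c by (intro mult_right_mono) auto
    finally show "(\<Sum>T\<in>act. ennreal ((vb v y)\<^sup>2) * indicator (K \<inter> T) y) \<le> of_nat N1 * (ennreal ((vb v y)\<^sup>2) * indicator (K \<inter> UNIV) y)"
      by simp
  qed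
  also have "\<dots> = (\<Sum>K\<in>\<K>. of_nat N1 * (\<integral>\<^sup>+y. ennreal ((vb v y)\<^sup>2) * indicator (K \<inter> UNIV) y \<partial>\<mu> K))"
  proof (intro sum.cong refl nn_integral_cmult)
    fix K assume "K \<in> \<K>"
    then have [measurable]: "K \<inter> UNIV \<in> sets borel" using K_borel by auto
    show "(\<lambda>y. ennreal ((vb v y)\<^sup>2) * indicator (K \<inter> UNIV) y) \<in> borel_measurable (\<mu> K)" by measurable
  qed
  also have "\<dots> = of_nat N1 * sq_int v UNIV" by (simp add: sq_int_def sum_distrib_left)
  also have "\<dots> = ennreal (real N1 * J v UNIV)"
    using J(1)[OF v, of UNIV] by (simp add: ennreal_mult' flip: ennreal_of_nat_eq_real_of_nat)
  finally show ?thesis using J(2)[of v UNIV] by (simp add: ennreal_le_iff)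
qed

text \<open>On \<open>T\<close> the function is at most its value at the base point plus
  \<open>D\<close> times its slope. As \<open>D / R\<close> is at least 1, this is at most
  \<open>D / R\<close> times the quantity squared in \<open>Mq\<close>.\<close>

lemma V_sq_integral:
  assumes v: "v \<in> V_space act"
  shows "(LINT x:Nh|lebesgue. (v x)\<^sup>2) \<le> (unit_ball_vol (real DIM('a)) * (2 * D) ^ DIM('a) * (D / R)\<^sup>2) * (\<Sum>T\<in>act. Mq v T)"
proof -
  let ?C = "unit_ball_vol (real DIM('a)) * (2 * D) ^ DIM('a) * (D / R)\<^sup>2"
  have m: "(\<lambda>x. indicator Nh x * (v x)\<^sup>2) \<in> borel_measurable borel"
  proof -
    have "continuous_on Nh (\<lambda>x. (v x)\<^sup>2)" using v by (auto simp: V_space_def intro: continuous_intros)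
    from borel_measurable_continuous_on_indicator[OF Nh_borel this] show ?thesis by simp
  qed
  have Tb: "T \<in> sets borel" if "T \<in> act" for T using closedT act_T that borel_closed by blast
  have M0: "0 \<le> Mq v T" for T by (simp add: Mq_def)
  have pt: "(v x)\<^sup>2 \<le> (D / R)\<^sup>2 * Mq v T" if "T \<in> act" "x \<in> T" for T x
  proof -
    have "v x = v (base T) + element_gradient v T \<bullet> (x - base T)"
      using V_affine[OF v that base(1)[OF that(1)]] by simp
    moreover have "\<bar>element_gradient v T \<bullet> (x - base T)\<bar> \<le> norm (element_gradient v T) * D"
      by (rule order_trans[OF Cauchy_Schwarz_ineq2]) (use that base act_T in \<open>auto intro!: mult_left_mono diam\<close>)
    ultimately have "\<bar>v x\<bar> \<le> \<bar>v (base T)\<bar> + norm (element_gradient v T) * D" by linarith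
    also have "\<dots> \<le> (D / R) * (\<bar>v (base T)\<bar> + R * norm (element_gradient v T))"
    proof -
      have "1 \<le> D / R" using R_\<rho> R_pos by simp
      then have "1 * \<bar>v (base T)\<bar> \<le> (D / R) * \<bar>v (base T)\<bar>" by (intro mult_right_mono) auto
      moreover have "(D / R) * (R * norm (element_gradient v T)) = norm (element_gradient v T) * D" using R_pos by simp
      ultimately show ?thesis by (simp add: distrib_left)
    qed
    finally have "\<bar>v x\<bar>\<^sup>2 \<le> ((D / R) * (\<bar>v (base T)\<bar> + R * norm (element_gradient v T)))\<^sup>2" by (intro power_mono) auto
    then show ?thesis by (simp only: Mq_def power_mult_distrib power2_abs)
  qed
  have vol: "emeasure lborel T \<le> ennreal (unit_ball_vol (real DIM('a)) * (2 * D) ^ DIM('a))" if T: "T \<in> act" for T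
  proof -
    have "T \<subseteq> ball (base T) (2 * D)"
    proof
      fix x assume "x \<in> T"
      then have "norm (x - base T) \<le> D" using T base act_T by (intro diam) auto
      then show "x \<in> ball (base T) (2 * D)" using D\<rho> by (simp add: dist_norm norm_minus_commute)
    qed
    then have "emeasure lborel T \<le> emeasure lborel (ball (base T) (2 * D))" by (intro emeasure_mono) auto
    then show ?thesis using D\<rho> by (simp add: emeasure_ball)
  qed
  have "(LINT x:Nh|lebesgue. (v x)\<^sup>2) = (LINT x|lebesgue. indicator Nh x * (v x)\<^sup>2)"
    by (simp add: set_lebesgue_integral_def)
  also have "\<dots> = (LINT x|lborel. indicator Nh x * (v x)\<^sup>2)" using m by (intro integral_completion) simp
  also have "\<dots> = enn2real (\<integral>\<^sup>+x. ennreal (indicator Nh x * (v x)\<^sup>2) \<partial>lborel)"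
    using m by (intro integral_eq_nn_integral) auto
  also have "\<dots> \<le> ?C * (\<Sum>T\<in>act. Mq v T)"
  proof (rule enn2real_leI)
    have "(\<integral>\<^sup>+x. ennreal (indicator Nh x * (v x)\<^sup>2) \<partial>lborel) \<le> (\<integral>\<^sup>+x. (\<Sum>T\<in>act. ennreal ((D / R)\<^sup>2 * Mq v T) * indicator T x) \<partial>lborel)"
    proof (intro nn_integral_mono)
      fix x
      show "ennreal (indicator Nh x * (v x)\<^sup>2) \<le> (\<Sum>T\<in>act. ennreal ((D / R)\<^sup>2 * Mq v T) * indicator T x)"
      proof (cases "x \<in> Nh")
        case True
        then obtain T where T: "T \<in> act" "x \<in> T" by auto
        have "ennreal (indicator Nh x * (v x)\<^sup>2) \<le> ennreal ((D / R)\<^sup>2 * Mq v T) * indicator T x"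
          using pt[OF T] T True by (simp add: ennreal_leI)
        also have "\<dots> \<le> (\<Sum>T\<in>act. ennreal ((D / R)\<^sup>2 * Mq v T) * indicator T x)"
          using fin_act T(1) by (intro member_le_sum[of T act "\<lambda>T. ennreal ((D / R)\<^sup>2 * Mq v T) * indicator T x"]) auto
        finally show ?thesis .
      qed simp
    qed
    also have "\<dots> = (\<Sum>T\<in>act. \<integral>\<^sup>+x. ennreal ((D / R)\<^sup>2 * Mq v T) * indicator T x \<partial>lborel)"
      by (rule nn_integral_sum) (use Tb in auto)
    also have "\<dots> = (\<Sum>T\<in>act. ennreal ((D / R)\<^sup>2 * Mq v T) * emeasure lborel T)"
      using Tb by (intro sum.cong refl nn_integral_cmult_indicator) auto
    also have "\<dots> \<le> (\<Sum>T\<in>act. ennreal ((D / R)\<^sup>2 * Mq v T) * ennreal (unit_ball_vol (real DIM('a)) * (2 * D) ^ DIM('a)))"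
      by (intro sum_mono mult_left_mono vol) auto
    also have "\<dots> = (\<Sum>T\<in>act. ennreal (?C * Mq v T))"
      using M0 D\<rho> by (intro sum.cong refl) (simp add: mult_ac flip: ennreal_mult)
    also have "\<dots> = ennreal (\<Sum>T\<in>act. ?C * Mq v T)" using M0 D\<rho> by (intro sum_ennreal) auto
    also have "\<dots> = ennreal (?C * (\<Sum>T\<in>act. Mq v T))" by (simp add: sum_distrib_left)
    finally show "(\<integral>\<^sup>+x. ennreal (indicator Nh x * (v x)\<^sup>2) \<partial>lborel) \<le> ennreal (?C * (\<Sum>T\<in>act. Mq v T))" .
  qed (use M0 D\<rho> in \<open>auto intro!: mult_nonneg_nonneg sum_nonneg\<close>)
  finally show ?thesis .
qed

end

section \<open>Absorption\<close>

context trace_mesh begin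

text \<open>Summing \<open>local_control\<close> brings back the total
  \<open>\<Sum>T\<in>act. R ^ k * Mq v T\<close> on the right with factor
  \<open>C5 * N1 * (2 * CQ\<^sup>2 * h\<^sup>2)\<close>, which \<open>sm\<close> makes at most
  \<open>1 / 2\<close>. The total is finite, so it can be subtracted.\<close>

lemma absorption:
  assumes v: "v \<in> V_space act" and sm: "4 * C5 * real N1 * CQ\<^sup>2 * h\<^sup>2 \<le> 1"
  shows "(\<Sum>T\<in>act. R ^ DIM('a) * Mq v T)
    \<le> 2 * C5 * real N1 * (R ^ c * (real N1 * J v UNIV) + 2 * (R ^ DIM('a) * R\<^sup>2) / B0 * Itot v)"
proof -
  let ?k = "DIM('a)" let ?g = "element_gradient v"
  define be where "be = 2 * (R ^ ?k * R\<^sup>2) / B0"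
  define t where "t = 2 * CQ\<^sup>2 * h\<^sup>2"
  define a where "a T = R ^ c * J v T" for T
  define b where "b T = be * e_r v T" for T
  define m where "m T = R ^ ?k * Mq v T" for T
  have be0: "0 \<le> be" using R_pos B0_pos by (simp add: be_def)
  have t0: "0 \<le> t" by (simp add: t_def)
  have a0: "0 \<le> a T" for T using R_pos J(2)[of v T] by (simp add: a_def)
  have b0: "0 \<le> b T" for T using be0 e_r(2)[of v T] by (simp add: b_def)
  have m0: "0 \<le> m T" for T using R_pos by (simp add: m_def Mq_def)
  have C50: "0 \<le> C5" using fan_A_nonneg cyl_pos by (simp add: C5_def less_imp_le)
  define w where "w T = a T + b T + t * m T" for T
  have w0: "0 \<le> w T" for T using a0 b0 m0 t0 by (simp add: w_def)
  have finn: "finite (nbr T)" for T using fin_act by (simp add: nbr_def)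
  have loc: "m T \<le> C5 * (\<Sum>T'\<in>nbr T. w T')" if T: "T \<in> act" for T
  proof -
    \<comment> \<open>The root of the sum of squares serves as \<open>G\<close> instead of the
      maximum: its square is a sum over neighbours and can be summed over \<open>T\<close>
      directly.\<close>
    let ?s = "\<Sum>T'\<in>nbr T. (norm (Qp T (?g T')))\<^sup>2"
    have s0: "0 \<le> ?s" by (intro sum_nonneg) simp
    have Gle: "norm (Qp T (?g T')) \<le> sqrt ?s" if "T' \<in> nbr T" for T'
    proof (rule real_le_rsqrt)
      show "(norm (Qp T (?g T')))\<^sup>2 \<le> ?s"
        using finn that by (intro member_le_sum[of T' "nbr T" "\<lambda>T'. (norm (Qp T (?g T')))\<^sup>2"]) auto
    qed
    have G0: "0 \<le> sqrt ?s" using s0 by simp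
    obtain T' where T': "T' \<in> nbr T"
      "R ^ ?k * Mq v T \<le> C5 * (R ^ c * J v T' + R ^ ?k * (R\<^sup>2 * (sqrt ?s)\<^sup>2))"
      by (rule local_control[OF v T G0 Gle])
    have 1: "a T' \<le> (\<Sum>T'\<in>nbr T. a T')" using finn a0 T'(1) by (intro member_le_sum) auto
    have "R ^ ?k * (R\<^sup>2 * (norm (Qp T (?g S)))\<^sup>2) \<le> b S + t * m S" if S: "S \<in> nbr T" for S
    proof -
      have "(norm (Qp T (?g S)))\<^sup>2 * B0 \<le> 2 * e_r v S + B0 * (t * (norm (?g S))\<^sup>2)"
        using Qp_energy[OF T S, of v] by (simp add: t_def mult_ac)
      then have "(norm (Qp T (?g S)))\<^sup>2 \<le> (2 * e_r v S + B0 * (t * (norm (?g S))\<^sup>2)) / B0"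
        using B0_pos by (simp add: pos_le_divide_eq)
      also have "\<dots> = 2 * e_r v S / B0 + t * (norm (?g S))\<^sup>2" using B0_pos by (simp add: field_simps)
      finally have "R ^ ?k * R\<^sup>2 * (norm (Qp T (?g S)))\<^sup>2 \<le> R ^ ?k * R\<^sup>2 * (2 * e_r v S / B0 + t * (norm (?g S))\<^sup>2)"
        using R_pos by (intro mult_left_mono) auto
      also have "\<dots> = b S + t * (R ^ ?k * (R * norm (?g S))\<^sup>2)"
        by (simp add: b_def be_def power_mult_distrib algebra_simps)
      also have "\<dots> \<le> b S + t * m S"
        unfolding m_def Mq_def using R_pos t0
        by (intro add_left_mono mult_left_mono power_mono) auto
      finally show ?thesis by (simp add: mult.assoc)
    qed
    then have "(\<Sum>S\<in>nbr T. R ^ ?k * (R\<^sup>2 * (norm (Qp T (?g S)))\<^sup>2)) \<le> (\<Sum>S\<in>nbr T. b S + t * m S)"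
      by (rule sum_mono)
    moreover have "R ^ ?k * (R\<^sup>2 * (sqrt ?s)\<^sup>2) = (\<Sum>S\<in>nbr T. R ^ ?k * (R\<^sup>2 * (norm (Qp T (?g S)))\<^sup>2))"
      using s0 by (simp only: real_sqrt_pow2 sum_distrib_left)
    ultimately have "R ^ c * J v T' + R ^ ?k * (R\<^sup>2 * (sqrt ?s)\<^sup>2) \<le> (\<Sum>S\<in>nbr T. a S) + (\<Sum>S\<in>nbr T. b S + t * m S)"
      using 1 by (simp add: a_def)
    also have "\<dots> = (\<Sum>S\<in>nbr T. w S)" by (simp add: w_def sum.distrib)
    finally have "C5 * (R ^ c * J v T' + R ^ ?k * (R\<^sup>2 * (sqrt ?s)\<^sup>2)) \<le> C5 * (\<Sum>S\<in>nbr T. w S)"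
      using C50 by (rule mult_left_mono)
    then show ?thesis using T'(2) by (simp add: m_def)
  qed
  have "(\<Sum>T\<in>act. m T) \<le> (\<Sum>T\<in>act. C5 * (\<Sum>T'\<in>nbr T. w T'))" by (rule sum_mono) (rule loc)
  also have "\<dots> = C5 * (\<Sum>T\<in>act. \<Sum>T'\<in>{T' \<in> act. T' \<in> nbr T}. w T')"
    by (simp add: sum_distrib_left nbr_def)
  \<comment> \<open>The double sum is ordered by neighbours: the base points of all \<open>T\<close>
    with neighbour \<open>T'\<close> lie within \<open>2 * R + D\<close> of that of
    \<open>T'\<close>, so each \<open>T'\<close> occurs at most \<open>N1\<close> times.\<close>
  also have "(\<Sum>T\<in>act. \<Sum>T'\<in>{T' \<in> act. T' \<in> nbr T}. w T') = (\<Sum>T'\<in>act. \<Sum>T\<in>{T \<in> act. T' \<in> nbr T}. w T')"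
    by (rule sum.swap_restrict) (rule fin_act)+
  also have "\<dots> \<le> (\<Sum>T'\<in>act. real N1 * w T')"
  proof (rule sum_mono)
    fix T' assume T': "T' \<in> act"
    have "card {T \<in> act. T' \<in> nbr T} \<le> card {T \<in> \<T>. T \<inter> cball (base T') (2 * R + D) \<noteq> {}}"
    proof (rule card_mono)
      show "{T \<in> act. T' \<in> nbr T} \<subseteq> {T \<in> \<T>. T \<inter> cball (base T') (2 * R + D) \<noteq> {}}"
      proof
        fix T assume "T \<in> {T \<in> act. T' \<in> nbr T}"
        then have T: "T \<in> act" "T' \<in> nbr T" by auto
        obtain z where z: "z \<in> T'" "norm (z - base T) \<le> 2 * R"
          using T(2) by (auto simp: nbr_def dist_norm norm_minus_commute)
        have "norm (z - base T') \<le> D" using T' z base(1)[OF T'] act_T by (intro diam) auto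
        then have "norm (base T' - base T) \<le> 2 * R + D"
          using z(2) norm_triangle_ineq4[of "z - base T" "z - base T'"] by simp
        then have "base T \<in> T \<inter> cball (base T') (2 * R + D)" using base(1)[OF T(1)] by (simp add: dist_norm)
        then show "T \<in> {T \<in> \<T>. T \<inter> cball (base T') (2 * R + D) \<noteq> {}}" using act_T[OF T(1)] by blast
      qed
    qed (use finT in simp)
    also have "\<dots> \<le> N1" using R_pos R_\<rho> D\<rho> by (intro N1_bound) auto
    finally show "(\<Sum>T\<in>{T \<in> act. T' \<in> nbr T}. w T') \<le> real N1 * w T'"
      using w0[of T'] by (simp add: mult_right_mono)
  qed
  also have "\<dots> = real N1 * ((\<Sum>T\<in>act. a T) + (\<Sum>T\<in>act. b T) + t * (\<Sum>T\<in>act. m T))"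
    by (simp add: w_def sum_distrib_left[symmetric] sum.distrib)
  finally have S: "(\<Sum>T\<in>act. m T) \<le> C5 * (real N1 * ((\<Sum>T\<in>act. a T) + (\<Sum>T\<in>act. b T) + t * (\<Sum>T\<in>act. m T)))"
    using C50 by (simp add: mult_left_mono)
  define X where "X = (\<Sum>T\<in>act. m T)"
  have "C5 * (real N1 * (t * X)) = (C5 * real N1 * t) * X" by simp
  also have "\<dots> \<le> (1 / 2) * X"
    by (rule mult_right_mono) (use sm m0 in \<open>auto simp: t_def X_def intro!: sum_nonneg\<close>)
  finally have half: "C5 * (real N1 * (t * X)) \<le> X / 2" by simp
  have sums: "(\<Sum>T\<in>act. a T) \<le> R ^ c * (real N1 * J v UNIV)" "(\<Sum>T\<in>act. b T) \<le> be * Itot v"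
    using J_sum[OF v] e_r_sum[of v] R_pos be0
    by (auto simp: a_def b_def sum_distrib_left[symmetric] intro!: mult_left_mono)
  have "X \<le> C5 * real N1 * ((\<Sum>T\<in>act. a T) + (\<Sum>T\<in>act. b T)) + X / 2"
    using S half by (simp add: X_def[symmetric] distrib_left mult.assoc)
  then have "X \<le> 2 * C5 * real N1 * ((\<Sum>T\<in>act. a T) + (\<Sum>T\<in>act. b T))" by simp
  also have "\<dots> \<le> 2 * C5 * real N1 * (R ^ c * (real N1 * J v UNIV) + be * Itot v)"
    using sums C50 by (intro mult_left_mono add_mono) auto
  finally show ?thesis by (simp add: X_def m_def be_def)
qed

definition C7 :: real where
  "C7 = unit_ball_vol (real DIM('a)) * (2 * D1 / R1) ^ DIM('a) * (D1 / R1)\<^sup>2 * (2 * C5 * real N1)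
    * (R1 ^ c * real N1 + 2 * R1\<^sup>2 * (R1 / \<rho>1) ^ DIM('a) / unit_ball_vol (real DIM('a)))"

lemma C7_nonneg: "0 \<le> C7"
proof -
  have "0 \<le> C5" using fan_A_nonneg cyl_pos by (simp add: C5_def less_imp_le)
  then show ?thesis using R_pos pars by (simp add: C7_def)
qed

text \<open>A count of powers of \<open>h\<close>: the weight cancels \<open>R ^ c\<close> in the
  trace term, while the energy arrives with \<open>h\<^sup>2\<close>. Since \<open>h \<le> 1\<close>
  and \<open>\<alpha> \<le> 2\<close>, the resulting \<open>h powr (2 - c)\<close> is at most the
  weight \<open>h powr (\<alpha> - c)\<close> of the stabilization.\<close>

lemma weighted_L2_bound:
  assumes v: "v \<in> V_space act" and sm: "4 * C5 * real N1 * CQ\<^sup>2 * h\<^sup>2 \<le> 1" and h1: "h \<le> 1" and \<alpha>: "\<alpha> \<le> 2"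
  shows "h powr (- real c) * (LINT x:Nh|lebesgue. (v x)\<^sup>2) \<le> C7 * (J v UNIV + h powr (\<alpha> - real c) * Itot v)"
proof -
  let ?k = "DIM('a)" let ?\<omega> = "unit_ball_vol (real DIM('a))"
  define X where "X = ?\<omega> * (2 * D1 / R1) ^ ?k * (D1 / R1)\<^sup>2"
  define Y where "Y = 2 * R1\<^sup>2 * (R1 / \<rho>1) ^ ?k / ?\<omega>"
  define N where "N = 2 * C5 * real N1"
  have C50: "0 \<le> C5" using fan_A_nonneg cyl_pos by (simp add: C5_def less_imp_le)
  have X0: "0 \<le> X" and Y0: "0 \<le> Y" and N0: "0 \<le> N" using R_pos pars C50 by (auto simp: X_def Y_def N_def)
  have DR: "D / R = D1 / R1" using h by (simp add: D_eq R_def)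
  have "(LINT x:Nh|lebesgue. (v x)\<^sup>2) \<le> (?\<omega> * (2 * D) ^ ?k * (D / R)\<^sup>2) * (\<Sum>T\<in>act. Mq v T)"
    by (rule V_sq_integral[OF v])
  also have "\<dots> = X * (\<Sum>T\<in>act. R ^ ?k * Mq v T)"
  proof -
    have "2 * D = (2 * D1 / R1) * R" using R_pos by (simp add: D_eq R_def)
    then have e: "(2 * D) ^ ?k = (2 * D1 / R1) ^ ?k * R ^ ?k" by (simp only: power_mult_distrib)
    show ?thesis unfolding X_def DR e sum_distrib_left[symmetric] by (simp only: mult_ac)
  qed
  also have "\<dots> \<le> X * (N * (R ^ c * (real N1 * J v UNIV) + 2 * (R ^ ?k * R\<^sup>2) / B0 * Itot v))"
    unfolding N_def by (rule mult_left_mono[OF absorption[OF v sm] X0])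
  also have "2 * (R ^ ?k * R\<^sup>2) / B0 = Y * h\<^sup>2"
    unfolding B0_def unfolding Y_def R_def \<rho>_eq using h pars by (simp add: power_mult_distrib power_divide mult_ac)
  finally have "(LINT x:Nh|lebesgue. (v x)\<^sup>2) \<le> X * (N * (R ^ c * (real N1 * J v UNIV) + Y * h\<^sup>2 * Itot v))" .
  then have "h powr (- real c) * (LINT x:Nh|lebesgue. (v x)\<^sup>2)
    \<le> h powr (- real c) * (X * (N * (R ^ c * (real N1 * J v UNIV) + Y * h\<^sup>2 * Itot v)))"
    by (rule mult_left_mono) simp
  also have "\<dots> = X * N * ((h powr (- real c) * R ^ c) * (real N1 * J v UNIV) + Y * (h powr (- real c) * h\<^sup>2) * Itot v)"
    by (simp add: algebra_simps)
  also have "\<dots> \<le> X * N * (R1 ^ c * (real N1 * J v UNIV) + Y * h powr (\<alpha> - real c) * Itot v)"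
  proof -
    have 1: "h powr (- real c) * R ^ c = R1 ^ c"
      using h by (simp add: R_def power_mult_distrib powr_minus powr_realpow)
    have "h powr (- real c) * h\<^sup>2 = h powr (2 - real c)"
      using h powr_realpow[OF h, of 2] by (simp add: powr_diff powr_minus field_simps)
    also have "\<dots> \<le> h powr (\<alpha> - real c)" using h h1 \<alpha> by (intro powr_mono') auto
    finally have 2: "h powr (- real c) * h\<^sup>2 \<le> h powr (\<alpha> - real c)" .
    show ?thesis unfolding 1 using X0 N0 Y0 2 Itot(2) by (intro mult_left_mono add_left_mono mult_right_mono mult_nonneg_nonneg) auto
  qed
  also have "\<dots> \<le> X * N * ((R1 ^ c * real N1 + Y) * (J v UNIV + h powr (\<alpha> - real c) * Itot v))"
  proof -
    have "0 \<le> Y * J v UNIV" "0 \<le> R1 ^ c * real N1 * (h powr (\<alpha> - real c) * Itot v)"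
      using Y0 J(2)[of v UNIV] Itot(2)[of v] R_pos by auto
    then show ?thesis using X0 N0 by (intro mult_left_mono) (auto simp: algebra_simps)
  qed
  also have "\<dots> = C7 * (J v UNIV + h powr (\<alpha> - real c) * Itot v)"
    by (simp add: C7_def X_def N_def Y_def mult.assoc)
  finally show ?thesis .
qed

lemma continuous_set_integrable:
  fixes g :: "'a \<Rightarrow> real"
  assumes g: "continuous_on \<Gamma>h g" and K: "K \<in> \<K>"
  shows "set_integrable (\<mu> K) K g"
proof -
  have gK: "continuous_on K g" using g K by (intro continuous_on_subset[OF g]) auto
  have "compact (g ` K)" by (rule compact_continuous_image[OF gK compactK[OF K]])
  then obtain b where b: "\<And>y. y \<in> K \<Longrightarrow> \<bar>g y\<bar> \<le> b" using compact_imp_bounded by (fastforce simp: bounded_iff)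
  have m: "(\<lambda>x. indicator K x *\<^sub>R g x) \<in> borel_measurable (\<mu> K)"
    using borel_measurable_continuous_on_indicator[OF K_borel[OF K] gK] by (simp add: measurable_cong_sets[OF sets_affine_lebesgue refl])
  have "integrable (\<mu> K) (\<lambda>x. indicator K x *\<^sub>R (indicator K x *\<^sub>R g x))"
    by (rule integrableI_bounded_set_indicator[where B="\<bar>b\<bar>"])
      (use K_borel[OF K] m emeasure_K_finite[OF K] b in \<open>fastforce simp: less_top\<close>)+
  moreover have "(\<lambda>x. indicator K x *\<^sub>R (indicator K x *\<^sub>R g x)) = (\<lambda>x. indicator K x *\<^sub>R g x)"
    by (auto simp: indicator_def fun_eq_iff)
  ultimately show ?thesis by (simp add: set_integrable_def)
qed

lemma J_eq_surface_integral:
  assumes v: "v \<in> V_space act" shows "J v UNIV = surface_integral \<K> (\<lambda>x. (v x)\<^sup>2)"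
proof -
  have c: "continuous_on \<Gamma>h (\<lambda>x. (v x)\<^sup>2)" using V_cont[OF v] by (intro continuous_intros)
  have K: "(\<integral>\<^sup>+y. ennreal ((vb v y)\<^sup>2) * indicator (K \<inter> UNIV) y \<partial>\<mu> K) = ennreal (LINT x:K|\<mu> K. (v x)\<^sup>2)"
    "0 \<le> (LINT x:K|\<mu> K. (v x)\<^sup>2)" if K: "K \<in> \<K>" for K
  proof -
    have "(\<integral>\<^sup>+y. ennreal ((vb v y)\<^sup>2) * indicator (K \<inter> UNIV) y \<partial>\<mu> K) = (\<integral>\<^sup>+y. ennreal (indicator K y *\<^sub>R (v y)\<^sup>2) \<partial>\<mu> K)"
      using K by (intro nn_integral_cong) (auto simp: indicator_def vb_def)
    also have "\<dots> = ennreal (LINT x:K|\<mu> K. (v x)\<^sup>2)"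
      unfolding set_lebesgue_integral_def
      by (rule nn_integral_eq_integral) (use continuous_set_integrable[OF c K] in \<open>auto simp: set_integrable_def\<close>)
    finally show "(\<integral>\<^sup>+y. ennreal ((vb v y)\<^sup>2) * indicator (K \<inter> UNIV) y \<partial>\<mu> K) = ennreal (LINT x:K|\<mu> K. (v x)\<^sup>2)" .
    show "0 \<le> (LINT x:K|\<mu> K. (v x)\<^sup>2)" unfolding set_lebesgue_integral_def
      by (rule Bochner_Integration.integral_nonneg) simp
  qed
  have "ennreal (J v UNIV) = (\<Sum>K\<in>\<K>. ennreal (LINT x:K|\<mu> K. (v x)\<^sup>2))"
    unfolding J(1)[OF v] sq_int_def by (intro sum.cong refl K(1))
  also have "\<dots> = ennreal (surface_integral \<K> (\<lambda>x. (v x)\<^sup>2))"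
    unfolding surface_integral_def by (rule sum_ennreal) (rule K(2))
  finally show ?thesis using J(2)[of v UNIV] K(2)
    by (simp add: surface_integral_def sum_nonneg ennreal_inj)
qed

end

section \<open>Deviation from the average\<close>

context trace_mesh begin

lemma V_space_shift: "v \<in> V_space act \<Longrightarrow> (\<lambda>x. v x - m) \<in> V_space act"
proof -
  assume v: "v \<in> V_space act"
  have "\<exists>g b. \<forall>x\<in>T. v x - m = g \<bullet> x + b" if T: "T \<in> act" for T
  proof -
    obtain g b where "\<forall>x\<in>T. v x = g \<bullet> x + b" using v T unfolding V_space_def by blast
    then show ?thesis by (intro exI[of _ g] exI[of _ "b - m"]) simp
  qed
  moreover have "continuous_on Nh (\<lambda>x. v x - m)" using v by (auto simp: V_space_def intro!: continuous_intros)
  ultimately show ?thesis by (simp add: V_space_def)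
qed

lemma element_gradient_shift:
  assumes v: "v \<in> V_space act" and T: "T \<in> act"
  shows "element_gradient (\<lambda>x. v x - m) T = element_gradient v T"
proof -
  obtain g b where gb: "\<forall>x\<in>T. v x = g \<bullet> x + b" using v T unfolding V_space_def by blast
  have "element_gradient v T = g"
    using gb interiorT[OF act_T[OF T]] by (intro element_gradient_eq) auto
  moreover have "element_gradient (\<lambda>x. v x - m) T = g"
    using gb interiorT[OF act_T[OF T]] by (intro element_gradient_eq[of T _ g "b - m"]) auto
  ultimately show ?thesis by simp
qed

lemma cell_act: "x \<in> Nh \<Longrightarrow> cell act x \<in> act \<and> x \<in> cell act x"
proof -
  assume "x \<in> Nh"
  then have "\<exists>S. S \<in> act \<and> x \<in> S" by blast
  then show ?thesis unfolding cell_def by (rule someI_ex)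
qed

lemma Itot_shift: assumes v: "v \<in> V_space act" shows "Itot (\<lambda>x. v x - m) = Itot v"
proof -
  have "indicator Nh x *\<^sub>R (qgrad (\<lambda>x. v x - m) x \<bullet> qgrad (\<lambda>x. v x - m) x) = indicator Nh x *\<^sub>R (qgrad v x \<bullet> qgrad v x)" for x
  proof (cases "x \<in> Nh")
    case True
    then have "broken_gradient act (\<lambda>x. v x - m) x = broken_gradient act v x"
      unfolding broken_gradient_def using cell_act by (intro element_gradient_shift[OF v]) blast
    then show ?thesis by (simp only: qgrad_def)
  qed simp
  then show ?thesis by (simp only: Itot_def set_lebesgue_integral_def)
qed

lemma stab_eq: "stab \<alpha> c \<Gamma> h \<K> act v v = h powr (\<alpha> - real c) * Itot v"
  by (simp only: stab_def Itot_def qgrad_def)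

lemma LINT_const: assumes "K \<in> \<K>" shows "(LINT x:K|\<mu> K. a) = a * measure (\<mu> K) K"
proof -
  have "space (\<mu> K) = UNIV" using sets_eq_imp_space_eq[OF sets_affine_lebesgue] by simp
  then show ?thesis by (simp add: set_lebesgue_integral_def mult.commute)
qed

lemma emeasure_K: "K \<in> \<K> \<Longrightarrow> emeasure (\<mu> K) K = ennreal (measure (\<mu> K) K)"
  using emeasure_K_finite by (intro emeasure_eq_ennreal_measure) force

lemma area_pos: "0 < surface_integral \<K> (\<lambda>_. 1)"
proof -
  obtain q where q: "q \<in> \<Gamma>" using ne by blast
  have "ennreal meas_lo \<le> (\<Sum>K\<in>\<K>. emeasure (\<mu> K) (K \<inter> ball q (R0 / 8)))" by (rule measure_lower[OF q])
  also have "\<dots> \<le> (\<Sum>K\<in>\<K>. emeasure (\<mu> K) K)" using K_borel by (intro sum_mono emeasure_mono) auto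
  also have "\<dots> = (\<Sum>K\<in>\<K>. ennreal (measure (\<mu> K) K))" by (intro sum.cong refl emeasure_K)
  also have "\<dots> = ennreal (\<Sum>K\<in>\<K>. measure (\<mu> K) K)" by (rule sum_ennreal) simp
  finally have "meas_lo \<le> (\<Sum>K\<in>\<K>. measure (\<mu> K) K)" by (simp add: ennreal_le_iff sum_nonneg)
  moreover have "surface_integral \<K> (\<lambda>_. 1) = (\<Sum>K\<in>\<K>. measure (\<mu> K) K)"
    unfolding surface_integral_def by (intro sum.cong refl) (simp add: LINT_const)
  ultimately show ?thesis using meas_lo_pos by linarith
qed

text \<open>The right-hand side is a quadratic polynomial in \<open>m\<close> with leading
  coefficient the area, and its vertex is the average.\<close>

lemma average_minimizes:
  assumes v: "v \<in> V_space act"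
  shows "surface_integral \<K> (\<lambda>x. (v x - surface_average \<K> v)\<^sup>2) \<le> surface_integral \<K> (\<lambda>x. (v x - m)\<^sup>2)"
proof -
  define I1 where "I1 = surface_integral \<K> v"
  define I2 where "I2 = surface_integral \<K> (\<lambda>x. (v x)\<^sup>2)"
  define M where "M = surface_integral \<K> (\<lambda>_. 1 :: real)"
  have M: "0 < M" unfolding M_def by (rule area_pos)
  have expand: "surface_integral \<K> (\<lambda>x. (v x - a)\<^sup>2) = I2 - 2 * a * I1 + a\<^sup>2 * M" for a
  proof -
    have "(LINT x:K|\<mu> K. (v x - a)\<^sup>2) = (LINT x:K|\<mu> K. (v x)\<^sup>2) - 2 * a * (LINT x:K|\<mu> K. v x) + a\<^sup>2 * (LINT x:K|\<mu> K. 1)"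
      if K: "K \<in> \<K>" for K
    proof -
      have i: "set_integrable (\<mu> K) K (\<lambda>x. (v x)\<^sup>2)" "set_integrable (\<mu> K) K (\<lambda>x. 2 * a * v x)" "set_integrable (\<mu> K) K (\<lambda>x. a\<^sup>2 * 1)"
        using V_cont[OF v] by (auto intro!: continuous_set_integrable[OF _ K] continuous_intros)
      have "(v x - a)\<^sup>2 = ((v x)\<^sup>2 - 2 * a * v x) + a\<^sup>2 * 1" for x by (simp add: power2_diff)
      then have "(LINT x:K|\<mu> K. (v x - a)\<^sup>2) = (LINT x:K|\<mu> K. ((v x)\<^sup>2 - 2 * a * v x) + a\<^sup>2 * 1)" by (simp only:)
      also have "\<dots> = (LINT x:K|\<mu> K. (v x)\<^sup>2 - 2 * a * v x) + (LINT x:K|\<mu> K. a\<^sup>2 * 1)"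
        by (rule set_integral_add(2)[OF set_integral_diff(1)[OF i(1,2)] i(3)])
      also have "(LINT x:K|\<mu> K. (v x)\<^sup>2 - 2 * a * v x) = (LINT x:K|\<mu> K. (v x)\<^sup>2) - (LINT x:K|\<mu> K. 2 * a * v x)"
        by (rule set_integral_diff(2)[OF i(1,2)])
      finally show ?thesis by (simp only: set_integral_mult_right)
    qed
    then show ?thesis
      by (simp add: surface_integral_def I1_def I2_def M_def sum.distrib sum_subtractf sum_distrib_left)
  qed
  have av: "surface_average \<K> v = I1 / M" by (simp add: surface_average_def I1_def M_def)
  have "0 \<le> M * (m - I1 / M)\<^sup>2" using M by simp
  also have "\<dots> = (I2 - 2 * m * I1 + m\<^sup>2 * M) - (I2 - 2 * (I1 / M) * I1 + (I1 / M)\<^sup>2 * M)"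
    using M by (simp add: power2_eq_square field_simps)
  finally show ?thesis unfolding expand av by simp
qed

definition el :: "'a set \<Rightarrow> 'a set" where "el K = (SOME T. T \<in> act \<and> K \<subseteq> T)"

definition tg :: "('a \<Rightarrow> real) \<Rightarrow> 'a set \<Rightarrow> 'a" where
  "tg v K = orth_proj (parallel_space K) (element_gradient v (el K))"

lemma el:
  assumes cmp: "compatible \<K> act" and K: "K \<in> \<K>" shows "el K \<in> act \<and> K \<subseteq> el K"
proof -
  have "rel_interior K \<noteq> {}" using neK[OF K] convexK[OF K] by (simp add: rel_interior_eq_empty)
  then obtain y where y: "y \<in> rel_interior K" by blast
  then have "y \<in> Nh" using rel_interior_subset K \<Gamma>h_act by blast
  then obtain T where T: "T \<in> act" "y \<in> T" by blast
  then have "K \<subseteq> T" using cmp K y unfolding compatible_def by blast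
  then have "\<exists>T. T \<in> act \<and> K \<subseteq> T" using T(1) by blast
  then show ?thesis unfolding el_def by (rule someI_ex)
qed

text \<open>The affine pieces of \<open>v\<close> on two elements containing \<open>K\<close> agree
  on \<open>K\<close>, so their gradients differ by a vector orthogonal to \<open>K\<close>.\<close>

lemma tg_independent:
  assumes v: "v \<in> V_space act" and cmp: "compatible \<K> act" and K: "K \<in> \<K>" and T: "T \<in> act" "K \<subseteq> T"
  shows "orth_proj (parallel_space K) (element_gradient v T) = tg v K"
proof -
  have s: "subspace (parallel_space K)" by (rule subspace_parallel_space[OF neK[OF K]])
  note E = el[OF cmp K]
  define w where "w = element_gradient v T - element_gradient v (el K)"
  obtain y where y: "y \<in> K" using neK[OF K] by blast
  have "K \<subseteq> {x. w \<bullet> x = w \<bullet> y}"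
  proof
    fix x assume x: "x \<in> K"
    have "v x - v y = element_gradient v T \<bullet> (x - y)" using x y T by (intro V_affine[OF v]) auto
    moreover have "v x - v y = element_gradient v (el K) \<bullet> (x - y)" using x y E by (intro V_affine[OF v]) auto
    ultimately show "x \<in> {x. w \<bullet> x = w \<bullet> y}" by (simp add: w_def inner_diff_left inner_diff_right)
  qed
  then have "affine hull K \<subseteq> {x. w \<bullet> x = w \<bullet> y}" by (rule hull_minimal) (rule affine_hyperplane)
  then have hull: "w \<bullet> x = w \<bullet> y" if "x \<in> affine hull K" for x using that by blast
  have w: "w \<bullet> z = 0" if z: "z \<in> parallel_space K" for z
  proof -
    obtain x x' where "z = x - x'" "x \<in> affine hull K" "x' \<in> affine hull K"
      using z by (auto simp: parallel_space_def)
    then show ?thesis using hull[of x] hull[of x'] by (simp add: inner_diff_right)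
  qed
  show ?thesis
  proof (rule orth_proj_unique[OF s])
    show "tg v K \<in> parallel_space K" unfolding tg_def by (rule orth_proj(1)[OF s])
    fix z assume z: "z \<in> parallel_space K"
    have "(element_gradient v T - tg v K) \<bullet> z = w \<bullet> z + (element_gradient v (el K) - tg v K) \<bullet> z"
      by (simp add: w_def inner_diff_left)
    also have "\<dots> = 0" using w[OF z] orth_proj(2)[OF s z] by (simp add: tg_def)
    finally show "orthogonal (element_gradient v T - tg v K) z" by (simp add: orthogonal_def)
  qed
qed

lemma surface_gradient_eq:
  assumes v: "v \<in> V_space act" and cmp: "compatible \<K> act" and K: "K \<in> \<K>"
    and y: "y \<in> rel_interior K" "cell \<K> y = K"
  shows "surface_gradient \<K> act v y = tg v K"
proof -
  have "y \<in> Nh" using y(1) rel_interior_subset K \<Gamma>h_act by blast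
  then have T: "cell act y \<in> act" "y \<in> cell act y" using cell_act by blast+
  then have "K \<subseteq> cell act y" using cmp K y(1) unfolding compatible_def by blast
  from tg_independent[OF v cmp K T(1) this] show ?thesis
    by (simp only: surface_gradient_def P_disc_def broken_gradient_def y(2))
qed

text \<open>On the relative interior of \<open>K\<close>, that is almost everywhere,
  \<open>cell\<close> picks \<open>K\<close> itself, and by compatibility any chosen element
  contains \<open>K\<close>. The integrand is therefore constant on each cell up to a null
  set.\<close>

lemma surface_gradient_integral:
  assumes v: "v \<in> V_space act" and cmp: "compatible \<K> act"
    and cellK: "\<And>K y. K \<in> \<K> \<Longrightarrow> y \<in> rel_interior K \<Longrightarrow> cell \<K> y = K"
  shows "surface_integral \<K> (\<lambda>x. (norm (surface_gradient \<K> act v x))\<^sup>2) = (\<Sum>K\<in>\<K>. (norm (tg v K))\<^sup>2 * measure (\<mu> K) K)"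
  unfolding surface_integral_def
proof (rule sum.cong[OF refl])
  fix K assume K: "K \<in> \<K>"
  let ?f = "\<lambda>x. (norm (surface_gradient \<K> act v x))\<^sup>2"
  define G where "G a b = (norm (orth_proj (parallel_space (SOME S. S \<in> b)) (element_gradient v (SOME S. S \<in> a))))\<^sup>2" for a b
  have "?f = (\<lambda>x. G {T \<in> act. x \<in> T} {K \<in> \<K>. x \<in> K})"
    by (simp add: fun_eq_iff G_def surface_gradient_def P_disc_def broken_gradient_def cell_def)
  moreover have "(\<lambda>x. G {T \<in> act. x \<in> T} {K \<in> \<K>. x \<in> K}) \<in> borel_measurable borel"
  proof (rule borel_measurable_incidence[where W="\<lambda>T. T" and X="\<lambda>K. K"])
    show "T \<in> sets borel" if "T \<in> act" for T using closedT act_T that borel_closed by blast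
  qed (use fin_act finK K_borel in auto)
  ultimately have f: "?f \<in> borel_measurable (\<mu> K)" by (simp add: measurable_cong_sets[OF sets_affine_lebesgue refl])
  have Ks: "K \<in> sets (\<mu> K)" using K_borel[OF K] by simp
  have "(LINT x:K|\<mu> K. ?f x) = (LINT x:K|\<mu> K. (norm (tg v K))\<^sup>2)"
    unfolding set_lebesgue_integral_def
  proof (rule integral_cong_AE)
    show "(\<lambda>x. indicator K x *\<^sub>R ?f x) \<in> borel_measurable (\<mu> K)"
      by (rule borel_measurable_scaleR[OF borel_measurable_indicator[OF Ks] f])
    show "(\<lambda>x. indicator K x *\<^sub>R (norm (tg v K))\<^sup>2) \<in> borel_measurable (\<mu> K)"
      by (rule borel_measurable_scaleR[OF borel_measurable_indicator[OF Ks] borel_measurable_const])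
    show "AE x in \<mu> K. indicator K x *\<^sub>R ?f x = indicator K x *\<^sub>R (norm (tg v K))\<^sup>2"
      using AE_ri[OF K]
    proof (rule eventually_mono)
      fix x assume x: "x \<in> K \<longrightarrow> x \<in> rel_interior K"
      show "indicator K x *\<^sub>R ?f x = indicator K x *\<^sub>R (norm (tg v K))\<^sup>2"
      proof (cases "x \<in> K")
        case True
        then have "x \<in> rel_interior K" using x by blast
        from surface_gradient_eq[OF v cmp K this cellK[OF K this]] show ?thesis by (simp only:)
      qed simp
    qed
  qed
  then show "(LINT x:K|\<mu> K. ?f x) = (norm (tg v K))\<^sup>2 * measure (\<mu> K) K" by (simp only: LINT_const[OF K])
qed

lemma cell_lip_vb:
  assumes v: "v \<in> V_space act" and cmp: "compatible \<K> act"
  shows "cell_lip (vb v) (\<lambda>K. norm (tg v K))"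
  unfolding cell_lip_def
proof (intro ballI conjI)
  fix K y y' assume K: "K \<in> \<K>" and y: "y \<in> K" "y' \<in> K"
  have s: "subspace (parallel_space K)" by (rule subspace_parallel_space[OF neK[OF K]])
  let ?g = "element_gradient v (el K)"
  have "y \<in> \<Gamma>h" "y' \<in> \<Gamma>h" using K y by blast+
  then have "vb v y - vb v y' = v y - v y'" by (simp add: vb_def del: Union_iff)
  also have "\<dots> = ?g \<bullet> (y - y')" using el[OF cmp K] y by (intro V_affine[OF v]) auto
  also have "\<dots> = ?g \<bullet> orth_proj (parallel_space K) (y - y')"
    using orth_proj_id[OF s parallel_mem[OF K y]] by simp
  also have "\<dots> = tg v K \<bullet> (y - y')" unfolding tg_def by (rule orth_proj_sym[OF s, symmetric])
  finally show "\<bar>vb v y - vb v y'\<bar> \<le> norm (tg v K) * norm (y - y')" using Cauchy_Schwarz_ineq2 by simp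
qed simp

lemma poinc_nonneg: "0 \<le> poinc M n"
  using poinc1_pos meas_lo_pos meas_up_pos by (simp add: poinc_def)

text \<open>\<open>global_poincare\<close> yields some constant \<open>m\<close> that need not be
  the average; \<open>average_minimizes\<close> exchanges it for the average at no cost. Subtracting
  a constant changes neither the gradients nor the stabilization.\<close>

lemma mean_deviation_bound:
  assumes v: "v \<in> V_space act" and cmp: "compatible \<K> act"
    and cellK: "\<And>K y. K \<in> \<K> \<Longrightarrow> y \<in> rel_interior K \<Longrightarrow> cell \<K> y = K"
    and F: "finite F" "F \<subseteq> \<Gamma>" "\<Gamma> \<subseteq> (\<Union>f\<in>F. ball f (R0 / 16))"
    and n: "\<And>(m :: 'a \<Rightarrow> real) b q q'. (\<And>q q'. q \<in> \<Gamma> \<Longrightarrow> q' \<in> \<Gamma> \<Longrightarrow> dist q q' < R0 / 8 \<Longrightarrow> \<bar>m q - m q'\<bar> \<le> b) \<Longrightarrow>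
      q \<in> \<Gamma> \<Longrightarrow> q' \<in> \<Gamma> \<Longrightarrow> \<bar>m q - m q'\<bar> \<le> real n * b"
    and sm: "4 * C5 * real N1 * CQ\<^sup>2 * h\<^sup>2 \<le> 1" and h1: "h \<le> 1" and \<alpha>: "\<alpha> \<le> 2"
  shows "h powr (- real c) * (LINT x:Nh|lebesgue. (v x - surface_average \<K> v)\<^sup>2)
    \<le> C7 * (poinc (card F) n + 1) *
      (surface_integral \<K> (\<lambda>x. (norm (surface_gradient \<K> act v x))\<^sup>2) + stab \<alpha> c \<Gamma> h \<K> act v v)"
proof -
  define P where "P = poinc (card F) n"
  have P0: "0 \<le> P" unfolding P_def by (rule poinc_nonneg)
  define SG where "SG = surface_integral \<K> (\<lambda>x. (norm (surface_gradient \<K> act v x))\<^sup>2)"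
  have SG: "SG = (\<Sum>K\<in>\<K>. (norm (tg v K))\<^sup>2 * measure (\<mu> K) K)"
    unfolding SG_def by (rule surface_gradient_integral[OF v cmp cellK])
  have SG0: "0 \<le> SG" unfolding SG by (intro sum_nonneg mult_nonneg_nonneg) auto
  have "\<exists>m. (\<Sum>K\<in>\<K>. \<integral>\<^sup>+y. ennreal ((vb v y - m)\<^sup>2) * indicator K y \<partial>\<mu> K)
    \<le> ennreal P * (\<Sum>K\<in>\<K>. ennreal ((norm (tg v K))\<^sup>2) * emeasure (\<mu> K) K)"
    unfolding P_def by (rule global_poincare[OF cell_lip_vb[OF v cmp] vb_measurable[OF v] F n])
  then obtain m where m: "(\<Sum>K\<in>\<K>. \<integral>\<^sup>+y. ennreal ((vb v y - m)\<^sup>2) * indicator K y \<partial>\<mu> K)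
    \<le> ennreal P * (\<Sum>K\<in>\<K>. ennreal ((norm (tg v K))\<^sup>2) * emeasure (\<mu> K) K)" by (rule exE)
  have "(\<Sum>K\<in>\<K>. ennreal ((norm (tg v K))\<^sup>2) * emeasure (\<mu> K) K) = (\<Sum>K\<in>\<K>. ennreal ((norm (tg v K))\<^sup>2 * measure (\<mu> K) K))"
    by (intro sum.cong refl) (simp add: emeasure_K ennreal_mult)
  also have "\<dots> = ennreal SG" unfolding SG by (rule sum_ennreal) simp
  finally have "(\<Sum>K\<in>\<K>. \<integral>\<^sup>+y. ennreal ((vb v y - m)\<^sup>2) * indicator K y \<partial>\<mu> K) \<le> ennreal (P * SG)"
    using m P0 SG0 by (simp add: ennreal_mult)
  moreover have "sq_int (\<lambda>x. v x - m) UNIV = (\<Sum>K\<in>\<K>. \<integral>\<^sup>+y. ennreal ((vb v y - m)\<^sup>2) * indicator K y \<partial>\<mu> K)"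
    unfolding sq_int_def
  proof (intro sum.cong nn_integral_cong refl)
    fix K y assume K: "K \<in> \<K>"
    show "ennreal ((vb (\<lambda>x. v x - m) y)\<^sup>2) * indicator (K \<inter> UNIV) y = ennreal ((vb v y - m)\<^sup>2) * indicator K y"
    proof (cases "y \<in> K")
      case True
      then have "y \<in> \<Gamma>h" using K by blast
      then show ?thesis by (simp add: vb_def del: Union_iff)
    qed simp
  qed
  ultimately have "ennreal (J (\<lambda>x. v x - m) UNIV) \<le> ennreal (P * SG)"
    unfolding J(1)[OF V_space_shift[OF v]] by (simp only:)
  then have Jm: "J (\<lambda>x. v x - m) UNIV \<le> P * SG" using P0 SG0 by (simp add: ennreal_le_iff)
  let ?l = "surface_average \<K> v"
  have "J (\<lambda>x. v x - ?l) UNIV \<le> J (\<lambda>x. v x - m) UNIV"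
    unfolding J_eq_surface_integral[OF V_space_shift[OF v]] by (rule average_minimizes[OF v])
  then have Jl: "J (\<lambda>x. v x - ?l) UNIV \<le> P * SG" using Jm by simp
  define st where "st = h powr (\<alpha> - real c) * Itot v"
  have st0: "0 \<le> st" using Itot(2)[of v] by (simp add: st_def)
  have "h powr (- real c) * (LINT x:Nh|lebesgue. (v x - ?l)\<^sup>2) \<le> C7 * (J (\<lambda>x. v x - ?l) UNIV + st)"
    using weighted_L2_bound[OF V_space_shift[OF v] sm h1 \<alpha>, of ?l] by (simp only: Itot_shift[OF v] st_def)
  also have "\<dots> \<le> C7 * ((P + 1) * (SG + st))"
  proof (rule mult_left_mono[OF _ C7_nonneg])
    have "0 \<le> P * st" using P0 st0 by simp
    then show "J (\<lambda>x. v x - ?l) UNIV + st \<le> (P + 1) * (SG + st)" using Jl SG0 by (simp add: algebra_simps)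
  qed
  finally show ?thesis by (simp add: SG_def st_def P_def stab_eq mult.assoc)
qed

end

section \<open>Uniform constants\<close>

text \<open>A cell sharing a relative interior point with \<open>K\<close> contains \<open>K\<close>
  as a face, and equality of the dimensions excludes a proper face.\<close>

lemma cell_eq:
  fixes \<K> :: "'a::euclidean_space set set"
  assumes m: "mesh d \<K>" and K: "K \<in> \<K>" "y \<in> rel_interior K"
  shows "cell \<K> y = K"
proof -
  have tri: "triangulation \<K>" and s: "\<And>S. S \<in> \<K> \<Longrightarrow> int d simplex S" using m by (auto simp: mesh_def)
  have yK: "y \<in> K" using K(2) rel_interior_subset by blast
  have uniq: "K' = K" if K': "K' \<in> \<K>" "y \<in> K'" for K'
  proof -
    have f: "K \<inter> K' face_of K" "K' \<inter> K face_of K'" using tri K(1) K'(1) unfolding triangulation_def by blast+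
    have 1: "K \<inter> K' = K"
    proof (rule ccontr)
      assume "K \<inter> K' \<noteq> K"
      from face_of_disjoint_rel_interior[OF f(1) this] show False using yK K'(2) K(2) by blast
    qed
    have "K' \<inter> K = K'"
    proof (rule ccontr)
      assume "K' \<inter> K \<noteq> K'"
      from face_of_aff_dim_lt[OF convex_simplex[OF s[OF K'(1)]] f(2) this]
      have "aff_dim K < aff_dim K'" using 1 by (simp only: Int_commute[of K' K])
      then show False using aff_dim_simplex[OF s[OF K(1)]] aff_dim_simplex[OF s[OF K'(1)]] by simp
    qed
    then show ?thesis using 1 by blast
  qed
  have a: "K \<in> \<K> \<and> y \<in> K" using K(1) yK ..
  show ?thesis unfolding cell_def by (rule some_equality, rule a) (use uniq in blast)
qed

lemma simplex_nonempty: "int d simplex K \<Longrightarrow> K \<noteq> {}"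
  using aff_dim_simplex[of "int d" K] by auto

lemma dim_parallel_space:
  fixes K :: "'a::euclidean_space set"
  assumes "int d simplex K" shows "dim (parallel_space K) = d"
proof -
  obtain a where a: "a \<in> K" using simplex_nonempty[OF assms] by blast
  then have ah: "a \<in> affine hull K" by (rule hull_inc)
  note parallel_space_eq[OF ah]
  moreover have "aff_dim (affine hull K) = int (dim ((\<lambda>x. x - a) ` (affine hull K)))"
    by (rule aff_dim_eq_dim_subtract) (simp add: hull_hull ah)
  ultimately show ?thesis using aff_dim_simplex[OF assms] by (simp add: aff_dim_affine_hull)
qed

context tubular begin

text \<open>\<open>M * h\<close> bounds the distance of the feet of two points of one cell, and
  \<open>L\<close> collects all bounds of order \<open>h\<close>. The given constants are arbitrary
  reals, hence the absolute values; the 1 added in \<open>D1\<close>, \<open>L\<close> and in the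
  denominator of \<open>\<rho>1\<close> makes these factors positive and well defined.\<close>

lemma trace_mesh_instance:
  assumes A: "0 < A"
    and lip: "\<And>q q' w. q \<in> \<Gamma> \<Longrightarrow> q' \<in> \<Gamma> \<Longrightarrow> norm (q - q') \<le> \<delta> / 2 \<Longrightarrow> norm (PG q w - PG q' w) \<le> A * norm (q - q') * norm w"
    and est: "\<And>q r x x'. q \<in> \<Gamma> \<Longrightarrow> r \<le> \<delta> / 2 \<Longrightarrow> norm (x - q) \<le> r \<Longrightarrow> norm (x' - q) \<le> r \<Longrightarrow>
      norm (p x - p x' - PG q (x - x')) \<le> A * r * norm (x - x')"
    and R0: "0 < R0" "112 * A * R0 \<le> 1" "28 * R0 \<le> \<delta>"
    and dc: "DIM('a) = d + c" and h: "0 < h" "h \<le> 1"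
    and M: "M = \<bar>\<mu>\<bar> + 2 * \<bar>C\<^sub>\<rho>\<bar>" and L: "L = \<bar>C\<^sub>P\<bar> + A * M + \<bar>\<mu>\<bar> + \<bar>C\<^sub>\<rho>\<bar> + 1"
    and D1: "D1 = \<bar>\<mu>\<bar> + 1" and \<rho>1: "\<rho>1 = 1 / (\<bar>\<mu> * \<kappa>\<bar> + 1)"
    and small: "M * h \<le> \<delta> / 2" "32 * (2 * A + 1) * (A * \<delta> + 1) * (L * h) \<le> 1" "16 * (L * h) \<le> R0"
      "4 * (D1 * h) + L * h \<le> R0" "L * h + \<rho>1 * h < \<delta>"
    and dm: "discrete_manifold d \<Gamma> \<delta> C\<^sub>\<rho> C\<^sub>P h \<K>" and bm: "background_mesh \<Gamma> \<delta> \<kappa> \<mu> h \<T>"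
    and cmp: "compatible \<K> (active_mesh \<T> \<K>)"
  shows "trace_mesh \<Gamma> \<delta> A (L * h) R0 \<K> c \<T> (\<rho>1 * h) (D1 * h) h \<rho>1 D1 L"
proof -
  have mK: "mesh d \<K>" using dm by (simp add: discrete_manifold_def)
  have sK: "int d simplex K" if "K \<in> \<K>" for K using mK that by (simp add: mesh_def)
  have mT: "mesh DIM('a) \<T>" using bm by (simp add: background_mesh_def)
  have sT: "int DIM('a) simplex T" if "T \<in> \<T>" for T using mT that by (simp add: mesh_def)
  have triT: "triangulation \<T>" using mT by (simp add: mesh_def)
  have M0: "0 \<le> M" by (simp add: M)
  have Lpos: "0 < L" using A M0 by (simp add: L add_nonneg_pos)
  have AM: "0 \<le> A * M" using A M0 by simp
  have Lh: "\<bar>\<mu>\<bar> * h \<le> L * h" "\<bar>C\<^sub>\<rho>\<bar> * h \<le> L * h" "(A * M + \<bar>C\<^sub>P\<bar>) * h \<le> L * h"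
    using h AM by (auto simp: L intro!: mult_right_mono)
  have finK': "finite \<K>" using mK by (simp add: mesh_def triangulation_def)
  have compactK': "compact K" if "K \<in> \<K>" for K using compact_simplex sK[OF that] by blast
  have convexK': "convex K" if "K \<in> \<K>" for K using convex_simplex sK[OF that] by blast
  have neK': "K \<noteq> {}" if "K \<in> \<K>" for K by (rule simplex_nonempty[OF sK[OF that]])
  have tubeK: "\<Union>\<K> \<subseteq> tube \<Gamma> \<delta>" using dm by (simp add: discrete_manifold_def)
  have tubeT: "tube \<Gamma> \<delta> \<subseteq> \<Union>\<T>" using bm unfolding background_mesh_def by blast
  have nearC: "norm (y - p y) \<le> \<bar>C\<^sub>\<rho>\<bar> * h" if y: "y \<in> \<Union>\<K>" for y
  proof -
    have "norm (y - p y) = infdist y \<Gamma>" using p_dist[of y] by (simp add: dist_norm)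
    also have "\<dots> \<le> C\<^sub>\<rho> * h\<^sup>2" using dm y unfolding discrete_manifold_def by blast
    also have "\<dots> \<le> \<bar>C\<^sub>\<rho>\<bar> * h\<^sup>2" by (intro mult_right_mono) auto
    also have "\<dots> \<le> \<bar>C\<^sub>\<rho>\<bar> * h" using h mult_left_mono[of h 1 h] by (intro mult_left_mono) (auto simp: power2_eq_square)
    finally show ?thesis .
  qed
  have near': "norm (y - p y) \<le> L * h" if "y \<in> \<Union>\<K>" for y using nearC[OF that] Lh(2) by linarith
  have diamT: "norm (x - y) \<le> \<bar>\<mu>\<bar> * h" if T: "T \<in> \<T>" and xy: "x \<in> T" "y \<in> T" for T x y
  proof -
    have "bounded T" using compact_simplex[OF sT[OF T]] by (rule compact_imp_bounded)
    from diameter_bounded_bound[OF this xy] have "norm (x - y) \<le> diameter T" by (simp add: dist_norm)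
    also have "\<dots> \<le> \<mu> * h" using bm T unfolding background_mesh_def quasi_uniform_def by blast
    also have "\<dots> \<le> \<bar>\<mu>\<bar> * h" using h by (intro mult_right_mono) auto
    finally show ?thesis .
  qed
  have ri: "\<exists>y. y \<in> rel_interior K" if "K \<in> \<K>" for K
    using neK'[OF that] convexK'[OF that] rel_interior_eq_empty[of K] by blast
  have diamC: "norm (x - y) \<le> \<bar>\<mu>\<bar> * h" if K: "K \<in> \<K>" and xy: "x \<in> K" "y \<in> K" for K x y
  proof -
    obtain z where z: "z \<in> rel_interior K" using ri[OF K] by (rule exE)
    then have zK: "z \<in> \<Union>\<K>" using rel_interior_subset K by blast
    then obtain T where T: "T \<in> \<T>" "z \<in> T" using tubeK tubeT by blast
    then have "T \<in> active_mesh \<T> \<K>" using zK by (auto simp: active_mesh_def)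
    then have "K \<subseteq> T" using cmp K z T(2) unfolding compatible_def by blast
    then show ?thesis using xy by (intro diamT[OF T(1)]) auto
  qed
  have diamK': "norm (x - y) \<le> L * h" if "K \<in> \<K>" "x \<in> K" "y \<in> K" for K x y
    using diamC[OF that] Lh(1) by linarith
  \<comment> \<open>The tilt is assumed at relative interior points only. A nearby such point
    \<open>z\<close> of the same cell has the same parallel space, and the tangent plane turns by at
    most \<open>A * M * h\<close> from the foot of \<open>z\<close> to the foot of
    \<open>y\<close>.\<close>
  have projK': "norm (PG (p y) w - orth_proj (parallel_space K) w) \<le> L * h * norm w" if K: "K \<in> \<K>" and y: "y \<in> K" for K y w
  proof -
    obtain z where z: "z \<in> rel_interior K" using ri[OF K] by (rule exE)
    then have zK: "z \<in> K" using rel_interior_subset by blast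
    have U: "y \<in> \<Union>\<K>" "z \<in> \<Union>\<K>" using K y zK by blast+
    let ?P = "orth_proj (parallel_space K)"
    have "norm (p y - p z) \<le> norm (y - p y) + norm (y - z) + norm (z - p z)"
      using norm_triangle_ineq[of "p y - y" "y - p z"] norm_triangle_ineq[of "y - z" "z - p z"]
      by (simp add: norm_minus_commute)
    also have "\<dots> \<le> M * h" using nearC[OF U(1)] nearC[OF U(2)] diamC[OF K y zK] by (simp add: M algebra_simps)
    finally have pd: "norm (p y - p z) \<le> M * h" .
    have "norm (PG (p y) w - PG (p z) w) \<le> A * norm (p y - p z) * norm w"
      using pd small(1) by (intro lip p_in) linarith
    also have "\<dots> \<le> A * (M * h) * norm w" using pd A by (intro mult_right_mono mult_left_mono) auto
    finally have 1: "norm (PG (p y) w - PG (p z) w) \<le> A * (M * h) * norm w" .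
    have "onorm (\<lambda>w. PG (p z) w - P_disc \<K> z w) \<le> C\<^sub>P * h"
      using dm K z unfolding discrete_manifold_def by blast
    then have on: "onorm (\<lambda>w. PG (p z) w - ?P w) \<le> C\<^sub>P * h" by (simp only: P_disc_def cell_eq[OF mK K z])
    have "linear (\<lambda>w. PG (p z) w - ?P w)"
      by (intro linear_compose_sub PG(1)[OF p_in] orth_proj_linear subspace_parallel_space neK' K)
    then have "bounded_linear (\<lambda>w. PG (p z) w - ?P w)" by (simp add: linear_conv_bounded_linear)
    from onorm[OF this, of w] have "norm (PG (p z) w - ?P w) \<le> onorm (\<lambda>w. PG (p z) w - ?P w) * norm w" .
    also have "\<dots> \<le> C\<^sub>P * h * norm w" using on by (rule mult_right_mono) simp
    also have "\<dots> \<le> \<bar>C\<^sub>P\<bar> * h * norm w" using h by (intro mult_right_mono) auto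
    finally have 2: "norm (PG (p z) w - ?P w) \<le> \<bar>C\<^sub>P\<bar> * h * norm w" .
    have "norm (PG (p y) w - ?P w) \<le> A * (M * h) * norm w + \<bar>C\<^sub>P\<bar> * h * norm w"
      using norm_triangle_ineq[of "PG (p y) w - PG (p z) w" "PG (p z) w - ?P w"] 1 2 by simp
    also have "\<dots> = ((A * M + \<bar>C\<^sub>P\<bar>) * h) * norm w" by (simp add: algebra_simps)
    also have "\<dots> \<le> L * h * norm w" using Lh(3) by (rule mult_right_mono) simp
    finally show ?thesis .
  qed
  have bij': "bij_betw p (\<Union>\<K>) \<Gamma>" using dm by (simp add: discrete_manifold_def)
  have \<epsilon>': "0 < L * h" "4 * (L * h) \<le> R0"
    using mult_pos_pos[OF Lpos h(1)] small(3) by linarith+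
  have dimK': "c + dim (parallel_space K) = DIM('a)" if "K \<in> \<K>" for K
    using dim_parallel_space[OF sK[OF that]] dc by simp
  have disjK': "rel_interior K \<inter> rel_interior K' = {}" if "K \<in> \<K>" "K' \<in> \<K>" "K \<noteq> K'" for K K'
  proof (rule equals0I)
    fix y assume "y \<in> rel_interior K \<inter> rel_interior K'"
    then have "cell \<K> y = K" "cell \<K> y = K'" using cell_eq[OF mK] that by blast+
    then show False using that(3) by (simp only:)
  qed
  have k0: "0 < \<bar>\<mu> * \<kappa>\<bar> + 1" by simp
  have \<rho>p: "0 < \<rho>1" unfolding \<rho>1 using k0 by (rule divide_pos_pos[OF zero_less_one])
  have \<rho>h: "0 < \<rho>1 * h" using \<rho>p h by simp
  have \<rho>D: "\<rho>1 \<le> D1"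
  proof -
    have "\<rho>1 \<le> 1" unfolding \<rho>1 by simp
    then show ?thesis by (simp add: D1)
  qed
  have inball': "\<exists>z. cball z (\<rho>1 * h) \<subseteq> T" if T: "T \<in> \<T>" for T
  proof -
    obtain z r where zr: "0 < r" "cball z r \<subseteq> T" "diameter T \<le> \<kappa> * r"
      using bm T unfolding background_mesh_def shape_regular_def by blast
    have d0: "0 \<le> diameter T" using compact_simplex[OF sT[OF T]] by (intro diameter_ge_0 compact_imp_bounded)
    have "h \<le> \<mu> * diameter T" using bm T unfolding background_mesh_def quasi_uniform_def by blast
    also have "\<dots> \<le> \<bar>\<mu>\<bar> * diameter T" using d0 by (intro mult_right_mono) auto
    also have "\<dots> \<le> \<bar>\<mu>\<bar> * (\<bar>\<kappa>\<bar> * r)"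
    proof (rule mult_left_mono)
      show "diameter T \<le> \<bar>\<kappa>\<bar> * r"
        using zr(3) by (rule order_trans) (use zr(1) in \<open>intro mult_right_mono; simp\<close>)
    qed simp
    also have "\<dots> \<le> (\<bar>\<mu> * \<kappa>\<bar> + 1) * r" using zr(1) by (simp add: abs_mult algebra_simps)
    finally have "\<rho>1 * h \<le> r" using k0 by (simp add: \<rho>1 pos_divide_le_eq mult.commute)
    then show ?thesis using zr(2) by (intro exI[of _ z]) auto
  qed
  have diamT': "norm (x - y) \<le> D1 * h" if "T \<in> \<T>" "x \<in> T" "y \<in> T" for T x y
    using diamT[OF that] h by (simp add: D1 algebra_simps)
  have cov': "cball y (\<rho>1 * h) \<subseteq> \<Union>\<T>" if y: "y \<in> \<Union>\<K>" for y
  proof (rule order_trans[OF _ tubeT], rule subsetI)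
    fix z assume "z \<in> cball y (\<rho>1 * h)"
    then have "norm (z - p y) \<le> \<rho>1 * h + L * h"
      using near'[OF y] norm_triangle_ineq[of "z - y" "y - p y"] by (simp add: dist_norm norm_minus_commute)
    then have "infdist z \<Gamma> < \<delta>" using infdist_le[OF p_in[of y], of z] small(5) by (simp add: dist_norm)
    then show "z \<in> tube \<Gamma> \<delta>" by (simp add: tube_def)
  qed
  show ?thesis
    by (unfold_locales; (rule refl | fact))
qed

end

theorem proposition8p8:
  fixes \<Gamma> :: "'a::euclidean_space set"
    and d c :: nat
    and \<delta>\<^sub>0 C\<^sub>\<rho> C\<^sub>P \<kappa> \<mu> \<alpha> :: real
  assumes "embedded_submanifold d \<Gamma>" and "compact \<Gamma>" and "connected \<Gamma>" and "\<Gamma> \<noteq> {}"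
    and "DIM('a) = d + c" and "1 \<le> c"
    and "tubular_radius \<Gamma> \<delta>\<^sub>0"
    and "0 \<le> \<alpha>" and "\<alpha> \<le> 2"
  shows "\<exists>h\<^sub>0>0. \<exists>C>0. \<forall>h \<K> \<T>.
           0 < h \<and> h \<le> h\<^sub>0 \<and>
           discrete_manifold d \<Gamma> \<delta>\<^sub>0 C\<^sub>\<rho> C\<^sub>P h \<K> \<and>
           background_mesh \<Gamma> \<delta>\<^sub>0 \<kappa> \<mu> h \<T> \<and>
           compatible \<K> (active_mesh \<T> \<K>) \<longrightarrow>
           (let \<T>\<^sub>h = active_mesh \<T> \<K> in
            \<forall>v\<in>V_space \<T>\<^sub>h.
              h powr (- real c) * (LINT x:\<Union>\<T>\<^sub>h|lebesgue. (v x)\<^sup>2)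
                \<le> C * (surface_integral \<K> (\<lambda>x. (v x)\<^sup>2) + stab \<alpha> c \<Gamma> h \<K> \<T>\<^sub>h v v) \<and>
              h powr (- real c) * (LINT x:\<Union>\<T>\<^sub>h|lebesgue. (v x - surface_average \<K> v)\<^sup>2)
                \<le> C * (surface_integral \<K> (\<lambda>x. (norm (surface_gradient \<K> \<T>\<^sub>h v x))\<^sup>2)
                       + stab \<alpha> c \<Gamma> h \<K> \<T>\<^sub>h v v))"
proof -
  interpret tb: tubular \<Gamma> \<delta>\<^sub>0 by unfold_locales (fact assms)+
  note \<delta>0 = tb.\<delta>
  obtain A where A: "0 < A"
    "\<And>q q' w. q \<in> \<Gamma> \<Longrightarrow> q' \<in> \<Gamma> \<Longrightarrow> norm (q - q') \<le> \<delta>\<^sub>0 / 2 \<Longrightarrow> norm (tb.PG q w - tb.PG q' w) \<le> A * norm (q - q') * norm w"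
    "\<And>q r x x'. q \<in> \<Gamma> \<Longrightarrow> r \<le> \<delta>\<^sub>0 / 2 \<Longrightarrow> norm (x - q) \<le> r \<Longrightarrow> norm (x' - q) \<le> r \<Longrightarrow>
      norm (tb.p x - tb.p x' - tb.PG q (x - x')) \<le> A * r * norm (x - x')"
  proof (rule tb.projection_estimates)
    fix A
    assume a: "0 < A"
      "\<And>q q' w. q \<in> \<Gamma> \<Longrightarrow> q' \<in> \<Gamma> \<Longrightarrow> norm (q - q') \<le> \<delta>\<^sub>0 / 2 \<Longrightarrow> norm (tb.PG q w - tb.PG q' w) \<le> A * norm (q - q') * norm w"
      "\<And>q r x x'. q \<in> \<Gamma> \<Longrightarrow> r \<le> \<delta>\<^sub>0 / 2 \<Longrightarrow> norm (x - q) \<le> r \<Longrightarrow> norm (x' - q) \<le> r \<Longrightarrow>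
        norm (tb.p x - tb.p x' - tb.PG q (x - x')) \<le> A * r * norm (x - x')"
    show thesis using a by (rule that)
  qed
  \<comment> \<open>The largest radius that satisfies both conditions on charts; it depends on
    \<Gamma> only.\<close>
  define R0 where "R0 = min (1 / (112 * A)) (\<delta>\<^sub>0 / 28)"
  have R0: "0 < R0" "112 * A * R0 \<le> 1" "28 * R0 \<le> \<delta>\<^sub>0"
  proof -
    show "0 < R0" using A(1) \<delta>0 by (simp add: R0_def)
    have "112 * A * R0 \<le> 112 * A * (1 / (112 * A))" using A(1) by (intro mult_left_mono) (auto simp: R0_def)
    then show "112 * A * R0 \<le> 1" using A(1) by simp
    show "28 * R0 \<le> \<delta>\<^sub>0" unfolding R0_def by linarith
  qed
  define M where "M = \<bar>\<mu>\<bar> + 2 * \<bar>C\<^sub>\<rho>\<bar>"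
  define L where "L = \<bar>C\<^sub>P\<bar> + A * M + \<bar>\<mu>\<bar> + \<bar>C\<^sub>\<rho>\<bar> + 1"
  define D1 where "D1 = \<bar>\<mu>\<bar> + 1"
  define \<rho>1 where "\<rho>1 = 1 / (\<bar>\<mu> * \<kappa>\<bar> + 1)"
  have M0: "0 \<le> M" by (simp add: M_def)
  have L0: "0 < L" using A(1) M0 by (simp add: L_def add_nonneg_pos)
  have D10: "0 < D1" by (simp add: D1_def add_nonneg_pos)
  have \<rho>10: "0 < \<rho>1" by (simp add: \<rho>1_def add_nonneg_pos)
  obtain F where F: "finite F" "F \<subseteq> \<Gamma>" "\<Gamma> \<subseteq> (\<Union>f\<in>F. ball f (R0 / 16))"
  proof -
    have "0 < R0 / 16" using R0 by simp
    with seq_compact_imp_totally_bounded[OF compact_imp_seq_compact[OF assms(2)]]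
    have "\<exists>k. finite k \<and> k \<subseteq> \<Gamma> \<and> \<Gamma> \<subseteq> (\<Union>x\<in>k. ball x (R0 / 16))" by blast
    then show ?thesis using that by (elim exE conjE)
  qed
  have R8: "0 < R0 / 8" using R0 by simp
  obtain n :: nat where n: "\<And>(m :: 'a \<Rightarrow> real) b q q'. (\<And>q q'. q \<in> \<Gamma> \<Longrightarrow> q' \<in> \<Gamma> \<Longrightarrow> dist q q' < R0 / 8 \<Longrightarrow> \<bar>m q - m q'\<bar> \<le> b) \<Longrightarrow>
      q \<in> \<Gamma> \<Longrightarrow> q' \<in> \<Gamma> \<Longrightarrow> \<bar>m q - m q'\<bar> \<le> real n * b"
  proof (rule connected_chain_bound[OF assms(2,3) R8])
    fix n :: nat
    assume a: "\<And>(m :: 'a \<Rightarrow> real) b q q'. (\<And>q q'. q \<in> \<Gamma> \<Longrightarrow> q' \<in> \<Gamma> \<Longrightarrow> dist q q' < R0 / 8 \<Longrightarrow> \<bar>m q - m q'\<bar> \<le> b) \<Longrightarrow>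
      q \<in> \<Gamma> \<Longrightarrow> q' \<in> \<Gamma> \<Longrightarrow> \<bar>m q - m q'\<bar> \<le> real n * b"
    show thesis using a by (rule that)
  qed
  \<comment> \<open>Outside their locales these constants are functions of the listed factors, so
    they can be named before any mesh is given.\<close>
  define C7 where "C7 = trace_mesh.C7 TYPE('a) c \<rho>1 D1"
  define S where "S = 4 * trace_mesh.C5 TYPE('a) c \<rho>1 D1 * real (trace_mesh.N1 TYPE('a) \<rho>1 D1) * (trace_mesh.CQ A D1 L)\<^sup>2"
  define P where "P = surface_mesh.poinc TYPE('a) R0 c (card F) n"
  \<comment> \<open>The signs of \<open>C7\<close> and \<open>P\<close> are available only once a
    mesh instantiates the locale; the absolute values make \<open>C\<close> positive
    beforehand.\<close>
  define C where "C = \<bar>C7\<bar> * (\<bar>P\<bar> + 1) + 1"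
  have C0: "0 < C" unfolding C_def by (intro add_nonneg_pos mult_nonneg_nonneg) auto
  \<comment> \<open>Each \<open>x1\<close>, ..., \<open>x5\<close> turns one smallness condition of
    \<open>trace_mesh_instance\<close> into \<open>x * h \<le> 1\<close>. In \<open>x5\<close> the
    factor 2 leaves room for the strict inequality.\<close>
  define x1 where "x1 = 32 * (2 * A + 1) * (A * \<delta>\<^sub>0 + 1) * L"
  define x2 where "x2 = 16 * L / R0"
  define x3 where "x3 = (4 * D1 + L) / R0"
  define x4 where "x4 = 2 * M / \<delta>\<^sub>0"
  define x5 where "x5 = 2 * (L + \<rho>1) / \<delta>\<^sub>0"
  have x0: "0 \<le> x1" "0 \<le> x2" "0 \<le> x3" "0 \<le> x4" "0 \<le> x5"
    using A(1) \<delta>0 L0 R0(1) D10 M0 \<rho>10 by (auto simp: x1_def x2_def x3_def x4_def x5_def)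
  \<comment> \<open>For \<open>h \<le> h0\<close> the weighted sum of all these terms is at most 1,
    so each of them is. The leading 1 gives \<open>h \<le> 1\<close>, and \<open>S\<close> gives the
    absorption condition, where \<open>h\<^sup>2 \<le> h\<close>.\<close>
  define h0 where "h0 = 1 / (1 + x1 + x2 + x3 + x4 + x5 + \<bar>S\<bar>)"
  have pos: "0 < 1 + x1 + x2 + x3 + x4 + x5 + \<bar>S\<bar>" using x0 by linarith
  have h00: "0 < h0" using pos by (simp add: h0_def)
  show ?thesis
  proof (rule exI[of _ h0], rule conjI[OF h00], rule exI[of _ C], rule conjI[OF C0], intro allI impI)
    fix h \<K> \<T>
    assume hyp: "0 < h \<and> h \<le> h0 \<and> discrete_manifold d \<Gamma> \<delta>\<^sub>0 C\<^sub>\<rho> C\<^sub>P h \<K> \<and>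
      background_mesh \<Gamma> \<delta>\<^sub>0 \<kappa> \<mu> h \<T> \<and> compatible \<K> (active_mesh \<T> \<K>)"
    then have h: "0 < h" and dm: "discrete_manifold d \<Gamma> \<delta>\<^sub>0 C\<^sub>\<rho> C\<^sub>P h \<K>"
      and bm: "background_mesh \<Gamma> \<delta>\<^sub>0 \<kappa> \<mu> h \<T>" and cmp: "compatible \<K> (active_mesh \<T> \<K>)" by blast+
    have "h * (1 + x1 + x2 + x3 + x4 + x5 + \<bar>S\<bar>) \<le> 1"
      using hyp pos by (simp add: h0_def pos_le_divide_eq)
    then have sum: "h + x1 * h + x2 * h + x3 * h + x4 * h + x5 * h + \<bar>S\<bar> * h \<le> 1" by (simp add: algebra_simps)
    have nn: "0 \<le> x1 * h" "0 \<le> x2 * h" "0 \<le> x3 * h" "0 \<le> x4 * h" "0 \<le> x5 * h" "0 \<le> \<bar>S\<bar> * h"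
      using x0 h by auto
    have h1: "h \<le> 1" using sum nn by linarith
    have s: "x1 * h \<le> 1" "x2 * h \<le> 1" "x3 * h \<le> 1" "x4 * h \<le> 1" "x5 * h \<le> 1" "\<bar>S\<bar> * h \<le> 1"
      using sum nn h by linarith+
    have small: "M * h \<le> \<delta>\<^sub>0 / 2" "32 * (2 * A + 1) * (A * \<delta>\<^sub>0 + 1) * (L * h) \<le> 1" "16 * (L * h) \<le> R0"
      "4 * (D1 * h) + L * h \<le> R0" "L * h + \<rho>1 * h < \<delta>\<^sub>0"
    proof -
      show "M * h \<le> \<delta>\<^sub>0 / 2" using s(4) \<delta>0 by (simp add: x4_def field_simps)
      show "32 * (2 * A + 1) * (A * \<delta>\<^sub>0 + 1) * (L * h) \<le> 1" using s(1) by (simp add: x1_def mult.assoc)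
      show "16 * (L * h) \<le> R0" using s(2) R0(1) by (simp add: x2_def field_simps)
      show "4 * (D1 * h) + L * h \<le> R0" using s(3) R0(1) by (simp add: x3_def field_simps)
      have "L * h + \<rho>1 * h \<le> \<delta>\<^sub>0 / 2" using s(5) \<delta>0 by (simp add: x5_def field_simps)
      then show "L * h + \<rho>1 * h < \<delta>\<^sub>0" using \<delta>0 by linarith
    qed
    interpret tm: trace_mesh \<Gamma> \<delta>\<^sub>0 A "L * h" R0 \<K> c \<T> "\<rho>1 * h" "D1 * h" h \<rho>1 D1 L
      by (rule tb.trace_mesh_instance[OF A(1) A(2) A(3) R0 assms(5) h h1 M_def L_def D1_def \<rho>1_def small dm bm cmp])
    have sm: "4 * tm.C5 * real tm.N1 * tm.CQ\<^sup>2 * h\<^sup>2 \<le> 1"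
    proof -
      have "S * h\<^sup>2 \<le> (\<bar>S\<bar> * h) * h" using mult_right_mono[OF abs_ge_self[of S], of "h\<^sup>2"] by (simp add: power2_eq_square)
      also have "\<dots> \<le> 1 * 1" using s(6) h1 h nn(6) by (intro mult_mono) auto
      finally show ?thesis by (simp add: S_def)
    qed
    have dmK: "mesh d \<K>" using dm by (simp add: discrete_manifold_def)
    have C7: "0 \<le> C7" and P: "0 \<le> P" unfolding C7_def P_def by (rule tm.C7_nonneg, rule tm.poinc_nonneg)
    have CC: "C7 \<le> C" "C7 * (P + 1) \<le> C"
      using C7 P mult_nonneg_nonneg[OF C7 P] by (auto simp: C_def algebra_simps)
    show "let \<T>\<^sub>h = active_mesh \<T> \<K> in
            \<forall>v\<in>V_space \<T>\<^sub>h.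
              h powr (- real c) * (LINT x:\<Union>\<T>\<^sub>h|lebesgue. (v x)\<^sup>2)
                \<le> C * (surface_integral \<K> (\<lambda>x. (v x)\<^sup>2) + stab \<alpha> c \<Gamma> h \<K> \<T>\<^sub>h v v) \<and>
              h powr (- real c) * (LINT x:\<Union>\<T>\<^sub>h|lebesgue. (v x - surface_average \<K> v)\<^sup>2)
                \<le> C * (surface_integral \<K> (\<lambda>x. (norm (surface_gradient \<K> \<T>\<^sub>h v x))\<^sup>2)
                       + stab \<alpha> c \<Gamma> h \<K> \<T>\<^sub>h v v)"
      unfolding Let_def
    proof (intro ballI conjI)
      fix v assume v: "v \<in> V_space (active_mesh \<T> \<K>)"
      define st where "st = stab \<alpha> c \<Gamma> h \<K> (active_mesh \<T> \<K>) v v"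
      define sg where "sg = surface_integral \<K> (\<lambda>x. (norm (surface_gradient \<K> (active_mesh \<T> \<K>) v x))\<^sup>2)"
      have st0: "0 \<le> st" using tm.Itot(2)[of v] by (simp add: st_def tm.stab_eq)
      have sg0: "0 \<le> sg" unfolding sg_def surface_integral_def set_lebesgue_integral_def
        by (intro sum_nonneg Bochner_Integration.integral_nonneg) simp
      have sq0: "0 \<le> surface_integral \<K> (\<lambda>x. (v x)\<^sup>2)" using tm.J(2)[of v UNIV] by (simp only: tm.J_eq_surface_integral[OF v])
      have "h powr (- real c) * (LINT x:\<Union>(active_mesh \<T> \<K>)|lebesgue. (v x)\<^sup>2) \<le> C7 * (surface_integral \<K> (\<lambda>x. (v x)\<^sup>2) + st)"
        using tm.weighted_L2_bound[OF v sm h1 assms(9)]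
        by (simp only: tm.J_eq_surface_integral[OF v] st_def tm.stab_eq C7_def)
      also have "\<dots> \<le> C * (surface_integral \<K> (\<lambda>x. (v x)\<^sup>2) + st)"
        using CC(1) sq0 st0 by (intro mult_right_mono) auto
      finally show "h powr (- real c) * (LINT x:\<Union>(active_mesh \<T> \<K>)|lebesgue. (v x)\<^sup>2)
        \<le> C * (surface_integral \<K> (\<lambda>x. (v x)\<^sup>2) + stab \<alpha> c \<Gamma> h \<K> (active_mesh \<T> \<K>) v v)"
        by (simp only: st_def)
      have "h powr (- real c) * (LINT x:\<Union>(active_mesh \<T> \<K>)|lebesgue. (v x - surface_average \<K> v)\<^sup>2) \<le> C7 * (P + 1) * (sg + st)"
        unfolding C7_def P_def sg_def st_def
        by (rule tm.mean_deviation_bound[OF v cmp cell_eq[OF dmK] F n sm h1 assms(9)])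
      also have "\<dots> \<le> C * (sg + st)" using CC(2) sg0 st0 by (intro mult_right_mono) auto
      finally show "h powr (- real c) * (LINT x:\<Union>(active_mesh \<T> \<K>)|lebesgue. (v x - surface_average \<K> v)\<^sup>2)
        \<le> C * (surface_integral \<K> (\<lambda>x. (norm (surface_gradient \<K> (active_mesh \<T> \<K>) v x))\<^sup>2)
          + stab \<alpha> c \<Gamma> h \<K> (active_mesh \<T> \<K>) v v)"
        by (simp only: st_def sg_def)
    qed
  qed
qed

end
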